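(* Let $I=[\eta,\xi]\subset\mathbb{R}$ be a compact interval, let $0<c_1\le c_2$, and let $f\in\overline{\mathcal{F}}(I;c_1,c_2)$. Then for any $\delta\in(0,1/2]$ and any integer $Q>1$, $$N_f(Q,\delta)=|I|\delta Q^2+O\left(\delta^{1/2}\left(\log\frac1\delta\right)Q^{3/2}+Q^{4/3}\right),$$ where the implied constant depends only on $I$, $c_1$ and $c_2$ (in particular it is independent of $f$, $\delta$ and $Q$).
   Context: $\mathcal{F}(I;c_1,c_2)$ denotes the set of $C^2$ functions $f:I\to\mathbb{R}$ with $c_1\le |f''(x)|\le c_2$ for all $x\in I$, and $\overline{\mathcal{F}}(I;c_1,c_2)$ denotes its closure in the space $C(I)$ of continuous functions on $I$ with respect to the uniform (sup) norm. $|I|$ is the length of $I$. For $x\in\mathbb{R}$, $\|x\|=\min_{k\in\mathbb{Z}}|x-k|$. For $Q\ge1$ and $\delta>0$, $$N_f(Q,\delta)=\#\left\{(a,q)\in\mathbb{Z}\times\mathbb{N}:\ q\le Q,\ a/q\in I,\ \|qf(a/q)\|<\delta\right\}$$ (here $a$ and $q$ are not required to be coprime). *)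

theory Defs
  imports "HOL-Analysis.Analysis"
begin

text \<open>
  A real function on a set \<open>I\<close> is represented by the element of \<^term>\<open>extensional I\<close> with the
  given values on \<open>I\<close>; this is how \<^term>\<open>cfunspace\<close> represents the points of \<open>C(I)\<close>.
  Derivatives are taken within \<open>I\<close>, hence they are one-sided at the endpoints of an interval.
\<close>

definition C2_class :: "real set \<Rightarrow> real \<Rightarrow> real \<Rightarrow> (real \<Rightarrow> real) set" where
  "C2_class I c1 c2 =
     {f \<in> extensional I. \<exists>f' f''.
        (\<forall>x\<in>I. (f has_real_derivative f' x) (at x within I)) \<and>
        (\<forall>x\<in>I. (f' has_real_derivative f'' x) (at x within I)) \<and>
        continuous_on I f'' \<and>
        (\<forall>x\<in>I. c1 \<le> \<bar>f'' x\<bar> \<and> \<bar>f'' x\<bar> \<le> c2)}"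

definition C2_class_closure :: "real set \<Rightarrow> real \<Rightarrow> real \<Rightarrow> (real \<Rightarrow> real) set" where
  "C2_class_closure I c1 c2 =
     mtopology_of (cfunspace (top_of_set I) euclidean_metric) closure_of C2_class I c1 c2"

definition dist_int :: "real \<Rightarrow> real" where
  "dist_int x = (INF k::int. \<bar>x - of_int k\<bar>)"

definition N_count :: "real set \<Rightarrow> (real \<Rightarrow> real) \<Rightarrow> real \<Rightarrow> real \<Rightarrow> nat" where
  "N_count I f Q \<delta> =
     card {(a :: int, q :: nat). 0 < q \<and> real q \<le> Q \<and> of_int a / real q \<in> I \<and>
             dist_int (real q * f (of_int a / real q)) < \<delta>}"

lemma dist_int_le: "dist_int x \<le> \<bar>x - of_int k\<bar>"
  unfolding dist_int_def by (rule cINF_lower) (auto intro!: bdd_belowI[where m = 0])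

lemma dist_int_attained: "\<exists>k::int. dist_int x = \<bar>x - of_int k\<bar>"
proof
  have "\<bar>x - of_int (round x)\<bar> \<le> dist_int x"
    unfolding dist_int_def by (rule cINF_greatest) (auto intro: round_diff_minimal)
  then show "dist_int x = \<bar>x - of_int (round x)\<bar>"
    using dist_int_le[of x "round x"] by simp
qed

text \<open>The set counted by \<^term>\<open>N_count\<close> is finite, so that \<^term>\<open>card\<close> is meaningful.\<close>

lemma finite_N_count:
  assumes "bounded I"
  shows "finite {(a :: int, q :: nat). 0 < q \<and> real q \<le> Q \<and> of_int a / real q \<in> I \<and>
             dist_int (real q * f (of_int a / real q)) < \<delta>}"
proof -
  obtain B where B: "\<And>x. x \<in> I \<Longrightarrow> \<bar>x\<bar> \<le> B"
    using assms by (auto simp: bounded_iff)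
  define K where "K = \<lceil>\<bar>B\<bar> * \<bar>Q\<bar>\<rceil>"
  have "(a, q) \<in> {-K..K} \<times> {..nat \<lceil>Q\<rceil>}"
    if "0 < q" "real q \<le> Q" "of_int a / real q \<in> I" for a and q :: nat
  proof -
    have "\<bar>of_int a / real q\<bar> \<le> \<bar>B\<bar>"
      using B[OF that(3)] by linarith
    then have "\<bar>of_int a\<bar> \<le> \<bar>B\<bar> * real q"
      using that(1) by (simp add: abs_divide divide_le_eq)
    also have "\<dots> \<le> \<bar>B\<bar> * \<bar>Q\<bar>"
      using that(2) by (intro mult_left_mono) auto
    finally have "\<bar>a\<bar> \<le> K"
      unfolding K_def by linarith
    moreover have "q \<le> nat \<lceil>Q\<rceil>"
      using that(2) by linarith
    ultimately show ?thesis by auto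
  qed
  then have "{(a :: int, q :: nat). 0 < q \<and> real q \<le> Q \<and> of_int a / real q \<in> I \<and>
             dist_int (real q * f (of_int a / real q)) < \<delta>}
           \<subseteq> {-K..K} \<times> {..nat \<lceil>Q\<rceil>}"
    by blast
  then show ?thesis
    by (rule finite_subset) auto
qed

lemma C2_class_closure_iff:
  assumes "compact I" "I \<noteq> {}"
  shows "f \<in> C2_class_closure I c1 c2 \<longleftrightarrow>
     f \<in> extensional I \<and> continuous_on I f \<and>
     (\<forall>\<epsilon>>0. \<exists>g\<in>C2_class I c1 c2. \<forall>x\<in>I. \<bar>f x - g x\<bar> \<le> \<epsilon>)"
proof -
  let ?m = "cfunspace (top_of_set I) (euclidean_metric :: real metric)"
  interpret M: Metric_space "mspace ?m" "mdist ?m"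
    by (rule Metric_space_mspace_mdist)
  have ms: "g \<in> mspace ?m \<longleftrightarrow> g \<in> extensional I \<and> continuous_on I g" for g
    by (subst compactin_mspace_cfunspace) (use assms in auto)
  have sub: "g \<in> mspace ?m" if "g \<in> C2_class I c1 c2" for g
    using that unfolding ms C2_class_def
    by (auto simp: continuous_on_eq_continuous_within intro: DERIV_continuous)
  have le: "mdist ?m f g \<le> e \<longleftrightarrow> (\<forall>x\<in>I. \<bar>f x - g x\<bar> \<le> e)"
    if "f \<in> mspace ?m" "g \<in> mspace ?m" for f g e
    by (subst cfunspace_mdist_le[OF that]) (use assms in \<open>auto simp: dist_real_def\<close>)
  have "f \<in> C2_class_closure I c1 c2 \<longleftrightarrow>
      f \<in> mspace ?m \<and> (\<forall>e>0. \<exists>g\<in>C2_class I c1 c2. g \<in> mspace ?m \<and> mdist ?m f g < e)"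
    unfolding C2_class_closure_def mtopology_of_def M.metric_closure_of M.in_mball by auto
  also have "\<dots> \<longleftrightarrow> f \<in> mspace ?m \<and> (\<forall>e>0. \<exists>g\<in>C2_class I c1 c2. mdist ?m f g \<le> e)"
    using sub by (meson field_lbound_gt_zero less_imp_le order_le_less_trans)
  also have "\<dots> \<longleftrightarrow> f \<in> mspace ?m \<and>
      (\<forall>e>0. \<exists>g\<in>C2_class I c1 c2. \<forall>x\<in>I. \<bar>f x - g x\<bar> \<le> e)"
    using le sub by (metis (no_types, lifting))
  finally show ?thesis by (simp only: ms conj_assoc)
qed

end

theory Submission
  imports Defs "HOL-Analysis.Analysis"
begin

text \<open>
  An approximant may be normalised to a strictly convex \<open>f\<close> on the whole line with
  \<open>0 \<le> f' \<eta> \<le> 1\<close>. The weighted Erdos-Turan inequality with \<open>H\<close> of order \<open>Q\<^bsup>2/3\<^esup>\<close> reduces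
  the count to the sums \<open>T\<^sub>j\<close> of \<open>e(j q f(a/q))\<close> over the rational points \<open>a/q\<close>, smoothed at the
  ends of the interval. Averaging with a Fejer kernel turns the sum over \<open>a\<close> into integrals with
  phases \<open>q (j f t - l t)\<close>; the sum over \<open>q\<close> is performed inside the integral, where it is bounded by
  the kernel \<open>Q / (1 + Q \<parallel>\<theta>\<parallel>)\<close>. Only a neighbourhood of the stationary point \<open>f' t = l / j\<close> matters,
  and there the phase is \<open>- j g (l / j)\<close> for the Legendre transform \<open>g\<close> of \<open>f\<close>. So \<open>T\<^sub>j\<close> is controlled
  by the number of rational points \<open>(l / j, m / j)\<close> close to the graph of the dual curve \<open>g\<close>.
  For \<open>j\<close> in a dyadic range these are counted geometrically: on a short arc all points lie on
  one line by a determinant argument, strict convexity bounds the number of points on a line, and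
  few lines with small coefficients occur. The closure is reached by perturbing \<open>\<delta>\<close> slightly.
\<close>

section \<open>Lattice points near a strongly convex curve\<close>

text \<open>Only two derivatives are available, and every constant may depend on \<open>c1\<close>,
  \<open>c2\<close> and the interval alone. An asymptotic stationary phase expansion is therefore
  not at hand; it is replaced throughout by upper bounds for absolute values. The exponents come
  from one balance. Put \<open>x = Q powr (1/6)\<close>. For \<open>j\<close> of order
  \<open>J\<close> the bound for the sum of the absolute values of the \<open>T\<^sub>j\<close> has
  two parts, \<open>x ^ 9 * sqrt J * (1 + ln J)\<close> and \<open>x ^ 6 * J * sqrt J\<close>.
  Against the weights \<open>min \<delta> (1 / J)\<close> the first part peaks for \<open>J\<close>
  near \<open>1 / \<delta>\<close> and gives
  \<open>sqrt \<delta> * ln (1 / \<delta>) * x ^ 9\<close>, while the second grows up to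
  \<open>J = H\<close> and gives \<open>x ^ 6 * sqrt H\<close>. The Erdos-Turan error
  \<open>Q\<^sup>2 / H\<close> has the same size when \<open>H\<close> is of order
  \<open>x ^ 4\<close>; both are then \<open>x ^ 8\<close>, that is \<open>Q powr (4/3)\<close>.
  Working with \<open>x\<close> makes all these exponents natural numbers. The factor
  \<open>1 + ln J\<close>, which turns into the logarithm of \<open>1 / \<delta>\<close>, has an
  arithmetic origin: dual points that are not primitive contribute a harmonic sum over their
  greatest common divisors.\<close>

lemma spaced_card:
  fixes Y :: "real set"
  assumes "Y \<subseteq> {u..v}" and "u \<le> v" and "\<sigma> > 0"
    and sp: "\<And>x y. x \<in> Y \<Longrightarrow> y \<in> Y \<Longrightarrow> x < y \<Longrightarrow> \<sigma> \<le> y - x"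
  shows "finite Y" "real (card Y) \<le> (v - u) / \<sigma> + 1"
proof -
  let ?f = "\<lambda>y. \<lfloor>(y - u) / \<sigma>\<rfloor>"
  have inj: "inj_on ?f Y"
  proof (rule linorder_inj_onI')
    fix x y assume xy: "x \<in> Y" "y \<in> Y" "x < y"
    have "1 \<le> (y - x) / \<sigma>" using sp[OF xy] \<open>\<sigma> > 0\<close> by simp
    also have "\<dots> = (y - u) / \<sigma> - (x - u) / \<sigma>"
      by (simp add: diff_divide_distrib[symmetric])
    finally have "(x - u) / \<sigma> + 1 \<le> (y - u) / \<sigma>" by simp
    then show "?f x \<noteq> ?f y" by linarith
  qed
  have sub: "?f ` Y \<subseteq> {0..\<lfloor>(v - u) / \<sigma>\<rfloor>}"
  proof
    fix n assume "n \<in> ?f ` Y"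
    then obtain y where y: "y \<in> Y" "n = ?f y" by blast
    have "(y - u) / \<sigma> \<le> (v - u) / \<sigma>" "0 \<le> (y - u) / \<sigma>"
      using y(1) assms(1,3) by (auto intro!: divide_right_mono)
    then show "n \<in> {0..\<lfloor>(v - u) / \<sigma>\<rfloor>}" unfolding y(2) by (simp add: floor_mono)
  qed
  show "finite Y"
    using inj sub finite_imageD finite_subset by blast
  have "card Y = card (?f ` Y)" using inj by (simp add: card_image)
  also have "\<dots> \<le> card {0..\<lfloor>(v - u) / \<sigma>\<rfloor>}" using sub by (intro card_mono) auto
  finally have "real (card Y) \<le> real (nat (\<lfloor>(v - u) / \<sigma>\<rfloor> + 1))" by simp
  moreover have "(v - u) / \<sigma> \<ge> 0" using assms by simp
  ultimately show "real (card Y) \<le> (v - u) / \<sigma> + 1" by linarith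
qed

text \<open>With \<open>x\<close> and \<open>z\<close> the extreme points, the triple condition
  forces every other point to lie within \<open>S\<close> of one of them, so \<open>Y\<close> splits
  into two clusters that \<open>spaced_card\<close> counts. An inner point also gives
  \<open>\<sigma> \<le> S\<close>, which absorbs the two additive ones; this is where three points
  are needed.\<close>

lemma two_cluster_card:
  fixes Y :: "real set"
  assumes "finite Y" "3 \<le> card Y" "\<sigma> > 0" "S \<ge> 0"
    and sp: "\<And>x y. x \<in> Y \<Longrightarrow> y \<in> Y \<Longrightarrow> x < y \<Longrightarrow> \<sigma> \<le> y - x"
    and tr: "\<And>x y z. x \<in> Y \<Longrightarrow> y \<in> Y \<Longrightarrow> z \<in> Y \<Longrightarrow> x < y \<Longrightarrow> y < z \<Longrightarrow> (y - x) * (z - y) \<le> S\<^sup>2"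
  shows "real (card Y) \<le> 4 * S / \<sigma>"
proof -
  have ne: "Y \<noteq> {}" using assms(2) by auto
  define x z where "x = Min Y" and "z = Max Y"
  have xz: "x \<in> Y" "z \<in> Y" "\<And>y. y \<in> Y \<Longrightarrow> x \<le> y \<and> y \<le> z"
    using assms(1) ne by (auto simp: x_def z_def)
  have "\<not> Y \<subseteq> {x, z}"
  proof
    assume "Y \<subseteq> {x, z}"
    then have "card Y \<le> card {x, z}" by (intro card_mono) auto
    also have "\<dots> \<le> 2" by (simp add: card_insert_if)
    finally show False using assms(2) by simp
  qed
  then obtain y where y: "y \<in> Y" "x < y" "y < z"
    using xz(3) by (metis insert_iff order_less_le subsetI)
  have "\<sigma>\<^sup>2 \<le> (y - x) * (z - y)"
    unfolding power2_eq_square using sp[OF xz(1) y(1,2)] sp[OF y(1) xz(2) y(3)] assms(3)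
    by (intro mult_mono) auto
  then have "\<sigma>\<^sup>2 \<le> S\<^sup>2" using tr[OF xz(1) y(1) xz(2) y(2,3)] by simp
  then have \<sigma>S: "\<sigma> \<le> S" using assms(4) by (rule power2_le_imp_le)
  have cover: "Y \<subseteq> (Y \<inter> {x..x+S}) \<union> (Y \<inter> {z-S..z})"
  proof
    fix w assume w: "w \<in> Y"
    show "w \<in> (Y \<inter> {x..x+S}) \<union> (Y \<inter> {z-S..z})"
    proof (rule ccontr)
      assume "\<not> ?thesis"
      then have *: "S < w - x" "S < z - w" using w xz(3)[OF w] by auto
      then have "S\<^sup>2 < (w - x) * (z - w)" unfolding power2_eq_square
        using assms(4) by (intro mult_strict_mono) auto
      moreover have "(w - x) * (z - w) \<le> S\<^sup>2"
        using * assms(4) by (intro tr[OF xz(1) w xz(2)]) auto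
      ultimately show False by simp
    qed
  qed
  have "real (card (Y \<inter> {x..x+S})) \<le> (x + S - x) / \<sigma> + 1"
    using assms(3,4) sp by (intro spaced_card) auto
  moreover have "real (card (Y \<inter> {z-S..z})) \<le> (z - (z - S)) / \<sigma> + 1"
    using assms(3,4) sp by (intro spaced_card) auto
  moreover have "card Y \<le> card (Y \<inter> {x..x+S}) + card (Y \<inter> {z-S..z})"
    using cover assms(1) by (metis card_Un_le card_mono finite_Int finite_Un order_trans)
  ultimately have "real (card Y) \<le> 2 * (S / \<sigma>) + 2" by simp
  moreover have "1 \<le> S / \<sigma>" using \<sigma>S assms(3) by simp
  ultimately show ?thesis by simp
qed

text \<open>Points with integer coordinates \<open>(l, j, m)\<close> stand for the rational points \<open>(l/j, m/j)\<close>.\<close>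

definition px :: "int \<times> int \<times> int \<Rightarrow> real" where
  "px v = of_int (fst v) / of_int (fst (snd v))"

definition py :: "int \<times> int \<times> int \<Rightarrow> real" where
  "py v = of_int (snd (snd v)) / of_int (fst (snd v))"

definition pd :: "int \<times> int \<times> int \<Rightarrow> int" where
  "pd v = fst (snd v)"

definition primitive_pt :: "int \<times> int \<times> int \<Rightarrow> bool" where
  "primitive_pt v \<longleftrightarrow> gcd (fst v) (gcd (fst (snd v)) (snd (snd v))) = 1"

text \<open>The homogeneous form of the line with slope \<open>p / r\<close> and intercept
  \<open>s / r\<close>. For coefficients with greatest common divisor one, \<open>r\<close> measures
  the arithmetic complexity of the line: the larger it is, the sparser are the points on it.\<close>

definition on_line :: "int \<Rightarrow> int \<Rightarrow> int \<Rightarrow> int \<times> int \<times> int \<Rightarrow> bool" where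
  "on_line p s r v \<longleftrightarrow> p * fst v + s * fst (snd v) = r * snd (snd v)"

lemma on_line_py:
  assumes "on_line p s r v" "r > 0" "pd v > 0"
  shows "py v = (of_int p * px v + of_int s) / of_int r"
proof -
  obtain l j m where v: "v = (l, j, m)" by (cases v)
  have "real_of_int (p * l + s * j) = real_of_int (r * m)"
    using assms(1) unfolding on_line_def v fst_conv snd_conv by simp
  then have "real_of_int p * l + s * j = r * m" by simp
  then show ?thesis using assms(2,3) unfolding v px_def py_def pd_def
    by (simp add: field_simps)
qed

lemma bezout3_int:
  assumes "gcd p (gcd s r) = (1::int)"
  obtains x y z where "x * p + y * s + z * r = 1"
proof -
  obtain u v where uv: "u * p + v * gcd s r = 1" using bezout_int[of p "gcd s r"] assms by auto
  obtain u' v' where uv': "u' * s + v' * r = gcd s r" using bezout_int[of s r] by auto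
  have "u * p + (v * u') * s + (v * v') * r = 1"
    using uv unfolding uv'[symmetric] by (simp add: algebra_simps)
  then show thesis by (rule that)
qed

text \<open>The cross product of two points on the line is an integer multiple of the primitive
  coefficient vector, and up to sign this is its last component. The equations show that
  \<open>r\<close> divides \<open>p * D\<close> and \<open>s * D\<close>; a Bezout combination of
  \<open>p\<close>, \<open>s\<close>, \<open>r\<close> recovers \<open>D\<close>.\<close>

lemma on_line_dvd:
  assumes "on_line p s r (l, j, m)" "on_line p s r (l', j', m')" "gcd p (gcd s r) = 1"
  shows "r dvd l' * j - l * j'"
proof -
  define D where "D = l' * j - l * j'"
  have e: "p * l + s * j = r * m" "p * l' + s * j' = r * m'"
    using assms(1,2) by (auto simp: on_line_def)
  have "p * D = (p * l') * j - (p * l) * j'" by (simp add: D_def algebra_simps)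
  also have "\<dots> = (r * m' - s * j') * j - (r * m - s * j) * j'"
    unfolding e[symmetric] by simp
  also have "\<dots> = r * (m' * j - m * j')" by (simp add: algebra_simps)
  finally have 1: "r dvd p * D" by simp
  have "s * D = (s * j) * l' - (s * j') * l" by (simp add: D_def algebra_simps)
  also have "\<dots> = (r * m - p * l) * l' - (r * m' - p * l') * l"
    unfolding e[symmetric] by simp
  also have "\<dots> = r * (m * l' - m' * l)" by (simp add: algebra_simps)
  finally have 2: "r dvd s * D" by simp
  obtain x y z where xyz: "x * p + y * s + z * r = 1" using bezout3_int[OF assms(3)] .
  obtain A where A: "p * D = r * A" using 1 by (rule dvdE)
  obtain B where B: "s * D = r * B" using 2 by (rule dvdE)
  have "D = (x * p + y * s + z * r) * D" using xyz by simp
  also have "\<dots> = x * (p * D) + y * (s * D) + r * (z * D)" by (simp add: algebra_simps)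
  also have "\<dots> = r * (x * A + y * B + z * D)" unfolding A B by (simp add: algebra_simps)
  finally have "r dvd D" by (rule dvdI)
  then show ?thesis by (simp add: D_def)
qed

text \<open>The difference of the abscissae is the determinant of \<open>on_line_dvd\<close> over
  the product of the denominators, and a positive multiple of \<open>r\<close> is at least
  \<open>r\<close>.\<close>

lemma on_line_spacing:
  assumes "on_line p s r v" "on_line p s r w" "gcd p (gcd s r) = 1" "r > 0"
    and "pd v > 0" "pd w > 0" "real_of_int (pd v) \<le> J" "real_of_int (pd w) \<le> J" "px v < px w"
  shows "of_int r / J\<^sup>2 \<le> px w - px v"
proof -
  obtain l j m where v: "v = (l, j, m)" by (cases v)
  obtain l' j' m' where w: "w = (l', j', m')" by (cases w)
  have pos: "j > 0" "j' > 0" using assms by (auto simp: pd_def v w)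
  have "real_of_int (l' * j - l * j') > 0"
    using assms(9) pos by (simp add: px_def v w field_simps)
  then have "l' * j - l * j' > 0" by linarith
  moreover have "r dvd l' * j - l * j'" 
    using on_line_dvd[OF assms(1)[unfolded v] assms(2)[unfolded w] assms(3)] .
  ultimately have "r \<le> l' * j - l * j'" by (rule zdvd_imp_le[rotated])
  then have r: "real_of_int r \<le> l' * j - l * j'" by linarith
  have "of_int r / J\<^sup>2 \<le> of_int r / (of_int j * of_int j')"
    using assms(4,7,8) pos unfolding power2_eq_square v w pd_def
    by (intro divide_left_mono mult_mono mult_pos_pos) auto
  also have "\<dots> \<le> (l' * j - l * j') / (of_int j * of_int j')"
    using r pos by (intro divide_right_mono) auto
  also have "\<dots> = px w - px v" using pos by (simp add: px_def v w field_simps)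
  finally show ?thesis .
qed

text \<open>Quadratic bounds around every supporting line take the place of a second derivative
  between \<open>2 * a\<close> and \<open>2 * b\<close>. The Legendre transform yields this form
  directly, with \<open>\<tau>\<close> the inverse of \<open>f'\<close>, so no derivative of the
  dual curve has to be computed.\<close>

locale strongly_convex =
  fixes g \<tau> :: "real \<Rightarrow> real" and a b :: real
  assumes a_pos: "0 < a"
    and lower: "\<And>x y. a * (y - x)\<^sup>2 \<le> g y - g x - \<tau> x * (y - x)"
    and upper: "\<And>x y. g y - g x - \<tau> x * (y - x) \<le> b * (y - x)\<^sup>2"
begin

lemma a_le_b: "a \<le> b"
  using lower[of 1 0] upper[of 1 0] by simp

lemma b_pos: "0 < b"
  using a_pos a_le_b by simp

text \<open>The quadratic bounds at the middle point \<open>y\<close> towards both neighbours are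
  weighted by the opposite gaps, so that the terms in \<open>\<tau> y\<close> cancel. The expression
  being bounded is \<open>z - x\<close> times the defect of \<open>g y\<close> from the
  chord.\<close>

lemma three_point:
  assumes "x < y" "y < z"
  shows "a * ((y - x) * (z - y) * (z - x)) \<le> g x * (z - y) + g z * (y - x) - g y * (z - x)"
    and "g x * (z - y) + g z * (y - x) - g y * (z - x) \<le> b * ((y - x) * (z - y) * (z - x))"
proof -
  have "(z - y) * (a * (x - y)\<^sup>2) \<le> (z - y) * (g x - g y - \<tau> y * (x - y))"
    using assms lower by (intro mult_left_mono) auto
  moreover have "(y - x) * (a * (z - y)\<^sup>2) \<le> (y - x) * (g z - g y - \<tau> y * (z - y))"
    using assms lower by (intro mult_left_mono) auto
  ultimately show "a * ((y - x) * (z - y) * (z - x)) \<le> g x * (z - y) + g z * (y - x) - g y * (z - x)"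
    by (simp add: algebra_simps power2_eq_square)
  have "(z - y) * (g x - g y - \<tau> y * (x - y)) \<le> (z - y) * (b * (x - y)\<^sup>2)"
    using assms upper by (intro mult_left_mono) auto
  moreover have "(y - x) * (g z - g y - \<tau> y * (z - y)) \<le> (y - x) * (b * (z - y)\<^sup>2)"
    using assms upper by (intro mult_left_mono) auto
  ultimately show "g x * (z - y) + g z * (y - x) - g y * (z - x) \<le> b * ((y - x) * (z - y) * (z - x))"
    by (simp add: algebra_simps power2_eq_square)
qed

lemma slope_bounds:
  assumes "x \<le> y"
  shows "\<tau> x \<le> \<tau> y" "\<tau> y \<le> \<tau> x + 2 * b * (y - x)"
proof -
  have 1: "(\<tau> y - \<tau> x) * (y - x) \<ge> 2 * a * (y - x)\<^sup>2"
    using lower[of y x] lower[of x y] by (simp add: algebra_simps power2_eq_square)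
  have 2: "(\<tau> y - \<tau> x) * (y - x) \<le> 2 * b * (y - x)\<^sup>2"
    using upper[of y x] upper[of x y] by (simp add: algebra_simps power2_eq_square)
  show "\<tau> x \<le> \<tau> y"
  proof (cases "x = y")
    case False
    then have "0 \<le> (\<tau> y - \<tau> x) * (y - x)" using 1 a_pos by (smt (verit) mult_nonneg_nonneg zero_le_power2)
    then show ?thesis using False assms by (simp add: zero_le_mult_iff)
  qed simp
  show "\<tau> y \<le> \<tau> x + 2 * b * (y - x)"
  proof (cases "x = y")
    case False
    then have "(\<tau> y - \<tau> x) \<le> 2 * b * (y - x)" using 2 assms
      by (simp add: power2_eq_square)
    then show ?thesis by simp
  qed simp
qed

text \<open>Here \<open>f0\<close>, \<open>f1\<close>, \<open>f2\<close> stand for values of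
  \<open>g\<close> minus a linear function at three consecutive points with gaps \<open>u\<close>
  and \<open>h\<close>. If the last two nearly lie on a line, convexity keeps the first from being
  far below it, no matter how large \<open>u\<close> is.\<close>

lemma line_near_pair:
  fixes c :: real
  assumes h: "0 < \<sigma>" "\<sigma> \<le> h" and u: "0 < u"
    and D: "a * (u * h * (u + h)) \<le> f0 * h + f2 * u - f1 * (u + h)"
    and e: "\<bar>f1 - L\<bar> \<le> \<epsilon>" "\<bar>f2 - L\<bar> \<le> \<epsilon>" "f0 \<le> L - d + \<epsilon>"
  shows "d \<le> 2 * \<epsilon> + \<epsilon>\<^sup>2 / (a * \<sigma>\<^sup>2)"
proof -
  have hp: "h > 0" using h by simp
  have "(f0 - f1) * h \<ge> a * (u * h * (u + h)) - (f2 - f1) * u"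
    using D by (simp add: algebra_simps)
  moreover have "(f2 - f1) * u \<le> 2 * \<epsilon> * u" using e u by (intro mult_right_mono) auto
  moreover have "a * (u * h * (u + h)) \<ge> a * h * u\<^sup>2"
    using a_pos u hp by (simp add: algebra_simps power2_eq_square)
  moreover have "(f0 - f1) * h \<le> (2 * \<epsilon> - d) * h" using e hp by (intro mult_right_mono) auto
  ultimately have 1: "(d - 2 * \<epsilon>) * h \<le> 2 * \<epsilon> * u - a * h * u\<^sup>2" by (simp add: algebra_simps)
  \<comment> \<open>Completing the square bounds the quadratic in \<open>u\<close> by its maximum,
    so the unknown gap disappears.\<close>
  have "0 \<le> (\<epsilon> - a * h * u)\<^sup>2" by simp
  then have 2: "(2 * \<epsilon> * u - a * h * u\<^sup>2) * (a * h) \<le> \<epsilon>\<^sup>2" by (simp add: algebra_simps power2_eq_square)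
  have "(d - 2 * \<epsilon>) * (a * h\<^sup>2) = ((d - 2 * \<epsilon>) * h) * (a * h)" by (simp add: power2_eq_square)
  also have "\<dots> \<le> (2 * \<epsilon> * u - a * h * u\<^sup>2) * (a * h)"
    using 1 a_pos hp by (intro mult_right_mono) auto
  also note 2
  finally have "d - 2 * \<epsilon> \<le> \<epsilon>\<^sup>2 / (a * h\<^sup>2)" using a_pos hp by (simp add: field_simps)
  also have "\<dots> \<le> \<epsilon>\<^sup>2 / (a * \<sigma>\<^sup>2)"
    using a_pos h hp by (intro divide_left_mono mult_left_mono power_mono mult_pos_pos) auto
  finally show ?thesis by simp
qed

text \<open>If \<open>z\<close> is left of \<open>w2\<close>, the pair \<open>w2\<close>,
  \<open>w3\<close> is used, otherwise \<open>w1\<close>, \<open>w2\<close>; in both cases the gap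
  \<open>h\<close> of \<open>line_near_pair\<close> is at least \<open>\<sigma>\<close>. Three
  points on the line are needed because \<open>z\<close> may lie on either side or between
  them.\<close>

lemma parallel_lines:
  assumes w: "w1 < w2" "w2 < w3" "\<sigma> \<le> w2 - w1" "\<sigma> \<le> w3 - w2" "0 < \<sigma>"
    and e: "\<bar>g w1 - (c * w1 + L)\<bar> \<le> \<epsilon>" "\<bar>g w2 - (c * w2 + L)\<bar> \<le> \<epsilon>" "\<bar>g w3 - (c * w3 + L)\<bar> \<le> \<epsilon>"
    and z: "g z \<le> c * z + L - d + \<epsilon>"
  shows "d \<le> 2 * \<epsilon> + \<epsilon>\<^sup>2 / (a * \<sigma>\<^sup>2)"
proof -
  consider "z < w2" | "z = w2" | "w2 < z" by linarith
  then show ?thesis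
  proof cases
    case 1
    show ?thesis
    proof (rule line_near_pair[where h = "w3 - w2" and u = "w2 - z" and ?f0.0 = "g z - c * z"
          and ?f1.0 = "g w2 - c * w2" and ?f2.0 = "g w3 - c * w3" and L = L])
      show "a * ((w2 - z) * (w3 - w2) * (w2 - z + (w3 - w2)))
          \<le> (g z - c * z) * (w3 - w2) + (g w3 - c * w3) * (w2 - z) - (g w2 - c * w2) * (w2 - z + (w3 - w2))"
        using three_point(1)[OF 1 w(2)] by (simp add: algebra_simps)
    qed (use assms 1 in auto)
  next
    case 2
    have "0 \<le> \<epsilon>\<^sup>2 / (a * \<sigma>\<^sup>2)" using a_pos by simp
    moreover have "g w2 \<le> c * w2 + L - d + \<epsilon>" using z 2 by simp
    ultimately show ?thesis using e(2) by linarith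
  next
    case 3
    show ?thesis
    proof (rule line_near_pair[where h = "w2 - w1" and u = "z - w2" and ?f0.0 = "g z - c * z"
          and ?f1.0 = "g w2 - c * w2" and ?f2.0 = "g w1 - c * w1" and L = L])
      show "a * ((z - w2) * (w2 - w1) * (z - w2 + (w2 - w1)))
          \<le> (g z - c * z) * (w2 - w1) + (g w1 - c * w1) * (z - w2) - (g w2 - c * w2) * (z - w2 + (w2 - w1))"
        using three_point(1)[OF w(1) 3] by (simp add: algebra_simps)
    qed (use assms 3 in auto)
  qed
qed

end

context strongly_convex begin

definition near_points :: "real \<Rightarrow> real \<Rightarrow> real \<Rightarrow> real \<Rightarrow> (int \<times> int \<times> int) set" where
  "near_points u v J \<Delta> = {w. J / 2 < of_int (pd w) \<and> of_int (pd w) \<le> J \<and> u \<le> px w \<and> px w \<le> v \<and>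
      \<bar>of_int (pd w) * g (px w) - of_int (snd (snd w))\<bar> < \<Delta>}"

lemma near_points_err:
  assumes "w \<in> near_points u v J \<Delta>" "J > 0"
  shows "pd w > 0" "of_int (pd w) \<le> J" "\<bar>g (px w) - py w\<bar> \<le> 2 * \<Delta> / J"
proof -
  have *: "J / 2 < of_int (pd w)" "of_int (pd w) \<le> J" "\<bar>of_int (pd w) * g (px w) - of_int (snd (snd w))\<bar> < \<Delta>"
    using assms by (auto simp: near_points_def)
  show pos: "pd w > 0" using *(1) assms(2) by (smt (verit) half_gt_zero of_int_0_less_iff)
  show "of_int (pd w) \<le> J" by fact
  have "\<bar>g (px w) - py w\<bar> = \<bar>of_int (pd w) * g (px w) - of_int (snd (snd w))\<bar> / of_int (pd w)"
  proof -
    have "g (px w) - py w = (of_int (pd w) * g (px w) - of_int (snd (snd w))) / of_int (pd w)"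
      using pos by (simp add: py_def pd_def field_simps)
    then show ?thesis using pos by (simp add: abs_divide)
  qed
  also have "\<dots> \<le> \<Delta> / of_int (pd w)" using * pos by (intro divide_right_mono) auto
  also have "\<dots> \<le> \<Delta> / (J / 2)" using * pos assms(2) by (intro divide_left_mono) auto
  finally show "\<bar>g (px w) - py w\<bar> \<le> 2 * \<Delta> / J" by (simp add: mult.commute)
qed

text \<open>For equal abscissae the number \<open>m * j' - m' * j\<close> is an integer of absolute
  value below 1, hence zero. The two triples are then proportional, and proportional primitive
  triples with positive \<open>j\<close> coincide.\<close>

lemma px_primitive_inj:
  assumes "J > 0" "2 * \<Delta> * J < 1"
  shows "inj_on px {w \<in> near_points u v J \<Delta>. primitive_pt w}"
proof (rule inj_onI)
  fix w w' assume ww: "w \<in> {w \<in> near_points u v J \<Delta>. primitive_pt w}"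
    "w' \<in> {w \<in> near_points u v J \<Delta>. primitive_pt w}" "px w = px w'"
  obtain l j m where w: "w = (l, j, m)" by (cases w)
  obtain l' j' m' where w': "w' = (l', j', m')" by (cases w')
  have pos: "j > 0" "j' > 0" and le: "of_int j \<le> J" "of_int j' \<le> J"
    using ww near_points_err[OF _ assms(1)] by (auto simp: w w' pd_def)
  have near: "\<bar>of_int j * g (px w) - of_int m\<bar> < \<Delta>" "\<bar>of_int j' * g (px w) - of_int m'\<bar> < \<Delta>"
    using ww by (auto simp: near_points_def w w' pd_def)
  have \<Delta>: "\<Delta> > 0" using near(1) by linarith
  have "real_of_int (m * j' - m' * j) = of_int j * (of_int j' * g (px w) - of_int m') - of_int j' * (of_int j * g (px w) - of_int m)"
    by (simp add: algebra_simps)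
  then have "\<bar>real_of_int (m * j' - m' * j)\<bar> \<le> of_int j * \<bar>of_int j' * g (px w) - of_int m'\<bar> + of_int j' * \<bar>of_int j * g (px w) - of_int m\<bar>"
    using pos abs_triangle_ineq4[of "of_int j * (of_int j' * g (px w) - of_int m')" "of_int j' * (of_int j * g (px w) - of_int m)"]
    by (simp only: abs_mult abs_of_pos of_int_0_less_iff)
  also have "\<dots> \<le> J * \<Delta> + J * \<Delta>"
    using near le pos \<Delta> by (intro add_mono mult_mono) auto
  also have "\<dots> < 1" using assms(2) by (simp add: algebra_simps)
  finally have "m * j' - m' * j = 0" by linarith
  then have m: "m * j' = m' * j" by simp
  have "real_of_int (l * j') = real_of_int (l' * j)"
    using ww(3) pos by (simp add: px_def w w' field_simps)
  then have l: "l * j' = l' * j" by linarith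
  have dvd: "j dvd j'" if h: "gcd l (gcd j m) = 1" "m * j' = m' * j" "l * j' = l' * j" for l j m l' j' m' :: int
  proof -
    obtain x y z where xyz: "x * l + y * j + z * m = 1" using bezout3_int[OF h(1)] .
    have "j' = (x * l + y * j + z * m) * j'" using xyz by simp
    also have "\<dots> = x * (l * j') + y * j * j' + z * (m * j')" by (simp add: algebra_simps)
    also have "\<dots> = j * (x * l' + y * j' + z * m')" unfolding h(2,3) by (simp add: algebra_simps)
    finally show ?thesis by (metis dvd_triv_left)
  qed
  have "j dvd j'" using ww(1) l m by (intro dvd[where l = l and j = j and m = m and m' = m' and l' = l']) (auto simp: primitive_pt_def w)
  moreover have "j' dvd j" using ww(2) l m by (intro dvd[where l = l' and j = j' and m = m' and m' = m and l' = l]) (auto simp: primitive_pt_def w')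
  ultimately have "j' = j" using pos by (simp add: zdvd_antisym_nonneg)
  then show "w = w'" using l m pos by (simp add: w w')
qed

lemma finite_near_points: "finite (near_points u v J \<Delta>)"
proof -
  define B where "B = \<lceil>(\<bar>u\<bar> + \<bar>v\<bar>) * \<bar>J\<bar>\<rceil>"
  have "near_points u v J \<Delta> \<subseteq> (\<Union>l\<in>{-B..B}. \<Union>j\<in>{0..\<lceil>J\<rceil>}. (\<lambda>m. (l, j, m)) ` 
      {\<lfloor>of_int j * g (of_int l / of_int j) - \<Delta>\<rfloor>..\<lceil>of_int j * g (of_int l / of_int j) + \<Delta>\<rceil>})"
  proof
    fix w assume w0: "w \<in> near_points u v J \<Delta>"
    obtain l j m where w: "w = (l, j, m)" by (cases w)
    have *: "J / 2 < of_int j" "of_int j \<le> J" "u \<le> px w" "px w \<le> v" "\<bar>of_int j * g (px w) - of_int m\<bar> < \<Delta>"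
      using w0 by (auto simp: near_points_def w pd_def)
    then have j: "j > 0" "J > 0" by (smt (verit) half_gt_zero_iff field_sum_of_halves of_int_0_less_iff)+
    have "\<bar>px w\<bar> \<le> \<bar>u\<bar> + \<bar>v\<bar>" using * by linarith
    then have "\<bar>of_int l\<bar> \<le> (\<bar>u\<bar> + \<bar>v\<bar>) * of_int j" using j by (simp add: px_def w abs_divide field_simps)
    also have "\<dots> \<le> (\<bar>u\<bar> + \<bar>v\<bar>) * \<bar>J\<bar>" using * j by (intro mult_left_mono) auto
    finally have "l \<in> {-B..B}" unfolding B_def by (simp add: abs_le_iff) linarith
    moreover have "j \<in> {0..\<lceil>J\<rceil>}" using * j by (simp add: le_ceiling_iff) 
    moreover have "m \<in> {\<lfloor>of_int j * g (of_int l / of_int j) - \<Delta>\<rfloor>..\<lceil>of_int j * g (of_int l / of_int j) + \<Delta>\<rceil>}"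
      using *(5) by (simp add: px_def w) linarith
    ultimately show "w \<in> (\<Union>l\<in>{-B..B}. \<Union>j\<in>{0..\<lceil>J\<rceil>}. (\<lambda>m. (l, j, m)) ` 
      {\<lfloor>of_int j * g (of_int l / of_int j) - \<Delta>\<rfloor>..\<lceil>of_int j * g (of_int l / of_int j) + \<Delta>\<rceil>})"
      unfolding w by blast
  qed
  then show ?thesis by (rule finite_subset) auto
qed

text \<open>Up to sign the determinant of the three integer triples, expanded along the last
  coordinates so that, after division by the denominators, it has the shape of the chord defect in
  \<open>three_point\<close>.\<close>

definition det3 :: "int \<times> int \<times> int \<Rightarrow> int \<times> int \<times> int \<Rightarrow> int \<times> int \<times> int \<Rightarrow> int" where
  "det3 P Q R = snd (snd P) * (fst R * pd Q - fst Q * pd R) + snd (snd R) * (fst Q * pd P - fst P * pd Q)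
     - snd (snd Q) * (fst R * pd P - fst P * pd R)"

text \<open>An integer of absolute value below 1. On an arc of length \<open>\<kappa> / J\<close>
  the chord defect of \<open>g\<close> is at most \<open>b * (\<kappa> / J) ^ 3\<close>, and
  clearing the denominators costs \<open>J ^ 3\<close>; the condition on \<open>\<kappa>\<close>
  makes this at most 1/2. The distances of the points from the curve add at most 1/4, by the bound
  on \<open>\<Delta>\<close>.\<close>

lemma det3_zero_sorted:
  assumes J: "J \<ge> 1" "0 < \<kappa>" "\<kappa> \<le> 1" "b * \<kappa> \<le> 1/2" "0 < \<Delta>" "\<Delta> \<le> 1 / (16 * J)"
    and P: "P \<in> near_points u v J \<Delta>" "Q \<in> near_points u v J \<Delta>" "R \<in> near_points u v J \<Delta>"
    and x: "px P < px Q" "px Q < px R" "px R - px P \<le> \<kappa> / J"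
  shows "det3 P Q R = 0"
proof -
  define \<epsilon> where "\<epsilon> = 2 * \<Delta> / J"
  define d where "d = px R - px P"
  have Jp: "J > 0" using J by simp
  have \<epsilon>: "\<epsilon> \<ge> 0" using J by (simp add: \<epsilon>_def)
  note eP = near_points_err[OF P(1) Jp, folded \<epsilon>_def]
  note eQ = near_points_err[OF P(2) Jp, folded \<epsilon>_def]
  note eR = near_points_err[OF P(3) Jp, folded \<epsilon>_def]
  define D where "D = py P * (px R - px Q) + py R * (px Q - px P) - py Q * (px R - px P)"
  have DD: "real_of_int (det3 P Q R) = of_int (pd P) * of_int (pd Q) * of_int (pd R) * D"
    using eP(1) eQ(1) eR(1) unfolding D_def det3_def px_def py_def pd_def 
    by (simp add: right_diff_distrib distrib_left diff_divide_distrib left_diff_distrib)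
  define G where "G = g (px P) * (px R - px Q) + g (px R) * (px Q - px P) - g (px Q) * (px R - px P)"
  have d: "d > 0" "px Q - px P \<le> d" "px R - px Q \<le> d" "d \<le> \<kappa> / J" using x by (auto simp: d_def)
  have prod: "0 \<le> (px Q - px P) * (px R - px Q) * (px R - px P)" "(px Q - px P) * (px R - px Q) * (px R - px P) \<le> d ^ 3"
    using x d unfolding power3_eq_cube by (auto intro!: mult_mono simp: d_def)
  have G: "\<bar>G\<bar> \<le> b * d ^ 3"
  proof -
    have "0 \<le> G" using three_point(1)[OF x(1,2)] prod a_pos unfolding G_def
      by (smt (verit) mult_nonneg_nonneg)
    moreover have "G \<le> b * ((px Q - px P) * (px R - px Q) * (px R - px P))"
      using three_point(2)[OF x(1,2)] unfolding G_def .
    moreover have "\<dots> \<le> b * d ^ 3" using prod b_pos by (intro mult_left_mono) auto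
    ultimately show ?thesis by linarith
  qed
  have "D - G = (py P - g (px P)) * (px R - px Q) + (py R - g (px R)) * (px Q - px P) - (py Q - g (px Q)) * (px R - px P)"
    by (simp add: D_def G_def algebra_simps)
  moreover have "\<bar>(py P - g (px P)) * (px R - px Q)\<bar> \<le> \<epsilon> * (px R - px Q)"
    using eP(3) x by (simp add: abs_mult abs_minus_commute)
  moreover have "\<bar>(py R - g (px R)) * (px Q - px P)\<bar> \<le> \<epsilon> * (px Q - px P)"
    using eR(3) x by (simp add: abs_mult abs_minus_commute)
  moreover have "\<bar>(py Q - g (px Q)) * (px R - px P)\<bar> \<le> \<epsilon> * (px R - px P)"
    using eQ(3) x by (simp add: abs_mult abs_minus_commute)
  moreover have "\<epsilon> * (px R - px Q) + \<epsilon> * (px Q - px P) + \<epsilon> * (px R - px P) = 2 * \<epsilon> * d"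
    by (simp add: d_def algebra_simps)
  ultimately have "\<bar>D\<bar> \<le> b * d ^ 3 + 2 * \<epsilon> * d" using G by linarith
  also have "\<dots> \<le> b * (\<kappa> / J) ^ 3 + 2 * \<epsilon> * (\<kappa> / J)"
    using d b_pos \<epsilon> by (intro add_mono mult_left_mono power_mono) auto
  finally have D: "\<bar>D\<bar> \<le> b * (\<kappa> / J) ^ 3 + 2 * \<epsilon> * (\<kappa> / J)" .
  have "\<bar>real_of_int (det3 P Q R)\<bar> \<le> J ^ 3 * (b * (\<kappa> / J) ^ 3 + 2 * \<epsilon> * (\<kappa> / J))"
    unfolding DD abs_mult power3_eq_cube using eP eQ eR D b_pos J \<epsilon>
    by (intro mult_mono) (auto simp: power3_eq_cube)
  also have "\<dots> = b * \<kappa> ^ 3 + 2 * \<epsilon> * \<kappa> * J\<^sup>2"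
    using Jp by (simp add: field_simps power3_eq_cube power2_eq_square)
  also have "\<dots> = b * \<kappa> * \<kappa>\<^sup>2 + 4 * \<kappa> * (\<Delta> * J)"
    using Jp by (simp add: \<epsilon>_def field_simps power3_eq_cube power2_eq_square)
  also have "\<dots> \<le> (1/2) * 1 + 4 * 1 * (1/16)"
  proof -
    have "\<Delta> * J \<le> 1/16" using J Jp by (simp add: field_simps)
    moreover have "\<kappa>\<^sup>2 \<le> 1" using J by (simp add: power_le_one)
    ultimately show ?thesis using J b_pos by (intro add_mono mult_mono) auto
  qed
  also have "\<dots> < 1" by simp
  finally show ?thesis by linarith
qed

text \<open>Subtracting a line does not change the convexity of \<open>g\<close>, so three near
  points on the line satisfy \<open>a * ((y - x) * (z - y)) \<le> 2 * \<epsilon>\<close>. This is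
  the triple condition of \<open>two_cluster_card\<close>, and \<open>on_line_spacing\<close>
  supplies the gap \<open>r / J\<^sup>2\<close>.\<close>

lemma line_card:
  assumes J: "J \<ge> 1" "0 < \<Delta>" "2 * \<Delta> * J < 1"
    and V: "V \<subseteq> {w \<in> near_points u v J \<Delta>. primitive_pt w}"
    and l: "\<And>w. w \<in> V \<Longrightarrow> on_line p s r w" "gcd p (gcd s r) = 1" "r > 0" and c: "3 \<le> card V"
  shows "real (card V) \<le> 8 * J powr (3/2) * sqrt (\<Delta> / a) / of_int r"
proof -
  define \<epsilon> where "\<epsilon> = 2 * \<Delta> / J"
  have Jp: "J > 0" using J by simp
  have inj: "inj_on px V" using px_primitive_inj[OF Jp J(3)] V by (rule inj_on_subset)
  have fin: "finite V" using c by (metis card.infinite not_numeral_le_zero)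
  have cY: "card (px ` V) = card V" using inj by (rule card_image)
  have VV: "pd w > 0" "of_int (pd w) \<le> J" "\<bar>g (px w) - (of_int p * px w + of_int s) / of_int r\<bar> \<le> \<epsilon>" if "w \<in> V" for w
  proof -
    have n: "w \<in> near_points u v J \<Delta>" using that V by auto
    show 1: "pd w > 0" "of_int (pd w) \<le> J" using near_points_err[OF n Jp] by auto
    show "\<bar>g (px w) - (of_int p * px w + of_int s) / of_int r\<bar> \<le> \<epsilon>"
      using near_points_err(3)[OF n Jp] on_line_py[OF l(1)[OF that] l(3) 1(1)] by (simp add: \<epsilon>_def)
  qed
  have "real (card (px ` V)) \<le> 4 * sqrt (2 * \<epsilon> / a) / (of_int r / J\<^sup>2)"
  proof (rule two_cluster_card)
    show "finite (px ` V)" using fin by simp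
    show "3 \<le> card (px ` V)" using c cY by simp
    show "0 < of_int r / J\<^sup>2" using l(3) Jp by simp
    show "0 \<le> sqrt (2 * \<epsilon> / a)" using J a_pos by (simp add: \<epsilon>_def)
    fix x y assume xy: "x \<in> px ` V" "y \<in> px ` V" "x < y"
    then obtain v w where vw: "v \<in> V" "w \<in> V" "x = px v" "y = px w" by blast
    show "of_int r / J\<^sup>2 \<le> y - x"
      using on_line_spacing[OF l(1)[OF vw(1)] l(1)[OF vw(2)] l(2,3)] VV vw xy(3) by auto
  next
    fix x y z assume xyz: "x \<in> px ` V" "y \<in> px ` V" "z \<in> px ` V" "x < y" "y < z"
    define L where "L = (\<lambda>x. (of_int p * x + of_int s) / of_int r :: real)"
    have e: "\<bar>g x - L x\<bar> \<le> \<epsilon>" "\<bar>g y - L y\<bar> \<le> \<epsilon>" "\<bar>g z - L z\<bar> \<le> \<epsilon>"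
      using xyz VV by (auto simp: L_def)
    have "a * ((y - x) * (z - y) * (z - x)) \<le> g x * (z - y) + g z * (y - x) - g y * (z - x)"
      by (rule three_point) fact+
    also have "\<dots> = (g x - L x) * (z - y) + (g z - L z) * (y - x) + (L y - g y) * (z - x)"
      using l(3) by (simp add: L_def field_simps)
    also have "\<dots> \<le> \<epsilon> * (z - y) + \<epsilon> * (y - x) + \<epsilon> * (z - x)"
      using e xyz by (intro add_mono mult_right_mono) auto
    also have "\<dots> = 2 * \<epsilon> * (z - x)" by (simp add: algebra_simps)
    finally have "a * ((y - x) * (z - y)) * (z - x) \<le> 2 * \<epsilon> * (z - x)" by (simp add: mult.assoc)
    then have "a * ((y - x) * (z - y)) \<le> 2 * \<epsilon>" using xyz by simp
    then have "(y - x) * (z - y) \<le> 2 * \<epsilon> / a" using a_pos by (simp add: field_simps)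
    moreover have "0 \<le> 2 * \<epsilon> / a" using a_pos J by (simp add: \<epsilon>_def)
    ultimately show "(y - x) * (z - y) \<le> (sqrt (2 * \<epsilon> / a))\<^sup>2" by simp
  qed
  also have "sqrt (2 * \<epsilon> / a) = 2 * sqrt (\<Delta> / a) / sqrt J"
  proof -
    have "2 * \<epsilon> / a = 4 * (\<Delta> / a) / J" by (simp add: \<epsilon>_def)
    also have "sqrt \<dots> = 2 * sqrt (\<Delta> / a) / sqrt J" by (simp add: real_sqrt_divide real_sqrt_mult)
    finally show ?thesis .
  qed
  also have "4 * (2 * sqrt (\<Delta> / a) / sqrt J) / (of_int r / J\<^sup>2) = 8 * (J\<^sup>2 / sqrt J) * sqrt (\<Delta> / a) / of_int r"
    using Jp l(3) by (simp only: divide_divide_eq_right times_divide_eq_right times_divide_eq_left mult.assoc mult.commute mult.left_commute) simp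
  also have "J\<^sup>2 / sqrt J = J powr 2 / J powr (1/2)"
    using Jp by (simp add: powr_half_sqrt)
  also have "\<dots> = J powr (3/2)" by (simp add: powr_diff[symmetric])
  finally show ?thesis using cY by simp
qed

end

lemma three_sorted:
  fixes Y :: "real set"
  assumes "3 \<le> card Y"
  obtains x y z where "x \<in> Y" "y \<in> Y" "z \<in> Y" "x < y" "y < z"
proof -
  have fin: "finite Y" using assms by (metis card.infinite not_numeral_le_zero)
  have ne: "Y \<noteq> {}" using assms by auto
  define x z where "x = Min Y" and "z = Max Y"
  have xz: "x \<in> Y" "z \<in> Y" "\<And>y. y \<in> Y \<Longrightarrow> x \<le> y \<and> y \<le> z"
    using fin ne by (auto simp: x_def z_def)
  have "\<not> Y \<subseteq> {x, z}"
  proof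
    assume "Y \<subseteq> {x, z}"
    then have "card Y \<le> card {x, z}" by (intro card_mono) auto
    also have "\<dots> \<le> 2" by (simp add: card_insert_if)
    finally show False using assms by simp
  qed
  then obtain y where "y \<in> Y" "y \<noteq> x" "y \<noteq> z" by auto
  then show thesis using that[of x y z] xz by force
qed

context strongly_convex begin

text \<open>With two points \<open>P\<close> and \<open>Q\<close> fixed, all determinants vanish by
  \<open>det3_zero_sorted\<close>, whatever the order of the three points on the axis; hence every
  point lies on the line through \<open>P\<close> and \<open>Q\<close>.\<close>

lemma arc_line:
  assumes J: "J \<ge> 1" "0 < \<kappa>" "\<kappa> \<le> 1" "b * \<kappa> \<le> 1/2" "0 < \<Delta>" "\<Delta> \<le> 1 / (16 * J)"
    and W: "W \<subseteq> {w \<in> near_points u v J \<Delta>. primitive_pt w}" "3 \<le> card W"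
    and arc: "\<And>w w'. w \<in> W \<Longrightarrow> w' \<in> W \<Longrightarrow> px w' - px w \<le> \<kappa> / J"
  obtains p s r where "r > 0" "gcd p (gcd s r) = 1" "\<And>w. w \<in> W \<Longrightarrow> on_line p s r w"
proof -
  have Jp: "J > 0" using J by simp
  have "2 * \<Delta> * J < 1" using J Jp by (simp add: field_simps)
  then have inj: "inj_on px W" using px_primitive_inj[OF Jp] W(1) inj_on_subset by blast
  then have "3 \<le> card (px ` W)" using W(2) by (simp add: card_image)
  then obtain P Q where PQ: "P \<in> W" "Q \<in> W" "px P < px Q"
    by (elim three_sorted[of "px ` W"]) blast
  have Wn: "w \<in> near_points u v J \<Delta>" "pd w > 0" if "w \<in> W" for w
  proof -
    show "w \<in> near_points u v J \<Delta>" using that W(1) by auto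
    then show "pd w > 0" using near_points_err(1)[OF _ Jp] by blast
  qed
  have det0: "det3 P Q R = 0" if R: "R \<in> W" for R
  proof -
    note z = det3_zero_sorted[OF J Wn(1) Wn(1) Wn(1) _ _ arc]
    consider "R = P" | "R = Q" | "px R < px P" | "px P < px R" "px R < px Q" | "px Q < px R"
      using inj PQ R by (metis inj_onD linorder_neqE_linordered_idom)
    then show ?thesis
    proof cases
      case 3
      have "det3 R P Q = 0" using z[OF R PQ(1,2) 3 PQ(3) R PQ(2)] .
      then show ?thesis unfolding det3_def by (simp add: algebra_simps)
    next
      case 4
      have "det3 P R Q = 0" using z[OF PQ(1) R PQ(2) 4 PQ(1,2)] .
      then show ?thesis unfolding det3_def by (simp add: algebra_simps)
    next
      case 5
      show ?thesis using z[OF PQ(1,2) R PQ(3) 5 PQ(1) R] .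
    qed (simp_all add: det3_def algebra_simps)
  qed
  obtain l1 j1 m1 where P: "P = (l1, j1, m1)" by (cases P)
  obtain l2 j2 m2 where Q: "Q = (l2, j2, m2)" by (cases Q)
  \<comment> \<open>The cross product of \<open>P\<close> and \<open>Q\<close> gives the line. Its
    entry \<open>r0\<close> is positive because \<open>P\<close> lies to the left of
    \<open>Q\<close>; dividing by the greatest common divisor makes the coefficients
    primitive.\<close>
  define p0 s0 r0 where "p0 = m2 * j1 - m1 * j2" and "s0 = m1 * l2 - m2 * l1" and "r0 = l2 * j1 - l1 * j2"
  have "j1 > 0" "j2 > 0" using Wn(2)[OF PQ(1)] Wn(2)[OF PQ(2)] by (auto simp: P Q pd_def)
  then have "real_of_int r0 > 0" using PQ(3) by (simp add: px_def P Q field_simps r0_def)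
  then have r0: "r0 > 0" by linarith
  define d where "d = gcd p0 (gcd s0 r0)"
  have d: "d > 0" using r0 by (simp add: d_def gcd_pos_int)
  have "d dvd p0" unfolding d_def by (rule gcd_dvd1)
  then obtain p where p: "p0 = d * p" by (rule dvdE)
  have "d dvd gcd s0 r0" unfolding d_def by (rule gcd_dvd2)
  then have "d dvd s0" "d dvd r0" using gcd_dvd1 gcd_dvd2 dvd_trans by blast+
  then obtain s r where sr: "s0 = d * s" "r0 = d * r" by (elim dvdE)
  show thesis
  proof (rule that)
    show "r > 0" using r0 d sr by (simp add: zero_less_mult_iff)
    have "gcd (d * p) (gcd (d * s) (d * r)) = \<bar>d\<bar> * gcd p (gcd s r)"
      using gcd_mult_distrib_int[of d s r] gcd_mult_distrib_int[of d p "gcd s r"] d by simp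
    then have "d * gcd p (gcd s r) = gcd (d * p) (gcd (d * s) (d * r))" using d by simp
    also have "\<dots> = d" unfolding p[symmetric] sr[symmetric] by (rule d_def[symmetric])
    finally show "gcd p (gcd s r) = 1" using d by simp
    fix w assume w: "w \<in> W"
    obtain l j m where wl: "w = (l, j, m)" by (cases w)
    have "p0 * l + s0 * j = r0 * m"
      using det0[OF w] by (simp add: det3_def P Q wl pd_def p0_def s0_def r0_def algebra_simps)
    then have "d * (p * l + s * j) = d * (r * m)" by (simp add: p sr algebra_simps)
    then show "on_line p s r w" using d by (simp add: on_line_def wl)
  qed
qed

text \<open>Distinct lines with the same \<open>p\<close> and \<open>r\<close> are at vertical
  distance at least \<open>1 / r\<close>. If \<open>s < s'\<close>, the point \<open>w0\<close> is
  essentially that far below a line carrying three near points, and \<open>parallel_lines\<close>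
  would give 1 at most 1/2. Used in both directions, this leaves at most one line with three points
  for each pair \<open>p\<close>, \<open>r\<close>.\<close>

lemma line_unique:
  assumes J: "J \<ge> 1" "0 < \<Delta>" "\<Delta> \<le> 1 / (16 * J)" "\<Delta> \<le> a / J"
    and V: "V = {w \<in> near_points u v J \<Delta>. primitive_pt w}"
    and l: "gcd p (gcd s' r) = 1" "0 < r" "of_int r \<le> J"
    and c: "3 \<le> card {w \<in> V. on_line p s' r w}" "w0 \<in> V" "on_line p s r w0"
  shows "s' \<le> s"
proof (rule ccontr)
  assume "\<not> s' \<le> s"
  then have ss: "s < s'" by simp
  define \<epsilon> where "\<epsilon> = 2 * \<Delta> / J"
  define W where "W = {w \<in> V. on_line p s' r w}"
  have Jp: "J > 0" using J by simp
  have "2 * \<Delta> * J < 1" using J Jp by (simp add: field_simps)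
  then have inj: "inj_on px W" using px_primitive_inj[OF Jp] unfolding W_def V by (auto intro: inj_on_subset)
  then have "3 \<le> card (px ` W)" using c(1) by (simp add: card_image W_def)
  then obtain x y z where "x \<in> px ` W" "y \<in> px ` W" "z \<in> px ` W" "x < y" "y < z"
    by (rule three_sorted)
  then obtain w1 w2 w3 where w: "w1 \<in> W" "w2 \<in> W" "w3 \<in> W" "px w1 < px w2" "px w2 < px w3" by blast
  have VV: "pd w > 0" "of_int (pd w) \<le> J" "\<bar>g (px w) - (of_int p * px w + of_int s) / of_int r\<bar> \<le> \<epsilon>"
    if "w \<in> V" "on_line p s r w" for w s
  proof -
    have n: "w \<in> near_points u v J \<Delta>" using that V by auto
    show 1: "pd w > 0" "of_int (pd w) \<le> J" using near_points_err[OF n Jp] by auto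
    show "\<bar>g (px w) - (of_int p * px w + of_int s) / of_int r\<bar> \<le> \<epsilon>"
      using near_points_err(3)[OF n Jp] on_line_py[OF that(2) l(2) 1(1)] by (simp add: \<epsilon>_def)
  qed
  define c where "c = real_of_int p / of_int r"
  define L where "L = real_of_int s' / of_int r"
  have r: "real_of_int r \<ge> 1" using l(2) by simp
  have WW: "\<bar>g (px w) - (c * px w + L)\<bar> \<le> \<epsilon>" if "w \<in> W" for w
    using VV(3)[of w s'] that by (simp add: W_def c_def L_def add_divide_distrib)
  have sp: "of_int r / J\<^sup>2 \<le> px w' - px w" if "w \<in> W" "w' \<in> W" "px w < px w'" for w w'
    using on_line_spacing[of p s' r w w' J] that l(1,2) VV(1,2)[of w s'] VV(1,2)[of w' s'] by (simp add: W_def)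
  have "1 / of_int r \<le> 2 * \<epsilon> + \<epsilon>\<^sup>2 / (a * (of_int r / J\<^sup>2)\<^sup>2)"
  proof (rule parallel_lines[of "px w1" "px w2" "px w3" _ c L \<epsilon> "px w0"])
    have "g (px w0) \<le> c * px w0 + real_of_int s / of_int r + \<epsilon>"
      using VV(3)[OF \<open>w0 \<in> V\<close> \<open>on_line p s r w0\<close>] by (simp add: c_def add_divide_distrib)
    moreover have "real_of_int s / of_int r \<le> L - 1 / of_int r"
      using ss r unfolding L_def by (simp add: diff_divide_distrib[symmetric] divide_right_mono)
    ultimately show "g (px w0) \<le> c * px w0 + L - 1 / of_int r + \<epsilon>" by linarith
  qed (use w WW sp r Jp in auto)
  then have "1 \<le> of_int r * (2 * \<epsilon> + \<epsilon>\<^sup>2 / (a * (of_int r / J\<^sup>2)\<^sup>2))"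
    using r by (simp add: field_simps)
  also have "\<dots> = of_int r * (2 * \<epsilon>) + (\<epsilon> * J\<^sup>2) * ((\<epsilon> * J\<^sup>2) / a) / of_int r"
    using r a_pos Jp by (simp add: field_simps power2_eq_square)
  also have "\<dots> \<le> 1/4 + (1/8) * 2 / 1"
  proof (rule add_mono)
    have e: "\<epsilon> * J\<^sup>2 = 2 * (\<Delta> * J)" using Jp by (simp add: \<epsilon>_def power2_eq_square)
    have e1: "\<Delta> * J \<le> 1/16" "\<Delta> * J \<le> a" using J Jp by (simp_all add: field_simps)
    have "(\<epsilon> * J\<^sup>2) * ((\<epsilon> * J\<^sup>2) / a) \<le> (1/8) * 2"
      unfolding e using e1 J a_pos by (intro mult_mono) (auto simp: field_simps)
    then show "(\<epsilon> * J\<^sup>2) * ((\<epsilon> * J\<^sup>2) / a) / of_int r \<le> (1/8) * 2 / 1"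
      using r a_pos e J by (intro frac_le) auto
    have "of_int r * (2 * \<epsilon>) \<le> J * (2 * \<epsilon>)"
      using l(3) J by (intro mult_right_mono) (auto simp: \<epsilon>_def)
    also have "\<dots> = 4 * \<Delta>" using Jp by (simp add: \<epsilon>_def)
    also have "\<dots> \<le> 4 * (\<Delta> * J)" using J by simp
    finally show "of_int r * (2 * \<epsilon>) \<le> 1/4" using e1 by linarith
  qed
  finally show False by simp
qed

text \<open>Two points on the line are at least \<open>r / J\<^sup>2\<close> apart, which is at
  least \<open>2 * \<epsilon>\<close>, so \<open>p / r\<close> differs by at most 1 from a chord
  slope of \<open>g\<close>. Hence the number of possible \<open>p\<close> is at most a constant
  times \<open>r\<close>.\<close>

lemma line_slope:
  assumes J: "J \<ge> 1" "0 < \<Delta>" "\<Delta> \<le> 1 / (16 * J)"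
    and V: "V \<subseteq> {w \<in> near_points u v J \<Delta>. primitive_pt w}"
    and l: "gcd p (gcd s r) = 1" "0 < r" "\<And>w. w \<in> V \<Longrightarrow> on_line p s r w" "3 \<le> card V"
  shows "of_int r * (\<tau> u - 1) \<le> of_int p" "of_int p \<le> of_int r * (\<tau> u + 3 * b * (v - u) + 1)"
proof -
  define \<epsilon> where "\<epsilon> = 2 * \<Delta> / J"
  have Jp: "J > 0" using J by simp
  have "2 * \<Delta> * J < 1" using J Jp by (simp add: field_simps)
  then have inj: "inj_on px V" using px_primitive_inj[OF Jp] V by (auto intro: inj_on_subset)
  then have "3 \<le> card (px ` V)" using l(4) by (simp add: card_image)
  then obtain w1 w2 where w: "w1 \<in> V" "w2 \<in> V" "px w1 < px w2"
    by (elim three_sorted[of "px ` V"]) blast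
  have VV: "pd w > 0" "of_int (pd w) \<le> J" "\<bar>g (px w) - (of_int p * px w + of_int s) / of_int r\<bar> \<le> \<epsilon>"
    "u \<le> px w" "px w \<le> v" if "w \<in> V" for w
  proof -
    have n: "w \<in> near_points u v J \<Delta>" using that V by auto
    show 1: "pd w > 0" "of_int (pd w) \<le> J" using near_points_err[OF n Jp] by auto
    show "\<bar>g (px w) - (of_int p * px w + of_int s) / of_int r\<bar> \<le> \<epsilon>"
      using near_points_err(3)[OF n Jp] on_line_py[OF l(3)[OF that] l(2) 1(1)] by (simp add: \<epsilon>_def)
    show "u \<le> px w" "px w \<le> v" using n by (auto simp: near_points_def)
  qed
  have r: "real_of_int r \<ge> 1" using l(2) by simp
  define x y where "x = px w1" and "y = px w2"
  have xy: "x < y" "u \<le> x" "y \<le> v" using w VV by (auto simp: x_def y_def)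
  have "of_int r / J\<^sup>2 \<le> y - x"
    using on_line_spacing[OF l(3)[OF w(1)] l(3)[OF w(2)] l(1,2)] VV w by (auto simp: x_def y_def)
  moreover have "2 * \<epsilon> \<le> of_int r / J\<^sup>2"
  proof -
    have "2 * \<epsilon> * J\<^sup>2 = 4 * (\<Delta> * J)" using Jp by (simp add: \<epsilon>_def power2_eq_square)
    also have "\<dots> \<le> 1" using J Jp by (simp add: field_simps)
    finally show ?thesis using r Jp by (simp add: field_simps)
  qed
  ultimately have e2: "2 * \<epsilon> \<le> y - x" by linarith
  define c where "c = real_of_int p / of_int r"
  have "\<bar>(g y - g x) - c * (y - x)\<bar> \<le> 2 * \<epsilon>"
  proof -
    have "\<bar>g x - (c * x + real_of_int s / of_int r)\<bar> \<le> \<epsilon>" "\<bar>g y - (c * y + real_of_int s / of_int r)\<bar> \<le> \<epsilon>"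
      using VV(3)[OF w(1)] VV(3)[OF w(2)] by (simp_all add: x_def y_def c_def add_divide_distrib)
    moreover have "c * (y - x) = c * y - c * x" by (simp add: algebra_simps)
    ultimately show ?thesis by linarith
  qed
  then have 1: "\<bar>(g y - g x) - c * (y - x)\<bar> \<le> y - x" using e2 by linarith
  have t: "\<tau> u \<le> \<tau> x" "\<tau> x \<le> \<tau> u + 2 * b * (v - u)"
  proof -
    show "\<tau> u \<le> \<tau> x" using slope_bounds[OF xy(2)] by simp
    have "2 * b * (x - u) \<le> 2 * b * (v - u)" using xy b_pos by (intro mult_left_mono) auto
    then show "\<tau> x \<le> \<tau> u + 2 * b * (v - u)" using slope_bounds(2)[OF xy(2)] by linarith
  qed
  have "0 \<le> a * (y - x)\<^sup>2" using a_pos by simp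
  then have "\<tau> x * (y - x) \<le> g y - g x" using lower[of y x] by linarith
  then have "(\<tau> x - 1) * (y - x) \<le> c * (y - x)" using 1 by (simp add: algebra_simps)
  then have "\<tau> x - 1 \<le> c" using xy by simp
  then have "\<tau> u - 1 \<le> c" using t by simp
  then show "of_int r * (\<tau> u - 1) \<le> of_int p" using r by (simp add: c_def field_simps)
  have "b * (y - x)\<^sup>2 \<le> b * (v - u) * (y - x)"
    using b_pos xy by (simp add: power2_eq_square)
  then have "g y - g x \<le> (\<tau> x + b * (v - u)) * (y - x)" using upper[of y x] by (simp add: algebra_simps)
  then have "c * (y - x) \<le> (\<tau> x + b * (v - u) + 1) * (y - x)" using 1 by (simp add: algebra_simps)
  then have "c \<le> \<tau> x + b * (v - u) + 1" using xy by simp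
  also have "\<dots> \<le> \<tau> u + 3 * b * (v - u) + 1" using t by (simp add: algebra_simps)
  finally show "of_int p \<le> of_int r * (\<tau> u + 3 * b * (v - u) + 1)" using r by (simp add: c_def field_simps)
qed

text \<open>The range is cut into arcs of length \<open>\<kappa> / J\<close>, and an arc with at
  least three points determines a line. Arcs with fewer points, or with \<open>r > R\<close>, cost
  at most \<open>2 + S / R\<close> each. For \<open>r \<le> R\<close> the count goes by lines
  instead of arcs: O(r) slopes, one intercept per slope, at most \<open>S / r\<close> points on
  each, in total O(S R).\<close>

lemma primitive_count:
  assumes J: "J \<ge> 1" "0 < \<Delta>" "\<Delta> \<le> 1 / (16 * J)" "\<Delta> \<le> a / J"
    and \<kappa>: "0 < \<kappa>" "\<kappa> \<le> 1" "b * \<kappa> \<le> 1/2" and uv: "u \<le> v" and R: "1 \<le> R" "real R \<le> J"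
    and S: "S = 8 * J powr (3/2) * sqrt (\<Delta> / a)"
  shows "real (card {w \<in> near_points u v J \<Delta>. primitive_pt w})
      \<le> ((v - u) * J / \<kappa> + 1) * (2 + S / R) + (3 + 3 * b * (v - u)) * S * R"
proof -
  define V where "V = {w \<in> near_points u v J \<Delta>. primitive_pt w}"
  have Jp: "J > 0" using J by simp
  have \<Delta>J: "2 * \<Delta> * J < 1" using J Jp by (simp add: field_simps)
  have S0: "S \<ge> 0" using J a_pos by (simp add: S)
  have finV: "finite V" using finite_near_points by (simp add: V_def)
  define idx where "idx w = \<lfloor>(px w - u) * J / \<kappa>\<rfloor>" for w
  define N where "N = \<lfloor>(v - u) * J / \<kappa>\<rfloor>"
  define A where "A i = {w \<in> V. idx w = i}" for i
  have idx: "idx w \<in> {0..N}" if "w \<in> V" for w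
    unfolding idx_def N_def using that Jp \<kappa>
    by (auto simp: V_def near_points_def intro!: floor_mono divide_right_mono mult_right_mono)
  have N0: "0 \<le> N" using uv Jp \<kappa> by (simp add: N_def)
  have cN: "real (card {0..N}) \<le> (v - u) * J / \<kappa> + 1" using N0 by (simp add: N_def)
  have finA: "finite (A i)" for i using finV by (simp add: A_def)
  have AV: "A i \<subseteq> V" for i by (auto simp: A_def)
  have line: "\<exists>p s r. r > 0 \<and> gcd p (gcd s r) = 1 \<and> (\<forall>w\<in>A i. on_line p s r w)" if "3 \<le> card (A i)" for i
  proof -
    have sub: "A i \<subseteq> {w \<in> near_points u v J \<Delta>. primitive_pt w}" using AV by (simp add: V_def)
    have arc: "px w' - px w \<le> \<kappa> / J" if "w \<in> A i" "w' \<in> A i" for w w'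
    proof -
      have "\<lfloor>(px w - u) * J / \<kappa>\<rfloor> = \<lfloor>(px w' - u) * J / \<kappa>\<rfloor>" using that by (simp add: A_def idx_def)
      then have "(px w' - u) * J / \<kappa> - (px w - u) * J / \<kappa> \<le> 1" by linarith
      then show ?thesis using Jp \<kappa> by (simp add: field_simps)
    qed
    from arc_line[OF J(1) \<kappa> J(2,3) sub that arc] show ?thesis by metis
  qed
  then obtain p s r where psr: "\<And>i. 3 \<le> card (A i) \<Longrightarrow> r i > 0 \<and> gcd (p i) (gcd (s i) (r i)) = 1 \<and> (\<forall>w\<in>A i. on_line (p i) (s i) (r i) w)"
    by metis
  define I1 where "I1 = {i \<in> {0..N}. card (A i) < 3}"
  define I2 where "I2 = {i \<in> {0..N}. 3 \<le> card (A i) \<and> int R < r i}"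
  define I3 where "I3 = {i \<in> {0..N}. 3 \<le> card (A i) \<and> r i \<le> int R}"
  have split: "V \<subseteq> (\<Union>i\<in>I1 \<union> I2. A i) \<union> (\<Union>i\<in>I3. A i)"
    using idx unfolding A_def I1_def I2_def I3_def by fastforce
  have fin: "finite I1" "finite I2" "finite I3" by (simp_all add: I1_def I2_def I3_def del: atLeastAtMost_iff)
  have "real (card (\<Union>i\<in>I1 \<union> I2. A i)) \<le> real (\<Sum>i\<in>I1 \<union> I2. card (A i))"
    using fin by (intro of_nat_mono card_UN_le) auto
  also have "\<dots> \<le> (\<Sum>i\<in>I1 \<union> I2. 2 + S / R)"
  proof (unfold of_nat_sum, rule sum_mono)
    fix i assume "i \<in> I1 \<union> I2"
    then consider "card (A i) < 3" | "3 \<le> card (A i)" "int R < r i" by (auto simp: I1_def I2_def)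
    then show "real (card (A i)) \<le> 2 + S / R"
    proof cases
      case 1
      have "0 \<le> S / R" using S0 by simp
      then show ?thesis using 1 by linarith
    next
      case 2
      have "real (card (A i)) \<le> S / of_int (r i)"
        unfolding S using psr[OF 2(1)] 2(1) AV[of i] line_card[OF J(1,2) \<Delta>J, of "A i" u v "p i" "s i" "r i"]
        by (auto simp: V_def)
      also have "\<dots> \<le> S / R" using 2(2) R S0 by (intro divide_left_mono) auto
      finally show ?thesis by simp
    qed
  qed
  also have "\<dots> = real (card (I1 \<union> I2)) * (2 + S / R)" by simp
  also have "\<dots> \<le> real (card {0..N}) * (2 + S / R)"
    using S0 by (intro mult_right_mono of_nat_mono card_mono) (auto simp: I1_def I2_def)
  also have "\<dots> \<le> ((v - u) * J / \<kappa> + 1) * (2 + S / R)" using cN S0 by (intro mult_right_mono) auto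
  finally have B1: "real (card (\<Union>i\<in>I1 \<union> I2. A i)) \<le> ((v - u) * J / \<kappa> + 1) * (2 + S / R)" .
  define PP where "PP r = {p::int. of_int r * (\<tau> u - 1) \<le> of_int p \<and> of_int p \<le> of_int r * (\<tau> u + 3 * b * (v - u) + 1)}" for r :: int
  \<comment> \<open>The points on any line with these \<open>p\<close> and \<open>r\<close> that
    carries at least three points; by \<open>line_unique\<close> they all lie on a single line, so
    \<open>line_card\<close> bounds the whole set.\<close>
  define B where "B p r = {w \<in> V. \<exists>s. gcd p (gcd s r) = 1 \<and> on_line p s r w \<and> 3 \<le> card {w \<in> V. on_line p s r w}}" for p r
  have PPc: "finite (PP r)" "real (card (PP r)) \<le> (3 + 3 * b * (v - u)) * of_int r" if r: "0 < r" for r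
  proof -
    let ?l = "of_int r * (\<tau> u - 1)" and ?h = "of_int r * (\<tau> u + 3 * b * (v - u) + 1)"
    have eq: "PP r = {\<lceil>?l\<rceil>..\<lfloor>?h\<rfloor>}" unfolding PP_def by (auto simp: le_floor_iff ceiling_le_iff)
    then show "finite (PP r)" by simp
    have lh: "?l \<le> ?h" using r b_pos uv by (intro mult_left_mono) auto
    have "real (card (PP r)) \<le> ?h - ?l + 1" unfolding eq using lh by simp linarith
    also have "\<dots> \<le> (3 + 3 * b * (v - u)) * of_int r" using r by (simp add: algebra_simps)
    finally show "real (card (PP r)) \<le> (3 + 3 * b * (v - u)) * of_int r" .
  qed
  have Bc: "real (card (B p r)) \<le> S / of_int r" if r: "0 < r" "r \<le> int R" for p r
  proof (cases "B p r = {}")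
    case False
    then obtain w0 where "w0 \<in> B p r" by blast
    then obtain s0 where w0: "w0 \<in> V" "gcd p (gcd s0 r) = 1" "on_line p s0 r w0" "3 \<le> card {w \<in> V. on_line p s0 r w}"
      unfolding B_def mem_Collect_eq by metis
    have rJ: "real_of_int r \<le> J" using r R by linarith
    have "B p r \<subseteq> {w \<in> V. on_line p s0 r w}"
    proof
      fix w assume "w \<in> B p r"
      then obtain s where s: "w \<in> V" "gcd p (gcd s r) = 1" "on_line p s r w" "3 \<le> card {w \<in> V. on_line p s r w}"
        unfolding B_def mem_Collect_eq by metis
      have "s \<le> s0" by (rule line_unique[OF J V_def s(2) r(1) rJ s(4) w0(1) w0(3)])
      moreover have "s0 \<le> s" by (rule line_unique[OF J V_def w0(2) r(1) rJ w0(4) s(1) s(3)])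
      ultimately show "w \<in> {w \<in> V. on_line p s0 r w}" using s by simp
    qed
    then have "card (B p r) \<le> card {w \<in> V. on_line p s0 r w}" using finV by (intro card_mono) auto
    also have "real \<dots> \<le> S / of_int r"
      unfolding S by (rule line_card[OF J(1,2) \<Delta>J _ _ w0(2) r(1) w0(4)]) (auto simp: V_def)
    finally show ?thesis by simp
  qed (use S0 r in auto)
  have "(\<Union>i\<in>I3. A i) \<subseteq> (\<Union>r\<in>{1..int R}. \<Union>p\<in>PP r. B p r)"
  proof
    fix w assume "w \<in> (\<Union>i\<in>I3. A i)"
    then obtain i where i: "3 \<le> card (A i)" "r i \<le> int R" "w \<in> A i" by (auto simp: I3_def)
    note l = psr[OF i(1)]
    have sub: "A i \<subseteq> {w \<in> V. on_line (p i) (s i) (r i) w}" using l AV by auto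
    then have "card (A i) \<le> card {w \<in> V. on_line (p i) (s i) (r i) w}" using finV by (intro card_mono) auto
    then have c3: "3 \<le> card {w \<in> V. on_line (p i) (s i) (r i) w}" using i(1) by linarith
    have wV: "w \<in> V" "on_line (p i) (s i) (r i) w" using sub i(3) by blast+
    have "w \<in> B (p i) (r i)" unfolding B_def mem_Collect_eq
      by (rule conjI[OF wV(1)], rule exI[of _ "s i"], intro conjI wV c3 l[THEN conjunct2, THEN conjunct1])
    moreover have "p i \<in> PP (r i)"
      using line_slope[OF J(1-3), of "A i" u v "p i" "s i" "r i"] l i AV[of i] by (auto simp: PP_def V_def)
    ultimately show "w \<in> (\<Union>r\<in>{1..int R}. \<Union>p\<in>PP r. B p r)" using l i(2) by force
  qed
  then have "card (\<Union>i\<in>I3. A i) \<le> card (\<Union>r\<in>{1..int R}. \<Union>p\<in>PP r. B p r)"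
    using finV PPc(1) by (intro card_mono) (auto simp: B_def)
  also have "\<dots> \<le> (\<Sum>r\<in>{1..int R}. card (\<Union>p\<in>PP r. B p r))" by (intro card_UN_le) auto
  also have "\<dots> \<le> (\<Sum>r\<in>{1..int R}. \<Sum>p\<in>PP r. card (B p r))"
    using PPc(1) by (intro sum_mono card_UN_le) auto
  finally have "real (card (\<Union>i\<in>I3. A i)) \<le> real (\<Sum>r\<in>{1..int R}. \<Sum>p\<in>PP r. card (B p r))"
    by (rule of_nat_mono)
  also have "\<dots> \<le> (\<Sum>r\<in>{1..int R}. \<Sum>p\<in>PP r. S / of_int r)"
    unfolding of_nat_sum using Bc by (intro sum_mono) auto
  also have "\<dots> = (\<Sum>r\<in>{1..int R}. real (card (PP r)) * (S / of_int r))" by simp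
  also have "\<dots> \<le> (\<Sum>r\<in>{1..int R}. (3 + 3 * b * (v - u)) * of_int r * (S / of_int r))"
    using PPc S0 by (intro sum_mono mult_right_mono) auto
  also have "\<dots> = (\<Sum>r\<in>{1..int R}. (3 + 3 * b * (v - u)) * S)" by (intro sum.cong) auto
  also have "\<dots> = (3 + 3 * b * (v - u)) * S * R" by simp
  finally have B2: "real (card (\<Union>i\<in>I3. A i)) \<le> (3 + 3 * b * (v - u)) * S * R" .
  have "card V \<le> card ((\<Union>i\<in>I1 \<union> I2. A i) \<union> (\<Union>i\<in>I3. A i))"
    using split fin finA by (intro card_mono) auto
  also have "\<dots> \<le> card (\<Union>i\<in>I1 \<union> I2. A i) + card (\<Union>i\<in>I3. A i)" by (rule card_Un_le)
  finally show ?thesis using B1 B2 unfolding V_def by linarith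
qed

end

section \<open>From primitive points to all points\<close>

lemma harmonic_le: "(\<Sum>k=1..n. 1 / real k) \<le> 1 + ln (real n)" if "n \<ge> 1"
  using that
proof (induction n rule: nat_induct_at_least)
  case base
  then show ?case by simp
next
  case (Suc n)
  have "ln (real n / real (Suc n)) \<le> real n / real (Suc n) - 1"
    using Suc by (intro ln_le_minus_one) auto
  moreover have "real n / real (Suc n) - 1 = - (1 / real (Suc n))" by (simp add: field_simps)
  ultimately have "1 / real (Suc n) \<le> ln (real (Suc n)) - ln (real n)"
    using Suc by (simp add: ln_div)
  then show ?case using Suc by simp
qed

lemma inverse_squares_le: "(\<Sum>k=1..n. 1 / (real k)\<^sup>2) \<le> 2"
proof -
  have "(\<Sum>k=1..n. 1 / (real k)\<^sup>2) \<le> 2 - 1 / real n" if "n \<ge> 1"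
    using that
  proof (induction n rule: nat_induct_at_least)
    case (Suc n)
    have "1 / (real (Suc n))\<^sup>2 \<le> 1 / (real n * real (Suc n))"
      using Suc by (intro divide_left_mono) (auto simp: power2_eq_square)
    also have "\<dots> = 1 / real n - 1 / real (Suc n)" using Suc by (simp add: field_simps)
    finally show ?case using Suc by simp
  qed simp
  then show ?thesis by (cases "n \<ge> 1") (auto intro: order_trans)
qed

context strongly_convex begin

lemma near_points_gcd_cover:
  assumes "J \<ge> 1"
  shows "near_points u v J \<Delta> \<subseteq>
    (\<Union>k\<in>{1..nat \<lfloor>J\<rfloor>}. (\<lambda>(l, j, m). (int k * l, int k * j, int k * m)) ` {w \<in> near_points u v (J / k) (\<Delta> / k). primitive_pt w})"
proof
  fix w assume w0: "w \<in> near_points u v J \<Delta>"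
  obtain l j m where w: "w = (l, j, m)" by (cases w)
  have *: "J / 2 < of_int j" "of_int j \<le> J" "u \<le> px w" "px w \<le> v" "\<bar>of_int j * g (px w) - of_int m\<bar> < \<Delta>"
    using w0 by (auto simp: near_points_def w pd_def)
  have j: "j > 0" using *(1) assms by linarith
  define k where "k = nat (gcd l (gcd j m))"
  have k: "int k = gcd l (gcd j m)" by (simp add: k_def)
  have kp: "k > 0" using j by (simp add: k_def gcd_pos_int)
  have "int k dvd l" unfolding k by simp
  then obtain l' where l': "l = int k * l'" by (rule dvdE)
  have "int k dvd j" unfolding k by (meson gcd_dvd1 gcd_dvd2 dvd_trans)
  then obtain j' where j': "j = int k * j'" by (rule dvdE)
  have "int k dvd m" unfolding k by (meson gcd_dvd2 dvd_trans)
  then obtain m' where m': "m = int k * m'" by (rule dvdE)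
  have "int k * gcd l' (gcd j' m') = gcd (int k * l') (gcd (int k * j') (int k * m'))"
    by (metis abs_of_nat gcd_mult_distrib_int)
  also have "\<dots> = int k" using k l' j' m' by simp
  finally have prim: "gcd l' (gcd j' m') = 1" using kp by simp
  have j'p: "j' > 0" using j j' kp by (simp add: zero_less_mult_iff)
  then have "int k * 1 \<le> int k * j'" by (intro mult_left_mono) auto
  then have "int k \<le> j" using j' by simp
  then have "real k \<le> J" using *(2) by linarith
  then have kJ: "k \<in> {1..nat \<lfloor>J\<rfloor>}" using kp le_nat_floor by simp
  have kr: "real k > 0" using kp by simp
  have px: "px (l', j', m') = px w" using kp by (simp add: px_def w l' j')
  have "\<bar>of_int j * g (px w) - of_int m\<bar> = real k * \<bar>of_int j' * g (px w) - of_int m'\<bar>"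
    by (simp add: j' m' right_diff_distrib[symmetric] abs_mult mult.assoc)
  then have "real k * \<bar>of_int j' * g (px w) - of_int m'\<bar> < \<Delta>" using *(5) by simp
  then have "(l', j', m') \<in> near_points u v (J / k) (\<Delta> / k)"
    using * kr unfolding near_points_def px pd_def by (simp add: j' field_simps px)
  then have "(l', j', m') \<in> {w \<in> near_points u v (J / k) (\<Delta> / k). primitive_pt w}"
    using prim by (simp add: primitive_pt_def)
  moreover have "w = (\<lambda>(l, j, m). (int k * l, int k * j, int k * m)) (l', j', m')"
    by (simp add: w l' j' m')
  ultimately show "w \<in> (\<Union>k\<in>{1..nat \<lfloor>J\<rfloor>}. (\<lambda>(l, j, m). (int k * l, int k * j, int k * m)) `
      {w \<in> near_points u v (J / k) (\<Delta> / k). primitive_pt w})"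
    using kJ by blast
qed

text \<open>Choosing \<open>R\<close> near \<open>sqrt J\<close> balances the terms
  \<open>J * S / R\<close> and \<open>S * R\<close> of \<open>primitive_count\<close>; both become
  of size \<open>J\<^sup>2 * sqrt \<Delta>\<close>.\<close>

lemma primitive_count':
  assumes J: "J \<ge> 1" "0 < \<Delta>" "\<Delta> \<le> 1 / (16 * J)" "\<Delta> \<le> a / J"
    and \<kappa>: "\<kappa> = min 1 (1 / (2 * b))" and uv: "u \<le> v"
    and C: "C = 2 * ((v - u) / \<kappa> + 1) + 16 * ((v - u) / \<kappa> + 1) / sqrt a + 8 * (3 + 3 * b * (v - u)) / sqrt a"
  shows "real (card {w \<in> near_points u v J \<Delta>. primitive_pt w}) \<le> C * (J + J\<^sup>2 * sqrt \<Delta>)"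
proof -
  have Jp: "J > 0" using J by simp
  have k: "0 < \<kappa>" "\<kappa> \<le> 1" "b * \<kappa> \<le> 1/2"
  proof -
    show "0 < \<kappa>" "\<kappa> \<le> 1" using b_pos by (auto simp: \<kappa>)
    have "b * \<kappa> \<le> b * (1 / (2 * b))" unfolding \<kappa> using b_pos by (intro mult_left_mono) auto
    then show "b * \<kappa> \<le> 1/2" using b_pos by simp
  qed
  define R where "R = nat \<lfloor>sqrt J\<rfloor>"
  have sq1: "1 \<le> sqrt J" using J by simp
  have R: "1 \<le> R" "real R \<le> sqrt J" "sqrt J / 2 \<le> real R"
  proof -
    have f: "\<lfloor>sqrt J\<rfloor> \<ge> 1" using sq1 by linarith
    then show "1 \<le> R" "real R \<le> sqrt J" by (auto simp: R_def le_nat_iff)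
    have "real R = of_int \<lfloor>sqrt J\<rfloor>" using f by (simp add: R_def)
    moreover have "of_int \<lfloor>sqrt J\<rfloor> > sqrt J - 1" by linarith
    moreover have "of_int \<lfloor>sqrt J\<rfloor> \<ge> (1::real)" using f by linarith
    ultimately show "sqrt J / 2 \<le> real R" by linarith
  qed
  have "sqrt J \<le> J" using J sq1 by (metis real_sqrt_pow2 Jp less_imp_le mult_le_cancel_left1 mult.right_neutral power2_eq_square real_sqrt_gt_0_iff not_le)
  then have RJ: "real R \<le> J" using R by simp
  define S where "S = 8 * J powr (3/2) * sqrt (\<Delta> / a)"
  have S0: "S \<ge> 0" using J a_pos by (simp add: S_def)
  have Sq: "S * sqrt J = 8 * J\<^sup>2 * sqrt \<Delta> / sqrt a"
  proof -
    have "J powr (3/2) * sqrt J = J powr (3/2) * J powr (1/2)" using Jp by (simp add: powr_half_sqrt)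
    also have "\<dots> = J\<^sup>2" using Jp by (simp add: powr_add[symmetric])
    finally show ?thesis by (simp add: S_def real_sqrt_divide mult_ac)
  qed
  define E where "E = (v - u) / \<kappa> + 1"
  have E0: "E \<ge> 1" using uv k by (simp add: E_def)
  have "real R > 0" using R(1) by simp
  then have "S / R \<le> S / (sqrt J / 2)" using R(3) S0 Jp by (intro divide_left_mono mult_pos_pos) auto
  also have "\<dots> = 2 * (S * sqrt J) / J" using Jp by (simp add: field_simps)
  finally have SR: "S / R \<le> 2 * (S * sqrt J) / J" .
  have EJ: "(v - u) * J / \<kappa> + 1 \<le> E * J" using J k by (simp add: E_def algebra_simps)
  have 1: "((v - u) * J / \<kappa> + 1) * (2 + S / R) \<le> E * J * (2 + 2 * (S * sqrt J) / J)"
    using EJ SR S0 E0 Jp uv k by (intro mult_mono) auto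
  have 2: "(3 + 3 * b * (v - u)) * S * R \<le> (3 + 3 * b * (v - u)) * S * sqrt J"
    using R S0 b_pos uv by (intro mult_left_mono) auto
  have "real (card {w \<in> near_points u v J \<Delta>. primitive_pt w})
      \<le> ((v - u) * J / \<kappa> + 1) * (2 + S / R) + (3 + 3 * b * (v - u)) * S * R"
    by (rule primitive_count[OF J k uv R(1) RJ S_def])
  also have "\<dots> \<le> E * J * (2 + 2 * (S * sqrt J) / J) + (3 + 3 * b * (v - u)) * S * sqrt J"
    using 1 2 by simp
  also have "\<dots> = 2 * E * J + (2 * E + (3 + 3 * b * (v - u))) * (S * sqrt J)"
    using Jp by (simp add: algebra_simps)
  also have "\<dots> = 2 * E * J + (16 * E / sqrt a + 8 * (3 + 3 * b * (v - u)) / sqrt a) * (J\<^sup>2 * sqrt \<Delta>)"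
  proof -
    have "(2 * E + W) * (8 * J\<^sup>2 * sqrt \<Delta> / sqrt a) = (16 * E / sqrt a + 8 * W / sqrt a) * (J\<^sup>2 * sqrt \<Delta>)" for W
      by (simp add: algebra_simps add_divide_distrib)
    then show ?thesis unfolding Sq by simp
  qed
  also have "\<dots> \<le> C * J + C * (J\<^sup>2 * sqrt \<Delta>)"
    using a_pos b_pos uv E0 J unfolding C E_def[symmetric] by (intro add_mono mult_right_mono) auto
  finally show ?thesis by (simp add: algebra_simps)
qed

text \<open>A point with greatest common divisor \<open>k\<close> is \<open>k\<close> times a
  primitive point for \<open>J / k\<close> and \<open>\<Delta> / k\<close>, and the smallness
  conditions survive this scaling. Summed over \<open>k\<close>, the term linear in \<open>J\<close>
  becomes harmonic and picks up the logarithm, while the quadratic one converges.\<close>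

lemma near_count:
  assumes J: "J \<ge> 1" "0 < \<Delta>" "\<Delta> \<le> 1 / (16 * J)" "\<Delta> \<le> a / J"
    and \<kappa>: "\<kappa> = min 1 (1 / (2 * b))" and uv: "u \<le> v"
    and C: "C = 2 * ((v - u) / \<kappa> + 1) + 16 * ((v - u) / \<kappa> + 1) / sqrt a + 8 * (3 + 3 * b * (v - u)) / sqrt a"
  shows "real (card (near_points u v J \<Delta>)) \<le> 2 * C * (J * (1 + ln J) + J\<^sup>2 * sqrt \<Delta>)"
proof -
  have Jp: "J > 0" using J by simp
  have C0: "C \<ge> 0" using a_pos b_pos uv unfolding C \<kappa> by simp
  define n where "n = nat \<lfloor>J\<rfloor>"
  have n: "n \<ge> 1" "real n \<le> J" using J by (auto simp: n_def le_nat_iff le_floor_iff)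
  define P where "P k = {w \<in> near_points u v (J / real k) (\<Delta> / real k). primitive_pt w}" for k
  have finP: "finite (P k)" for k using finite_near_points by (simp add: P_def)
  have "card (near_points u v J \<Delta>) \<le> card (\<Union>k\<in>{1..n}. (\<lambda>(l, j, m). (int k * l, int k * j, int k * m)) ` P k)"
    using near_points_gcd_cover[OF J(1), of u v \<Delta>] finP unfolding n_def P_def
    by (intro card_mono) auto
  also have "\<dots> \<le> (\<Sum>k\<in>{1..n}. card ((\<lambda>(l, j, m). (int k * l, int k * j, int k * m)) ` P k))"
    by (intro card_UN_le) auto
  also have "\<dots> \<le> (\<Sum>k\<in>{1..n}. card (P k))"
    using finP by (intro sum_mono card_image_le)
  finally have "real (card (near_points u v J \<Delta>)) \<le> (\<Sum>k\<in>{1..n}. real (card (P k)))"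
    unfolding of_nat_sum[symmetric] by (rule of_nat_mono)
  also have "\<dots> \<le> (\<Sum>k\<in>{1..n}. C * (J * (1 / k) + J\<^sup>2 * sqrt \<Delta> * (1 / (real k)\<^sup>2)))"
  proof (rule sum_mono)
    fix k assume "k \<in> {1..n}"
    then have k: "1 \<le> real k" "real k \<le> J" using n by auto
    have "real (card (P k)) \<le> C * (J / k + (J / k)\<^sup>2 * sqrt (\<Delta> / k))"
      unfolding P_def
    proof (rule primitive_count'[OF _ _ _ _ \<kappa> uv C])
      show "1 \<le> J / real k" "0 < \<Delta> / real k" using k J by auto
      show "\<Delta> / real k \<le> 1 / (16 * (J / real k))"
      proof -
        have "\<Delta> / real k \<le> \<Delta>" using k J by (simp add: field_simps)
        also have "\<dots> \<le> 1 / (16 * J)" by fact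
        also have "\<dots> \<le> 1 / (16 * (J / real k))" using k Jp by (simp add: field_simps)
        finally show ?thesis .
      qed
      show "\<Delta> / real k \<le> a / (J / real k)"
      proof -
        have "\<Delta> / real k \<le> \<Delta>" using k J by (simp add: field_simps)
        also have "\<dots> \<le> a / J" by fact
        also have "\<dots> \<le> a / (J / real k)" using k Jp a_pos by (simp add: field_simps)
        finally show ?thesis .
      qed
    qed
    also have "\<dots> \<le> C * (J * (1 / k) + J\<^sup>2 * sqrt \<Delta> * (1 / (real k)\<^sup>2))"
    proof (intro mult_left_mono add_mono C0)
      have "sqrt (\<Delta> / real k) \<le> sqrt \<Delta>" using k J by (simp add: field_simps)
      then have "(J / real k)\<^sup>2 * sqrt (\<Delta> / real k) \<le> (J / real k)\<^sup>2 * sqrt \<Delta>"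
        by (intro mult_left_mono) auto
      then show "(J / real k)\<^sup>2 * sqrt (\<Delta> / real k) \<le> J\<^sup>2 * sqrt \<Delta> * (1 / (real k)\<^sup>2)"
        by (simp add: power_divide)
    qed simp
    finally show "real (card (P k)) \<le> C * (J * (1 / k) + J\<^sup>2 * sqrt \<Delta> * (1 / (real k)\<^sup>2))" .
  qed
  also have "\<dots> = C * (J * (\<Sum>k=1..n. 1 / real k) + J\<^sup>2 * sqrt \<Delta> * (\<Sum>k=1..n. 1 / (real k)\<^sup>2))"
    by (simp only: sum_distrib_left sum.distrib[symmetric])
  also have "\<dots> \<le> C * (J * (2 * (1 + ln J)) + J\<^sup>2 * sqrt \<Delta> * 2)"
  proof (intro mult_left_mono add_mono C0 inverse_squares_le)
    have "ln (real n) \<le> ln J" using n by simp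
    moreover have "0 \<le> ln (real n)" using n by simp
    moreover have "1 + x \<le> 2 * (1 + y)" if "x \<le> y" "0 \<le> x" for x y :: real using that by simp
    ultimately have "1 + ln (real n) \<le> 2 * (1 + ln J)" by blast
    then show "(\<Sum>k=1..n. 1 / real k) \<le> 2 * (1 + ln J)"
      using harmonic_le[OF n(1)] by (rule order_trans[rotated])
  qed (use J in auto)
  finally show ?thesis by (simp add: algebra_simps)
qed

section \<open>Points with one fixed denominator, by differencing\<close>

lemma parallelogram:
  assumes "0 < h" "0 < k"
  shows "2 * a * h * k \<le> g (x + h + k) + g x - g (x + h) - g (x + k)"
proof -
  have 1: "a * (h * k * (h + k)) \<le> g x * k + g (x + h + k) * h - g (x + h) * (h + k)"
    using three_point(1)[of x "x + h" "x + h + k"] assms by (simp add: algebra_simps)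
  have 2: "a * (k * h * (h + k)) \<le> g x * h + g (x + h + k) * k - g (x + k) * (h + k)"
    using three_point(1)[of x "x + k" "x + h + k"] assms by (simp add: algebra_simps)
  have "(2 * a * h * k) * (h + k) \<le> (g (x + h + k) + g x - g (x + h) - g (x + k)) * (h + k)"
    using 1 2 by (simp add: algebra_simps)
  then show ?thesis using assms by simp
qed

text \<open>Takes over where \<open>\<Delta>\<close> is too large for the determinant argument.
  Points of \<open>A\<close> without a successor within \<open>R\<close> are more than
  \<open>R\<close> apart. A pair \<open>l\<close>, \<open>l + r\<close> forces an increment of
  \<open>h\<close> to be near an integer \<open>n\<close>; there are O(r) such \<open>n\<close>, and
  since by \<open>parallelogram\<close> the increment grows steadily with \<open>l\<close>, each
  \<open>n\<close> occurs for at most \<open>2 * \<Delta> * j / (a * r) + 1\<close> values of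
  \<open>l\<close>.\<close>

lemma fixed_denominator_count:
  fixes j :: int
  assumes j: "j > 0" and uv: "u \<le> v" and \<Delta>: "0 < \<Delta>" "\<Delta> \<le> 1" and R: "R \<ge> 1"
  defines "A \<equiv> {l::int. u \<le> of_int l / of_int j \<and> of_int l / of_int j \<le> v \<and>
        (\<exists>m::int. \<bar>of_int j * g (of_int l / of_int j) - of_int m\<bar> < \<Delta>)}"
  shows "finite A" "real (card A) \<le> (v - u) * of_int j / real R + 1
        + (3 * b * (v - u) + 5) * (2 * \<Delta> * of_int j * real R / a + (real R)\<^sup>2)"
proof -
  have jr: "real_of_int j > 0" using j by simp
  have "A \<subseteq> {\<lceil>u * of_int j\<rceil>..\<lfloor>v * of_int j\<rfloor>}"
    using jr by (auto simp: A_def ceiling_le_iff le_floor_iff field_simps)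
  then show fin: "finite A" by (rule finite_subset) auto
  define h where "h l = of_int j * g (of_int l / of_int j)" for l :: int
  define P where "P r = {l \<in> A. l + int r \<in> A}" for r :: nat
  have P: "real (card (P r)) \<le> (3 * b * (v - u) + 5) * (2 * \<Delta> * of_int j / a + real r)" if r: "r \<ge> 1" for r
  proof -
    define D where "D n = {l \<in> P r. \<bar>h (l + int r) - h l - of_int n\<bar> < 2 * \<Delta>}" for n :: int
    \<comment> \<open>The increment over \<open>r\<close> steps lies between
      \<open>r * \<tau> u\<close> and \<open>r * (\<tau> u + 3 * b * (v - u))\<close>; the margin 2
      covers the distance \<open>2 * \<Delta>\<close> to the integer.\<close>
    let ?lo = "real r * \<tau> u - 2" and ?hi = "real r * (\<tau> u + 3 * b * (v - u)) + 2"
    have finP: "finite (P r)" using fin by (simp add: P_def)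
    have rr: "real r \<ge> 1" using r by simp
    have "P r \<subseteq> (\<Union>n\<in>{\<lceil>?lo\<rceil>..\<lfloor>?hi\<rfloor>}. D n)"
    proof
      fix l assume l: "l \<in> P r"
      define x y where "x = real_of_int l / of_int j" and "y = real_of_int (l + int r) / of_int j"
      have xy: "u \<le> x" "y \<le> v" "y - x = real r / of_int j"
        using l by (auto simp: P_def A_def x_def y_def add_divide_distrib)
      have xly: "x < y" using xy(3) rr jr by (smt (verit) divide_pos_pos)
      obtain m m' where m: "\<bar>h l - of_int m\<bar> < \<Delta>" "\<bar>h (l + int r) - of_int m'\<bar> < \<Delta>"
        using l by (auto simp: P_def A_def h_def)
      then have n: "\<bar>h (l + int r) - h l - of_int (m' - m)\<bar> < 2 * \<Delta>" by simp
      have hh: "h (l + int r) - h l = of_int j * (g y - g x)" by (simp add: h_def x_def y_def algebra_simps)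
      have 1: "\<tau> u * (y - x) \<le> g y - g x"
      proof -
        have "\<tau> u * (y - x) \<le> \<tau> x * (y - x)" using slope_bounds(1)[OF xy(1)] xly by (intro mult_right_mono) auto
        moreover have "0 \<le> a * (y - x)\<^sup>2" using a_pos by simp
        ultimately show ?thesis using lower[of y x] by linarith
      qed
      have 2: "g y - g x \<le> (\<tau> u + 3 * b * (v - u)) * (y - x)"
      proof -
        have "2 * b * (x - u) \<le> 2 * b * (v - u)" using xy xly b_pos by (intro mult_left_mono) auto
        then have "\<tau> x \<le> \<tau> u + 2 * b * (v - u)" using slope_bounds(2)[OF xy(1)] by linarith
        then have "\<tau> x * (y - x) \<le> (\<tau> u + 2 * b * (v - u)) * (y - x)" using xly by (intro mult_right_mono) auto
        moreover have "b * (y - x)\<^sup>2 \<le> b * (v - u) * (y - x)"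
        proof -
          have "(y - x) * (y - x) \<le> (v - u) * (y - x)" using xy(1,2) xly by (intro mult_right_mono) linarith+
          then show ?thesis using b_pos by (simp add: power2_eq_square mult.assoc)
        qed
        ultimately show ?thesis using upper[of y x] by (simp add: algebra_simps)
      qed
      have "of_int j * (\<tau> u * (y - x)) \<le> h (l + int r) - h l" unfolding hh using 1 jr by (intro mult_left_mono) auto
      then have 3: "real r * \<tau> u \<le> h (l + int r) - h l" using jr by (simp add: xy(3) mult_ac)
      have "h (l + int r) - h l \<le> of_int j * ((\<tau> u + 3 * b * (v - u)) * (y - x))" unfolding hh using 2 jr by (intro mult_left_mono) auto
      then have 4: "h (l + int r) - h l \<le> real r * (\<tau> u + 3 * b * (v - u))" using jr by (simp add: xy(3) mult_ac)
      have "?lo \<le> of_int (m' - m)" "of_int (m' - m) \<le> ?hi" using n 3 4 \<Delta> by linarith+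
      then have mem: "m' - m \<in> {\<lceil>?lo\<rceil>..\<lfloor>?hi\<rfloor>}"
        unfolding atLeastAtMost_iff ceiling_le_iff le_floor_iff by blast
      show "l \<in> (\<Union>n\<in>{\<lceil>?lo\<rceil>..\<lfloor>?hi\<rfloor>}. D n)"
        by (rule UN_I[OF mem]) (use l n in \<open>simp add: D_def\<close>)
    qed
    then have "card (P r) \<le> card (\<Union>n\<in>{\<lceil>?lo\<rceil>..\<lfloor>?hi\<rfloor>}. D n)"
      using finP by (intro card_mono) (auto simp: D_def)
    also have "\<dots> \<le> (\<Sum>n\<in>{\<lceil>?lo\<rceil>..\<lfloor>?hi\<rfloor>}. card (D n))" by (intro card_UN_le) auto
    finally have "real (card (P r)) \<le> (\<Sum>n\<in>{\<lceil>?lo\<rceil>..\<lfloor>?hi\<rfloor>}. real (card (D n)))"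
      unfolding of_nat_sum[symmetric] by (rule of_nat_mono)
    also have "\<dots> \<le> (\<Sum>n\<in>{\<lceil>?lo\<rceil>..\<lfloor>?hi\<rfloor>}. 2 * \<Delta> * of_int j / (a * real r) + 1)"
    proof (rule sum_mono)
      fix n
      show "real (card (D n)) \<le> 2 * \<Delta> * of_int j / (a * real r) + 1"
      proof (cases "D n = {}")
        case False
        have finD: "finite (D n)" using finP by (simp add: D_def)
        define l0 where "l0 = Min (D n)"
        have l0: "l0 \<in> D n" "\<And>l. l \<in> D n \<Longrightarrow> l0 \<le> l" using finD False by (auto simp: l0_def)
        have up: "real_of_int l \<le> of_int l0 + 2 * \<Delta> * of_int j / (a * real r)" if l: "l \<in> D n" for l
        proof (cases "l = l0")
          case False
          then have ll: "l0 < l" using l0(2)[OF l] by simp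
          have "2 * a * (real r / of_int j) * (of_int (l - l0) / of_int j)
             \<le> g (of_int l0 / of_int j + real r / of_int j + of_int (l - l0) / of_int j) + g (of_int l0 / of_int j)
               - g (of_int l0 / of_int j + real r / of_int j) - g (of_int l0 / of_int j + of_int (l - l0) / of_int j)"
            using ll rr jr by (intro parallelogram) auto
          also have "\<dots> = (h (l + int r) - h l - (h (l0 + int r) - h l0)) / of_int j"
            using jr by (simp add: h_def diff_divide_distrib add_divide_distrib add.commute)
          also have "\<dots> \<le> 4 * \<Delta> / of_int j"
            using l l0(1) jr by (intro divide_right_mono) (auto simp: D_def)
          finally have "2 * a * (real r / of_int j) * (of_int (l - l0) / of_int j) * (of_int j * of_int j / 2)
              \<le> 4 * \<Delta> / of_int j * (of_int j * of_int j / 2)"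
            using jr by (intro mult_right_mono) auto
          moreover have "2 * a * (real r / of_int j) * (d / of_int j) * (of_int j * of_int j / 2) = a * real r * d" for d
            using jr by (simp add: field_simps)
          ultimately have "a * real r * of_int (l - l0) \<le> 2 * \<Delta> * of_int j"
            using jr by simp
          then have "of_int (l - l0) \<le> 2 * \<Delta> * of_int j / (a * real r)"
            using a_pos rr by (simp add: field_simps)
          then show ?thesis by simp
        qed (use \<Delta> a_pos jr in auto)
        have "D n \<subseteq> {l0..\<lfloor>of_int l0 + 2 * \<Delta> * of_int j / (a * real r)\<rfloor>}"
          unfolding subset_iff atLeastAtMost_iff le_floor_iff using up l0(2) by blast
        then have "card (D n) \<le> card {l0..\<lfloor>of_int l0 + 2 * \<Delta> * of_int j / (a * real r)\<rfloor>}"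
          by (intro card_mono) auto
        moreover have "0 \<le> 2 * \<Delta> * of_int j / (a * real r)" using \<Delta> a_pos jr by simp
        ultimately show ?thesis by simp linarith
      qed (use \<Delta> a_pos jr in auto)
    qed
    also have "\<dots> = real (card {\<lceil>?lo\<rceil>..\<lfloor>?hi\<rfloor>}) * (2 * \<Delta> * of_int j / (a * real r) + 1)" by simp
    also have "\<dots> \<le> (3 * b * (v - u) + 5) * real r * (2 * \<Delta> * of_int j / (a * real r) + 1)"
    proof (intro mult_right_mono)
      have "0 \<le> real r * (3 * b * (v - u))" using b_pos uv by simp
      then have "?lo \<le> ?hi" unfolding distrib_left by linarith
      then have "real (card {\<lceil>?lo\<rceil>..\<lfloor>?hi\<rfloor>}) \<le> ?hi - ?lo + 1" by simp linarith
      also have "\<dots> = 3 * b * (v - u) * real r + 5" by (simp add: algebra_simps)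
      also have "\<dots> \<le> (3 * b * (v - u) + 5) * real r" using rr by (simp add: algebra_simps)
      finally show "real (card {\<lceil>?lo\<rceil>..\<lfloor>?hi\<rfloor>}) \<le> (3 * b * (v - u) + 5) * real r" .
    qed (use \<Delta> a_pos jr in auto)
    also have "\<dots> = (3 * b * (v - u) + 5) * (2 * \<Delta> * of_int j / a + real r)"
      using rr a_pos by (simp add: field_simps)
    finally show ?thesis .
  qed
  define A0 where "A0 = {l \<in> A. \<forall>r\<in>{1..R}. l + int r \<notin> A}"
  have "real (card (real_of_int ` A0)) \<le> (v * of_int j - u * of_int j) / real R + 1"
  proof (rule spaced_card)
    show "real_of_int ` A0 \<subseteq> {u * of_int j..v * of_int j}"
      using jr by (auto simp: A0_def A_def field_simps)
    show "u * of_int j \<le> v * of_int j" using uv jr by simp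
    show "0 < real R" using R by simp
    fix x y assume "x \<in> real_of_int ` A0" "y \<in> real_of_int ` A0" "x < y"
    then obtain l l' where l: "l \<in> A0" "l' \<in> A0" "x = of_int l" "y = of_int l'" "l < l'" by auto
    have "\<not> l' - l \<le> int R"
    proof
      assume "l' - l \<le> int R"
      then have "nat (l' - l) \<in> {1..R}" using l by auto
      moreover have "\<forall>r\<in>{1..R}. l + int r \<notin> A" using l(1) by (simp add: A0_def)
      ultimately have "l + int (nat (l' - l)) \<notin> A" by blast
      then show False using l by (simp add: A0_def)
    qed
    then show "real R \<le> y - x" using l by linarith
  qed
  then have A0: "real (card A0) \<le> (v - u) * of_int j / real R + 1"
    by (simp add: card_image inj_on_def algebra_simps)
  have "A \<subseteq> A0 \<union> (\<Union>r\<in>{1..R}. P r)" by (auto simp: A0_def P_def)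
  then have "card A \<le> card (A0 \<union> (\<Union>r\<in>{1..R}. P r))"
    using fin by (intro card_mono) (auto simp: A0_def P_def)
  also have "\<dots> \<le> card A0 + card (\<Union>r\<in>{1..R}. P r)" by (rule card_Un_le)
  also have "card A0 + card (\<Union>r\<in>{1..R}. P r) \<le> card A0 + (\<Sum>r\<in>{1..R}. card (P r))"
    by (intro add_left_mono card_UN_le) auto
  finally have "real (card A) \<le> real (card A0) + (\<Sum>r\<in>{1..R}. real (card (P r)))"
    unfolding of_nat_sum[symmetric] of_nat_add[symmetric] by (simp only: of_nat_le_iff add_left_mono)
  also have "(\<Sum>r\<in>{1..R}. real (card (P r))) \<le> (\<Sum>r\<in>{1..R}. (3 * b * (v - u) + 5) * (2 * \<Delta> * of_int j / a + real R))"
  proof (rule sum_mono)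
    fix r assume r: "r \<in> {1..R}"
    have "(3 * b * (v - u) + 5) * (2 * \<Delta> * of_int j / a + real r) \<le> (3 * b * (v - u) + 5) * (2 * \<Delta> * of_int j / a + real R)"
      using r b_pos uv by (intro mult_left_mono) auto
    then show "real (card (P r)) \<le> (3 * b * (v - u) + 5) * (2 * \<Delta> * of_int j / a + real R)"
      using P[of r] r by simp
  qed
  also have "\<dots> = (3 * b * (v - u) + 5) * (2 * \<Delta> * of_int j * real R / a + (real R)\<^sup>2)"
  proof -
    have "real R * (E * (x / a + real R)) = E * (x * real R / a + (real R)\<^sup>2)" for E x
      using a_pos by (simp add: field_simps power2_eq_square)
    then show ?thesis by simp
  qed
  finally show "real (card A) \<le> (v - u) * of_int j / real R + 1
        + (3 * b * (v - u) + 5) * (2 * \<Delta> * of_int j * real R / a + (real R)\<^sup>2)" using A0 by simp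
qed

end

section \<open>Kernel sums over the layers of lattice points\<close>

lemma dist_int_nonneg: "0 \<le> dist_int x"
  using dist_int_attained[of x] by auto

lemma dist_int_le_half: "dist_int x \<le> 1/2"
  using dist_int_le[of x "round x"] of_int_round_abs_le[of x] by (simp add: abs_minus_commute)

text \<open>A continuous substitute for the minimum of \<open>Q\<close> and
  \<open>1 / dist_int x\<close>, the size of a geometric sum of the characters of
  \<open>q * x\<close> over \<open>q \<le> Q\<close>. Continuity matters because the kernel is
  integrated along the phase.\<close>

definition kern :: "real \<Rightarrow> real \<Rightarrow> real" where
  "kern Q x = Q / (1 + Q * dist_int x)"

lemma kern_pos: "0 < Q \<Longrightarrow> 0 < kern Q x"
  using dist_int_nonneg[of x] by (auto simp: kern_def intro!: divide_pos_pos add_pos_nonneg)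

lemma kern_le: "0 < Q \<Longrightarrow> kern Q x \<le> Q"
proof -
  assume Q: "0 < Q"
  then have "0 < 1 + Q * dist_int x" using dist_int_nonneg[of x] by (intro add_pos_nonneg) auto
  then show ?thesis using Q dist_int_nonneg[of x] by (simp add: kern_def pos_divide_le_eq algebra_simps)
qed

lemma kern_le_inverse: "0 < Q \<Longrightarrow> 0 < d \<Longrightarrow> d \<le> dist_int x \<Longrightarrow> kern Q x \<le> 1 / d"
proof -
  assume *: "0 < Q" "0 < d" "d \<le> dist_int x"
  have "Q * d \<le> 1 + Q * dist_int x" using * by (smt (verit) mult_left_mono)
  moreover have "0 < 1 + Q * dist_int x" using * by (intro add_pos_nonneg mult_nonneg_nonneg) auto
  ultimately show ?thesis using * by (simp add: kern_def field_simps)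
qed

text \<open>The largest \<open>i \<le> n\<close> with \<open>dist_int x < 1 / 2 ^ i\<close> alone is
  enough: either the next layer is missed, which bounds the kernel by \<open>2 ^ (i + 1)\<close>, or
  \<open>i = n\<close> and the trivial bound \<open>Q \<le> 2 ^ n\<close> suffices. Such an
  \<open>i\<close> exists because layer 0 contains every \<open>x\<close>.\<close>

lemma kern_layers:
  assumes "0 < Q" "Q \<le> 2 ^ n"
  shows "kern Q x \<le> (\<Sum>i\<le>n. 2 ^ (i + 1) * (if dist_int x < 1 / 2 ^ i then 1 else 0))"
proof -
  have nn: "0 \<le> (\<Sum>i\<in>A. 2 ^ (i + 1) * (if dist_int x < 1 / 2 ^ i then 1 else 0 :: real))" for A
    by (intro sum_nonneg) auto
  define I where "I = {i. i \<le> n \<and> dist_int x < 1 / 2 ^ i}"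
  have "0 \<in> I" using dist_int_le_half[of x] by (simp add: I_def)
  moreover have finI: "finite I" by (simp add: I_def)
  ultimately have m: "Max I \<in> I" "\<And>i. i \<in> I \<Longrightarrow> i \<le> Max I" by (auto intro: Max_in)
  define m where "m = Max I"
  have "kern Q x \<le> 2 ^ (m + 1)"
  proof (cases "m = n")
    case True
    have "kern Q x \<le> 2 ^ n" using kern_le[OF assms(1)] assms(2) by (rule order_trans)
    also have "\<dots> \<le> 2 ^ (m + 1)" using True by simp
    finally show ?thesis .
  next
    case False
    have "m < n" using m(1) False by (auto simp: I_def m_def)
    moreover have "Suc m \<notin> I" using m(2)[of "Suc m"] by (auto simp: m_def)
    ultimately have "1 / 2 ^ (m + 1) \<le> dist_int x" by (auto simp: I_def)
    then show ?thesis using kern_le_inverse[OF assms(1), of "1 / 2 ^ (m + 1)" x] by simp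
  qed
  also have "\<dots> = 2 ^ (m + 1) * (if dist_int x < 1 / 2 ^ m then 1 else 0)"
    using m(1) by (simp add: I_def m_def)
  also have "\<dots> \<le> (\<Sum>i\<le>n. 2 ^ (i + 1) * (if dist_int x < 1 / 2 ^ i then 1 else 0))"
    using m(1) by (intro member_le_sum) (auto simp: I_def m_def)
  finally show ?thesis .
qed

lemma geometric_le: "(\<Sum>i\<le>n. 2 ^ i :: real) \<le> 2 * 2 ^ n"
  by (induction n) auto

lemma geometric_sqrt_le: "(\<Sum>i\<le>n. sqrt 2 ^ i) \<le> 4 * sqrt 2 ^ n"
proof (induction n)
  case (Suc n)
  have "sqrt 2 \<ge> 4/3" by (rule real_le_rsqrt) (simp add: power2_eq_square)
  then have "4 * sqrt 2 ^ n \<le> 3 * sqrt 2 ^ Suc n" by (simp add: field_simps)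
  then show ?case unfolding sum.atMost_Suc using Suc by linarith
qed simp

context strongly_convex begin

definition denominators :: "real \<Rightarrow> real \<Rightarrow> real \<Rightarrow> (int \<times> int) set" where
  "denominators u v J = {(l, j). J / 2 < of_int j \<and> of_int j \<le> J \<and> u \<le> of_int l / of_int j \<and> of_int l / of_int j \<le> v}"

lemma finite_denominators: "J > 0 \<Longrightarrow> finite (denominators u v J)"
proof -
  assume J: "J > 0"
  have "denominators u v J \<subseteq> (\<lambda>(j, l). (l, j)) ` (SIGMA j:{0..\<lceil>J\<rceil>}. {\<lceil>u * of_int j\<rceil>..\<lfloor>v * of_int j\<rfloor>})"
  proof
    fix w assume "w \<in> denominators u v J"
    then obtain l j where w: "w = (l, j)" "J / 2 < of_int j" "of_int j \<le> J" "u \<le> of_int l / of_int j" "of_int l / of_int j \<le> v"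
      by (auto simp: denominators_def)
    have j: "real_of_int j > 0" using w J by linarith
    have "j \<in> {0..\<lceil>J\<rceil>}" using j w(3) by (simp add: le_ceiling_iff) 
    moreover have "l \<in> {\<lceil>u * of_int j\<rceil>..\<lfloor>v * of_int j\<rfloor>}"
      using w(4,5) j by (simp add: ceiling_le_iff le_floor_iff field_simps)
    ultimately show "w \<in> (\<lambda>(j, l). (l, j)) ` (SIGMA j:{0..\<lceil>J\<rceil>}. {\<lceil>u * of_int j\<rceil>..\<lfloor>v * of_int j\<rfloor>})"
      unfolding w(1) by force
  qed
  then show ?thesis by (rule finite_subset) auto
qed

lemma small_layer_count:
  assumes "J \<ge> 1"
  shows "card {w \<in> denominators u v J. dist_int (of_int (snd w) * g (of_int (fst w) / of_int (snd w))) < \<Delta>}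
     \<le> card (near_points u v J \<Delta>)"
proof (rule card_inj_on_le[where f = "\<lambda>(l, j). (l, j, round (of_int j * g (of_int l / of_int j)))"])
  show "inj_on (\<lambda>(l, j). (l, j, round (of_int j * g (of_int l / of_int j))))
     {w \<in> denominators u v J. dist_int (of_int (snd w) * g (of_int (fst w) / of_int (snd w))) < \<Delta>}"
    by (auto simp: inj_on_def)
  have r: "\<bar>x - of_int (round x)\<bar> \<le> dist_int x" for x
    using dist_int_attained[of x] round_diff_minimal[of x] by metis
  then have r: "dist_int x < \<Delta> \<Longrightarrow> \<bar>x - of_int (round x)\<bar> < \<Delta>" for x
    using le_less_trans by blast
  show "(\<lambda>(l, j). (l, j, round (of_int j * g (of_int l / of_int j)))) `
     {w \<in> denominators u v J. dist_int (of_int (snd w) * g (of_int (fst w) / of_int (snd w))) < \<Delta>}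
     \<subseteq> near_points u v J \<Delta>"
  proof (rule image_subsetI)
    fix w assume w: "w \<in> {w \<in> denominators u v J. dist_int (of_int (snd w) * g (of_int (fst w) / of_int (snd w))) < \<Delta>}"
    obtain l j where lj: "w = (l, j)" by (cases w)
    show "(case w of (l, j) \<Rightarrow> (l, j, round (of_int j * g (of_int l / of_int j)))) \<in> near_points u v J \<Delta>"
      using w r[of "of_int j * g (of_int l / of_int j)"]
      by (simp add: lj denominators_def near_points_def pd_def px_def)
  qed
qed (rule finite_near_points)

text \<open>In \<open>fixed_denominator_count\<close> the choice of \<open>R\<close> near
  \<open>J powr (1/3)\<close> balances \<open>J / R\<close> against \<open>R\<^sup>2\<close>;
  summing over the denominators costs a factor \<open>J\<close>.\<close>

lemma large_layer_count:
  assumes J: "J \<ge> 1" and \<Delta>: "0 < \<Delta>" "\<Delta> \<le> 1" and uv: "u \<le> v"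
  shows "real (card {w \<in> denominators u v J. dist_int (of_int (snd w) * g (of_int (fst w) / of_int (snd w))) < \<Delta>})
     \<le> ((v - u) + 1 + (3 * b * (v - u) + 5) * (4 + 4 / a)) * (J powr (5/3) + \<Delta> * J powr (7/3))"
proof -
  let ?D = "{w \<in> denominators u v J. dist_int (of_int (snd w) * g (of_int (fst w) / of_int (snd w))) < \<Delta>}"
  define E where "E = 3 * b * (v - u) + 5"
  have E: "E \<ge> 0" using b_pos uv by (simp add: E_def)
  have Jp: "J > 0" using J by simp
  define R where "R = nat \<lceil>J powr (1/3)\<rceil>"
  have J13: "1 \<le> J powr (1/3)" using J by (simp add: ge_one_powr_ge_zero)
  have R: "R \<ge> 1" "J powr (1/3) \<le> real R" "real R \<le> 2 * J powr (1/3)"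
    using J13 unfolding R_def by linarith+
  define A where "A j = {l::int. u \<le> of_int l / of_int j \<and> of_int l / of_int j \<le> v \<and>
        (\<exists>m::int. \<bar>of_int j * g (of_int l / of_int j) - of_int m\<bar> < \<Delta>)}" for j :: int
  have A: "finite (A j)" "real (card (A j)) \<le> ((v - u) + 1 + E * (4 + 4 / a)) * (J powr (2/3) + \<Delta> * J powr (4/3))"
    if j: "j > 0" "of_int j \<le> J" for j
  proof -
    note c = fixed_denominator_count[OF j(1) uv \<Delta> R(1), folded A_def E_def]
    show "finite (A j)" by (rule c)
    have jr: "real_of_int j > 0" using j by simp
    have "(v - u) * of_int j / real R \<le> (v - u) * J / (J powr (1/3))"
      using j uv R J13 jr by (intro frac_le mult_left_mono mult_nonneg_nonneg) auto
    also have "\<dots> = (v - u) * (J powr 1 / J powr (1/3))" using Jp by simp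
    also have "J powr 1 / J powr (1/3) = J powr (2/3)" by (simp only: powr_diff[symmetric]) simp
    finally have 1: "(v - u) * of_int j / real R \<le> (v - u) * J powr (2/3)" .
    have "(real R)\<^sup>2 \<le> (2 * J powr (1/3))\<^sup>2" using R by (intro power_mono) auto
    also have "\<dots> = 4 * (J powr (1/3) * J powr (1/3))" by (simp add: power2_eq_square)
    also have "J powr (1/3) * J powr (1/3) = J powr (2/3)" by (simp only: powr_add[symmetric]) simp
    finally have 2: "(real R)\<^sup>2 \<le> 4 * J powr (2/3)" .
    have "2 * \<Delta> * of_int j * real R / a \<le> 2 * \<Delta> * J * (2 * J powr (1/3)) / a"
      using j R \<Delta> a_pos jr J by (intro divide_right_mono mult_mono) auto
    also have "\<dots> = (4 / a) * (\<Delta> * (J powr 1 * J powr (1/3)))" using Jp by simp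
    also have "J powr 1 * J powr (1/3) = J powr (4/3)" by (simp only: powr_add[symmetric]) simp
    finally have 3: "2 * \<Delta> * of_int j * real R / a \<le> (4 / a) * (\<Delta> * J powr (4/3))" .
    have 4: "1 \<le> J powr (2/3)" using J by (simp add: ge_one_powr_ge_zero)
    have gen: "X \<le> ((v - u) + 1 + E * (4 + 4 / a)) * (p + q)"
      if "X \<le> A + 1 + E * (B + D)" "A \<le> (v - u) * p" "1 \<le> p" "B \<le> (4 / a) * q" "D \<le> 4 * p" "0 \<le> q" for X A B D p q :: real
    proof -
      have "E * (B + D) \<le> E * ((4 / a) * q + 4 * p)" using that E by (intro mult_left_mono add_mono)
      moreover have "0 \<le> (v - u + 1 + E * 4) * q" "0 \<le> E * (4 / a) * p"
        using uv E a_pos that by auto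
      ultimately show ?thesis using that by (simp add: algebra_simps add_divide_distrib)
    qed
    have "real (card (A j)) \<le> ((v - u) + 1 + E * (4 + 4 / a)) * (J powr (2/3) + \<Delta> * J powr (4/3))"
      by (rule gen[OF c(2) 1 4 3 2]) (use \<Delta> in simp)
    then show "real (card (A j)) \<le> ((v - u) + 1 + E * (4 + 4 / a)) * (J powr (2/3) + \<Delta> * J powr (4/3))" .
  qed
  define C where "C = (v - u) + 1 + E * (4 + 4 / a)"
  have C: "C \<ge> 0" using uv E a_pos by (simp add: C_def)
  have "?D \<subseteq> (\<Union>j\<in>{1..\<lfloor>J\<rfloor>}. (\<lambda>l. (l, j)) ` A j)"
  proof
    fix w assume w: "w \<in> ?D"
    obtain l j where lj: "w = (l, j)" by (cases w)
    have "real_of_int j > 0" using w J by (auto simp: denominators_def lj)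
    moreover have "\<exists>m::int. \<bar>of_int j * g (of_int l / of_int j) - of_int m\<bar> < \<Delta>"
      using w dist_int_attained[of "of_int j * g (of_int l / of_int j)"] by (auto simp: lj)
    ultimately have "l \<in> A j" "j \<in> {1..\<lfloor>J\<rfloor>}"
      using w by (simp_all add: A_def lj denominators_def le_floor_iff)
    then show "w \<in> (\<Union>j\<in>{1..\<lfloor>J\<rfloor>}. (\<lambda>l. (l, j)) ` A j)" unfolding lj by blast
  qed
  then have "card ?D \<le> card (\<Union>j\<in>{1..\<lfloor>J\<rfloor>}. (\<lambda>l. (l, j)) ` A j)"
    using A(1) by (intro card_mono) (auto simp: le_floor_iff)
  also have "\<dots> \<le> (\<Sum>j\<in>{1..\<lfloor>J\<rfloor>}. card ((\<lambda>l. (l, j)) ` A j))" by (intro card_UN_le) auto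
  also have "\<dots> \<le> (\<Sum>j\<in>{1..\<lfloor>J\<rfloor>}. card (A j))"
    using A(1) by (intro sum_mono card_image_le) (auto simp: le_floor_iff)
  finally have "real (card ?D) \<le> (\<Sum>j\<in>{1..\<lfloor>J\<rfloor>}. real (card (A j)))"
    unfolding of_nat_sum[symmetric] by (rule of_nat_mono)
  also have "\<dots> \<le> (\<Sum>j\<in>{1..\<lfloor>J\<rfloor>}. C * (J powr (2/3) + \<Delta> * J powr (4/3)))"
    unfolding C_def using A(2) by (intro sum_mono) (auto simp: le_floor_iff)
  also have "\<dots> = of_int \<lfloor>J\<rfloor> * (C * (J powr (2/3) + \<Delta> * J powr (4/3)))"
    using J by simp
  also have "\<dots> \<le> J powr 1 * (C * (J powr (2/3) + \<Delta> * J powr (4/3)))"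
    using C \<Delta> J by (intro mult_right_mono mult_nonneg_nonneg add_nonneg_nonneg) auto
  also have "\<dots> = C * (J powr 1 * J powr (2/3) + \<Delta> * (J powr 1 * J powr (4/3)))"
    by (simp only: algebra_simps)
  also have "J powr 1 * J powr (2/3) = J powr (5/3)" by (simp only: powr_add[symmetric]) simp
  also have "J powr 1 * J powr (4/3) = J powr (7/3)" by (simp only: powr_add[symmetric]) simp
  finally show ?thesis unfolding C_def E_def .
qed

end

text \<open>The sum is geometric. The number of indices is logarithmic in \<open>X\<close>, but a
  cube root is recorded: multiplied by \<open>J powr (7/3)\<close> it then fits the same
  \<open>J powr (8/3)\<close> that the geometric sum produces.\<close>

lemma power_lt_card_bound:
  assumes X: "1 \<le> X" "\<And>i. i \<in> I \<Longrightarrow> 2 ^ i < X" and "finite (I :: nat set)"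
  shows "(\<Sum>i\<in>I. 2 ^ i) \<le> 2 * X" "real (card I) \<le> 5 * X powr (1/3)"
proof -
  have "(\<Sum>i\<in>I. 2 ^ i) \<le> 2 * X \<and> real (card I) \<le> 5 * X powr (1/3)"
  proof (cases "I = {}")
    case True
    then show ?thesis using X by simp
  next
    case False
    define m where "m = Max I"
    have m: "m \<in> I" "I \<subseteq> {..m}" using assms(3) False by (auto simp: m_def)
    have "(\<Sum>i\<in>I. 2 ^ i :: real) \<le> (\<Sum>i\<le>m. 2 ^ i)" using m by (intro sum_mono2) auto
    also have "\<dots> \<le> 2 * 2 ^ m" by (rule geometric_le)
    also have "\<dots> \<le> 2 * X" using X(2)[OF m(1)] by simp
    finally have 1: "(\<Sum>i\<in>I. 2 ^ i) \<le> 2 * X" .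
    have "card I \<le> card {..m}" using m by (intro card_mono) auto
    then have "real (card I) \<le> real m + 1" by simp
    also have "\<dots> \<le> 5 * (1 + real m / 3 * ln 2)"
    proof -
      have "ln 2 \<ge> (3/5::real)" using ln2_ge_two_thirds by simp
      then have "real m / 3 * (3/5) \<le> real m / 3 * ln 2" by (intro mult_left_mono) auto
      then show ?thesis by simp
    qed
    also have "\<dots> \<le> 5 * exp (real m / 3 * ln 2)" 
      using exp_ge_add_one_self[of "real m / 3 * ln 2"] by (rule mult_left_mono) simp
    also have "exp (real m / 3 * ln 2) = (2 powr real m) powr (1/3)"
      by (simp add: powr_def powr_powr)
    also have "2 powr real m = 2 ^ m" by (simp add: powr_realpow)
    also have "5 * (2 ^ m) powr (1/3) \<le> 5 * X powr (1/3)"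
      using X(2)[OF m(1)] by (intro mult_left_mono powr_mono2) auto
    finally show ?thesis using 1 by simp
  qed
  then show "(\<Sum>i\<in>I. 2 ^ i) \<le> 2 * X" "real (card I) \<le> 5 * X powr (1/3)" by auto
qed

text \<open>A layer of thickness \<open>1 / 2 ^ i\<close> falls under \<open>near_count\<close> once
  it is at most \<open>c0 / J\<close>, and under \<open>large_layer_count\<close> before that. In
  the first range the weights \<open>2 ^ i\<close> sum to O(Q), and to O(sqrt Q) against
  \<open>sqrt (1 / 2 ^ i)\<close>. In the second they stop at \<open>J / c0\<close>, which produces
  \<open>J powr (8/3)\<close>.\<close>

lemma (in strongly_convex) kern_sum_layers:
  assumes J: "J \<ge> 1" and Q: "Q \<ge> 1" and uv: "u \<le> v"
    and \<kappa>: "\<kappa> = min 1 (1 / (2 * b))"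
    and C1: "C1 = 2 * (2 * ((v - u) / \<kappa> + 1) + 16 * ((v - u) / \<kappa> + 1) / sqrt a + 8 * (3 + 3 * b * (v - u)) / sqrt a)"
    and C2: "C2 = (v - u) + 1 + (3 * b * (v - u) + 5) * (4 + 4 / a)"
    and c0: "c0 = min (1/16) a"
  shows "(\<Sum>(l, j)\<in>denominators u v J. kern Q (of_int j * g (of_int l / of_int j)))
    \<le> C1 * (8 * (Q * (J * (1 + ln J))) + 16 * (J\<^sup>2 * sqrt Q)) + C2 * (4 / c0 + 10 / c0) * J powr (8/3)"
proof -
  have Jp: "J > 0" using J by simp
  have c0p: "0 < c0" "c0 \<le> 1" using a_pos by (auto simp: c0)
  have C1p: "C1 \<ge> 0" using a_pos b_pos uv unfolding C1 \<kappa> by simp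
  have C2p: "C2 \<ge> 0" using a_pos b_pos uv unfolding C2 by simp
  define n where "n = nat \<lceil>log 2 Q\<rceil>"
  have lq: "0 \<le> log 2 Q" using Q by simp
  have n1: "Q \<le> 2 ^ n"
  proof -
    have "log 2 Q \<le> real n" using lq unfolding n_def by linarith
    then have "2 powr log 2 Q \<le> 2 powr real n" by (intro powr_mono) auto
    then show ?thesis using Q by (simp add: powr_realpow)
  qed
  have n2: "2 ^ n \<le> 2 * Q"
  proof -
    have "real n \<le> log 2 Q + 1" using lq unfolding n_def by linarith
    then have "2 powr real n \<le> 2 powr (log 2 Q + 1)" by (intro powr_mono) auto
    then show ?thesis using Q by (simp add: powr_realpow powr_add)
  qed
  define D where "D i = {w \<in> denominators u v J. dist_int (of_int (snd w) * g (of_int (fst w) / of_int (snd w))) < 1 / 2 ^ i}" for i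
  have fin: "finite (denominators u v J)" using finite_denominators[OF Jp] .
  define L where "L = J * (1 + ln J)"
  have L0: "L \<ge> 0" using J by (simp add: L_def)
  have "(\<Sum>(l, j)\<in>denominators u v J. kern Q (of_int j * g (of_int l / of_int j)))
    \<le> (\<Sum>w\<in>denominators u v J. \<Sum>i\<le>n. 2 ^ (i + 1) * (if dist_int (of_int (snd w) * g (of_int (fst w) / of_int (snd w))) < 1 / 2 ^ i then 1 else 0))"
    using kern_layers[OF _ n1] Q by (intro sum_mono) (auto simp: case_prod_beta)
  also have "\<dots> = (\<Sum>i\<le>n. \<Sum>w\<in>denominators u v J. 2 ^ (i + 1) * (if dist_int (of_int (snd w) * g (of_int (fst w) / of_int (snd w))) < 1 / 2 ^ i then 1 else 0))"
    by (rule sum.swap)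
  also have "\<dots> = (\<Sum>i\<le>n. 2 ^ (i + 1) * real (card (D i)))"
  proof (rule sum.cong[OF refl])
    fix i
    have "(\<Sum>w\<in>denominators u v J. if dist_int (of_int (snd w) * g (of_int (fst w) / of_int (snd w))) < 1 / 2 ^ i then 1 else 0 :: real) = real (card (D i))"
      unfolding D_def using fin by (simp add: sum.If_cases Int_def)
    then show "(\<Sum>w\<in>denominators u v J. 2 ^ (i + 1) * (if dist_int (of_int (snd w) * g (of_int (fst w) / of_int (snd w))) < 1 / 2 ^ i then 1 else 0))
      = 2 ^ (i + 1) * real (card (D i))" by (simp only: sum_distrib_left[symmetric])
  qed
  also have "\<dots> \<le> (\<Sum>i\<le>n. 2 ^ (i + 1) * (C1 * (L + J\<^sup>2 * sqrt (1 / 2 ^ i)))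
      + (if 2 ^ i < J / c0 then 2 ^ (i + 1) * (C2 * (J powr (5/3) + 1 / 2 ^ i * J powr (7/3))) else 0))"
  proof (rule sum_mono)
    fix i
    have nn: "0 \<le> 2 ^ (i + 1) * (C1 * (L + J\<^sup>2 * sqrt (1 / 2 ^ i)))" using C1p L0 by simp
    show "2 ^ (i + 1) * real (card (D i)) \<le> 2 ^ (i + 1) * (C1 * (L + J\<^sup>2 * sqrt (1 / 2 ^ i)))
      + (if 2 ^ i < J / c0 then 2 ^ (i + 1) * (C2 * (J powr (5/3) + 1 / 2 ^ i * J powr (7/3))) else 0)"
    proof (cases "2 ^ i < J / c0")
      case True
      have "real (card (D i)) \<le> C2 * (J powr (5/3) + 1 / 2 ^ i * J powr (7/3))"
        unfolding D_def C2 by (rule large_layer_count[OF J _ _ uv]) auto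
      then have "2 ^ (i + 1) * real (card (D i)) \<le> 2 ^ (i + 1) * (C2 * (J powr (5/3) + 1 / 2 ^ i * J powr (7/3)))"
        by (intro mult_left_mono) auto
      then show ?thesis using nn unfolding if_P[OF True] by linarith
    next
      case False
      then have "1 / 2 ^ i \<le> c0 / J" using c0p Jp by (simp add: field_simps)
      then have s: "1 / 2 ^ i \<le> 1 / (16 * J)" "1 / 2 ^ i \<le> a / J"
        using Jp by (auto simp: c0 field_simps min_le_iff_disj split: if_splits)
      have "real (card (D i)) \<le> real (card (near_points u v J (1 / 2 ^ i)))"
        unfolding D_def by (intro of_nat_mono small_layer_count J)
      also have "\<dots> \<le> C1 * (L + J\<^sup>2 * sqrt (1 / 2 ^ i))"
        unfolding C1 L_def by (rule near_count[OF J _ s \<kappa> uv refl]) auto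
      finally have "2 ^ (i + 1) * real (card (D i)) \<le> 2 ^ (i + 1) * (C1 * (L + J\<^sup>2 * sqrt (1 / 2 ^ i)))"
        by (intro mult_left_mono) auto
      then show ?thesis unfolding if_not_P[OF False] by linarith
    qed
  qed
  also have "\<dots> = (\<Sum>i\<le>n. 2 ^ (i + 1) * (C1 * (L + J\<^sup>2 * sqrt (1 / 2 ^ i))))
      + (\<Sum>i\<in>{i. i \<le> n \<and> 2 ^ i < J / c0}. 2 ^ (i + 1) * (C2 * (J powr (5/3) + 1 / 2 ^ i * J powr (7/3))))"
    unfolding sum.distrib by (simp add: sum.If_cases Int_def)
  also have "(\<Sum>i\<le>n. 2 ^ (i + 1) * (C1 * (L + J\<^sup>2 * sqrt (1 / 2 ^ i)))) \<le> C1 * (8 * (Q * L) + 16 * (J\<^sup>2 * sqrt Q))"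
  proof -
    have p: "2 ^ i * sqrt (1 / 2 ^ i) = sqrt 2 ^ i" for i :: nat
    proof -
      have "(2::real) ^ i = sqrt (2 ^ i) * sqrt (2 ^ i)" by simp
      then show ?thesis by (simp add: real_sqrt_divide real_sqrt_power)
    qed
    have "(\<Sum>i\<le>n. 2 ^ (i + 1) * (C1 * (L + J\<^sup>2 * sqrt (1 / 2 ^ i))))
       = (\<Sum>i\<le>n. 2 * C1 * L * 2 ^ i + 2 * C1 * J\<^sup>2 * (2 ^ i * sqrt (1 / 2 ^ i)))"
      by (intro sum.cong) (auto simp: algebra_simps)
    also have "\<dots> = 2 * C1 * L * (\<Sum>i\<le>n. 2 ^ i) + 2 * C1 * J\<^sup>2 * (\<Sum>i\<le>n. sqrt 2 ^ i)"
      unfolding p by (simp only: sum.distrib sum_distrib_left)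
    also have "\<dots> \<le> 2 * C1 * L * (4 * Q) + 2 * C1 * J\<^sup>2 * (8 * sqrt Q)"
    proof (intro add_mono mult_left_mono)
      show "(\<Sum>i\<le>n. 2 ^ i :: real) \<le> 4 * Q" using geometric_le[of n] n2 by linarith
      have "sqrt 2 ^ n = sqrt (2 ^ n)" by (simp add: real_sqrt_power)
      also have "\<dots> \<le> sqrt (2 * Q)" using n2 by simp
      also have "\<dots> \<le> sqrt (4 * Q)" using Q by simp
      also have "\<dots> = 2 * sqrt Q" by (simp add: real_sqrt_mult)
      finally show "(\<Sum>i\<le>n. sqrt 2 ^ i) \<le> 8 * sqrt Q" using geometric_sqrt_le[of n] by linarith
    qed (use C1p L0 in auto)
    finally show ?thesis by (simp add: algebra_simps)
  qed
  also have "(\<Sum>i\<in>{i. i \<le> n \<and> 2 ^ i < J / c0}. 2 ^ (i + 1) * (C2 * (J powr (5/3) + 1 / 2 ^ i * J powr (7/3))))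
      \<le> C2 * (4 / c0 + 10 / c0) * J powr (8/3)"
  proof -
    let ?I = "{i. i \<le> n \<and> 2 ^ i < J / c0}"
    have X: "1 \<le> J / c0" using J c0p by simp
    have "finite ?I" by simp
    note b = power_lt_card_bound[OF X, of ?I, OF _ this]
    have "(\<Sum>i\<in>?I. 2 ^ (i + 1) * (C2 * (J powr (5/3) + 1 / 2 ^ i * J powr (7/3))))
      = (\<Sum>i\<in>?I. 2 * C2 * J powr (5/3) * 2 ^ i + 2 * C2 * J powr (7/3))"
      by (intro sum.cong) (auto simp: algebra_simps)
    also have "\<dots> = 2 * C2 * J powr (5/3) * (\<Sum>i\<in>?I. 2 ^ i) + 2 * C2 * J powr (7/3) * real (card ?I)"
      by (simp add: sum.distrib sum_distrib_left)
    also have "\<dots> \<le> 2 * C2 * J powr (5/3) * (2 * (J / c0)) + 2 * C2 * J powr (7/3) * (5 * (J / c0) powr (1/3))"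
      using b C2p by (intro add_mono mult_left_mono) auto
    also have "\<dots> \<le> 2 * C2 * J powr (5/3) * (2 * (J / c0)) + 2 * C2 * J powr (7/3) * (5 * (J powr (1/3) / c0))"
    proof -
      have "(J / c0) powr (1/3) = J powr (1/3) / c0 powr (1/3)" using Jp c0p by (simp add: powr_divide)
      also have "\<dots> \<le> J powr (1/3) / c0 powr 1"
        using c0p by (intro divide_left_mono powr_mono' mult_pos_pos) auto
      finally have "(J / c0) powr (1/3) \<le> J powr (1/3) / c0" using c0p by simp
      then show ?thesis using C2p by (intro add_left_mono mult_left_mono) auto
    qed
    also have "\<dots> = C2 * (4 / c0) * (J powr (5/3) * J) + C2 * (10 / c0) * (J powr (7/3) * J powr (1/3))"
    proof -
      have "2 * C2 * p * (2 * (J / c0)) + 2 * C2 * q * (5 * (r / c0)) = C2 * (4 / c0) * (p * J) + C2 * (10 / c0) * (q * r)" for p q r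
        by (simp add: mult_ac)
      then show ?thesis .
    qed
    also have "J powr (5/3) * J = J powr (5/3) * J powr 1" using Jp by simp
    also have "\<dots> = J powr (8/3)" by (simp only: powr_add[symmetric]) simp
    also have "J powr (7/3) * J powr (1/3) = J powr (8/3)" by (simp only: powr_add[symmetric]) simp
    finally show ?thesis by (simp only: distrib_left distrib_right)
  qed
  finally show ?thesis by (simp add: L_def)
qed

section \<open>The weighted Erdos-Turan inequality\<close>

definition echar :: "real \<Rightarrow> complex" where
  "echar x = cis (2 * pi * x)"

lemma echar_0 [simp]: "echar 0 = 1"
  by (simp add: echar_def)

lemma norm_echar [simp]: "norm (echar x) = 1"
  by (simp add: echar_def)

lemma echar_add: "echar (x + y) = echar x * echar y"
  by (simp add: echar_def cis_mult distrib_left)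

lemma echar_minus: "echar (- x) = cnj (echar x)"
  by (simp add: echar_def cis_cnj)

lemma echar_diff: "echar (x - y) = echar x * cnj (echar y)"
  using echar_add[of x "- y"] by (simp add: echar_minus)

lemma echar_int [simp]: "echar (of_int k) = 1"
  using cis_multiple_2pi[of "of_int k"] by (simp add: echar_def)

lemma echar_add_int [simp]: "echar (x + of_int k) = echar x"
  by (simp add: echar_add)

lemma echar_mult_of_nat: "echar (of_nat n * x) = echar x ^ n"
proof -
  have "2 * pi * (of_nat n * x) = real n * (2 * pi * x)" by simp
  then show ?thesis unfolding echar_def Complex.DeMoivre by (simp only:)
qed

lemma norm_echar_minus_1: "norm (echar x - 1) = 2 * \<bar>sin (pi * x)\<bar>"
proof -
  have "echar x - 1 = cis (pi * x) * (cis (pi * x) - cis (- (pi * x)))"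
    by (simp add: echar_def right_diff_distrib cis_mult mult.assoc)
  also have "cis (pi * x) - cis (- (pi * x)) = 2 * \<i> * of_real (sin (pi * x))"
    by (simp add: complex_eq_iff)
  finally show ?thesis by (simp add: norm_mult)
qed

lemma continuous_echar [continuous_intros]:
  "continuous_on S f \<Longrightarrow> continuous_on S (\<lambda>x. echar (f x))"
  unfolding echar_def by (intro continuous_intros)

lemma has_vector_derivative_echar:
  assumes "(f has_real_derivative f') (at x within S)"
  shows "((\<lambda>x. echar (f x)) has_vector_derivative (of_real (2 * pi * f') * \<i> * echar (f x))) (at x within S)"
proof -
  have "((\<lambda>x. 2 * pi * f x) has_derivative (\<lambda>t. 2 * pi * (f' * t))) (at x within S)"
    using assms by (auto intro!: derivative_eq_intros simp: has_field_derivative_def)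
  from has_derivative_cis[OF this] show ?thesis
    by (simp add: echar_def has_vector_derivative_def scaleR_conv_of_real mult_ac)
qed

lemma has_integral_echar:
  assumes "a \<le> b" "k \<noteq> (0::int)"
  shows "((\<lambda>u. echar (of_int k * u)) has_integral
     (echar (of_int k * b) - echar (of_int k * a)) / (2 * pi * of_int k * \<i>)) {a..b}"
proof -
  have "((\<lambda>u. of_real (2 * pi * of_int k) * \<i> * echar (of_int k * u)) has_integral
     (echar (of_int k * b) - echar (of_int k * a))) {a..b}"
    using assms(1)
    by (intro fundamental_theorem_of_calculus has_vector_derivative_echar) (auto intro!: derivative_eq_intros)
  from has_integral_mult_right[OF this, of "1 / (2 * pi * of_int k * \<i>)"] show ?thesis
    using assms(2) by (simp add: field_simps)
qed

lemma sin_ge_linear: "0 \<le> d \<Longrightarrow> d \<le> 1/2 \<Longrightarrow> 2 * d \<le> sin (pi * d)"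
proof -
  assume d: "0 \<le> d" "d \<le> 1/2"
  have "concave_on {0..pi} sin"
    unfolding concave_on_def
    by (rule f''_ge0_imp_convex[where f' = "\<lambda>x. - cos x" and f'' = sin])
       (auto intro!: derivative_eq_intros sin_ge_zero)
  then have *: "u * sin x + v * sin y \<le> sin (u *\<^sub>R x + v *\<^sub>R y)"
    if "x \<in> {0..pi}" "y \<in> {0..pi}" "0 \<le> u" "0 \<le> v" "u + v = 1" for u v x y
    using that unfolding concave_on_iff by blast
  have "(1 - 2 * d) * sin 0 + (2 * d) * sin (pi / 2) \<le> sin ((1 - 2 * d) *\<^sub>R 0 + (2 * d) *\<^sub>R (pi / 2))"
    using d by (intro *) auto
  then show ?thesis by (simp add: mult_ac)
qed

lemma dist_int_add_int: "dist_int (x + of_int k) = dist_int x"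
proof -
  have le: "dist_int (x + of_int k) \<le> dist_int x" for x k
  proof -
    obtain m :: int where "dist_int x = \<bar>x - of_int m\<bar>" using dist_int_attained by blast
    then show ?thesis using dist_int_le[of "x + of_int k" "m + k"] by simp
  qed
  show ?thesis using le[of x k] le[of "x + of_int k" "- k"] by simp
qed

lemma dist_int_minus: "dist_int (- x) = dist_int x"
proof -
  have le: "dist_int (- x) \<le> dist_int x" for x
  proof -
    obtain m :: int where "dist_int x = \<bar>x - of_int m\<bar>" using dist_int_attained by blast
    then show ?thesis using dist_int_le[of "- x" "- m"] by (simp add: abs_minus_commute)
  qed
  show ?thesis using le[of x] le[of "- x"] by simp
qed

lemma dist_int_lipschitz: "dist_int y \<le> dist_int x + \<bar>y - x\<bar>"
proof -
  obtain m :: int where "dist_int x = \<bar>x - of_int m\<bar>" using dist_int_attained by blast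
  then show ?thesis using dist_int_le[of y m] by linarith
qed

lemma dist_int_eq_min:
  assumes "0 \<le> x" "x \<le> 1"
  shows "dist_int x = min x (1 - x)"
proof -
  obtain m :: int where m: "dist_int x = \<bar>x - of_int m\<bar>" using dist_int_attained by blast
  have "dist_int x \<le> x" "dist_int x \<le> 1 - x"
    using dist_int_le[of x 0] dist_int_le[of x 1] assms by auto
  moreover have "min x (1 - x) \<le> \<bar>x - of_int m\<bar>"
  proof (cases "m \<le> 0")
    case True
    then have "real_of_int m \<le> 0" by simp
    then show ?thesis by linarith
  next
    case False
    then have "real_of_int m \<ge> 1" by simp
    then show ?thesis by linarith
  qed
  ultimately show ?thesis using m by linarith
qed

lemma abs_sin_pi_ge: "2 * dist_int x \<le> \<bar>sin (pi * x)\<bar>"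
proof -
  obtain m :: int where m: "dist_int x = \<bar>x - of_int m\<bar>" using dist_int_attained by blast
  define d where "d = x - of_int m"
  have "\<bar>sin (pi * x)\<bar> = norm (echar x - 1) / 2" by (simp add: norm_echar_minus_1)
  also have "echar x = echar (d + of_int m)" by (simp add: d_def)
  also have "\<dots> = echar d" by (rule echar_add_int)
  also have "norm (echar d - 1) / 2 = \<bar>sin (pi * d)\<bar>" by (simp add: norm_echar_minus_1)
  also have "\<dots> = \<bar>sin (pi * \<bar>d\<bar>)\<bar>" by (simp add: abs_if)
  finally have "\<bar>sin (pi * x)\<bar> = \<bar>sin (pi * \<bar>d\<bar>)\<bar>" .
  moreover have "2 * \<bar>d\<bar> \<le> sin (pi * \<bar>d\<bar>)"
    using dist_int_le_half[of x] m by (intro sin_ge_linear) (auto simp: d_def)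
  ultimately show ?thesis using m by (simp add: d_def)
qed

section \<open>Dirichlet kernels, their second and fourth powers\<close>

definition dirichlet :: "nat \<Rightarrow> real \<Rightarrow> complex" where
  "dirichlet H x = (\<Sum>h<H. echar (of_nat h * x))"

lemma continuous_dirichlet [continuous_intros]: "continuous_on S (dirichlet H)"
  unfolding dirichlet_def by (intro continuous_intros)

lemma dirichlet_mult: "dirichlet H x * (echar x - 1) = echar (of_nat H * x) - 1"
  unfolding dirichlet_def echar_mult_of_nat by (simp add: geometric_sum mult.commute power_diff_1_eq)

lemma norm_dirichlet_le: "norm (dirichlet H x) \<le> H"
  unfolding dirichlet_def by (rule order_trans[OF norm_sum]) simp

lemma norm_dirichlet_eq: "norm (dirichlet H x) * \<bar>sin (pi * x)\<bar> = \<bar>sin (pi * (of_nat H * x))\<bar>"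
  using arg_cong[OF dirichlet_mult[of H x], of norm] by (simp add: norm_mult norm_echar_minus_1)

lemma norm_dirichlet_dist: "norm (dirichlet H x) * (2 * dist_int x) \<le> 1"
proof -
  have "norm (dirichlet H x) * (2 * dist_int x) \<le> norm (dirichlet H x) * \<bar>sin (pi * x)\<bar>"
    by (intro mult_left_mono abs_sin_pi_ge) auto
  also have "\<dots> \<le> 1" unfolding norm_dirichlet_eq by simp
  finally show ?thesis .
qed

lemma norm_dirichlet_kern:
  assumes "H \<le> Q" "0 < Q"
  shows "norm (dirichlet H x) \<le> 2 * kern (real Q) x"
proof -
  have d: "0 \<le> dist_int x" by (rule dist_int_nonneg)
  then have p: "0 < 1 + real Q * dist_int x" by (intro add_pos_nonneg) auto
  have "norm (dirichlet H x) * (1 + real Q * dist_int x) = norm (dirichlet H x) + real Q * (norm (dirichlet H x) * dist_int x)"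
    by (simp add: algebra_simps)
  also have "\<dots> \<le> real Q + real Q * 1"
    using norm_dirichlet_le[of H x] assms norm_dirichlet_dist[of H x]
    by (intro add_mono mult_left_mono) auto
  finally show ?thesis using p by (simp add: kern_def field_simps)
qed

lemma dirichlet_norm_sq:
  "of_real ((norm (dirichlet H x))\<^sup>2) = (\<Sum>p\<in>{..<H}\<times>{..<H}. echar (of_int (int (fst p) - int (snd p)) * x))"
proof -
  have "complex_of_real ((norm (dirichlet H x))\<^sup>2) = dirichlet H x * cnj (dirichlet H x)"
    by (rule complex_norm_square)
  also have "\<dots> = (\<Sum>h<H. \<Sum>k<H. echar (of_nat h * x) * cnj (echar (of_nat k * x)))"
    by (simp add: dirichlet_def sum_product cnj_sum)
  also have "\<dots> = (\<Sum>p\<in>{..<H}\<times>{..<H}. echar (of_int (int (fst p) - int (snd p)) * x))"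
    unfolding sum.cartesian_product
    by (intro sum.cong) (auto simp: echar_diff[symmetric] left_diff_distrib)
  finally show ?thesis .
qed

text \<open>The frequency of one term when the squared modulus of the Dirichlet kernel is multiplied
  out; \<open>diff4\<close> does the same for the fourth power. Summing over index tuples instead of
  frequencies avoids closed forms for the Fejer and Jackson coefficients, since only bounds for
  multiplicities are needed.\<close>

definition diff2 :: "nat \<times> nat \<Rightarrow> int" where
  "diff2 p = int (fst p) - int (snd p)"

definition diff4 :: "(nat \<times> nat) \<times> (nat \<times> nat) \<Rightarrow> int" where
  "diff4 w = diff2 (fst w) + diff2 (snd w)"

definition sq2 :: "nat \<Rightarrow> (nat \<times> nat) set" where
  "sq2 H = {..<H} \<times> {..<H}"

lemma finite_sq2 [simp]: "finite (sq2 H)"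
  by (simp add: sq2_def)

lemma dirichlet_norm_2: "of_real ((norm (dirichlet H x))\<^sup>2) = (\<Sum>p\<in>sq2 H. echar (of_int (diff2 p) * x))"
  unfolding dirichlet_norm_sq diff2_def sq2_def ..

lemma dirichlet_norm_4:
  "of_real ((norm (dirichlet H x)) ^ 4) = (\<Sum>w\<in>sq2 H \<times> sq2 H. echar (of_int (diff4 w) * x))"
proof -
  have "(norm (dirichlet H x)) ^ 4 = (norm (dirichlet H x))\<^sup>2 * (norm (dirichlet H x))\<^sup>2"
    by (simp add: power2_eq_square power4_eq_xxxx)
  then have "complex_of_real ((norm (dirichlet H x)) ^ 4) = (\<Sum>p\<in>sq2 H. \<Sum>p'\<in>sq2 H. echar (of_int (diff2 p) * x) * echar (of_int (diff2 p') * x))"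
    unfolding sum_product[symmetric] dirichlet_norm_2[symmetric] by simp
  also have "\<dots> = (\<Sum>w\<in>sq2 H \<times> sq2 H. echar (of_int (diff4 w) * x))"
    unfolding sum.cartesian_product
    by (intro sum.cong) (auto simp: diff4_def distrib_right echar_add)
  finally show ?thesis .
qed

lemma card_diff2_le: "card {p\<in>sq2 H. diff2 p = k} \<le> H"
proof -
  have "card {p\<in>sq2 H. diff2 p = k} \<le> card {..<H}"
    by (rule card_inj_on_le[where f = fst]) (auto simp: inj_on_def sq2_def diff2_def)
  then show ?thesis by simp
qed

lemma card_diff4_le: "card {w\<in>sq2 H \<times> sq2 H. diff4 w = k} \<le> H ^ 3"
proof -
  have "card {w\<in>sq2 H \<times> sq2 H. diff4 w = k} \<le> card ({..<H} \<times> {..<H} \<times> {..<H})"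
    by (rule card_inj_on_le[where f = "\<lambda>w. (fst (fst w), snd (fst w), fst (snd w))"])
       (auto simp: inj_on_def sq2_def diff4_def diff2_def)
  then show ?thesis by (simp add: power3_eq_cube card_cartesian_product)
qed

text \<open>The frequency zero of the fourth power has multiplicity the sum of squares of the
  representation numbers \<open>\<rho> k\<close>. Cauchy-Schwarz over the \<open>2 * H - 1\<close>
  possible differences, with total \<open>H ^ 2\<close>, gives the cubic lower bound. This
  multiplicity is also the integral of the fourth power over a period, hence the normalising factor
  later on.\<close>

lemma card_diff4_zero_ge:
  assumes "H \<ge> 1"
  shows "real H ^ 3 / 2 \<le> real (card {w\<in>sq2 H \<times> sq2 H. diff4 w = 0})"
proof -
  define \<rho> where "\<rho> k = card {p\<in>sq2 H. diff2 p = k}" for k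
  let ?K = "{1 - int H..int H - 1}"
  have tot: "(\<Sum>k\<in>?K. real (\<rho> k)) = real H ^ 2"
  proof -
    have "(\<Sum>k\<in>?K. \<rho> k) = (\<Sum>k\<in>?K. \<Sum>p\<in>{p\<in>sq2 H. diff2 p = k}. 1)" by (simp add: \<rho>_def)
    also have "\<dots> = (\<Sum>p\<in>sq2 H. 1)"
      by (rule sum.group) (auto simp: sq2_def diff2_def)
    also have "\<dots> = H ^ 2" by (simp add: sq2_def card_cartesian_product power2_eq_square)
    finally have "real (\<Sum>k\<in>?K. \<rho> k) = real (H ^ 2)" by (rule arg_cong)
    then show ?thesis by (simp only: of_nat_sum of_nat_power)
  qed
  have sym: "\<rho> (- k) = \<rho> k" for k
    unfolding \<rho>_def
    by (rule bij_betw_same_card[of prod.swap]) (auto simp: bij_betw_def inj_on_def sq2_def diff2_def image_iff)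
  have "card {w\<in>sq2 H \<times> sq2 H. diff4 w = 0} = (\<Sum>k\<in>?K. \<rho> k * \<rho> (- k))"
  proof -
    have "card {w\<in>sq2 H \<times> sq2 H. diff4 w = 0} = card (SIGMA k:?K. {p\<in>sq2 H. diff2 p = k} \<times> {p\<in>sq2 H. diff2 p = - k})"
    proof (rule bij_betw_same_card[of "\<lambda>w. (diff2 (fst w), w)"])
      show "bij_betw (\<lambda>w. (diff2 (fst w), w)) {w\<in>sq2 H \<times> sq2 H. diff4 w = 0}
         (SIGMA k:?K. {p\<in>sq2 H. diff2 p = k} \<times> {p\<in>sq2 H. diff2 p = - k})"
        unfolding bij_betw_def
      proof
        show "inj_on (\<lambda>w. (diff2 (fst w), w)) {w\<in>sq2 H \<times> sq2 H. diff4 w = 0}" by (auto simp: inj_on_def)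
        show "(\<lambda>w. (diff2 (fst w), w)) ` {w\<in>sq2 H \<times> sq2 H. diff4 w = 0}
          = (SIGMA k:?K. {p\<in>sq2 H. diff2 p = k} \<times> {p\<in>sq2 H. diff2 p = - k})"
          by (auto simp: diff4_def image_iff sq2_def diff2_def)
      qed
    qed
    then show ?thesis by (simp add: \<rho>_def card_cartesian_product)
  qed
  then have A: "real (card {w\<in>sq2 H \<times> sq2 H. diff4 w = 0}) = (\<Sum>k\<in>?K. (real (\<rho> k))\<^sup>2)"
    by (simp add: sym power2_eq_square)
  have "(\<Sum>k\<in>?K. real (\<rho> k) * 1)\<^sup>2 \<le> (\<Sum>k\<in>?K. (real (\<rho> k))\<^sup>2) * (\<Sum>k\<in>?K. 1\<^sup>2)"
    by (rule Cauchy_Schwarz_ineq_sum)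
  then have "real H ^ 4 \<le> (\<Sum>k\<in>?K. (real (\<rho> k))\<^sup>2) * (2 * real H - 1)"
    using tot assms by (simp add: of_nat_diff)
  also have "\<dots> \<le> (\<Sum>k\<in>?K. (real (\<rho> k))\<^sup>2) * (2 * real H)"
    by (intro mult_left_mono sum_nonneg) auto
  finally have "real H ^ 3 * real H \<le> (2 * (\<Sum>k\<in>?K. (real (\<rho> k))\<^sup>2)) * real H"
    by (simp add: power4_eq_xxxx power3_eq_cube mult_ac)
  then have "real H ^ 3 \<le> 2 * (\<Sum>k\<in>?K. (real (\<rho> k))\<^sup>2)" using assms by simp
  then show ?thesis unfolding A by simp
qed

lemma sum_group_bound:
  fixes F :: "nat \<Rightarrow> real"
  assumes "finite S" "\<And>v. v \<in> S \<Longrightarrow> r v \<in> {1..N}" "\<And>k. 0 \<le> F k"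
    and "\<And>k. real (card {v\<in>S. r v = k}) \<le> B"
  shows "(\<Sum>v\<in>S. F (r v)) \<le> B * (\<Sum>k=1..N. F k)"
proof -
  have "(\<Sum>v\<in>S. F (r v)) = (\<Sum>k=1..N. \<Sum>v\<in>{v\<in>S. r v = k}. F (r v))"
    using assms(1,2) by (intro sum.group[symmetric]) auto
  also have "\<dots> = (\<Sum>k=1..N. real (card {v\<in>S. r v = k}) * F k)"
    by (intro sum.cong) auto
  also have "\<dots> \<le> (\<Sum>k=1..N. B * F k)"
    using assms by (intro sum_mono mult_right_mono) auto
  finally show ?thesis by (simp add: sum_distrib_left)
qed

lemma integral_dirichlet_4:
  assumes "a \<le> b"
  shows "complex_of_real (integral {a..b} (\<lambda>u. norm (dirichlet H u) ^ 4))
     = (\<Sum>w\<in>sq2 H \<times> sq2 H. if diff4 w = 0 then of_real (b - a)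
         else (echar (of_int (diff4 w) * b) - echar (of_int (diff4 w) * a)) / (2 * pi * of_int (diff4 w) * \<i>))"
proof -
  have "((\<lambda>u. \<Sum>w\<in>sq2 H \<times> sq2 H. echar (of_int (diff4 w) * u)) has_integral
     (\<Sum>w\<in>sq2 H \<times> sq2 H. if diff4 w = 0 then of_real (b - a)
         else (echar (of_int (diff4 w) * b) - echar (of_int (diff4 w) * a)) / (2 * pi * of_int (diff4 w) * \<i>))) {a..b}"
  proof (rule has_integral_sum)
    fix w
    show "((\<lambda>u. echar (of_int (diff4 w) * u)) has_integral (if diff4 w = 0 then of_real (b - a)
         else (echar (of_int (diff4 w) * b) - echar (of_int (diff4 w) * a)) / (2 * pi * of_int (diff4 w) * \<i>))) {a..b}"
    proof (cases "diff4 w = 0")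
      case True
      show ?thesis using True assms has_integral_const_real[of "1::complex" a b] by (simp add: scaleR_conv_of_real)
    qed (use has_integral_echar[OF assms] in auto)
  qed simp
  moreover have "((\<lambda>u. complex_of_real (norm (dirichlet H u) ^ 4)) has_integral
      of_real (integral {a..b} (\<lambda>u. norm (dirichlet H u) ^ 4))) {a..b}"
    by (intro has_integral_of_real integrable_integral integrable_continuous_interval continuous_intros)
  ultimately show ?thesis unfolding dirichlet_norm_4 by (rule has_integral_unique[rotated])
qed

lemma integral_dirichlet_4_period:
  "integral {c..c+1} (\<lambda>u. norm (dirichlet H u) ^ 4) = real (card {w\<in>sq2 H \<times> sq2 H. diff4 w = 0})"
proof -
  have "complex_of_real (integral {c..c+1} (\<lambda>u. norm (dirichlet H u) ^ 4))
     = (\<Sum>w\<in>sq2 H \<times> sq2 H. if diff4 w = 0 then 1 else 0)"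
    unfolding integral_dirichlet_4[of c "c + 1" H, simplified]
    by (intro sum.cong refl) (auto simp: distrib_left)
  also have "\<dots> = of_real (real (card {w\<in>sq2 H \<times> sq2 H. diff4 w = 0}))"
    by (simp add: sum.If_cases Int_def)
  finally show ?thesis by (simp only: of_real_eq_iff)
qed

lemma abs_sin_pi_le: "\<bar>sin (pi * x)\<bar> \<le> pi * dist_int x"
proof -
  obtain m :: int where m: "dist_int x = \<bar>x - of_int m\<bar>" using dist_int_attained by blast
  define d where "d = x - of_int m"
  have "\<bar>sin (pi * x)\<bar> = norm (echar (d + of_int m) - 1) / 2" by (simp only: norm_echar_minus_1) (simp add: d_def)
  also have "\<dots> = \<bar>sin (pi * d)\<bar>" unfolding echar_add_int by (simp add: norm_echar_minus_1)
  also have "\<dots> \<le> \<bar>pi * d\<bar>" by (rule abs_sin_x_le_abs_x)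
  finally show ?thesis using m by (simp add: d_def abs_mult)
qed

text \<open>One Dirichlet kernel does not suffice, because it vanishes at zeros of
  \<open>sin (pi * (H * y))\<close>. A shift by \<open>1 / (2 * H)\<close> turns this sine into a
  cosine, so the squares of the two numerators add up to 1. The majorant is a trigonometric
  polynomial, which makes it possible to average it over the points by exponential sums.\<close>

lemma tail_majorant:
  assumes "H \<ge> 1"
  shows "1 / (1 + real H * dist_int y)\<^sup>2
     \<le> pi\<^sup>2 * ((norm (dirichlet H y))\<^sup>2 + (norm (dirichlet H (y + 1 / (2 * real H))))\<^sup>2) / (real H)\<^sup>2"
proof -
  have Hp: "real H > 0" using assms by simp
  define y' where "y' = y + 1 / (2 * real H)"
  \<comment> \<open>The summand \<open>1 / H\<close> makes \<open>d\<close> an upper bound for the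
    distance to the integers of both \<open>y\<close> and the shifted point, and gives
    \<open>H * d = 1 + H * dist_int y\<close>.\<close>
  define d where "d = dist_int y + 1 / real H"
  have d: "d > 0" using dist_int_nonneg[of y] Hp by (simp add: d_def add_nonneg_pos)
  have "dist_int y' \<le> dist_int y + 1 / (2 * real H)" using dist_int_lipschitz[of y' y] Hp by (simp add: y'_def)
  also have "\<dots> \<le> d" using Hp by (simp add: d_def field_simps)
  finally have d': "dist_int y' \<le> d" .
  have "\<bar>sin (pi * (real H * y))\<bar> \<le> norm (dirichlet H y) * (pi * d)"
    unfolding norm_dirichlet_eq[symmetric] using abs_sin_pi_le[of y] Hp
    by (intro mult_left_mono) (auto simp: d_def intro: order_trans mult_left_mono)
  then have 1: "(sin (pi * (real H * y)))\<^sup>2 \<le> (norm (dirichlet H y))\<^sup>2 * (pi * d)\<^sup>2"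
    by (metis abs_ge_zero power2_abs power_mono power_mult_distrib)
  have "pi * (real H * y') = pi * (real H * y) + pi / 2" using Hp by (simp add: y'_def field_simps)
  then have c: "sin (pi * (real H * y')) = cos (pi * (real H * y))" by (simp add: sin_add)
  have "\<bar>sin (pi * (real H * y'))\<bar> \<le> norm (dirichlet H y') * (pi * d)"
    unfolding norm_dirichlet_eq[symmetric]
    using order_trans[OF abs_sin_pi_le[of y'] mult_left_mono[OF d', of pi]]
    by (intro mult_left_mono) auto
  then have 2: "(cos (pi * (real H * y)))\<^sup>2 \<le> (norm (dirichlet H y'))\<^sup>2 * (pi * d)\<^sup>2"
    unfolding c by (metis abs_ge_zero power2_abs power_mono power_mult_distrib)
  have "1 \<le> ((norm (dirichlet H y))\<^sup>2 + (norm (dirichlet H y'))\<^sup>2) * (pi * d)\<^sup>2"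
    using 1 2 sin_cos_squared_add[of "pi * (real H * y)"] by (simp only: distrib_right)
  then have "1 \<le> (pi\<^sup>2 * ((norm (dirichlet H y))\<^sup>2 + (norm (dirichlet H y'))\<^sup>2)) * d\<^sup>2"
    by (simp add: power_mult_distrib mult_ac)
  then have "1 / d\<^sup>2 \<le> pi\<^sup>2 * ((norm (dirichlet H y))\<^sup>2 + (norm (dirichlet H y'))\<^sup>2)"
    using d by (simp add: field_simps)
  then have "1 / d\<^sup>2 / (real H)\<^sup>2 \<le> pi\<^sup>2 * ((norm (dirichlet H y))\<^sup>2 + (norm (dirichlet H y'))\<^sup>2) / (real H)\<^sup>2"
    by (intro divide_right_mono) auto
  moreover have "1 / d\<^sup>2 / (real H)\<^sup>2 = 1 / (1 + real H * dist_int y)\<^sup>2"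
  proof -
    have "1 + real H * dist_int y = real H * d" using Hp by (simp add: d_def field_simps)
    then show ?thesis by (simp add: power_mult_distrib mult.commute)
  qed
  ultimately show ?thesis by (simp add: y'_def)
qed

text \<open>The integrand is at most \<open>1 / (2 * dist_int u) ^ 4\<close>, whose integral grows
  like the inverse cube of the distance; relative to a normaliser of order \<open>H ^ 3\<close> only
  \<open>H * p\<close> and \<open>H * q\<close> matter. If one of these is at most 1, the integral
  over a full period is good enough. The decay is lowered from cubes to squares to match
  \<open>tail_majorant\<close>.\<close>

lemma tail_integral:
  assumes H: "H \<ge> 1" and pq: "0 \<le> p" "0 \<le> q" "p + q \<le> 1"
  shows "integral {p..1-q} (\<lambda>u. norm (dirichlet H u) ^ 4)
     \<le> 4 * (1 / (1 + real H * p)\<^sup>2 + 1 / (1 + real H * q)\<^sup>2) * real (card {w\<in>sq2 H \<times> sq2 H. diff4 w = 0})"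
proof -
  define A where "A = real (card {w\<in>sq2 H \<times> sq2 H. diff4 w = 0})"
  have Hp: "real H > 0" using H by simp
  have A: "real H ^ 3 / 2 \<le> A" unfolding A_def by (rule card_diff4_zero_ge[OF H])
  then have A0: "A > 0" using Hp by (smt (verit) divide_pos_pos zero_less_power)
  have int: "(\<lambda>u. norm (dirichlet H u) ^ 4) integrable_on {a..b}" for a b
    by (intro integrable_continuous_interval continuous_intros)
  define P R where "P = real H * p" and "R = real H * q"
  have PR: "P \<ge> 0" "R \<ge> 0" using pq by (auto simp: P_def R_def)
  show ?thesis
  proof (cases "P \<le> 1 \<or> R \<le> 1")
    case True
    have "integral {p..1-q} (\<lambda>u. norm (dirichlet H u) ^ 4) \<le> integral {0..0+1} (\<lambda>u. norm (dirichlet H u) ^ 4)"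
      using pq by (intro integral_subset_le int) auto
    also have "\<dots> = A" unfolding integral_dirichlet_4_period A_def ..
    also have "\<dots> \<le> 4 * (1 / (1 + P)\<^sup>2 + 1 / (1 + R)\<^sup>2) * A"
    proof -
      have *: "1 \<le> 4 * (1 / (1 + z)\<^sup>2)" if "0 \<le> z" "z \<le> 1" for z :: real
      proof -
        have "(1 + z)\<^sup>2 \<le> 2\<^sup>2" using that by (intro power_mono) auto
        then show ?thesis using that by (simp add: field_simps add_pos_nonneg)
      qed
      have "0 \<le> 1 / (1 + P)\<^sup>2" "0 \<le> 1 / (1 + R)\<^sup>2" by auto
      moreover have "1 \<le> 4 * (1 / (1 + P)\<^sup>2) \<or> 1 \<le> 4 * (1 / (1 + R)\<^sup>2)" using True * PR by blast
      moreover have "0 \<le> x \<Longrightarrow> 0 \<le> y \<Longrightarrow> 1 \<le> 4 * x \<or> 1 \<le> 4 * y \<Longrightarrow> 1 \<le> 4 * (x + y)" for x y :: real by auto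
      ultimately have "1 \<le> 4 * (1 / (1 + P)\<^sup>2 + 1 / (1 + R)\<^sup>2)" by blast
      then show ?thesis using A0 by simp
    qed
    finally show ?thesis by (simp add: A_def P_def R_def)
  next
    case False
    then have PR1: "P > 1" "R > 1" by auto
    then have pq': "p > 0" "q > 0" using Hp pq by (auto simp: P_def R_def zero_less_mult_iff intro: ccontr)
    define F where "F u = (1/16) * ((- 1 / 3) * inverse u ^ 3 + (1 / 3) * inverse (1 - u) ^ 3)" for u :: real
    have bound: "norm (dirichlet H u) ^ 4 \<le> (1/16) * (inverse u ^ 4 + inverse (1 - u) ^ 4)" if u: "u \<in> {p..1-q}" for u
    proof -
      have u01: "0 < u" "u < 1" using u pq' by auto
      define m where "m = min u (1 - u)"
      have m: "m > 0" using u01 by (simp add: m_def)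
      have "dist_int u = m" using u01 by (simp add: dist_int_eq_min m_def)
      then have "norm (dirichlet H u) \<le> 1 / (2 * m)" using norm_dirichlet_dist[of H u] m by (simp add: field_simps)
      then have "norm (dirichlet H u) ^ 4 \<le> (1 / (2 * m)) ^ 4" by (intro power_mono) auto
      also have "\<dots> = (1/16) * (1 / m ^ 4)" by (simp add: power_divide power_mult_distrib)
      also have "\<dots> \<le> (1/16) * (inverse u ^ 4 + inverse (1 - u) ^ 4)"
        using u01 by (auto simp: m_def min_def inverse_eq_divide power_one_over)
      finally show ?thesis .
    qed
    have hasF: "((\<lambda>u. (1/16) * (inverse u ^ 4 + inverse (1 - u) ^ 4)) has_integral (F (1 - q) - F p)) {p..1-q}"
    proof (rule fundamental_theorem_of_calculus)
      show "p \<le> 1 - q" using pq by simp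
      fix u assume "u \<in> {p..1-q}"
      then have u01: "0 < u" "u < 1" using pq' by auto
      have 1: "((\<lambda>u. (- 1 / 3) * inverse u ^ 3) has_real_derivative inverse u ^ 4) (at u within {p..1-q})"
        using u01 by (auto intro!: derivative_eq_intros simp: power4_eq_xxxx power2_eq_square)
      have 2: "((\<lambda>u. (1 / 3) * inverse (1 - u) ^ 3) has_real_derivative inverse (1 - u) ^ 4) (at u within {p..1-q})"
        using u01 by (auto intro!: derivative_eq_intros simp: power4_eq_xxxx power2_eq_square)
      show "(F has_vector_derivative (1/16) * (inverse u ^ 4 + inverse (1 - u) ^ 4)) (at u within {p..1-q})"
        unfolding has_real_derivative_iff_has_vector_derivative[symmetric] F_def
        by (intro DERIV_cmult DERIV_add 1 2)
    qed
    have "integral {p..1-q} (\<lambda>u. norm (dirichlet H u) ^ 4) \<le> F (1 - q) - F p"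
      by (rule has_integral_le[OF integrable_integral[OF int] hasF bound])
    also have "\<dots> \<le> (1/48) * (1 / p ^ 3 + 1 / q ^ 3)"
    proof -
      have "0 \<le> inverse (1 - q) ^ 3" "0 \<le> inverse (1 - p) ^ 3" using pq by auto
      moreover have "1 / p ^ 3 = inverse p ^ 3" "1 / q ^ 3 = inverse q ^ 3"
        by (simp_all add: inverse_eq_divide power_one_over)
      moreover have "F (1 - q) = (1/16) * ((- 1 / 3) * inverse (1 - q) ^ 3 + (1 / 3) * inverse q ^ 3)"
        by (simp add: F_def)
      moreover have "(1/16) * ((- 1 / 3) * r + (1 / 3) * t) - (1/16) * ((- 1 / 3) * z + (1 / 3) * s) \<le> (1/48) * (z + t)"
        if "0 \<le> r" "0 \<le> s" for r s t z :: real
      proof -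
        have eq: "(1/16) * ((- 1 / 3) * r + (1 / 3) * t) - (1/16) * ((- 1 / 3) * z + (1 / 3) * s) = (1/48) * (z + t) - (1/48) * (r + s)"
          by (simp add: algebra_simps)
        show ?thesis unfolding eq using that by (simp only: diff_le_eq le_add_same_cancel1) simp
      qed
      ultimately show ?thesis unfolding F_def[of p] by (simp only:)
    qed
    also have "\<dots> = (1/24) * (1 / P ^ 3 + 1 / R ^ 3) * (real H ^ 3 / 2)"
    proof -
      have "1 / p ^ 3 = real H ^ 3 * (1 / P ^ 3)" "1 / q ^ 3 = real H ^ 3 * (1 / R ^ 3)"
        using Hp pq' by (simp_all add: P_def R_def power_mult_distrib)
      moreover have "(1/48) * (X * y + X * z) = (1/24) * (y + z) * (X / 2)" for X y z :: real
        by (simp add: algebra_simps)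
      ultimately show ?thesis by (simp only:)
    qed
    also have "\<dots> \<le> (1/24) * (1 / P ^ 3 + 1 / R ^ 3) * A"
      using A PR1 by (intro mult_left_mono) auto
    also have "\<dots> \<le> 4 * (1 / (1 + P)\<^sup>2 + 1 / (1 + R)\<^sup>2) * A"
    proof (rule mult_right_mono)
      have *: "1 / z ^ 3 \<le> 4 * (1 / (1 + z)\<^sup>2)" if "1 < z" for z :: real
      proof -
        have "(1 + z)\<^sup>2 \<le> (2 * z)\<^sup>2" using that by (intro power_mono) auto
        also have "\<dots> = 4 * z\<^sup>2" by (simp add: power2_eq_square)
        also have "\<dots> \<le> 4 * z ^ 3" using that by (simp add: power_increasing)
        finally have "(1 + z)\<^sup>2 \<le> 4 * z ^ 3" .
        then show ?thesis using that by (simp add: field_simps)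
      qed
      have "0 \<le> 1 / P ^ 3" "0 \<le> 1 / R ^ 3" using PR by auto
      then show "(1/24) * (1 / P ^ 3 + 1 / R ^ 3) \<le> 4 * (1 / (1 + P)\<^sup>2 + 1 / (1 + R)\<^sup>2)"
        using *[OF PR1(1)] *[OF PR1(2)] by argo
    qed (use A0 in simp)
    finally show ?thesis by (simp add: A_def P_def R_def)
  qed
qed

text \<open>The indicator of \<open>\<parallel>x\<parallel> < \<delta>\<close> convolved with the normalised fourth power of the Dirichlet kernel;
  the error decays like the square of the inverse distance to the endpoints, so it is summable.\<close>

definition smoothed :: "nat \<Rightarrow> real \<Rightarrow> real \<Rightarrow> real" where
  "smoothed H \<delta> x = integral {x-\<delta>..x+\<delta>} (\<lambda>u. norm (dirichlet H u) ^ 4)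
     / real (card {w\<in>sq2 H \<times> sq2 H. diff4 w = 0})"

text \<open>The Fourier coefficients of the indicator function of the arcs of radius
  \<open>\<delta>\<close> around the integers.\<close>

definition arc_coeff :: "real \<Rightarrow> int \<Rightarrow> complex" where
  "arc_coeff \<delta> k = (if k = 0 then of_real (2 * \<delta>)
     else (echar (of_int k * \<delta>) - echar (- (of_int k * \<delta>))) / (2 * pi * of_int k * \<i>))"

lemma norm_arc_coeff:
  assumes "k \<noteq> 0" "0 < \<delta>"
  shows "norm (arc_coeff \<delta> k) \<le> 2 * min \<delta> (1 / \<bar>of_int k\<bar>)"
proof -
  define y where "y = of_int k * \<delta>"
  have k: "\<bar>real_of_int k\<bar> > 0" using assms by simp
  have "echar y - echar (- y) = echar (- y) * (echar (2 * y) - 1)"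
    by (simp add: right_diff_distrib echar_add[symmetric])
  then have n: "norm (echar y - echar (- y)) = 2 * \<bar>sin (2 * pi * y)\<bar>"
    by (simp add: norm_mult norm_echar_minus_1 mult_ac)
  have "norm (arc_coeff \<delta> k) = norm (echar y - echar (- y)) / (2 * pi * \<bar>of_int k\<bar>)"
    using assms by (simp add: arc_coeff_def y_def norm_divide norm_mult)
  also have "\<dots> = \<bar>sin (2 * pi * y)\<bar> / (pi * \<bar>of_int k\<bar>)" unfolding n by simp
  finally have e: "norm (arc_coeff \<delta> k) = \<bar>sin (2 * pi * y)\<bar> / (pi * \<bar>of_int k\<bar>)" .
  have "\<bar>sin (2 * pi * y)\<bar> \<le> \<bar>2 * pi * y\<bar>" by (rule abs_sin_x_le_abs_x)
  also have "\<dots> = 2 * \<delta> * (pi * \<bar>of_int k\<bar>)" using assms(2) by (simp add: y_def abs_mult mult_ac)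
  finally have "norm (arc_coeff \<delta> k) \<le> 2 * \<delta>" unfolding e using k by (simp add: field_simps)
  moreover have "norm (arc_coeff \<delta> k) \<le> 2 * (1 / \<bar>of_int k\<bar>)"
  proof -
    have "\<bar>sin (2 * pi * y)\<bar> / (pi * \<bar>of_int k\<bar>) \<le> 1 / (1 * \<bar>of_int k\<bar>)"
      using k pi_gt3 by (intro frac_le mult_right_mono) auto
    also have "\<dots> \<le> 2 * (1 / \<bar>of_int k\<bar>)" using divide_right_mono[of 1 2 "\<bar>real_of_int k\<bar>"] by simp
    finally show ?thesis unfolding e .
  qed
  ultimately show ?thesis by (simp add: min_def)
qed

lemma smoothed_expansion:
  assumes "H \<ge> 1" "0 < \<delta>"
  shows "complex_of_real (smoothed H \<delta> x) = (\<Sum>w\<in>sq2 H \<times> sq2 H. arc_coeff \<delta> (diff4 w) * echar (of_int (diff4 w) * x))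
      / of_nat (card {w\<in>sq2 H \<times> sq2 H. diff4 w = 0})"
proof -
  have le: "x - \<delta> \<le> x + \<delta>" using assms by simp
  have "complex_of_real (integral {x-\<delta>..x+\<delta>} (\<lambda>u. norm (dirichlet H u) ^ 4))
     = (\<Sum>w\<in>sq2 H \<times> sq2 H. arc_coeff \<delta> (diff4 w) * echar (of_int (diff4 w) * x))"
    unfolding integral_dirichlet_4[OF le]
    by (intro sum.cong refl)
       (auto simp: arc_coeff_def distrib_left right_diff_distrib echar_add echar_diff echar_minus algebra_simps diff_divide_distrib)
  then show ?thesis by (simp add: smoothed_def)
qed

text \<open>Outside the arc \<open>smoothed\<close> is the mass of the kernel on an interval
  avoiding the integers; inside the arc its defect from 1 is the mass on the complementary interval.
  Both are tails in the sense of \<open>tail_integral\<close>, with the distances to the two ends of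
  the arc as \<open>p\<close> and \<open>q\<close>.\<close>

lemma smoothed_error:
  assumes H: "H \<ge> 1" and \<delta>: "0 < \<delta>" "\<delta> \<le> 1/2"
  shows "\<bar>(if dist_int x < \<delta> then 1 else 0) - smoothed H \<delta> x\<bar>
     \<le> 4 * (1 / (1 + real H * dist_int (x - \<delta>))\<^sup>2 + 1 / (1 + real H * dist_int (x + \<delta>))\<^sup>2)"
proof -
  define A where "A = real (card {w\<in>sq2 H \<times> sq2 H. diff4 w = 0})"
  have "real H ^ 3 / 2 \<le> A" unfolding A_def by (rule card_diff4_zero_ge[OF H])
  then have A0: "A > 0" using H by (smt (verit) divide_pos_pos of_nat_0_less_iff zero_less_power less_le_trans zero_less_one)
  define K where "K = (\<lambda>u. norm (dirichlet H u) ^ 4)"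
  have int: "K integrable_on {a..b}" for a b
    unfolding K_def by (intro integrable_continuous_interval continuous_intros)
  have nn: "0 \<le> integral {a..b} K" for a b by (intro integral_nonneg int) (auto simp: K_def)
  \<comment> \<open>Periodicity moves \<open>x\<close> into the half-open period from
    \<open>- \<delta>\<close> to \<open>1 - \<delta>\<close>, in which the arc around 0 comes first
    and its complement after it.\<close>
  define k where "k = \<lfloor>x + \<delta>\<rfloor>"
  define y where "y = x - of_int k"
  have y: "- \<delta> \<le> y" "y < 1 - \<delta>" unfolding y_def k_def by linarith+
  have xy: "x = y + of_int k" by (simp add: y_def)
  have sm: "smoothed H \<delta> x = smoothed H \<delta> y"
  proof -
    have "echar (of_int j * (y + of_int k)) = echar (of_int j * y)" for j
    proof -
      have "echar (of_int j * (y + of_int k)) = echar (of_int j * y + of_int (j * k))" by (simp add: distrib_left)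
      then show ?thesis by (simp only: echar_add_int)
    qed
    then have "complex_of_real (smoothed H \<delta> x) = complex_of_real (smoothed H \<delta> y)"
      unfolding smoothed_expansion[OF H \<delta>(1)] by (simp add: xy)
    then show ?thesis by (simp only: of_real_eq_iff)
  qed
  have d: "dist_int x = dist_int y" "dist_int (x - \<delta>) = dist_int (y - \<delta>)" "dist_int (x + \<delta>) = dist_int (y + \<delta>)"
    using dist_int_add_int[of y k] dist_int_add_int[of "y - \<delta>" k] dist_int_add_int[of "y + \<delta>" k]
    by (simp_all add: xy algebra_simps)
  define T where "T p = 1 / (1 + real H * p)\<^sup>2" for p
  have Tmono: "T p \<le> T q" if "0 \<le> q" "q \<le> p" for p q
    unfolding T_def using that H by (intro divide_left_mono power_mono mult_pos_pos zero_less_power add_left_mono mult_left_mono) (auto simp: add_pos_nonneg)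
  have tail: "integral {p..1-q} K / A \<le> 4 * (T p + T q)" if "0 \<le> p" "0 \<le> q" "p + q \<le> 1" for p q
    using tail_integral[OF H that] A0 unfolding K_def T_def A_def by (simp add: pos_divide_le_eq)
  have smy: "smoothed H \<delta> y = integral {y-\<delta>..y+\<delta>} K / A" by (simp add: smoothed_def K_def A_def)
  show ?thesis
  proof (cases "- \<delta> < y \<and> y < \<delta>")
    case True
    have "dist_int y < \<delta>" using dist_int_le[of y 0] True by (auto simp: abs_if split: if_splits)
    moreover have "integral {y-\<delta>..(y-\<delta>)+1} K = integral {y-\<delta>..y+\<delta>} K + integral {y+\<delta>..(y-\<delta>)+1} K"
      using \<delta> by (intro Henstock_Kurzweil_Integration.integral_combine[symmetric] int) auto
    then have "A = integral {y-\<delta>..y+\<delta>} K + integral {y+\<delta>..1-(\<delta>-y)} K"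
      unfolding A_def integral_dirichlet_4_period[of "y - \<delta>", symmetric] K_def by (simp add: algebra_simps)
    then have "1 - smoothed H \<delta> y = integral {y+\<delta>..1-(\<delta>-y)} K / A"
      unfolding smy using A0 by (simp add: field_simps)
    moreover have "integral {y+\<delta>..1-(\<delta>-y)} K / A \<le> 4 * (T (y+\<delta>) + T (\<delta>-y))"
      using True \<delta> by (intro tail) auto
    moreover have "T (y + \<delta>) \<le> T (dist_int (y + \<delta>))"
      using dist_int_le[of "y + \<delta>" 0] True by (intro Tmono dist_int_nonneg) auto
    moreover have "T (\<delta> - y) \<le> T (dist_int (y - \<delta>))"
      using dist_int_le[of "y - \<delta>" 0] True by (intro Tmono dist_int_nonneg) auto
    moreover have "0 \<le> integral {y+\<delta>..1-(\<delta>-y)} K / A" using nn A0 by simp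
    ultimately show ?thesis unfolding d sm T_def[symmetric] by simp
  next
    case False
    show ?thesis
    proof (cases "y = - \<delta>")
      case True
      \<comment> \<open>At \<open>y = - \<delta>\<close> the strict inequality excludes the point,
        while \<open>smoothed\<close> is only known to lie between 0 and 1. The summand with
        \<open>dist_int (y + \<delta>) = 0\<close> contributes 4 and covers this.\<close>
      have "dist_int y = \<delta>" using dist_int_minus[of y] dist_int_eq_min[of \<delta>] \<delta> True by simp
      moreover have "0 \<le> smoothed H \<delta> y" unfolding smy using nn A0 by simp
      moreover have "smoothed H \<delta> y \<le> 1"
      proof -
        have "integral {y-\<delta>..y+\<delta>} K \<le> integral {y-\<delta>..(y-\<delta>)+1} K"
          using \<delta> by (intro integral_subset_le int) (auto simp: K_def)
        also have "\<dots> = A" unfolding A_def integral_dirichlet_4_period[of "y - \<delta>", symmetric] K_def ..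
        finally show ?thesis unfolding smy using A0 by simp
      qed
      moreover have "T (dist_int (y + \<delta>)) = 1" using True dist_int_le[of 0 0] dist_int_nonneg[of 0] by (simp add: T_def)
      moreover have "0 \<le> T (dist_int (y - \<delta>))" by (simp add: T_def)
      ultimately show ?thesis unfolding d sm T_def[symmetric] by simp
    next
      case False': False
      have y\<delta>: "\<delta> \<le> y" using False False' y by auto
      have "dist_int y = min y (1 - y)" using y\<delta> y \<delta> by (intro dist_int_eq_min) auto
      then have "\<not> dist_int y < \<delta>" using y\<delta> y by simp
      moreover have "integral {y-\<delta>..1-(1-y-\<delta>)} K / A \<le> 4 * (T (y-\<delta>) + T (1-y-\<delta>))"
        using y\<delta> y \<delta> by (intro tail) auto
      then have "smoothed H \<delta> y \<le> 4 * (T (y-\<delta>) + T (1-y-\<delta>))" unfolding smy by (simp add: algebra_simps)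
      moreover have "0 \<le> smoothed H \<delta> y" unfolding smy using nn A0 by simp
      moreover have "T (y - \<delta>) \<le> T (dist_int (y - \<delta>))"
        using dist_int_le[of "y - \<delta>" 0] y\<delta> by (intro Tmono dist_int_nonneg) auto
      moreover have "T (1 - y - \<delta>) \<le> T (dist_int (y + \<delta>))"
        using dist_int_le[of "y + \<delta>" 1] y by (intro Tmono dist_int_nonneg) auto
      ultimately show ?thesis unfolding d sm T_def[symmetric] by simp
    qed
  qed
qed

text \<open>When \<open>smoothed_expansion\<close> is averaged over the weighted points, frequency
  zero gives the main term \<open>2 * \<delta> * W\<close>. A nonzero frequency has, together with
  its negative, multiplicity at most \<open>2 * H ^ 3\<close> against a normaliser of at least
  \<open>H ^ 3 / 2\<close>. The smoothing error is majorised by Fejer kernels, and their averages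
  again consist of the sums \<open>T k\<close>, now with weight \<open>1 / H\<close>.\<close>

lemma erdos_turan:
  fixes w x :: "'a \<Rightarrow> real" and \<Omega> :: "'a set"
  assumes H: "H \<ge> 1" and \<delta>: "0 < \<delta>" "\<delta> \<le> 1/2" and \<Omega>: "finite \<Omega>" "\<And>n. n \<in> \<Omega> \<Longrightarrow> 0 \<le> w n"
  defines "T \<equiv> \<lambda>k::int. \<Sum>n\<in>\<Omega>. of_real (w n) * echar (of_int k * x n)"
  defines "W \<equiv> \<Sum>n\<in>\<Omega>. w n"
  shows "\<bar>(\<Sum>n\<in>\<Omega>. w n * (if dist_int (x n) < \<delta> then 1 else 0)) - 2 * \<delta> * W\<bar>
     \<le> 320 * ((\<Sum>k=1..2*H. (min \<delta> (1 / real k) + 1 / real H) * norm (T (int k))) + W / real H)"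
proof -
  have Hp: "real H > 0" using H by simp
  define A where "A = real (card {v\<in>sq2 H \<times> sq2 H. diff4 v = 0})"
  have A: "real H ^ 3 / 2 \<le> A" unfolding A_def by (rule card_diff4_zero_ge[OF H])
  then have A0: "A > 0" using Hp by (smt (verit) divide_pos_pos zero_less_power)
  have W0: "W \<ge> 0" unfolding W_def using \<Omega> by (intro sum_nonneg) auto
  have T0: "T 0 = of_real W" by (simp add: T_def W_def)
  have Tm: "T (- k) = cnj (T k)" for k
    by (simp add: T_def cnj_sum echar_minus[symmetric])
  have Tabs: "norm (T (int (nat \<bar>k\<bar>))) = norm (T k)" for k
    using Tm[of k] by (cases "k \<ge> 0") (auto simp: norm_minus_commute)
  have Tabs': "norm (T \<bar>k\<bar>) = norm (T k)" for k using Tabs[of k] by simp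
  have main: "\<bar>(\<Sum>n\<in>\<Omega>. w n * smoothed H \<delta> (x n)) - 2 * \<delta> * W\<bar> \<le> 8 * (\<Sum>k=1..2*H. min \<delta> (1 / real k) * norm (T (int k)))"
  proof -
    let ?S = "sq2 H \<times> sq2 H"
    let ?Z = "{v\<in>?S. diff4 v = 0}" and ?N = "{v\<in>?S. diff4 v \<noteq> 0}"
    have "complex_of_real (\<Sum>n\<in>\<Omega>. w n * smoothed H \<delta> (x n))
        = (\<Sum>n\<in>\<Omega>. of_real (w n) * ((\<Sum>v\<in>?S. arc_coeff \<delta> (diff4 v) * echar (of_int (diff4 v) * x n)) / of_real A))"
      unfolding of_real_sum of_real_mult smoothed_expansion[OF H \<delta>(1)] A_def of_real_of_nat_eq ..
    also have "\<dots> = (\<Sum>n\<in>\<Omega>. \<Sum>v\<in>?S. arc_coeff \<delta> (diff4 v) * (of_real (w n) * echar (of_int (diff4 v) * x n))) / of_real A"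
      by (simp add: sum_distrib_left sum_divide_distrib mult_ac)
    also have "\<dots> = (\<Sum>v\<in>?S. arc_coeff \<delta> (diff4 v) * T (diff4 v)) / of_real A"
      unfolding T_def by (subst sum.swap) (simp add: sum_distrib_left)
    also have "(\<Sum>v\<in>?S. arc_coeff \<delta> (diff4 v) * T (diff4 v))
        = (\<Sum>v\<in>?Z. arc_coeff \<delta> (diff4 v) * T (diff4 v)) + (\<Sum>v\<in>?N. arc_coeff \<delta> (diff4 v) * T (diff4 v))"
      by (subst sum.union_disjoint[symmetric]) (auto intro!: sum.cong)
    also have "(\<Sum>v\<in>?Z. arc_coeff \<delta> (diff4 v) * T (diff4 v)) = (\<Sum>v\<in>?Z. of_real (2 * \<delta> * W))"
      by (intro sum.cong refl) (simp add: arc_coeff_def T0)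
    also have "\<dots> = of_real A * of_real (2 * \<delta> * W)" by (simp add: A_def)
    finally have e: "complex_of_real ((\<Sum>n\<in>\<Omega>. w n * smoothed H \<delta> (x n)) - 2 * \<delta> * W)
        = (\<Sum>v\<in>?N. arc_coeff \<delta> (diff4 v) * T (diff4 v)) / of_real A"
      using A0 by (simp add: add_divide_distrib)
    have "\<bar>(\<Sum>n\<in>\<Omega>. w n * smoothed H \<delta> (x n)) - 2 * \<delta> * W\<bar> = norm (\<Sum>v\<in>?N. arc_coeff \<delta> (diff4 v) * T (diff4 v)) / A"
      using arg_cong[OF e, of norm] A0 by (simp only: norm_of_real norm_divide abs_of_pos)
    also have "\<dots> \<le> (\<Sum>v\<in>?N. 2 * min \<delta> (1 / real (nat \<bar>diff4 v\<bar>)) * norm (T (int (nat \<bar>diff4 v\<bar>)))) / A"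
    proof (rule divide_right_mono)
      show "norm (\<Sum>v\<in>?N. arc_coeff \<delta> (diff4 v) * T (diff4 v))
          \<le> (\<Sum>v\<in>?N. 2 * min \<delta> (1 / real (nat \<bar>diff4 v\<bar>)) * norm (T (int (nat \<bar>diff4 v\<bar>))))"
        by (intro order_trans[OF norm_sum] sum_mono)
           (use norm_arc_coeff[OF _ \<delta>(1)] in \<open>auto simp: norm_mult Tabs Tabs' intro!: mult_right_mono\<close>)
    qed (use A0 in simp)
    also have "\<dots> \<le> 2 * real H ^ 3 * (\<Sum>k=1..2*H. 2 * min \<delta> (1 / real k) * norm (T (int k))) / A"
    proof (intro divide_right_mono sum_group_bound)
      fix v assume "v \<in> ?N"
      then show "nat \<bar>diff4 v\<bar> \<in> {1..2*H}" by (auto simp: diff4_def diff2_def sq2_def)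
    next
      fix k
      have "card {v\<in>?N. nat \<bar>diff4 v\<bar> = k} \<le> card ({v\<in>?S. diff4 v = int k} \<union> {v\<in>?S. diff4 v = - int k})"
        by (intro card_mono) auto
      also have "\<dots> \<le> card {v\<in>?S. diff4 v = int k} + card {v\<in>?S. diff4 v = - int k}" by (rule card_Un_le)
      also have "\<dots> \<le> 2 * H ^ 3" using card_diff4_le[of H "int k"] card_diff4_le[of H "- int k"] by simp
      finally have "real (card {v\<in>?N. nat \<bar>diff4 v\<bar> = k}) \<le> real (2 * H ^ 3)" by (rule of_nat_mono)
      then show "real (card {v\<in>?N. nat \<bar>diff4 v\<bar> = k}) \<le> 2 * real H ^ 3"
        by (simp only: of_nat_mult of_nat_power of_nat_numeral)
    qed (use A0 \<delta> in auto)
    also have "\<dots> = (real H ^ 3 / A) * (4 * (\<Sum>k=1..2*H. min \<delta> (1 / real k) * norm (T (int k))))"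
    proof -
      have "(\<Sum>k=1..2*H. 2 * min \<delta> (1 / real k) * norm (T (int k))) = 2 * (\<Sum>k=1..2*H. min \<delta> (1 / real k) * norm (T (int k)))"
        by (simp only: sum_distrib_left mult.assoc)
      moreover have "2 * h * (2 * X) / A = (h / A) * (4 * X)" for h X :: real by simp
      ultimately show ?thesis by (simp only:)
    qed
    also have "\<dots> \<le> 2 * (4 * (\<Sum>k=1..2*H. min \<delta> (1 / real k) * norm (T (int k))))"
      using A A0 \<delta> by (intro mult_right_mono mult_nonneg_nonneg sum_nonneg) (auto simp: field_simps)
    finally show ?thesis by simp
  qed
  \<comment> \<open>\<open>(real H)\<^sup>2 * E\<close> bounds a Fejer average: at most
    \<open>H\<close> pairs have frequency zero and contribute \<open>W\<close> each, and every other
    frequency has multiplicity at most \<open>2 * H\<close>, counting both signs.\<close>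
  define E where "E = W / real H + 2 / real H * (\<Sum>k=1..2*H. norm (T (int k)))"
  have fejer: "(\<Sum>n\<in>\<Omega>. w n * (norm (dirichlet H (x n - \<beta>)))\<^sup>2) \<le> (real H)\<^sup>2 * E" for \<beta>
  proof -
    let ?Z = "{p\<in>sq2 H. diff2 p = 0}" and ?N = "{p\<in>sq2 H. diff2 p \<noteq> 0}"
    have "complex_of_real (\<Sum>n\<in>\<Omega>. w n * (norm (dirichlet H (x n - \<beta>)))\<^sup>2)
        = (\<Sum>n\<in>\<Omega>. \<Sum>p\<in>sq2 H. echar (- (of_int (diff2 p) * \<beta>)) * (of_real (w n) * echar (of_int (diff2 p) * x n)))"
      unfolding of_real_sum of_real_mult dirichlet_norm_2
      by (simp add: sum_distrib_left right_diff_distrib echar_diff echar_minus mult_ac)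
    also have "\<dots> = (\<Sum>p\<in>sq2 H. echar (- (of_int (diff2 p) * \<beta>)) * T (diff2 p))"
      unfolding T_def by (subst sum.swap) (simp add: sum_distrib_left)
    finally have "norm (complex_of_real (\<Sum>n\<in>\<Omega>. w n * (norm (dirichlet H (x n - \<beta>)))\<^sup>2)) = norm (\<Sum>p\<in>sq2 H. echar (- (of_int (diff2 p) * \<beta>)) * T (diff2 p))"
      by (rule arg_cong)
    then have "\<bar>\<Sum>n\<in>\<Omega>. w n * (norm (dirichlet H (x n - \<beta>)))\<^sup>2\<bar> = norm (\<Sum>p\<in>sq2 H. echar (- (of_int (diff2 p) * \<beta>)) * T (diff2 p))"
      unfolding norm_of_real .
    also have "\<dots> \<le> (\<Sum>p\<in>sq2 H. norm (T (diff2 p)))"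
      by (intro order_trans[OF norm_sum] sum_mono) (simp add: norm_mult)
    also have "\<dots> = (\<Sum>p\<in>?Z. norm (T (diff2 p))) + (\<Sum>p\<in>?N. norm (T (int (nat \<bar>diff2 p\<bar>))))"
      unfolding Tabs by (subst sum.union_disjoint[symmetric]) (auto intro!: sum.cong)
    also have "(\<Sum>p\<in>?Z. norm (T (diff2 p))) = real (card ?Z) * W" using W0 by (simp add: T0)
    also have "\<dots> \<le> real H * W" using W0 card_diff2_le[of H 0] by (intro mult_right_mono) auto
    also have "(\<Sum>p\<in>?N. norm (T (int (nat \<bar>diff2 p\<bar>)))) \<le> 2 * real H * (\<Sum>k=1..2*H. norm (T (int k)))"
    proof (rule sum_group_bound)
      fix v assume "v \<in> ?N"
      then show "nat \<bar>diff2 v\<bar> \<in> {1..2*H}" by (auto simp: diff2_def sq2_def)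
    next
      fix k
      have "card {v\<in>?N. nat \<bar>diff2 v\<bar> = k} \<le> card ({v\<in>sq2 H. diff2 v = int k} \<union> {v\<in>sq2 H. diff2 v = - int k})"
        by (intro card_mono) auto
      also have "\<dots> \<le> card {v\<in>sq2 H. diff2 v = int k} + card {v\<in>sq2 H. diff2 v = - int k}" by (rule card_Un_le)
      also have "\<dots> \<le> 2 * H" using card_diff2_le[of H "int k"] card_diff2_le[of H "- int k"] by simp
      finally have "real (card {v\<in>?N. nat \<bar>diff2 v\<bar> = k}) \<le> real (2 * H)" by (rule of_nat_mono)
      then show "real (card {v\<in>?N. nat \<bar>diff2 v\<bar> = k}) \<le> 2 * real H"
        by (simp only: of_nat_mult of_nat_numeral)
    qed auto
    finally have "\<bar>\<Sum>n\<in>\<Omega>. w n * (norm (dirichlet H (x n - \<beta>)))\<^sup>2\<bar> \<le> real H * W + 2 * real H * (\<Sum>k=1..2*H. norm (T (int k)))"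
      by simp
    also have "\<dots> = (real H)\<^sup>2 * E" using Hp by (simp add: E_def power2_eq_square algebra_simps)
    finally show ?thesis by simp
  qed
  have tail: "(\<Sum>n\<in>\<Omega>. w n * (1 / (1 + real H * dist_int (x n + \<beta>))\<^sup>2)) \<le> 20 * E" for \<beta>
  proof -
    have "(\<Sum>n\<in>\<Omega>. w n * (1 / (1 + real H * dist_int (x n + \<beta>))\<^sup>2))
        \<le> (\<Sum>n\<in>\<Omega>. w n * (pi\<^sup>2 * ((norm (dirichlet H (x n + \<beta>)))\<^sup>2 + (norm (dirichlet H (x n + \<beta> + 1 / (2 * real H))))\<^sup>2) / (real H)\<^sup>2))"
      using \<Omega> by (intro sum_mono mult_left_mono tail_majorant H)
    also have "\<dots> = pi\<^sup>2 / (real H)\<^sup>2 * ((\<Sum>n\<in>\<Omega>. w n * (norm (dirichlet H (x n - (- \<beta>))))\<^sup>2)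
        + (\<Sum>n\<in>\<Omega>. w n * (norm (dirichlet H (x n - (- \<beta> - 1 / (2 * real H)))))\<^sup>2))"
      by (simp add: sum_distrib_left sum.distrib[symmetric] sum_divide_distrib algebra_simps add_divide_distrib)
    also have "\<dots> \<le> pi\<^sup>2 / (real H)\<^sup>2 * ((real H)\<^sup>2 * E + (real H)\<^sup>2 * E)"
      by (intro mult_left_mono add_mono fejer) auto
    also have "\<dots> = pi\<^sup>2 * (2 * E)" using Hp by simp
    also have "\<dots> \<le> 10 * (2 * E)"
    proof (rule mult_right_mono)
      have "pi \<le> 3.15" using pi_approx by simp
      then have "pi\<^sup>2 \<le> 3.15\<^sup>2" by (intro power_mono) auto
      then show "pi\<^sup>2 \<le> 10" by (simp add: power2_eq_square)
      show "0 \<le> 2 * E" using W0 by (simp add: E_def sum_nonneg)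
    qed
    finally show ?thesis by simp
  qed
  have "\<bar>(\<Sum>n\<in>\<Omega>. w n * (if dist_int (x n) < \<delta> then 1 else 0)) - (\<Sum>n\<in>\<Omega>. w n * smoothed H \<delta> (x n))\<bar>
      \<le> (\<Sum>n\<in>\<Omega>. w n * \<bar>(if dist_int (x n) < \<delta> then 1 else 0) - smoothed H \<delta> (x n)\<bar>)"
    unfolding sum_subtractf[symmetric] right_diff_distrib[symmetric] using \<Omega>
    by (intro order_trans[OF sum_abs] sum_mono) (auto simp: abs_mult)
  also have "\<dots> \<le> (\<Sum>n\<in>\<Omega>. w n * (4 * (1 / (1 + real H * dist_int (x n - \<delta>))\<^sup>2 + 1 / (1 + real H * dist_int (x n + \<delta>))\<^sup>2)))"
    using \<Omega> by (intro sum_mono mult_left_mono smoothed_error H \<delta>)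
  also have "\<dots> = 4 * ((\<Sum>n\<in>\<Omega>. w n * (1 / (1 + real H * dist_int (x n + (- \<delta>)))\<^sup>2)) + (\<Sum>n\<in>\<Omega>. w n * (1 / (1 + real H * dist_int (x n + \<delta>))\<^sup>2)))"
    by (simp add: sum_distrib_left sum.distrib[symmetric] algebra_simps)
  also have "\<dots> \<le> 4 * (20 * E + 20 * E)" by (intro mult_left_mono add_mono tail) auto
  finally have err: "\<bar>(\<Sum>n\<in>\<Omega>. w n * (if dist_int (x n) < \<delta> then 1 else 0)) - (\<Sum>n\<in>\<Omega>. w n * smoothed H \<delta> (x n))\<bar> \<le> 160 * E"
    by simp
  define X where "X = (\<Sum>k=1..2*H. min \<delta> (1 / real k) * norm (T (int k)))"
  define Y where "Y = (\<Sum>k=1..2*H. norm (T (int k))) / real H"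
  have X0: "X \<ge> 0" unfolding X_def using \<delta> by (intro sum_nonneg) auto
  have XY: "(\<Sum>k=1..2*H. (min \<delta> (1 / real k) + 1 / real H) * norm (T (int k))) = X + Y"
    by (simp add: X_def Y_def distrib_right sum.distrib sum_divide_distrib)
  have "E = W / real H + 2 * Y" by (simp add: E_def Y_def)
  moreover have "0 \<le> W / real H" using W0 by simp
  \<comment> \<open>The constant 320 is \<open>160 * 2\<close>: the smoothing error is at most
    \<open>160 * E\<close>, and \<open>E\<close> contains \<open>2 * Y\<close>.\<close>
  moreover have "\<bar>p - r\<bar> \<le> 320 * (X + Y + z)"
    if "\<bar>p - q\<bar> \<le> 160 * E" "\<bar>q - r\<bar> \<le> 8 * X" "E = z + 2 * Y" "0 \<le> z" for p q r z
    using that X0 by (smt (verit))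
  ultimately show ?thesis unfolding XY using err main[folded X_def] by blast
qed

section \<open>Summation by the Fejer kernel\<close>

lemma norm_echar_diff_le: "norm (echar x - echar y) \<le> 2 * pi * \<bar>x - y\<bar>"
proof -
  have "echar x - echar y = echar y * (echar (x - y) - 1)"
    by (simp add: right_diff_distrib echar_add[symmetric])
  then have "norm (echar x - echar y) = 2 * \<bar>sin (pi * (x - y))\<bar>"
    by (simp add: norm_mult norm_echar_minus_1)
  also have "\<dots> \<le> 2 * \<bar>pi * (x - y)\<bar>" by (intro mult_left_mono abs_sin_x_le_abs_x) auto
  finally show ?thesis by (simp add: abs_mult)
qed

lemma dist_int_near:
  assumes "\<bar>x - of_int m\<bar> \<le> 1/2"
  shows "dist_int x = \<bar>x - of_int m\<bar>"
proof -
  obtain k :: int where k: "dist_int x = \<bar>x - of_int k\<bar>" using dist_int_attained by blast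
  have le: "dist_int x \<le> \<bar>x - of_int m\<bar>" by (rule dist_int_le)
  show ?thesis
  proof (cases "k = m")
    case False
    then have "1 \<le> \<bar>real_of_int (k - m)\<bar>" by linarith
    then show ?thesis using assms k le by (simp add: abs_if split: if_splits)
  qed (use k in simp)
qed

definition fejer :: "nat \<Rightarrow> real \<Rightarrow> real" where
  "fejer K x = (norm (dirichlet K x))\<^sup>2 / real K"

lemma fejer_nonneg: "0 \<le> fejer K x"
  by (simp add: fejer_def)

lemma continuous_fejer [continuous_intros]: "continuous_on S (fejer K)"
  unfolding fejer_def by (cases "K = 0") (auto intro!: continuous_intros)

lemma fejer_expansion: "of_real (fejer K x) = (\<Sum>p\<in>sq2 K. echar (of_int (diff2 p) * x)) / of_nat K"
  using dirichlet_norm_2[of K x] by (simp add: fejer_def)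

lemma integral_fejer_period:
  assumes "K \<ge> 1"
  shows "integral {c..c+1} (fejer K) = 1"
proof -
  have "((\<lambda>u. (\<Sum>p\<in>sq2 K. echar (of_int (diff2 p) * u)) / of_nat K) has_integral
     (\<Sum>p\<in>sq2 K. if diff2 p = 0 then 1 else 0) / of_nat K) {c..c+1}"
  proof (intro has_integral_divide has_integral_sum)
    fix p
    show "((\<lambda>u. echar (of_int (diff2 p) * u)) has_integral (if diff2 p = 0 then 1 else 0)) {c..c+1}"
    proof (cases "diff2 p = 0")
      case True
      show ?thesis using True has_integral_const_real[of "1::complex" c "c + 1"] by simp
    next
      case False
      then show ?thesis using has_integral_echar[of c "c + 1" "diff2 p"] by (simp add: distrib_left)
    qed
  qed simp
  moreover have "((\<lambda>u. complex_of_real (fejer K u)) has_integral of_real (integral {c..c+1} (fejer K))) {c..c+1}"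
    by (intro has_integral_of_real integrable_integral integrable_continuous_interval continuous_intros)
  ultimately have "complex_of_real (integral {c..c+1} (fejer K)) = (\<Sum>p\<in>sq2 K. if diff2 p = 0 then 1 else 0) / of_nat K"
    unfolding fejer_expansion by (rule has_integral_unique[rotated])
  also have "(\<Sum>p\<in>sq2 K. if diff2 p = 0 then 1 else 0 :: complex) = of_nat (card {p\<in>sq2 K. diff2 p = 0})"
    by (simp add: sum.If_cases Int_def)
  also have "{p\<in>sq2 K. diff2 p = 0} = (\<lambda>h. (h, h)) ` {..<K}"
    by (auto simp: sq2_def diff2_def)
  also have "card \<dots> = K" by (simp add: card_image inj_on_def)
  finally show ?thesis using assms by (simp add: complex_eq_iff)
qed

text \<open>The cut is at distance \<open>1 / sqrt K\<close>: closer in, the distance itself is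
  small; further out, the decay of the Dirichlet kernel gives \<open>1 / (4 * d * K)\<close>. The
  pointwise form allows integration against the unit mass of the kernel.\<close>

lemma fejer_first_moment:
  assumes K: "K \<ge> 1" and x: "\<bar>x - of_int m\<bar> \<le> 1/2"
  shows "\<bar>x - of_int m\<bar> * fejer K x \<le> fejer K x / sqrt K + 1 / (4 * sqrt K)"
proof -
  define d where "d = \<bar>x - of_int m\<bar>"
  have Kp: "real K > 0" using K by simp
  have dd: "dist_int x = d" unfolding d_def by (rule dist_int_near[OF x])
  show ?thesis
  proof (cases "d \<le> 1 / sqrt K")
    case True
    then have "d * fejer K x \<le> 1 / sqrt K * fejer K x" by (intro mult_right_mono fejer_nonneg)
    then show ?thesis by (simp add: d_def add_increasing2)
  next
    case False
    then have d: "1 / sqrt K < d" by simp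
    then have d0: "d > 0" using Kp by (smt (verit) divide_nonneg_nonneg real_sqrt_ge_zero of_nat_0_le_iff)
    have "norm (dirichlet K x) * (2 * d) \<le> 1" using norm_dirichlet_dist[of K x] dd by simp
    then have "(norm (dirichlet K x) * (2 * d))\<^sup>2 \<le> 1" by (simp add: power_le_one d0 less_imp_le)
    then have "d * fejer K x \<le> 1 / (4 * d * K)"
      using d0 Kp by (simp add: fejer_def field_simps power2_eq_square)
    also have "\<dots> \<le> 1 / (4 * (1 / sqrt K) * K)"
      using d d0 Kp by (intro divide_left_mono mult_right_mono mult_left_mono mult_pos_pos) auto
    also have "\<dots> = 1 / (4 * sqrt K)"
    proof -
      have "1 / (4 * (1 / s) * (s * s)) = 1 / (4 * s)" for s :: real by simp
      from this[of "sqrt K"] show ?thesis using Kp by simp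
    qed
    finally show ?thesis using fejer_nonneg[of K x] by (simp add: d_def add_increasing)
  qed
qed

text \<open>Stands in for Poisson summation: the value at an integer is compared with the average
  over the surrounding unit interval against a kernel of mass 1, and the first moment of the kernel
  measures the error. Only a Lipschitz bound enters, and the Fourier side stays a finite
  sum.\<close>

lemma fejer_cell:
  fixes h :: "real \<Rightarrow> complex"
  assumes K: "K \<ge> 1" and \<Lambda>: "0 \<le> \<Lambda>" "\<And>x y. norm (h x - h y) \<le> \<Lambda> * \<bar>x - y\<bar>" and h: "continuous_on UNIV h"
  shows "norm (h (of_int m) - integral {of_int m - 1/2..of_int m + 1/2} (\<lambda>x. h x * of_real (fejer K x))) \<le> 2 * \<Lambda> / sqrt K"
proof -
  let ?I = "{of_int m - 1/2..of_int m + 1/2 :: real}"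
  have Kp: "real K > 0" using K by simp
  have hI: "continuous_on ?I h" using h continuous_on_subset by blast
  have one: "integral ?I (fejer K) = 1"
    using integral_fejer_period[OF K, of "of_int m - 1/2"] by (simp add: algebra_simps)
  have i1: "(\<lambda>x. h (of_int m) * complex_of_real (fejer K x)) integrable_on ?I"
    by (intro integrable_continuous_interval continuous_intros)
  have i2: "(\<lambda>x. h x * complex_of_real (fejer K x)) integrable_on ?I"
    by (intro integrable_continuous_interval continuous_intros hI)
  have "((\<lambda>x. complex_of_real (fejer K x)) has_integral of_real (integral ?I (fejer K))) ?I"
    by (intro has_integral_of_real integrable_integral integrable_continuous_interval continuous_intros)
  then have "h (of_int m) = integral ?I (\<lambda>x. h (of_int m) * complex_of_real (fejer K x))"
    unfolding one using integral_unique[OF has_integral_mult_right, of _ _ ?I "h (of_int m)"] by simp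
  then have "h (of_int m) - integral ?I (\<lambda>x. h x * of_real (fejer K x))
      = integral ?I (\<lambda>x. (h (of_int m) - h x) * of_real (fejer K x))"
    using Henstock_Kurzweil_Integration.integral_diff[OF i1 i2] by (simp add: left_diff_distrib)
  also have "norm \<dots> \<le> integral ?I (\<lambda>x. \<Lambda> * (fejer K x / sqrt K + 1 / (4 * sqrt K)))"
  proof (rule Henstock_Kurzweil_Integration.integral_norm_bound_integral)
    show "(\<lambda>x. (h (of_int m) - h x) * of_real (fejer K x)) integrable_on ?I"
      by (intro integrable_continuous_interval continuous_intros hI)
    show "(\<lambda>x. \<Lambda> * (fejer K x / sqrt K + 1 / (4 * sqrt K))) integrable_on ?I"
      using Kp by (intro integrable_continuous_interval continuous_intros) auto
    fix x assume x: "x \<in> ?I"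
    have "norm ((h (of_int m) - h x) * of_real (fejer K x)) = norm (h x - h (of_int m)) * fejer K x"
      by (simp add: norm_mult fejer_nonneg norm_minus_commute)
    also have "\<dots> \<le> \<Lambda> * \<bar>x - of_int m\<bar> * fejer K x" by (intro mult_right_mono \<Lambda> fejer_nonneg)
    also have "\<dots> \<le> \<Lambda> * (fejer K x / sqrt K + 1 / (4 * sqrt K))"
    proof -
      have "x - of_int m \<le> 1/2" "- (x - of_int m) \<le> 1/2" using x by auto
      then have "\<bar>x - of_int m\<bar> \<le> 1/2" by (rule abs_leI)
      then show ?thesis unfolding mult.assoc by (intro mult_left_mono fejer_first_moment K \<Lambda>)
    qed
    finally show "norm ((h (of_int m) - h x) * of_real (fejer K x)) \<le> \<Lambda> * (fejer K x / sqrt K + 1 / (4 * sqrt K))" .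
  qed
  also have "\<dots> = \<Lambda> * (1 / sqrt K + 1 / (4 * sqrt K))"
  proof (rule integral_unique)
    have c: "((\<lambda>x. 1 / (4 * sqrt K)) has_integral 1 / (4 * sqrt K)) ?I"
      using has_integral_const_real[of "1 / (4 * sqrt K)" "of_int m - 1/2" "of_int m + 1/2"] by simp
    have "((\<lambda>x. \<Lambda> * (fejer K x / sqrt K + 1 / (4 * sqrt K))) has_integral \<Lambda> * (integral ?I (fejer K) / sqrt K + 1 / (4 * sqrt K))) ?I"
      by (intro has_integral_mult_right has_integral_add has_integral_divide c integrable_integral integrable_continuous_interval continuous_intros)
    then show "((\<lambda>x. \<Lambda> * (fejer K x / sqrt K + 1 / (4 * sqrt K))) has_integral \<Lambda> * (1 / sqrt K + 1 / (4 * sqrt K))) ?I"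
      unfolding one by simp
  qed
  also have "\<dots> \<le> \<Lambda> * (2 / sqrt K)" using Kp \<Lambda>(1) by (intro mult_left_mono) (auto simp: field_simps)
  finally show ?thesis by (simp add: mult.commute)
qed

lemma integral_cells:
  fixes h :: "real \<Rightarrow> complex"
  assumes "continuous_on UNIV h"
  shows "integral {c..c + real n} h = (\<Sum>i<n. integral {c + real i..c + real i + 1} h)"
proof (induction n)
  case (Suc n)
  have "h integrable_on {c..c + real (Suc n)}"
    using assms continuous_on_subset by (intro integrable_continuous_interval) blast
  then have "integral {c..c + real n} h + integral {c + real n..c + real (Suc n)} h = integral {c..c + real (Suc n)} h"
    by (intro Henstock_Kurzweil_Integration.integral_combine) auto
  then show ?case using Suc by (simp add: algebra_simps)
qed simp

text \<open>The loss is of order \<open>1 / sqrt K\<close> per integer, so taking a high power of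
  \<open>Q\<close> for \<open>K\<close> makes it harmless; the number of frequencies will enter the
  estimates only through its logarithm.\<close>

lemma fejer_summation:
  fixes h :: "real \<Rightarrow> complex"
  assumes K: "K \<ge> 1" and \<Lambda>: "0 \<le> \<Lambda>" "\<And>x y. norm (h x - h y) \<le> \<Lambda> * \<bar>x - y\<bar>"
  shows "norm ((\<Sum>i<n. h (of_int (m + int i))) - integral {of_int m - 1/2..of_int m - 1/2 + real n} (\<lambda>x. h x * of_real (fejer K x)))
     \<le> real n * (2 * \<Lambda> / sqrt K)"
proof -
  have "lipschitz_on \<Lambda> UNIV h"
    using \<Lambda> by (intro lipschitz_onI) (auto simp: dist_norm)
  then have h: "continuous_on UNIV h" by (rule lipschitz_on_continuous_on)
  have "integral {of_int m - 1/2..of_int m - 1/2 + real n} (\<lambda>x. h x * of_real (fejer K x))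
      = (\<Sum>i<n. integral {of_int m - 1/2 + real i..of_int m - 1/2 + real i + 1} (\<lambda>x. h x * of_real (fejer K x)))"
    by (intro integral_cells continuous_intros h)
  also have "\<dots> = (\<Sum>i<n. integral {of_int (m + int i) - 1/2..of_int (m + int i) + 1/2} (\<lambda>x. h x * of_real (fejer K x)))"
    by (intro sum.cong refl arg_cong2[where f = integral]) auto
  finally have "(\<Sum>i<n. h (of_int (m + int i))) - integral {of_int m - 1/2..of_int m - 1/2 + real n} (\<lambda>x. h x * of_real (fejer K x))
      = (\<Sum>i<n. h (of_int (m + int i)) - integral {of_int (m + int i) - 1/2..of_int (m + int i) + 1/2} (\<lambda>x. h x * of_real (fejer K x)))"
    by (simp add: sum_subtractf)
  also have "norm \<dots> \<le> (\<Sum>i<n. 2 * \<Lambda> / sqrt K)"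
    by (intro order_trans[OF norm_sum] sum_mono fejer_cell[OF K \<Lambda> h])
  finally show ?thesis by simp
qed

lemma fejer_integral_expansion:
  fixes h :: "real \<Rightarrow> complex"
  assumes h: "continuous_on {a..b} h"
  shows "integral {a..b} (\<lambda>x. h x * of_real (fejer K x))
     = (\<Sum>p\<in>sq2 K. integral {a..b} (\<lambda>x. h x * echar (of_int (diff2 p) * x))) / of_nat K"
proof -
  have "((\<lambda>x. (\<Sum>p\<in>sq2 K. h x * echar (of_int (diff2 p) * x)) / of_nat K) has_integral
     (\<Sum>p\<in>sq2 K. integral {a..b} (\<lambda>x. h x * echar (of_int (diff2 p) * x))) / of_nat K) {a..b}"
    by (intro has_integral_divide has_integral_sum integrable_integral integrable_continuous_interval continuous_intros h) auto
  then show ?thesis unfolding fejer_expansion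
    by (intro integral_unique) (simp add: sum_distrib_left)
qed

section \<open>Oscillatory integrals with a convex phase\<close>

text \<open>The geometric mean of the bounds \<open>Q\<close> and \<open>1 / d\<close>. Unlike
  \<open>1 / d\<close> it remains integrable when the phase crosses an integer.\<close>

lemma kern_le_sqrt:
  assumes "0 < Q" "0 < d" "d \<le> dist_int x"
  shows "kern Q x \<le> sqrt (Q / d)"
proof -
  have k: "kern Q x \<le> Q" "kern Q x \<le> 1 / d" "0 \<le> kern Q x"
    using kern_le[OF assms(1)] kern_le_inverse[OF assms] kern_pos[OF assms(1), of x] by auto
  have "(kern Q x)\<^sup>2 \<le> Q * (1 / d)" unfolding power2_eq_square using k assms by (intro mult_mono) auto
  then show ?thesis by (intro real_le_rsqrt) simp
qed

lemma continuous_dist_int [continuous_intros]: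
  assumes "continuous_on S f"
  shows "continuous_on S (\<lambda>x. dist_int (f x))"
proof -
  have "lipschitz_on 1 UNIV dist_int"
  proof (rule lipschitz_onI)
    fix x y :: real
    show "dist (dist_int x) (dist_int y) \<le> 1 * dist x y"
      using dist_int_lipschitz[of x y] dist_int_lipschitz[of y x] by (simp add: dist_real_def abs_if split: if_splits)
  qed simp
  then have "continuous_on UNIV dist_int" by (rule lipschitz_on_continuous_on)
  then show ?thesis using assms by (rule continuous_on_compose2) auto
qed

lemma continuous_kern [continuous_intros]:
  assumes "continuous_on S f" "0 < Q"
  shows "continuous_on S (\<lambda>x. kern Q (f x))"
proof -
  have "1 + Q * dist_int y \<noteq> 0" for y
    using dist_int_nonneg[of y] assms(2) by (smt (verit) mult_nonneg_nonneg)
  then show ?thesis unfolding kern_def using assms by (intro continuous_intros) auto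
qed

text \<open>The integrand is a Lorentzian of height \<open>Q\<close> and of width of order
  \<open>1 / sqrt (j * Q)\<close>, hence of mass of order \<open>sqrt (Q / j)\<close>. Scaling by
  \<open>\<beta>\<close> turns it into the derivative of an arctangent.\<close>

lemma arctan_integral:
  assumes "0 < \<alpha>" "0 < Q" "0 < j" "0 \<le> r"
  shows "integral {0..r} (\<lambda>s. j / ((\<alpha> * j * s)\<^sup>2 + j / Q)) \<le> 2 / \<alpha> * sqrt (Q / j)"
proof -
  define \<beta> where "\<beta> = \<alpha> * sqrt (j * Q)"
  have \<beta>: "\<beta> > 0" using assms by (simp add: \<beta>_def)
  have \<beta>2: "\<beta>\<^sup>2 = \<alpha>\<^sup>2 * (j * Q)" using assms by (simp add: \<beta>_def power_mult_distrib)
  have eq: "j / ((\<alpha> * j * s)\<^sup>2 + j / Q) = (Q / \<beta>) * (inverse (1 + (\<beta> * s)\<^sup>2) * \<beta>)" for s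
  proof -
    have p: "0 < 1 + (\<beta> * s)\<^sup>2" by (simp add: add_pos_nonneg)
    have "(\<alpha> * j * s)\<^sup>2 + j / Q = (j / Q) * (1 + (\<beta> * s)\<^sup>2)"
    proof -
      have "(\<alpha> * j * s)\<^sup>2 = \<alpha>\<^sup>2 * (j * j) * s\<^sup>2" by (simp add: power2_eq_square)
      moreover have "(\<beta> * s)\<^sup>2 = \<alpha>\<^sup>2 * (j * Q) * s\<^sup>2" by (simp add: power_mult_distrib \<beta>2)
      moreover have "\<alpha>\<^sup>2 * (j * j) * s\<^sup>2 + j / Q = (j / Q) * (1 + \<alpha>\<^sup>2 * (j * Q) * s\<^sup>2)"
        using assms by (simp add: field_simps)
      ultimately show ?thesis by (simp only:)
    qed
    then have "j / ((\<alpha> * j * s)\<^sup>2 + j / Q) = j / ((j / Q) * (1 + (\<beta> * s)\<^sup>2))" by simp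
    also have "\<dots> = Q * inverse (1 + (\<beta> * s)\<^sup>2)"
    proof -
      have "j / ((j / Q) * x) = Q * inverse x" if "0 < x" for x using assms that by (simp add: field_simps)
      then show ?thesis using p by blast
    qed
    finally show ?thesis using \<beta> by simp
  qed
  have "((\<lambda>s. (Q / \<beta>) * (inverse (1 + (\<beta> * s)\<^sup>2) * \<beta>)) has_integral (Q / \<beta>) * (arctan (\<beta> * r) - arctan (\<beta> * 0))) {0..r}"
    using assms by (intro has_integral_mult_right fundamental_theorem_of_calculus)
      (auto intro!: derivative_eq_intros simp: has_real_derivative_iff_has_vector_derivative[symmetric])
  then have "integral {0..r} (\<lambda>s. j / ((\<alpha> * j * s)\<^sup>2 + j / Q)) = (Q / \<beta>) * arctan (\<beta> * r)"
    unfolding eq by (simp add: integral_unique)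
  also have "\<dots> \<le> (Q / \<beta>) * 2"
    using arctan_ubound[of "\<beta> * r"] pi_less_4 \<beta> assms by (intro mult_left_mono) auto
  also have "Q / \<beta> = 1 / \<alpha> * sqrt (Q / j)"
  proof -
    have "sqrt (Q / j) * sqrt (j * Q) = Q"
      using assms by (simp add: real_sqrt_mult[symmetric] )
    then show ?thesis using \<beta> assms unfolding \<beta>_def by (simp add: field_simps)
  qed
  finally show ?thesis by (simp add: mult.commute)
qed

text \<open>The case in which the phase \<open>\<nu> + Y\<close> increases through an integer. Near the crossing,
  \<open>kern\<close> is dominated by an integrable inverse square root whose product with the other factor
  has an explicit antiderivative in terms of \<open>sqrt \<bar>1 - d / Y\<bar>\<close>.\<close>

lemma crossing_integral:
  fixes Y V \<Phi> :: "real \<Rightarrow> real"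
  assumes ab: "a \<le> b" and d: "0 < d" and C: "0 \<le> C"
    and Y: "\<And>s. s \<in> {a..b} \<Longrightarrow> (Y has_real_derivative V s) (at s)" "\<And>s. s \<in> {a..b} \<Longrightarrow> 0 < V s"
      "\<And>s. s \<in> {a..b} \<Longrightarrow> 0 < Y s" "d / 2 \<le> Y a"
    and \<Phi>: "continuous_on {a..b} \<Phi>" "\<And>s. s \<in> {a..b} \<Longrightarrow> Y s \<noteq> d \<Longrightarrow> \<Phi> s \<le> C * (V s / ((Y s)\<^sup>2 * sqrt \<bar>1 - d / Y s\<bar>))"
  shows "integral {a..b} \<Phi> \<le> 4 * C / d"
proof -
  \<comment> \<open>\<open>sqrt\<close> is an odd function on the reals, so \<open>\<Psi>\<close> changes sign at the crossing.\<close>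
  define \<Psi> where "\<Psi> s = sqrt (1 - d / Y s)" for s
  \<comment> \<open>At the crossing the quotient with the vanishing root evaluates to 0 and would
    not majorise \<open>\<Phi>\<close>. The value \<open>\<Phi> s\<close> is put in there; by strict
    monotonicity of \<open>Y\<close> this concerns at most one point.\<close>
  define D where "D s = (if Y s = d then \<Phi> s else C * (V s / ((Y s)\<^sup>2 * sqrt \<bar>1 - d / Y s\<bar>)))" for s
  have mono: "Y s < Y t" if "a \<le> s" "s < t" "t \<le> b" for s t
    using that Y(1,2) by (intro DERIV_pos_imp_increasing[OF that(2)]) (metis atLeastAtMost_iff order_trans)
  have inj: "s = t" if "s \<in> {a..b}" "t \<in> {a..b}" "Y s = Y t" for s t
    using mono[of s t] mono[of t s] that by (metis atLeastAtMost_iff linorder_neqE_linordered_idom order_less_irrefl)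
  define S where "S = {s \<in> {a..b}. Y s = d}"
  have finS: "finite S"
  proof (cases "S = {}")
    case False
    then obtain s where "s \<in> S" by blast
    then have "S \<subseteq> {s}" using inj by (auto simp: S_def)
    then show ?thesis by (rule finite_subset) simp
  qed simp
  have contY: "continuous_on {a..b} Y"
    using Y(1) by (intro continuous_at_imp_continuous_on ballI DERIV_isCont) auto
  have cont: "continuous_on {a..b} (\<lambda>s. (2 * C / d) * \<Psi> s)"
    unfolding \<Psi>_def using Y(3) by (intro continuous_intros contY) force
  have der: "((\<lambda>s. (2 * C / d) * \<Psi> s) has_vector_derivative D s) (at s)" if s: "s \<in> {a<..<b} - S" for s
  proof -
    have sI: "s \<in> {a..b}" "Y s \<noteq> d" using s by (auto simp: S_def)
    have Yp: "Y s > 0" "V s > 0" using Y(2,3) sI by auto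
    have i: "((\<lambda>s. 1 - d / Y s) has_real_derivative (d * V s / (Y s)\<^sup>2)) (at s)"
      using Y(1)[OF sI(1)] Yp by (auto intro!: derivative_eq_intros simp: power2_eq_square)
    have nz: "1 - d / Y s \<noteq> 0" using sI(2) Yp by simp
    have "(sqrt has_real_derivative 1 / (2 * sqrt \<bar>1 - d / Y s\<bar>)) (at (1 - d / Y s))"
      using nz by (intro DERIV_real_sqrt_generic) (auto simp: real_sqrt_minus[symmetric] field_simps)
    from DERIV_chain2[OF this i]
    have "(\<Psi> has_real_derivative (d * V s / (Y s)\<^sup>2) / (2 * sqrt \<bar>1 - d / Y s\<bar>)) (at s)"
      by (simp add: \<Psi>_def[abs_def] mult_ac)
    then have "((\<lambda>s. (2 * C / d) * \<Psi> s) has_real_derivative (2 * C / d) * ((d * V s / (Y s)\<^sup>2) / (2 * sqrt \<bar>1 - d / Y s\<bar>))) (at s)"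
      by (rule DERIV_cmult)
    moreover have "(2 * C / d) * ((d * V s / (Y s)\<^sup>2) / (2 * sqrt \<bar>1 - d / Y s\<bar>)) = D s"
      using sI d by (simp add: D_def)
    ultimately show ?thesis unfolding has_real_derivative_iff_has_vector_derivative by simp
  qed
  have hasD: "(D has_integral (2 * C / d) * \<Psi> b - (2 * C / d) * \<Psi> a) {a..b}"
    by (rule fundamental_theorem_of_calculus_interior_strong[OF finS ab der cont])
  have "integral {a..b} \<Phi> \<le> (2 * C / d) * \<Psi> b - (2 * C / d) * \<Psi> a"
  proof (rule has_integral_le[OF integrable_integral hasD])
    show "\<Phi> integrable_on {a..b}" by (intro integrable_continuous_interval \<Phi>)
    fix s assume "s \<in> {a..b}"
    then show "\<Phi> s \<le> D s" using \<Phi>(2)[of s] by (simp add: D_def)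
  qed
  also have "\<dots> = (2 * C / d) * (\<Psi> b - \<Psi> a)" by (simp add: right_diff_distrib)
  also have "\<dots> \<le> (2 * C / d) * 2"
  proof (rule mult_left_mono)
    have "\<Psi> b \<le> 1"
    proof -
      have "1 - d / Y b \<le> 1" using Y(3)[of b] ab d by simp
      then show ?thesis by (simp add: \<Psi>_def)
    qed
    moreover have "- 1 \<le> \<Psi> a"
    proof -
      have "d / Y a \<le> 2" using Y(3)[of a] Y(4) ab by (simp add: field_simps)
      then have "sqrt (- 1) \<le> sqrt (1 - d / Y a)" by (intro real_sqrt_le_mono) simp
      then show ?thesis by (simp add: \<Psi>_def real_sqrt_minus)
    qed
    ultimately show "\<Psi> b - \<Psi> a \<le> 2" by linarith
  qed (use C d in auto)
  finally show ?thesis by simp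
qed

text \<open>Up to a constant the kernel may be frozen at the value \<open>\<nu>\<close> of the phase
  at the stationary point. With \<open>d = dist_int \<nu>\<close> this is clear if
  \<open>Q * d \<le> 1\<close>, and also if the phase, which increases by at most 1/4, moves away
  from its nearest integer. If it moves towards it, the kernel stays comparable as long as
  \<open>Y s \<le> d / 2\<close>, and the rest, including a possible crossing, is left to
  \<open>crossing_integral\<close>.\<close>

lemma near_one_side:
  fixes Y V :: "real \<Rightarrow> real"
  assumes c: "0 < c1" "c1 \<le> c2" and Q: "0 < Q" and j: "0 < j" and r: "0 \<le> r" "c2 * j * r\<^sup>2 \<le> 1/2"
    and Y: "\<And>s. s \<in> {0..r} \<Longrightarrow> (Y has_real_derivative V s) (at s)" "Y 0 = 0"
    and V: "continuous_on {0..r} V" "\<And>s. s \<in> {0..r} \<Longrightarrow> c1 * j * s \<le> V s" "\<And>s. s \<in> {0..r} \<Longrightarrow> V s \<le> c2 * j * s"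
    and c3: "c3 = c1 * sqrt (2 / c2)"
  shows "integral {0..r} (\<lambda>s. j / ((V s)\<^sup>2 + j / Q) * kern Q (\<nu> + Y s)) \<le> (8 / c1 + 8 / c3 ^ 3) * sqrt (Q / j) * kern Q \<nu>"
proof -
  define \<Phi> where "\<Phi> s = j / ((V s)\<^sup>2 + j / Q) * kern Q (\<nu> + Y s)" for s
  define B where "B s = j / ((c1 * j * s)\<^sup>2 + j / Q)" for s
  define d where "d = dist_int \<nu>"
  have c2p: "c2 > 0" using c by simp
  have c3p: "c3 > 0" using c c2p by (simp add: c3)
  have jQ: "j / Q > 0" using j Q by simp
  have den: "0 < x\<^sup>2 + j / Q" for x using jQ by (simp add: add_nonneg_pos)
  have d: "0 \<le> d" "d \<le> 1/2" using dist_int_nonneg dist_int_le_half by (auto simp: d_def)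
  have sq: "0 < sqrt (Q / j)" using Q j by simp
  have kp: "0 < kern Q x" for x using kern_pos[OF Q] .
  have contY: "continuous_on {0..r} Y"
    using Y(1) by (intro continuous_at_imp_continuous_on ballI DERIV_isCont) auto
  have cont\<Phi>: "continuous_on {0..r} \<Phi>"
    unfolding \<Phi>_def using den Q by (intro continuous_intros V contY) (metis less_irrefl)
  have contB: "continuous_on A B" for A
    unfolding B_def using den by (intro continuous_intros) (metis less_irrefl)
  have B0: "0 \<le> B s" for s unfolding B_def using j den by (simp add: less_imp_le)
  have \<Phi>B: "j / ((V s)\<^sup>2 + j / Q) \<le> B s" if "s \<in> {0..r}" for s
    unfolding B_def using that V(2) c j den
    by (intro divide_left_mono add_right_mono power_mono mult_pos_pos) auto
  have intB: "integral {0..t} B \<le> 2 / c1 * sqrt (Q / j)" if "0 \<le> t" for t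
    unfolding B_def by (rule arctan_integral[OF c(1) Q j that])
  have Ylow: "c1 * j * s\<^sup>2 / 2 \<le> Y s" and Yup: "Y s \<le> c2 * j * s\<^sup>2 / 2" if s: "s \<in> {0..r}" for s
  proof -
    have "Y 0 - c1 * j * 0\<^sup>2 / 2 \<le> Y s - c1 * j * s\<^sup>2 / 2"
    proof (rule DERIV_nonneg_imp_nondecreasing[where f = "\<lambda>x. Y x - c1 * j * x\<^sup>2 / 2"])
      fix x assume x: "0 \<le> x" "x \<le> s"
      have "((\<lambda>x. Y x - c1 * j * x\<^sup>2 / 2) has_real_derivative V x - c1 * j * x) (at x)"
        using x s by (auto intro!: derivative_eq_intros Y(1))
      then show "\<exists>y. ((\<lambda>x. Y x - c1 * j * x\<^sup>2 / 2) has_real_derivative y) (at x) \<and> 0 \<le> y"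
        using V(2)[of x] x s by auto
    qed (use s in simp)
    then show "c1 * j * s\<^sup>2 / 2 \<le> Y s" using Y(2) by simp
    have "c2 * j * 0\<^sup>2 / 2 - Y 0 \<le> c2 * j * s\<^sup>2 / 2 - Y s"
    proof (rule DERIV_nonneg_imp_nondecreasing[where f = "\<lambda>x. c2 * j * x\<^sup>2 / 2 - Y x"])
      fix x assume x: "0 \<le> x" "x \<le> s"
      have "((\<lambda>x. c2 * j * x\<^sup>2 / 2 - Y x) has_real_derivative c2 * j * x - V x) (at x)"
        using x s by (auto intro!: derivative_eq_intros Y(1))
      then show "\<exists>y. ((\<lambda>x. c2 * j * x\<^sup>2 / 2 - Y x) has_real_derivative y) (at x) \<and> 0 \<le> y"
        using V(3)[of x] x s by auto
    qed (use s in simp)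
    then show "Y s \<le> c2 * j * s\<^sup>2 / 2" using Y(2) by simp
  qed
  have Y0: "0 \<le> Y s" if "s \<in> {0..r}" for s
    using Ylow[OF that] c j by (smt (verit) divide_nonneg_nonneg mult_nonneg_nonneg zero_le_power2)
  have Y4: "Y s \<le> 1/4" if s: "s \<in> {0..r}" for s
  proof -
    have "s\<^sup>2 \<le> r\<^sup>2" using s by (intro power_mono) auto
    then have "c2 * j * s\<^sup>2 \<le> c2 * j * r\<^sup>2" using c2p j by (intro mult_left_mono) auto
    then show ?thesis using Yup[OF s] r(2) by linarith
  qed
  have small: "integral {0..t} \<Phi> \<le> M * (2 / c1 * sqrt (Q / j))"
    if t: "0 \<le> t" "t \<le> r" and M: "0 \<le> M" "\<And>s. s \<in> {0..t} \<Longrightarrow> kern Q (\<nu> + Y s) \<le> M" for t M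
  proof -
    have "integral {0..t} \<Phi> \<le> integral {0..t} (\<lambda>s. M * B s)"
    proof (rule integral_le)
      show "\<Phi> integrable_on {0..t}"
        using t by (intro integrable_continuous_interval continuous_on_subset[OF cont\<Phi>]) auto
      show "(\<lambda>s. M * B s) integrable_on {0..t}"
        by (intro integrable_continuous_interval continuous_intros contB)
      fix s assume s: "s \<in> {0..t}"
      have "\<Phi> s \<le> B s * M" unfolding \<Phi>_def
        using s t \<Phi>B[of s] M(2)[OF s] B0 kp by (intro mult_mono) (auto simp: less_imp_le)
      then show "\<Phi> s \<le> M * B s" by (simp add: mult.commute)
    qed
    also have "\<dots> = M * integral {0..t} B" by simp
    also have "\<dots> \<le> M * (2 / c1 * sqrt (Q / j))" using M intB[OF t(1)] by (intro mult_left_mono)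
    finally show ?thesis .
  qed
  define R where "R = sqrt (Q / j) * kern Q \<nu>"
  have R: "R \<ge> 0" using sq kp[of \<nu>] by (simp add: R_def less_imp_le)
  have goal: "X \<le> (8 / c1 + 8 / c3 ^ 3) * R" if "X \<le> 8 / c1 * R" for X
    using that R c3p by (simp add: distrib_right) (smt (verit) divide_nonneg_nonneg mult_nonneg_nonneg zero_le_power)
  have "integral {0..r} \<Phi> \<le> (8 / c1 + 8 / c3 ^ 3) * R"
  proof (cases "Q * d \<le> 1")
    case True
    have "0 < 1 + Q * d" using Q d by (simp add: add_pos_nonneg)
    then have "Q \<le> 4 * kern Q \<nu>" using True Q unfolding kern_def d_def[symmetric] by (simp add: field_simps)
    then have "integral {0..r} \<Phi> \<le> (4 * kern Q \<nu>) * (2 / c1 * sqrt (Q / j))"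
      using kern_le[OF Q] kp[of \<nu>] r by (intro small) (auto intro: order_trans)
    also have "\<dots> = 8 / c1 * R" by (simp add: R_def)
    finally show ?thesis by (rule goal)
  next
    case False
    then have dp: "d > 0" using Q d by (smt (verit) mult_nonneg_nonpos mult_not_zero)
    have kd: "1 / d \<le> 2 * kern Q \<nu>"
    proof -
      have "0 < 1 + Q * d" using Q d by (simp add: add_pos_nonneg)
      then show ?thesis using False dp Q unfolding kern_def d_def[symmetric] by (simp add: field_simps)
    qed
    have far: "kern Q x \<le> 4 * kern Q \<nu>" if "d / 2 \<le> dist_int x" for x
      using kern_le_inverse[OF Q _ that] dp kd by simp
    obtain m :: int where m: "d = \<bar>\<nu> - of_int m\<bar>" using dist_int_attained unfolding d_def by blast
    show ?thesis
    proof (cases "of_int m \<le> \<nu>")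
      case True
      have "integral {0..r} \<Phi> \<le> (4 * kern Q \<nu>) * (2 / c1 * sqrt (Q / j))"
      proof (rule small)
        fix s assume s: "s \<in> {0..r}"
        have "dist_int (\<nu> + Y s) = dist_int (d + Y s)"
        proof -
          have "\<nu> + Y s = d + Y s + of_int m" using m True by simp
          then show ?thesis by (simp only: dist_int_add_int)
        qed
        also have "\<dots> = min (d + Y s) (1 - (d + Y s))"
          using d Y0[OF s] Y4[OF s] by (intro dist_int_eq_min) auto
        also have "\<dots> \<ge> d / 2" using d Y0[OF s] Y4[OF s] by auto
        finally show "kern Q (\<nu> + Y s) \<le> 4 * kern Q \<nu>" by (rule far)
      qed (use r kp[of \<nu>] in auto)
      also have "\<dots> = 8 / c1 * R" by (simp add: R_def)
      finally show ?thesis by (rule goal)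
    next
      case False
      have dY: "dist_int (\<nu> + Y s) = \<bar>Y s - d\<bar>" if s: "s \<in> {0..r}" for s
      proof -
        have e: "\<nu> + Y s - of_int m = Y s - d" using m False by simp
        have "\<bar>\<nu> + Y s - of_int m\<bar> \<le> 1/2" unfolding e using d Y0[OF s] Y4[OF s] by (intro abs_leI) linarith+
        from dist_int_near[OF this] show ?thesis unfolding e .
      qed
      have mono: "Y s \<le> Y t" if "0 \<le> s" "s \<le> t" "t \<le> r" for s t
      proof (rule DERIV_nonneg_imp_nondecreasing[OF that(2)])
        fix x assume "s \<le> x" "x \<le> t"
        then have x: "x \<in> {0..r}" using that by auto
        have "0 \<le> c1 * j * x" using c j x by simp
        then have "0 \<le> V x" using V(2)[OF x] by linarith
        then show "\<exists>y. (Y has_real_derivative y) (at x) \<and> 0 \<le> y" using Y(1)[OF x] by blast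
      qed
      have pre: "integral {0..t} \<Phi> \<le> 8 / c1 * R" if t: "0 \<le> t" "t \<le> r" "Y t \<le> d / 2" for t
      proof -
        have "integral {0..t} \<Phi> \<le> (4 * kern Q \<nu>) * (2 / c1 * sqrt (Q / j))"
        proof (rule small)
          fix s assume s: "s \<in> {0..t}"
          then have "Y s \<le> d / 2" using mono[of s t] t by auto
          moreover have "dist_int (\<nu> + Y s) = \<bar>Y s - d\<bar>" using dY[of s] s t by auto
          ultimately have "d / 2 \<le> dist_int (\<nu> + Y s)" by linarith
          then show "kern Q (\<nu> + Y s) \<le> 4 * kern Q \<nu>" by (rule far)
        qed (use t kp[of \<nu>] in auto)
        then show ?thesis by (simp add: R_def mult.commute)
      qed
      show ?thesis
      proof (cases "Y r \<le> d / 2")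
        case True
        then show ?thesis using pre[of r] r by (intro goal) auto
      next
        case False
        have "\<exists>t\<ge>0. t \<le> r \<and> Y t = d / 2"
          using False Y(2) dp r contY by (intro IVT') auto
        then obtain t where t: "0 \<le> t" "t \<le> r" "Y t = d / 2" by blast
        have t0: "t > 0" using t Y(2) dp by (cases "t = 0") auto
        have split: "integral {0..t} \<Phi> + integral {t..r} \<Phi> = integral {0..r} \<Phi>"
          using t by (intro Henstock_Kurzweil_Integration.integral_combine integrable_continuous_interval cont\<Phi>)
        define C where "C = sqrt (Q / j) / c3 ^ 3"
        have "integral {t..r} \<Phi> \<le> 4 * C / d"
        proof (rule crossing_integral[OF t(2) dp])
          show "0 \<le> C" using sq c3p by (simp add: C_def)
          show "continuous_on {t..r} \<Phi>" using t by (intro continuous_on_subset[OF cont\<Phi>]) auto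
          show "d / 2 \<le> Y t" using t by simp
          fix s assume s: "s \<in> {t..r}"
          then have s0: "s \<in> {0..r}" "s > 0" using t t0 by auto
          show "(Y has_real_derivative V s) (at s)" using Y(1)[OF s0(1)] .
          have "0 < c1 * j * s" using c j s0 by simp
          then show Vp: "0 < V s" using V(2)[OF s0(1)] by linarith
          have "d / 2 \<le> Y s" using mono[of t s] s t by auto
          then show Yp: "0 < Y s" using dp by linarith
          assume ne: "Y s \<noteq> d"
          \<comment> \<open>Eliminates \<open>s\<close>: the upper bound for \<open>Y s\<close> and
            the lower bound for \<open>V s\<close> combine to
            \<open>c3 * sqrt (j * Y s) \<le> V s\<close>. The first factor of \<open>\<Phi>\<close>
            is then at most \<open>V s\<close> times a function of \<open>Y s\<close>, the form
            required by \<open>crossing_integral\<close>.\<close>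
          have "c3\<^sup>2 * (j * Y s) \<le> (c1 * j * s)\<^sup>2"
          proof -
            have "c3\<^sup>2 = c1\<^sup>2 * (2 / c2)" using c2p by (simp add: c3 power_mult_distrib)
            then have "c3\<^sup>2 * (j * Y s) = (c1\<^sup>2 * j * (2 / c2)) * Y s" by simp
            also have "\<dots> \<le> (c1\<^sup>2 * j * (2 / c2)) * (c2 * j * s\<^sup>2 / 2)"
              using Yup[OF s0(1)] c2p j by (intro mult_left_mono) auto
            also have "\<dots> = (c1 * j * s)\<^sup>2" using c2p by (simp add: power2_eq_square)
            finally show ?thesis .
          qed
          also have "\<dots> \<le> (V s)\<^sup>2" using V(2)[OF s0(1)] c j s0 by (intro power_mono) auto
          finally have "sqrt (c3\<^sup>2 * (j * Y s)) \<le> V s" using Vp by (intro real_le_lsqrt) auto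
          then have cV: "c3 * sqrt (j * Y s) \<le> V s" using c3p by (simp add: real_sqrt_mult)
          have "c3 ^ 3 * (j * Y s * sqrt (j * Y s)) = (c3 * sqrt (j * Y s)) ^ 3"
            using j Yp by (simp add: power_mult_distrib power3_eq_cube)
          also have "\<dots> \<le> (V s) ^ 3" using cV c3p j Yp by (intro power_mono) auto
          finally have cube: "c3 ^ 3 * (j * Y s * sqrt (j * Y s)) \<le> (V s) ^ 3" .
          have 1: "j / ((V s)\<^sup>2 + j / Q) \<le> V s / (c3 ^ 3 * (Y s * sqrt (j * Y s)))"
          proof -
            have "j / ((V s)\<^sup>2 + j / Q) \<le> j / (V s)\<^sup>2"
              using j jQ Vp by (intro divide_left_mono) (auto intro!: mult_pos_pos add_pos_pos)
            also have "\<dots> \<le> V s / (c3 ^ 3 * (Y s * sqrt (j * Y s)))"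
            proof -
              have "0 < c3 ^ 3 * (Y s * sqrt (j * Y s))" using c3p Yp j by simp
              then show ?thesis using cube Vp by (simp add: field_simps power3_eq_cube power2_eq_square)
            qed
            finally show ?thesis .
          qed
          define z where "z = \<bar>1 - d / Y s\<bar>"
          have z: "z > 0" using ne Yp by (simp add: z_def)
          have dz: "\<bar>Y s - d\<bar> = Y s * z" using Yp by (simp add: z_def abs_mult_pos[symmetric] field_simps abs_divide)
          have 2: "kern Q (\<nu> + Y s) \<le> sqrt (Q / (Y s * z))"
            using Yp z dY[OF s0(1)] dz by (intro kern_le_sqrt[OF Q]) auto
          have "\<Phi> s \<le> V s / (c3 ^ 3 * (Y s * sqrt (j * Y s))) * sqrt (Q / (Y s * z))"
            unfolding \<Phi>_def using 1 2 kp[of "\<nu> + Y s"] c3p Yp Vp j by (intro mult_mono) (auto simp: less_imp_le)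
          also have "\<dots> = C * (V s / ((Y s)\<^sup>2 * sqrt z))"
          proof -
            have sqY: "(Y s)\<^sup>2 = Y s * (sqrt (Y s) * sqrt (Y s))" using Yp by (simp add: power2_eq_square)
            have "v / (A * (y * (sj * sy))) * (sQ / (sy * sz)) = sQ / sj / A * (v / (y * (sy * sy) * sz))"
              for v A y sj sy sQ sz :: real by (simp add: mult_ac)
            then show ?thesis unfolding C_def sqY real_sqrt_mult real_sqrt_divide .
          qed
          finally show "\<Phi> s \<le> C * (V s / ((Y s)\<^sup>2 * sqrt \<bar>1 - d / Y s\<bar>))" by (simp add: z_def)
        qed
        also have "4 * C / d \<le> 4 * C * (2 * kern Q \<nu>)"
          using mult_left_mono[OF kd, of "4 * C"] sq c3p by (simp add: C_def)
        also have "\<dots> = 8 / c3 ^ 3 * R" by (simp add: C_def R_def)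
        finally show ?thesis using split pre[of t] t by (simp add: distrib_right)
      qed
    qed
  qed
  then show ?thesis by (simp add: \<Phi>_def[abs_def] R_def mult.assoc)
qed

section \<open>Exponential sums over the denominator\<close>

definition esum :: "nat \<Rightarrow> real \<Rightarrow> complex" where
  "esum Q x = (\<Sum>q=1..Q. echar (of_nat q * x))"

text \<open>The weight \<open>q\<close> is the Jacobian of the substitution
  \<open>x = q * t\<close>, which passes from an integral over the numerators to one over the curve
  parameter, with the same domain for all \<open>q\<close>.\<close>

definition esum1 :: "nat \<Rightarrow> real \<Rightarrow> complex" where
  "esum1 Q x = (\<Sum>q=1..Q. of_nat q * echar (of_nat q * x))"

lemma norm_esum_le:
  assumes "n \<le> Q" "0 < Q"
  shows "norm (esum n x) \<le> 2 * kern (real Q) x"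
proof -
  have "esum n x = (\<Sum>k<n. echar (of_nat (Suc k) * x))"
    unfolding esum_def One_nat_def by (rule sum.atLeast1_atMost_eq)
  also have "\<dots> = echar x * dirichlet n x"
    by (simp add: dirichlet_def sum_distrib_left echar_add[symmetric] distrib_right)
  finally show ?thesis using norm_dirichlet_kern[OF assms, of x] by (simp add: norm_mult)
qed

text \<open>Partial summation. It calls for the bound on all shorter sums \<open>esum k\<close> by
  the kernel with the same \<open>Q\<close>, which is the reason for the two parameters in
  \<open>norm_esum_le\<close>.\<close>

lemma norm_esum1_le:
  assumes "0 < Q"
  shows "norm (esum1 Q x) \<le> 4 * real Q * kern (real Q) x"
proof -
  have "esum1 n x = of_nat n * esum n x - (\<Sum>k<n. esum k x)" for n
    by (induction n) (simp_all add: esum_def esum1_def algebra_simps)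
  then have "norm (esum1 Q x) \<le> norm (of_nat Q * esum Q x) + norm (\<Sum>k<Q. esum k x)"
    by (metis norm_triangle_ineq4)
  also have "\<dots> \<le> real Q * (2 * kern (real Q) x) + (\<Sum>k<Q. 2 * kern (real Q) x)"
    using assms by (intro add_mono order_trans[OF norm_sum] sum_mono) (auto simp: norm_mult intro!: mult_left_mono norm_esum_le)
  finally show ?thesis by simp
qed

lemma continuous_esum [continuous_intros]:
  "continuous_on S f \<Longrightarrow> continuous_on S (\<lambda>x. esum Q (f x))"
  "continuous_on S f \<Longrightarrow> continuous_on S (\<lambda>x. esum1 Q (f x))"
  unfolding esum_def esum1_def by (intro continuous_intros; assumption)+

lemma has_vector_derivative_esum:
  assumes "(f has_real_derivative f') (at x within S)"
  shows "((\<lambda>x. esum Q (f x)) has_vector_derivative of_real (2 * pi * f') * \<i> * esum1 Q (f x)) (at x within S)"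
proof -
  have "((\<lambda>x. \<Sum>q=1..Q. echar (of_nat q * f x)) has_vector_derivative
      (\<Sum>q=1..Q. of_real (2 * pi * (of_nat q * f')) * \<i> * echar (of_nat q * f x))) (at x within S)"
    by (intro has_vector_derivative_sum has_vector_derivative_echar DERIV_cmult assms)
  also have "(\<Sum>q=1..Q. of_real (2 * pi * (of_nat q * f')) * \<i> * echar (of_nat q * f x))
      = of_real (2 * pi * f') * \<i> * esum1 Q (f x)"
    by (simp add: esum1_def sum_distrib_left mult_ac)
  finally show ?thesis by (simp add: esum_def)
qed

text \<open>The curve lives on the whole line so that \<open>f'\<close> is onto and every frequency
  has a stationary point, even when that point falls outside the interval of interest.\<close>

locale convex_curve =
  fixes f f' f'' :: "real \<Rightarrow> real" and c1 c2 :: real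
  assumes c1_pos: "0 < c1"
    and deriv1: "\<And>x. (f has_real_derivative f' x) (at x)"
    and deriv2: "\<And>x. (f' has_real_derivative f'' x) (at x)"
    and cont2: "continuous_on UNIV f''"
    and bounds2: "\<And>x. c1 \<le> f'' x" "\<And>x. f'' x \<le> c2"
begin

lemma c12: "c1 \<le> c2"
  using bounds2[of 0] by simp

lemma c2_pos: "0 < c2"
  using c1_pos c12 by simp

lemma cont0: "continuous_on S f"
  using deriv1 by (intro continuous_at_imp_continuous_on ballI DERIV_isCont) auto

lemma cont1: "continuous_on S f'"
  using deriv2 by (intro continuous_at_imp_continuous_on ballI DERIV_isCont) auto

lemma cont2': "continuous_on S f''"
  using cont2 continuous_on_subset by blast

lemma f'_bounds:
  assumes "x \<le> y"
  shows "c1 * (y - x) \<le> f' y - f' x" "f' y - f' x \<le> c2 * (y - x)"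
proof -
  have "c1 * (y - x) \<le> f' y - f' x \<and> f' y - f' x \<le> c2 * (y - x)"
  proof (cases "x = y")
    case False
    then have "x < y" using assms by simp
    then obtain z where "f' y - f' x = (y - x) * f'' z"
      using MVT2[of x y f' f''] deriv2 by blast
    then show ?thesis using assms bounds2[of z] mult_right_mono[of c1 "f'' z" "y - x"] mult_right_mono[of "f'' z" c2 "y - x"]
      by (simp add: mult.commute)
  qed simp
  then show "c1 * (y - x) \<le> f' y - f' x" "f' y - f' x \<le> c2 * (y - x)" by auto
qed

lemma f_quadratic:
  "c1 / 2 * (y - x)\<^sup>2 \<le> f y - f x - f' x * (y - x)" "f y - f x - f' x * (y - x) \<le> c2 / 2 * (y - x)\<^sup>2"
proof -
  define k where "k c z = f z - f' x * (z - x) - c / 2 * (z - x)\<^sup>2" for c z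
  have k: "(k c has_real_derivative f' z - f' x - c * (z - x)) (at z)" for c z
    unfolding k_def by (auto intro!: derivative_eq_intros deriv1 simp: algebra_simps diff_divide_distrib)
  have km: "((\<lambda>z. - k c z) has_real_derivative - (f' z - f' x - c * (z - x))) (at z)" for c z
    using DERIV_minus[OF k] .
  have "k c1 x \<le> k c1 y \<and> - k c2 x \<le> - k c2 y"
  proof (cases "x \<le> y")
    case True
    have "k c1 x \<le> k c1 y"
    proof (rule DERIV_nonneg_imp_nondecreasing[OF True])
      fix z assume "x \<le> z" "z \<le> y"
      then show "\<exists>d. (k c1 has_real_derivative d) (at z) \<and> 0 \<le> d"
        using k[of c1 z] f'_bounds[of x z] by (intro exI[of _ "f' z - f' x - c1 * (z - x)"]) auto
    qed
    moreover have "- k c2 x \<le> - k c2 y"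
    proof (rule DERIV_nonneg_imp_nondecreasing[OF True])
      fix z assume "x \<le> z" "z \<le> y"
      then show "\<exists>d. ((\<lambda>z. - k c2 z) has_real_derivative d) (at z) \<and> 0 \<le> d"
        using km[of c2 z] f'_bounds[of x z] by (intro exI[of _ "- (f' z - f' x - c2 * (z - x))"]) auto
    qed
    ultimately show ?thesis by simp
  next
    case False
    then have yx: "y \<le> x" by simp
    have "k c1 x \<le> k c1 y"
    proof (rule DERIV_nonpos_imp_nonincreasing[OF yx])
      fix z assume "y \<le> z" "z \<le> x"
      then show "\<exists>d. (k c1 has_real_derivative d) (at z) \<and> d \<le> 0"
        using k[of c1 z] f'_bounds[of z x] by (intro exI[of _ "f' z - f' x - c1 * (z - x)"]) (auto simp: algebra_simps)
    qed
    moreover have "- k c2 x \<le> - k c2 y"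
    proof (rule DERIV_nonpos_imp_nonincreasing[OF yx])
      fix z assume "y \<le> z" "z \<le> x"
      then show "\<exists>d. ((\<lambda>z. - k c2 z) has_real_derivative d) (at z) \<and> d \<le> 0"
        using km[of c2 z] f'_bounds[of z x] by (intro exI[of _ "- (f' z - f' x - c2 * (z - x))"]) (auto simp: algebra_simps)
    qed
    ultimately show ?thesis by simp
  qed
  then show "c1 / 2 * (y - x)\<^sup>2 \<le> f y - f x - f' x * (y - x)" "f y - f x - f' x * (y - x) \<le> c2 / 2 * (y - x)\<^sup>2"
    by (auto simp: k_def)
qed

lemma f'_surj: "\<exists>t. f' t = x"
proof -
  define R where "R = \<bar>x - f' 0\<bar> / c1"
  have R: "R \<ge> 0" "c1 * R = \<bar>x - f' 0\<bar>" using c1_pos by (auto simp: R_def)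
  have "f' (- R) \<le> x" using f'_bounds(1)[of "- R" 0] R by simp
  moreover have "x \<le> f' R" using f'_bounds(1)[of 0 R] R by simp
  ultimately show ?thesis using IVT'[of f' "- R" x R] R(1) cont1 by auto
qed

definition \<tau> :: "real \<Rightarrow> real" where
  "\<tau> x = (SOME t. f' t = x)"

lemma f'_\<tau> [simp]: "f' (\<tau> x) = x"
  unfolding \<tau>_def using f'_surj by (rule someI_ex)

definition legendre :: "real \<Rightarrow> real" where
  "legendre x = x * \<tau> x - f (\<tau> x)"

text \<open>For \<open>x = f' s\<close> and \<open>y = f' t\<close> the defect of the transform at
  \<open>x\<close> towards \<open>y\<close> equals the defect of \<open>f\<close> at
  \<open>t\<close> towards \<open>s\<close>, with the roles of the points exchanged. The bounds
  \<open>c1\<close> and \<open>c2\<close> on the slopes of \<open>f'\<close> convert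
  \<open>s - t\<close> into \<open>y - x\<close>, which accounts for the squares in the
  constants.\<close>

lemma legendre_strongly_convex: "strongly_convex legendre \<tau> (c1 / (2 * c2\<^sup>2)) (c2 / (2 * c1\<^sup>2))"
proof
  show "0 < c1 / (2 * c2\<^sup>2)" using c1_pos c2_pos by simp
  fix x y :: real
  define s t where "s = \<tau> x" and "t = \<tau> y"
  have e: "legendre y - legendre x - \<tau> x * (y - x) = f s - f t - f' t * (s - t)"
    by (simp add: legendre_def s_def t_def algebra_simps)
  have yx: "y - x = f' t - f' s" by (simp add: s_def t_def)
  have lip: "c1 * \<bar>t - s\<bar> \<le> \<bar>y - x\<bar>" "\<bar>y - x\<bar> \<le> c2 * \<bar>t - s\<bar>"
  proof -
    have "c1 * \<bar>t - s\<bar> \<le> \<bar>y - x\<bar> \<and> \<bar>y - x\<bar> \<le> c2 * \<bar>t - s\<bar>"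
    proof (cases "s \<le> t")
      case True
      then have "0 \<le> c1 * (t - s)" using c1_pos by simp
      then show ?thesis using f'_bounds[OF True] True unfolding yx by simp
    next
      case False
      then have st: "t \<le> s" by simp
      then have "0 \<le> c1 * (s - t)" using c1_pos by simp
      then show ?thesis using f'_bounds[OF st] st unfolding yx by simp
    qed
    then show "c1 * \<bar>t - s\<bar> \<le> \<bar>y - x\<bar>" "\<bar>y - x\<bar> \<le> c2 * \<bar>t - s\<bar>" by auto
  qed
  have sq: "c1\<^sup>2 * (s - t)\<^sup>2 \<le> (y - x)\<^sup>2" "(y - x)\<^sup>2 \<le> c2\<^sup>2 * (s - t)\<^sup>2"
  proof -
    have "(c1 * \<bar>t - s\<bar>)\<^sup>2 \<le> \<bar>y - x\<bar>\<^sup>2" using lip c1_pos by (intro power_mono) auto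
    then show "c1\<^sup>2 * (s - t)\<^sup>2 \<le> (y - x)\<^sup>2" by (simp add: power_mult_distrib power2_commute)
    have "\<bar>y - x\<bar>\<^sup>2 \<le> (c2 * \<bar>t - s\<bar>)\<^sup>2" using lip by (intro power_mono) auto
    then show "(y - x)\<^sup>2 \<le> c2\<^sup>2 * (s - t)\<^sup>2" by (simp add: power_mult_distrib power2_commute)
  qed
  have "c1 / (2 * c2\<^sup>2) * (y - x)\<^sup>2 \<le> c1 / (2 * c2\<^sup>2) * (c2\<^sup>2 * (s - t)\<^sup>2)"
    using sq c1_pos by (intro mult_left_mono) auto
  also have "\<dots> = c1 / 2 * (s - t)\<^sup>2" using c2_pos by simp
  finally show "c1 / (2 * c2\<^sup>2) * (y - x)\<^sup>2 \<le> legendre y - legendre x - \<tau> x * (y - x)"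
    unfolding e using f_quadratic(1)[of s t] by linarith
  have "c2 / 2 * (s - t)\<^sup>2 = c2 / (2 * c1\<^sup>2) * (c1\<^sup>2 * (s - t)\<^sup>2)" using c1_pos by simp
  also have "\<dots> \<le> c2 / (2 * c1\<^sup>2) * (y - x)\<^sup>2"
    using sq c2_pos by (intro mult_left_mono) auto
  finally show "legendre y - legendre x - \<tau> x * (y - x) \<le> c2 / (2 * c1\<^sup>2) * (y - x)\<^sup>2"
    unfolding e using f_quadratic(2)[where y = s and x = t] by linarith
qed

text \<open>Integration by parts against the regularised factor \<open>\<theta>' / (\<theta>'\<^sup>2 + j / Q)\<close>, where
  \<open>\<theta> = j f - l t\<close>; the regularisation removes the pole at the stationary point.\<close>

lemma weighted_integral_bound:
  fixes w w' :: "real \<Rightarrow> real"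
  assumes I: "\<eta> \<le> \<xi>" and Q: "0 < (Q::nat)" and j: "0 < j"
    and w: "\<And>t. t \<in> {\<eta>..\<xi>} \<Longrightarrow> (w has_real_derivative w' t) (at t within {\<eta>..\<xi>})" "continuous_on {\<eta>..\<xi>} w'"
      "w \<eta> = 0" "w \<xi> = 0" "\<And>t. t \<in> {\<eta>..\<xi>} \<Longrightarrow> 0 \<le> w t \<and> w t \<le> 1"
  shows "norm (integral {\<eta>..\<xi>} (\<lambda>t. of_real (w t) * esum1 Q (j * f t - l * t)))
    \<le> integral {\<eta>..\<xi>} (\<lambda>t. ((4 + c2) * j + \<bar>w' t\<bar> * \<bar>j * f' t - l\<bar>) / ((j * f' t - l)\<^sup>2 + j / Q) * kern Q (j * f t - l * t))"
proof -
  define L where "L = j / real Q"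
  define p where "p t = j * f' t - l" for t
  define \<theta> where "\<theta> t = j * f t - l * t" for t
  define D where "D t = (p t)\<^sup>2 + L" for t
  define G where "G t = p t / D t" for t
  define G' where "G' t = j * f'' t * (L - (p t)\<^sup>2) / (D t)\<^sup>2" for t
  have Lp: "L > 0" using j Q by (simp add: L_def)
  have Dp: "D t > 0" for t using Lp by (simp add: D_def add_nonneg_pos)
  have dp: "(p has_real_derivative j * f'' t) (at t within S)" for t S
    unfolding p_def by (auto intro!: derivative_eq_intros has_field_derivative_at_within[OF deriv2])
  have d\<theta>: "(\<theta> has_real_derivative p t) (at t within S)" for t S
    unfolding p_def \<theta>_def by (auto intro!: derivative_eq_intros has_field_derivative_at_within[OF deriv1])
  have dG: "(G has_real_derivative G' t) (at t within S)" for t S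
  proof -
    have "((\<lambda>t. p t / D t) has_real_derivative ((j * f'' t) * D t - p t * (2 * p t * (j * f'' t))) / (D t * D t)) (at t within S)"
      unfolding D_def by (rule DERIV_divide) (use Dp[of t] in \<open>auto intro!: derivative_eq_intros dp simp: D_def\<close>)
    moreover have "(j * f'' t) * D t - p t * (2 * p t * (j * f'' t)) = j * f'' t * (L - (p t)\<^sup>2)"
      by (simp add: D_def algebra_simps power2_eq_square)
    ultimately show ?thesis by (simp add: G_def[abs_def] G'_def power2_eq_square)
  qed
  have cp: "continuous_on S p" and c\<theta>: "continuous_on S \<theta>" for S
    unfolding p_def \<theta>_def by (intro continuous_intros cont0 cont1)+
  have cD: "continuous_on S D" for S unfolding D_def by (intro continuous_intros cp)
  have cG: "continuous_on S G" for S unfolding G_def using Dp by (intro continuous_intros cp cD) (metis less_irrefl)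
  have cG': "continuous_on S G'" for S unfolding G'_def using Dp
    by (intro continuous_intros cp cD cont2') (metis less_irrefl power_not_zero)
  have cw: "continuous_on {\<eta>..\<xi>} w" using w(1) by (intro DERIV_continuous_on)
  \<comment> \<open>Everything rests on \<open>L / D t + p t * G t = 1\<close>. The first share of
    the integrand is small away from the stationary point. The second is, up to a constant factor,
    the derivative of \<open>esum\<close> along the phase and is integrated by parts:
    \<open>B\<close> is the derivative of \<open>w * G * esum\<close>, whose integral vanishes
    because \<open>w\<close> is zero at both ends, and \<open>A\<close> is what remains.\<close>
  define A where "A t = of_real (w t * (L / D t)) * esum1 Q (\<theta> t) - of_real (w' t * G t + w t * G' t) * esum Q (\<theta> t) / (2 * pi * \<i>)" for t
  define B where "B t = of_real (w' t * G t + w t * G' t) * esum Q (\<theta> t) + of_real (w t * G t) * (of_real (2 * pi * p t) * \<i> * esum1 Q (\<theta> t))" for t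
  have "(B has_integral of_real (w \<xi> * G \<xi>) * esum Q (\<theta> \<xi>) - of_real (w \<eta> * G \<eta>) * esum Q (\<theta> \<eta>)) {\<eta>..\<xi>}"
  proof (rule fundamental_theorem_of_calculus[OF I])
    fix t assume t: "t \<in> {\<eta>..\<xi>}"
    have 1: "((\<lambda>t. of_real (w t * G t) :: complex) has_vector_derivative of_real (w' t * G t + w t * G' t)) (at t within {\<eta>..\<xi>})"
      using has_vector_derivative_of_real[OF DERIV_mult[OF w(1)[OF t] dG[of t "{\<eta>..\<xi>}"]]]
      by (simp add: mult.commute add.commute)
    show "((\<lambda>t. of_real (w t * G t) * esum Q (\<theta> t)) has_vector_derivative B t) (at t within {\<eta>..\<xi>})"
      using has_vector_derivative_mult[OF 1 has_vector_derivative_esum[OF d\<theta>[of t "{\<eta>..\<xi>}"], of Q]]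
      unfolding B_def by (simp add: add.commute)
  qed
  then have B0: "(B has_integral 0) {\<eta>..\<xi>}" using w(3,4) by simp
  have cA: "continuous_on {\<eta>..\<xi>} A"
    unfolding A_def using Dp by (intro continuous_intros cw cD cG cG' w(2) c\<theta>) (auto, metis less_irrefl)
  have "of_real (w t) * esum1 Q (\<theta> t) = A t + B t / (2 * pi * \<i>)" for t
  proof -
    have "L / D t + p t * G t = 1" using Dp[of t] by (simp add: G_def D_def add_divide_distrib[symmetric] power2_eq_square add.commute)
    then have "complex_of_real (w t) = of_real (w t * (L / D t)) + of_real (w t * G t) * of_real (p t)"
      unfolding of_real_mult[symmetric] of_real_add[symmetric] by (metis distrib_left mult.assoc mult.commute mult.right_neutral)
    then have "of_real (w t) * esum1 Q (\<theta> t) = of_real (w t * (L / D t)) * esum1 Q (\<theta> t) + of_real (w t * G t) * of_real (p t) * esum1 Q (\<theta> t)"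
      by (metis distrib_right)
    moreover have "B t / (2 * pi * \<i>) = of_real (w' t * G t + w t * G' t) * esum Q (\<theta> t) / (2 * pi * \<i>) + of_real (w t * G t) * of_real (p t) * esum1 Q (\<theta> t)"
    proof -
      have "x * (of_real (2 * pi * y) * \<i> * z) / (2 * pi * \<i>) = x * of_real y * z" for x z :: complex and y :: real
      proof -
        have eq: "x * (of_real (2 * pi * y) * \<i> * z) = (x * of_real y * z) * (2 * pi * \<i>)" by simp
        show ?thesis unfolding eq by (rule nonzero_mult_div_cancel_right) simp
      qed
      then show ?thesis unfolding B_def add_divide_distrib by (simp only:)
    qed
    ultimately show ?thesis by (simp add: A_def)
  qed
  moreover have "((\<lambda>t. A t + B t / (2 * pi * \<i>)) has_integral integral {\<eta>..\<xi>} A + 0 / (2 * pi * \<i>)) {\<eta>..\<xi>}"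
    by (intro has_integral_add has_integral_divide B0 integrable_integral integrable_continuous_interval cA)
  ultimately have "integral {\<eta>..\<xi>} (\<lambda>t. of_real (w t) * esum1 Q (\<theta> t)) = integral {\<eta>..\<xi>} A"
    by (simp add: integral_unique)
  also have "norm \<dots> \<le> integral {\<eta>..\<xi>} (\<lambda>t. ((4 + c2) * j + \<bar>w' t\<bar> * \<bar>p t\<bar>) / D t * kern Q (\<theta> t))"
  proof (rule Henstock_Kurzweil_Integration.integral_norm_bound_integral)
    show "A integrable_on {\<eta>..\<xi>}" by (intro integrable_continuous_interval cA)
    show "(\<lambda>t. ((4 + c2) * j + \<bar>w' t\<bar> * \<bar>p t\<bar>) / D t * kern Q (\<theta> t)) integrable_on {\<eta>..\<xi>}"
      using Dp Q by (intro integrable_continuous_interval continuous_intros cp cD c\<theta> w(2)) (auto, metis less_irrefl)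
    fix t assume t: "t \<in> {\<eta>..\<xi>}"
    define k where "k = kern Q (\<theta> t)"
    have k: "k > 0" using kern_pos Q by (simp add: k_def)
    have wt: "0 \<le> w t" "w t \<le> 1" using w(5)[OF t] by auto
    have f2: "0 \<le> f'' t" "f'' t \<le> c2" using bounds2[of t] c1_pos by auto
    have n1: "norm (of_real (w t * (L / D t)) * esum1 Q (\<theta> t)) \<le> 4 * j / D t * k"
    proof -
      have "norm (of_real (w t * (L / D t)) * esum1 Q (\<theta> t)) = w t * (L / D t) * norm (esum1 Q (\<theta> t))"
      proof -
        have "0 \<le> w t * (L / D t)" using wt Lp Dp[of t] by simp
        then show ?thesis by (simp only: norm_mult norm_of_real abs_of_nonneg)
      qed
      also have "\<dots> \<le> 1 * (L / D t) * (4 * real Q * k)"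
        unfolding k_def using wt Lp Dp[of t] Q by (intro mult_mono norm_esum1_le) auto
      also have "\<dots> = 4 * j / D t * k" using Q by (simp add: L_def)
      finally show ?thesis .
    qed
    have aG: "\<bar>G t\<bar> = \<bar>p t\<bar> / D t" using Dp[of t] by (simp add: G_def)
    have aG': "\<bar>G' t\<bar> \<le> c2 * j / D t"
    proof -
      have "\<bar>L - (p t)\<^sup>2\<bar> \<le> D t" using Lp by (simp add: D_def abs_le_iff)
      then have "j * f'' t * \<bar>L - (p t)\<^sup>2\<bar> \<le> j * c2 * D t" using f2 j Lp by (intro mult_mono) auto
      then have "\<bar>G' t\<bar> \<le> j * c2 * D t / (D t)\<^sup>2"
        using f2 j unfolding G'_def by (simp add: abs_mult divide_right_mono)
      also have "\<dots> = c2 * j / D t" using Dp[of t] by (simp add: power2_eq_square)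
      finally show ?thesis .
    qed
    have "\<bar>w' t * G t + w t * G' t\<bar> \<le> \<bar>w' t\<bar> * \<bar>G t\<bar> + \<bar>w t\<bar> * \<bar>G' t\<bar>"
      using abs_triangle_ineq[of "w' t * G t" "w t * G' t"] by (simp only: abs_mult)
    also have "\<dots> \<le> \<bar>w' t\<bar> * (\<bar>p t\<bar> / D t) + 1 * (c2 * j / D t)"
      unfolding aG using aG' wt less_imp_le[OF Dp[of t]] by (intro add_mono mult_mono) auto
    finally have m: "\<bar>w' t * G t + w t * G' t\<bar> \<le> (\<bar>w' t\<bar> * \<bar>p t\<bar> + c2 * j) / D t" by (simp add: add_divide_distrib)
    have n2: "norm (of_real (w' t * G t + w t * G' t) * esum Q (\<theta> t) / (2 * pi * \<i>)) \<le> (\<bar>w' t\<bar> * \<bar>p t\<bar> + c2 * j) / D t * k"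
    proof -
      have "norm (of_real (w' t * G t + w t * G' t) * esum Q (\<theta> t) / (2 * pi * \<i>))
          = \<bar>w' t * G t + w t * G' t\<bar> * norm (esum Q (\<theta> t)) / (2 * pi)"
        by (simp only: norm_divide norm_mult norm_of_real) (simp add: norm_mult)
      also have "\<dots> \<le> ((\<bar>w' t\<bar> * \<bar>p t\<bar> + c2 * j) / D t) * (2 * k) / (2 * 1)"
        unfolding k_def using m Q pi_gt3 Dp[of t] c2_pos j kern_pos[of Q "\<theta> t"]
        by (intro frac_le mult_mono norm_esum_le) auto
      also have "\<dots> = (\<bar>w' t\<bar> * \<bar>p t\<bar> + c2 * j) / D t * k" by simp
      finally show ?thesis .
    qed
    have "norm (A t) \<le> 4 * j / D t * k + (\<bar>w' t\<bar> * \<bar>p t\<bar> + c2 * j) / D t * k"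
      unfolding A_def using norm_triangle_ineq4 add_mono[OF n1 n2] by (rule order_trans)
    also have "\<dots> = ((4 + c2) * j + \<bar>w' t\<bar> * \<bar>p t\<bar>) / D t * k"
      by (simp add: add_divide_distrib distrib_right)
    finally show "norm (A t) \<le> ((4 + c2) * j + \<bar>w' t\<bar> * \<bar>p t\<bar>) / D t * kern Q (\<theta> t)" by (simp add: k_def)
  qed
  finally show ?thesis by (simp add: \<theta>_def p_def D_def L_def)
qed

text \<open>Convexity makes the phase increase away from \<open>t0\<close> on both sides, so
  \<open>near_one_side\<close> applies to the right half directly and to the left half after
  reflection, with the sign of the derivative reversed.\<close>

lemma stationary_integral:
  assumes Q: "0 < Q" and j: "0 < j" and r: "0 \<le> r" "c2 * j * r\<^sup>2 \<le> 1/2" and t0: "j * f' t0 = l"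
    and c3: "c3 = c1 * sqrt (2 / c2)"
  shows "integral {t0 - r..t0 + r} (\<lambda>t. j / ((j * f' t - l)\<^sup>2 + j / Q) * kern Q (j * f t - l * t))
     \<le> 2 * (8 / c1 + 8 / c3 ^ 3) * sqrt (Q / j) * kern Q (j * f t0 - l * t0)"
proof -
  define \<theta> where "\<theta> t = j * f t - l * t" for t
  define p where "p t = j * f' t - l" for t
  define g where "g t = j / ((p t)\<^sup>2 + j / Q) * kern Q (\<theta> t)" for t
  have den: "0 < x\<^sup>2 + j / Q" for x using j Q by (simp add: add_nonneg_pos)
  have d\<theta>: "(\<theta> has_real_derivative p t) (at t)" for t
    unfolding p_def \<theta>_def by (auto intro!: derivative_eq_intros deriv1)
  have cp: "continuous_on S p" and c\<theta>: "continuous_on S \<theta>" for S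
    unfolding p_def \<theta>_def by (intro continuous_intros cont0 cont1)+
  have cg: "continuous_on S g" for S
    unfolding g_def using den Q by (intro continuous_intros cp c\<theta>) (metis less_irrefl)
  have pd: "p t = j * (f' t - f' t0)" for t using t0 by (simp add: p_def algebra_simps)
  have R: "integral {0..r} (\<lambda>s. g (t0 + s)) \<le> (8 / c1 + 8 / c3 ^ 3) * sqrt (Q / j) * kern Q (\<theta> t0)"
  proof -
    have "integral {0..r} (\<lambda>s. j / ((p (t0 + s))\<^sup>2 + j / Q) * kern Q (\<theta> t0 + (\<theta> (t0 + s) - \<theta> t0)))
        \<le> (8 / c1 + 8 / c3 ^ 3) * sqrt (Q / j) * kern Q (\<theta> t0)"
    proof (rule near_one_side[OF c1_pos c12 Q j r _ _ _ _ _ c3])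
      fix s assume s: "s \<in> {0..r}"
      show "((\<lambda>s. \<theta> (t0 + s) - \<theta> t0) has_real_derivative p (t0 + s)) (at s)"
      proof -
        have "((\<lambda>s. \<theta> (t0 + s)) has_real_derivative p (t0 + s) * 1) (at s)"
          by (rule DERIV_chain2[OF d\<theta>]) (auto intro!: derivative_eq_intros)
        from DERIV_diff[OF this DERIV_const[of "\<theta> t0"]] show ?thesis by simp
      qed
      show "c1 * j * s \<le> p (t0 + s)"
        using mult_left_mono[OF f'_bounds(1)[of t0 "t0 + s"], of j] s j by (simp add: pd mult_ac)
      show "p (t0 + s) \<le> c2 * j * s"
        using mult_left_mono[OF f'_bounds(2)[of t0 "t0 + s"], of j] s j by (simp add: pd mult_ac)
    next
      show "continuous_on {0..r} (\<lambda>s. p (t0 + s))"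
        by (rule continuous_on_compose2[OF cp[of UNIV]]) (auto intro!: continuous_intros)
    qed simp
    then show ?thesis by (simp add: g_def)
  qed
  have Lf: "integral {0..r} (\<lambda>s. g (t0 - s)) \<le> (8 / c1 + 8 / c3 ^ 3) * sqrt (Q / j) * kern Q (\<theta> t0)"
  proof -
    have "integral {0..r} (\<lambda>s. j / ((- p (t0 - s))\<^sup>2 + j / Q) * kern Q (\<theta> t0 + (\<theta> (t0 - s) - \<theta> t0)))
        \<le> (8 / c1 + 8 / c3 ^ 3) * sqrt (Q / j) * kern Q (\<theta> t0)"
    proof (rule near_one_side[OF c1_pos c12 Q j r _ _ _ _ _ c3])
      fix s assume s: "s \<in> {0..r}"
      show "((\<lambda>s. \<theta> (t0 - s) - \<theta> t0) has_real_derivative - p (t0 - s)) (at s)"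
      proof -
        have "((\<lambda>s. \<theta> (t0 - s)) has_real_derivative p (t0 - s) * (- 1)) (at s)"
          by (rule DERIV_chain2[OF d\<theta>]) (auto intro!: derivative_eq_intros)
        from DERIV_diff[OF this DERIV_const[of "\<theta> t0"]] show ?thesis by simp
      qed
      show "c1 * j * s \<le> - p (t0 - s)"
        using mult_left_mono[OF f'_bounds(1)[of "t0 - s" t0], of j] s j by (simp add: pd algebra_simps)
      show "- p (t0 - s) \<le> c2 * j * s"
        using mult_left_mono[OF f'_bounds(2)[of "t0 - s" t0], of j] s j by (simp add: pd algebra_simps)
    next
      show "continuous_on {0..r} (\<lambda>s. - p (t0 - s))"
        by (intro continuous_on_minus continuous_on_compose2[OF cp[of UNIV]]) (auto intro!: continuous_intros)
    qed simp
    then show ?thesis by (simp add: g_def)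
  qed
  have "integral {t0..t0 + r} g = integral {0..r} (\<lambda>s. g (t0 + s))"
    using integral_shift[of 0 t0 r g] cg by (simp add: o_def add.commute)
  moreover have "integral {t0 - r..t0} g = integral {0..r} (\<lambda>s. g (t0 - s))"
  proof -
    have "integral {0..r} (\<lambda>s. g (t0 - s)) = integral {- r..0} (\<lambda>s. g (t0 + s))"
      using Henstock_Kurzweil_Integration.integral_reflect_real[of r 0 "\<lambda>s. g (t0 - s)"] by simp
    also have "\<dots> = integral {t0 - r..t0} g"
      using integral_shift[of "- r" t0 0 g] cg by (simp add: o_def add.commute)
    finally show ?thesis by simp
  qed
  moreover have "integral {t0 - r..t0} g + integral {t0..t0 + r} g = integral {t0 - r..t0 + r} g"
    using r(1) by (intro Henstock_Kurzweil_Integration.integral_combine integrable_continuous_interval cg) auto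
  ultimately have "integral {t0 - r..t0 + r} g \<le> 2 * ((8 / c1 + 8 / c3 ^ 3) * sqrt (Q / j) * kern Q (\<theta> t0))"
    using R Lf by linarith
  then show ?thesis by (simp only: g_def[abs_def] p_def \<theta>_def mult.assoc)
qed

end

section \<open>Sums over integer frequencies\<close>

lemma two_to_one_sum:
  fixes \<psi> :: "nat \<Rightarrow> real" and \<alpha> :: real
  assumes "finite \<Lambda>" "\<And>k. 0 \<le> \<psi> k" "\<And>l. l \<in> \<Lambda> \<Longrightarrow> nat \<lfloor>\<bar>\<alpha> - of_int l\<bar>\<rfloor> \<le> N"
  shows "(\<Sum>l\<in>\<Lambda>. \<psi> (nat \<lfloor>\<bar>\<alpha> - of_int l\<bar>\<rfloor>)) \<le> 2 * (\<Sum>k\<le>N. \<psi> k)"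
proof -
  have c: "card {l\<in>\<Lambda>. nat \<lfloor>\<bar>\<alpha> - of_int l\<bar>\<rfloor> = k} \<le> 2" for k
  proof -
    have "{l\<in>\<Lambda>. nat \<lfloor>\<bar>\<alpha> - of_int l\<bar>\<rfloor> = k} \<subseteq> {\<lfloor>\<alpha>\<rfloor> - int k, \<lceil>\<alpha>\<rceil> + int k}"
    proof
      fix l assume "l \<in> {l\<in>\<Lambda>. nat \<lfloor>\<bar>\<alpha> - of_int l\<bar>\<rfloor> = k}"
      then have "\<lfloor>\<bar>\<alpha> - of_int l\<bar>\<rfloor> = int k" by auto
      then have k: "real k \<le> \<bar>\<alpha> - of_int l\<bar>" "\<bar>\<alpha> - of_int l\<bar> < real k + 1" by linarith+
      show "l \<in> {\<lfloor>\<alpha>\<rfloor> - int k, \<lceil>\<alpha>\<rceil> + int k}"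
      proof (cases "of_int l \<le> \<alpha>")
        case True
        then have "\<lfloor>\<alpha>\<rfloor> = l + int k" using k by (intro floor_unique) auto
        then show ?thesis by simp
      next
        case False
        then have "\<lceil>\<alpha>\<rceil> = l - int k" using k by (intro ceiling_unique) auto
        then show ?thesis by simp
      qed
    qed
    then have "card {l\<in>\<Lambda>. nat \<lfloor>\<bar>\<alpha> - of_int l\<bar>\<rfloor> = k} \<le> card {\<lfloor>\<alpha>\<rfloor> - int k, \<lceil>\<alpha>\<rceil> + int k}"
      by (intro card_mono) auto
    also have "\<dots> \<le> 2" by (simp add: card_insert_if)
    finally show ?thesis .
  qed
  have "(\<Sum>l\<in>\<Lambda>. \<psi> (nat \<lfloor>\<bar>\<alpha> - of_int l\<bar>\<rfloor>)) = (\<Sum>k\<le>N. \<Sum>l\<in>{l\<in>\<Lambda>. nat \<lfloor>\<bar>\<alpha> - of_int l\<bar>\<rfloor> = k}. \<psi> (nat \<lfloor>\<bar>\<alpha> - of_int l\<bar>\<rfloor>))"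
    using assms(1,3) by (intro sum.group[symmetric]) auto
  also have "\<dots> = (\<Sum>k\<le>N. real (card {l\<in>\<Lambda>. nat \<lfloor>\<bar>\<alpha> - of_int l\<bar>\<rfloor> = k}) * \<psi> k)"
    by (intro sum.cong) auto
  also have "\<dots> \<le> (\<Sum>k\<le>N. 2 * \<psi> k)"
  proof (intro sum_mono mult_right_mono assms)
    fix k show "real (card {l\<in>\<Lambda>. nat \<lfloor>\<bar>\<alpha> - of_int l\<bar>\<rfloor> = k}) \<le> 2" using of_nat_mono[OF c[of k], where ?'a = real] by simp
  qed
  finally show ?thesis by (simp add: sum_distrib_left)
qed

text \<open>A Lorentzian of width \<open>y \<ge> 1\<close> sampled at integers behaves like its
  integral: at most two \<open>l\<close> share the same rounded-down distance to
  \<open>\<alpha>\<close>, and \<open>1 / (k + y)\<^sup>2\<close> is dominated by a telescoping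
  term.\<close>

lemma far_sum:
  fixes \<alpha> y :: real
  assumes "finite \<Lambda>" "y \<ge> 1"
  shows "(\<Sum>l\<in>\<Lambda>. 1 / ((\<alpha> - of_int l)\<^sup>2 + y\<^sup>2)) \<le> 8 / y"
proof -
  define N where "N = Max (insert 0 ((\<lambda>l. nat \<lfloor>\<bar>\<alpha> - of_int l\<bar>\<rfloor>) ` \<Lambda>))"
  have N: "nat \<lfloor>\<bar>\<alpha> - of_int l\<bar>\<rfloor> \<le> N" if "l \<in> \<Lambda>" for l using assms(1) that by (simp add: N_def)
  have "(\<Sum>l\<in>\<Lambda>. 1 / ((\<alpha> - of_int l)\<^sup>2 + y\<^sup>2)) \<le> (\<Sum>l\<in>\<Lambda>. 2 / (real (nat \<lfloor>\<bar>\<alpha> - of_int l\<bar>\<rfloor>) + y)\<^sup>2)"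
  proof (rule sum_mono)
    fix l
    define k where "k = real (nat \<lfloor>\<bar>\<alpha> - of_int l\<bar>\<rfloor>)"
    have k: "0 \<le> k" "k \<le> \<bar>\<alpha> - of_int l\<bar>" by (auto simp: k_def)
    have "(k + y)\<^sup>2 \<le> 2 * (k\<^sup>2 + y\<^sup>2)" using sum_squares_bound[of k y] by (simp add: power2_sum)
    also have "\<dots> \<le> 2 * ((\<alpha> - of_int l)\<^sup>2 + y\<^sup>2)" using power_mono[OF k(2,1), of 2] by simp
    finally have "(k + y)\<^sup>2 \<le> 2 * ((\<alpha> - of_int l)\<^sup>2 + y\<^sup>2)" .
    moreover have "0 < (k + y)\<^sup>2" "0 < (\<alpha> - of_int l)\<^sup>2 + y\<^sup>2" using k assms(2) by (auto simp: add_nonneg_pos)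
    ultimately show "1 / ((\<alpha> - of_int l)\<^sup>2 + y\<^sup>2) \<le> 2 / (real (nat \<lfloor>\<bar>\<alpha> - of_int l\<bar>\<rfloor>) + y)\<^sup>2"
      unfolding k_def[symmetric] by (simp add: field_simps)
  qed
  also have "\<dots> \<le> 2 * (\<Sum>k\<le>N. 2 / (real k + y)\<^sup>2)"
    using assms(1) N by (intro two_to_one_sum[where \<psi> = "\<lambda>k. 2 / (real k + y)\<^sup>2"]) auto
  also have "(\<Sum>k\<le>N. 2 / (real k + y)\<^sup>2) = 2 * (\<Sum>k\<le>N. 1 / (real k + y)\<^sup>2)" by (simp add: sum_distrib_left)
  also have "(\<Sum>k\<le>N. 1 / (real k + y)\<^sup>2) \<le> 1 / y\<^sup>2 + (1 / y - 1 / (real N + y))"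
  proof (induction N)
    case (Suc N)
    have "1 / (real (Suc N) + y)\<^sup>2 \<le> 1 / ((real N + y) * (real (Suc N) + y))"
      using assms(2) by (intro divide_left_mono) (auto simp: power2_eq_square intro!: mult_right_mono mult_pos_pos)
    also have "\<dots> = 1 / (real N + y) - 1 / (real (Suc N) + y)" using assms(2) by (simp add: field_simps)
    finally show ?case using Suc by simp
  qed simp
  also have "1 / y\<^sup>2 + (1 / y - 1 / (real N + y)) \<le> 1 / y + 1 / y"
  proof -
    have "1 / y\<^sup>2 \<le> 1 / y" using assms(2) by (intro divide_left_mono) (auto simp: power2_eq_square)
    moreover have "0 \<le> 1 / (real N + y)" using assms(2) by simp
    moreover have "a \<le> b \<Longrightarrow> 0 \<le> d \<Longrightarrow> a + (b - d) \<le> b + b" for a b d :: real by simp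
    ultimately show ?thesis by blast
  qed
  finally show ?thesis by simp
qed

lemma log_sum:
  fixes \<alpha> L :: real
  assumes "finite \<Lambda>" "L > 0" "N \<ge> 1" "\<And>l. l \<in> \<Lambda> \<Longrightarrow> \<bar>\<alpha> - of_int l\<bar> \<le> real N"
  shows "(\<Sum>l\<in>\<Lambda>. \<bar>\<alpha> - of_int l\<bar> / ((\<alpha> - of_int l)\<^sup>2 + L)) \<le> 1 / sqrt L + 2 * (1 + ln (real N))"
proof -
  \<comment> \<open>At rounded-down distance 0 the summand is bounded by its maximum over all
    distances, \<open>1 / (2 * sqrt L)\<close>. This term stays separate because \<open>L\<close>,
    later \<open>j / Q\<close>, can be far below 1.\<close>
  define \<psi> where "\<psi> k = (if k = 0 then 1 / (2 * sqrt L) else 1 / real k)" for k :: nat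
  have "(\<Sum>l\<in>\<Lambda>. \<bar>\<alpha> - of_int l\<bar> / ((\<alpha> - of_int l)\<^sup>2 + L)) \<le> (\<Sum>l\<in>\<Lambda>. \<psi> (nat \<lfloor>\<bar>\<alpha> - of_int l\<bar>\<rfloor>))"
  proof (rule sum_mono)
    fix l
    define x where "x = \<bar>\<alpha> - of_int l\<bar>"
    have x: "0 \<le> x" "(\<alpha> - of_int l)\<^sup>2 = x\<^sup>2" by (auto simp: x_def)
    have p: "0 < x\<^sup>2 + L" using assms(2) by (simp add: add_nonneg_pos)
    have "x / (x\<^sup>2 + L) \<le> \<psi> (nat \<lfloor>x\<rfloor>)"
    proof (cases "nat \<lfloor>x\<rfloor> = 0")
      case True
      have "2 * x * sqrt L \<le> x\<^sup>2 + L" using sum_squares_bound[of x "sqrt L"] assms(2) by simp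
      then have "x / (x\<^sup>2 + L) \<le> 1 / (2 * sqrt L)" using p assms(2) by (simp add: field_simps)
      then show ?thesis using True by (simp add: \<psi>_def)
    next
      case False
      then have k: "real (nat \<lfloor>x\<rfloor>) \<le> x" "0 < real (nat \<lfloor>x\<rfloor>)" using x by auto
      then have "x / (x\<^sup>2 + L) \<le> x / x\<^sup>2" using assms(2) by (intro divide_left_mono) (auto intro!: mult_pos_pos add_pos_pos)
      also have "\<dots> = 1 / x" by (simp add: power2_eq_square)
      also have "\<dots> \<le> 1 / real (nat \<lfloor>x\<rfloor>)" using k by (intro divide_left_mono) auto
      finally show ?thesis using False by (simp add: \<psi>_def)
    qed
    then show "\<bar>\<alpha> - of_int l\<bar> / ((\<alpha> - of_int l)\<^sup>2 + L) \<le> \<psi> (nat \<lfloor>\<bar>\<alpha> - of_int l\<bar>\<rfloor>)"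
      unfolding x(2) by (simp add: x_def)
  qed
  also have "\<dots> \<le> 2 * (\<Sum>k\<le>N. \<psi> k)"
  proof (rule two_to_one_sum[OF assms(1)])
    show "0 \<le> \<psi> k" for k using assms(2) by (simp add: \<psi>_def)
    fix l assume "l \<in> \<Lambda>"
    then show "nat \<lfloor>\<bar>\<alpha> - of_int l\<bar>\<rfloor> \<le> N" using assms(4)[of l] by linarith
  qed
  also have "(\<Sum>k\<le>N. \<psi> k) = \<psi> 0 + (\<Sum>k=1..N. \<psi> k)"
    by (simp add: sum.atMost_shift sum.atLeast1_atMost_eq flip: atMost_atLeast0)
  also have "(\<Sum>k=1..N. \<psi> k) = (\<Sum>k=1..N. 1 / real k)" by (intro sum.cong) (auto simp: \<psi>_def)
  also have "\<dots> \<le> 1 + ln (real N)" by (rule harmonic_le[OF assms(3)])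
  finally show ?thesis by (simp add: \<psi>_def)
qed

context convex_curve begin

text \<open>Near its stationary point each frequency contributes the kernel at a point of the dual
  curve. Elsewhere \<open>kern\<close> is replaced by \<open>Q\<close>, and for each fixed
  \<open>t\<close> the sum over \<open>l\<close> is taken inside the integral. The part with
  \<open>w'\<close> is treated in the same way and is the only one in which the range of frequencies
  matters, through the logarithm of \<open>N\<close>.\<close>

lemma stationary_sum:
  fixes w w' :: "real \<Rightarrow> real" and Q :: nat and \<Lambda> :: "int set"
  assumes I: "\<eta> \<le> \<xi>" and Q: "0 < Q" and j: "1 \<le> j" and \<Lambda>: "finite \<Lambda>"
    and w: "\<And>t. t \<in> {\<eta>..\<xi>} \<Longrightarrow> (w has_real_derivative w' t) (at t within {\<eta>..\<xi>})" "continuous_on {\<eta>..\<xi>} w'"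
      "w \<eta> = 0" "w \<xi> = 0" "\<And>t. t \<in> {\<eta>..\<xi>} \<Longrightarrow> 0 \<le> w t \<and> w t \<le> 1" "integral {\<eta>..\<xi>} (\<lambda>t. \<bar>w' t\<bar>) \<le> 2"
    and N: "N \<ge> 1" "\<And>t l. t \<in> {\<eta>..\<xi>} \<Longrightarrow> l \<in> \<Lambda> \<Longrightarrow> \<bar>j * f' t - of_int l\<bar> \<le> real N"
    and c3: "c3 = c1 * sqrt (2 / c2)" and c4: "c4 = min 1 (1 / (2 * c2))"
  shows "(\<Sum>l\<in>\<Lambda>. norm (integral {\<eta>..\<xi>} (\<lambda>t. of_real (w t) * esum1 Q (j * f t - of_int l * t))))
    \<le> (4 + c2) * (2 * (8 / c1 + 8 / c3 ^ 3) * sqrt (Q / j)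
          * (\<Sum>l\<in>{l\<in>\<Lambda>. \<eta> - 1 \<le> \<tau> (of_int l / j) \<and> \<tau> (of_int l / j) \<le> \<xi> + 1}. kern Q (j * legendre (of_int l / j)))
        + (\<xi> - \<eta>) * ((1 + 1 / (c1 * c4)\<^sup>2) * Q * (8 * sqrt j)))
      + 2 * (Q * (sqrt (Q / j) + 2 * (1 + ln (real N))))"
proof -
  define p where "p l t = j * f' t - of_int l" for l t
  define \<theta> where "\<theta> l t = j * f t - of_int l * t" for l t
  define L where "L = j / real Q"
  define D where "D l t = (p l t)\<^sup>2 + L" for l t
  define a where "a l t = j / D l t * kern Q (\<theta> l t)" for l t
  have jp: "j > 0" using j by simp
  have Qp: "real Q > 0" using Q by simp
  have Lp: "L > 0" using jp Q by (simp add: L_def)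
  have Dp: "D l t > 0" for l t using Lp by (simp add: D_def add_nonneg_pos)
  have c4p: "c4 > 0" "c4 \<le> 1" "c2 * c4 \<le> 1/2"
  proof -
    show "c4 > 0" "c4 \<le> 1" using c2_pos by (auto simp: c4)
    have "c2 * c4 \<le> c2 * (1 / (2 * c2))" using c2_pos by (intro mult_left_mono) (auto simp: c4)
    then show "c2 * c4 \<le> 1/2" using c2_pos by simp
  qed
  \<comment> \<open>The stationary window has radius of order \<open>1 / sqrt j\<close>; the
    constant \<open>c4\<close> keeps the change of the phase on it small, as required in
    \<open>stationary_integral\<close>.\<close>
  define r where "r = c4 / sqrt j"
  have r: "r > 0" "r \<le> 1" using c4p j by (auto simp: r_def divide_le_eq intro: order_trans)
  have r2: "c2 * j * r\<^sup>2 \<le> 1/2"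
  proof -
    have "j * r\<^sup>2 = c4\<^sup>2" using jp by (simp add: r_def power_divide)
    then have "c2 * j * r\<^sup>2 = (c2 * c4) * c4" by (simp add: mult.assoc power2_eq_square)
    also have "\<dots> \<le> (1/2) * 1" using c4p by (intro mult_mono) auto
    finally show ?thesis by simp
  qed
  have cp: "continuous_on S (p l)" and c\<theta>: "continuous_on S (\<theta> l)" for S l
    unfolding p_def \<theta>_def by (intro continuous_intros cont0 cont1)+
  have cD: "continuous_on S (D l)" for S l unfolding D_def by (intro continuous_intros cp)
  have ca: "continuous_on S (a l)" for S l
    unfolding a_def using Dp Q by (intro continuous_intros cD c\<theta>) (auto, metis less_irrefl)
  have a0: "0 \<le> a l t" for l t unfolding a_def using jp Dp[of l t] kern_pos[OF Qp, of "\<theta> l t"] by simp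
  \<comment> \<open>Outside the window \<open>(p l t)\<^sup>2\<close> is at least
    \<open>(c1 * c4)\<^sup>2 * j\<close>, so the regularisation \<open>j / Q\<close> can be
    exchanged for \<open>j\<close> at the cost of the factor \<open>M\<close>; then
    \<open>far_sum\<close> applies with \<open>y = sqrt j\<close>.\<close>
  define M where "M = 1 + 1 / (c1 * c4)\<^sup>2"
  have M0: "M \<ge> 0" by (simp add: M_def)
  define near where "near l = {\<tau> (of_int l / j) - r..\<tau> (of_int l / j) + r}" for l :: int
  define C where "C = 2 * (8 / c1 + 8 / c3 ^ 3)"
  have c3p: "c3 > 0" using c1_pos c2_pos by (simp add: c3)
  have C0: "C \<ge> 0" using c1_pos c3p by (simp add: C_def)
  \<comment> \<open>As \<open>r \<le> 1\<close>, the window of a frequency meets the interval only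
    if the stationary point is within distance 1 of it.\<close>
  define Z where "Z = {l\<in>\<Lambda>. \<eta> - 1 \<le> \<tau> (of_int l / j) \<and> \<tau> (of_int l / j) \<le> \<xi> + 1}"
  have finZ: "finite Z" using \<Lambda> by (simp add: Z_def)
  have far: "a l t \<le> (if t \<in> near l then a l t else 0) + M * Q * (j / ((p l t)\<^sup>2 + j))" for l t
  proof -
    have pos: "0 < (p l t)\<^sup>2 + j" using jp by (simp add: add_nonneg_pos)
    show ?thesis
    proof (cases "t \<in> near l")
      case True
      have "0 \<le> M * Q * (j / ((p l t)\<^sup>2 + j))" using M0 Qp jp pos by simp
      then show ?thesis using True by simp
    next
      case False
      define t0 where "t0 = \<tau> (of_int l / j)"
      have pt: "p l t = j * (f' t - f' t0)" using jp by (simp add: p_def t0_def right_diff_distrib)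
      have "c1 * r \<le> \<bar>f' t - f' t0\<bar>"
      proof -
        consider "t0 + r < t" | "t < t0 - r" using False by (auto simp: near_def t0_def not_le)
        then show ?thesis
        proof cases
          case 1
          have "c1 * r \<le> c1 * (t - t0)" using 1 c1_pos by (intro mult_left_mono) auto
          also have "\<dots> \<le> f' t - f' t0" using 1 r by (intro f'_bounds) auto
          finally show ?thesis by simp
        next
          case 2
          have "c1 * r \<le> c1 * (t0 - t)" using 2 c1_pos by (intro mult_left_mono) auto
          also have "\<dots> \<le> f' t0 - f' t" using 2 r by (intro f'_bounds) auto
          finally show ?thesis by simp
        qed
      qed
      then have "(j * (c1 * r))\<^sup>2 \<le> (j * \<bar>f' t - f' t0\<bar>)\<^sup>2"
        using jp c1_pos r by (intro power_mono mult_left_mono) auto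
      then have "(j * (c1 * r))\<^sup>2 \<le> (p l t)\<^sup>2" by (simp add: pt power_mult_distrib)
      moreover have "(j * (c1 * r))\<^sup>2 = (c1 * c4)\<^sup>2 * j"
        using jp by (simp add: r_def power_mult_distrib power_divide power2_eq_square)
      ultimately have P: "(c1 * c4)\<^sup>2 * j \<le> (p l t)\<^sup>2" by simp
      have cc: "0 < (c1 * c4)\<^sup>2" using c1_pos c4p by simp
      have Pp: "0 < (p l t)\<^sup>2" using P cc jp by (smt (verit) mult_pos_pos)
      have "j \<le> (p l t)\<^sup>2 / (c1 * c4)\<^sup>2" using P cc by (simp add: pos_le_divide_eq mult.commute)
      then have "(p l t)\<^sup>2 + j \<le> M * (p l t)\<^sup>2" by (simp add: M_def distrib_right)
      then have "j / D l t \<le> M * (j / ((p l t)\<^sup>2 + j))"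
      proof -
        assume le: "(p l t)\<^sup>2 + j \<le> M * (p l t)\<^sup>2"
        have "j / D l t \<le> j / (p l t)\<^sup>2"
          using jp Lp Pp Dp[of l t] by (intro divide_left_mono) (auto simp: D_def)
        also have "\<dots> \<le> M * (j / ((p l t)\<^sup>2 + j))"
        proof -
          have "j * ((p l t)\<^sup>2 + j) \<le> j * (M * (p l t)\<^sup>2)" using le jp by (intro mult_left_mono) auto
          then show ?thesis using Pp pos by (simp add: divide_simps mult_ac)
        qed
        finally show ?thesis .
      qed
      then have "a l t \<le> (M * (j / ((p l t)\<^sup>2 + j))) * Q"
        unfolding a_def using kern_le[OF Qp] kern_pos[OF Qp, of "\<theta> l t"] M0 jp pos by (intro mult_mono) auto
      then show ?thesis using False by (simp add: mult_ac)
    qed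
  qed
  have nearint: "integral {\<eta>..\<xi>} (\<lambda>t. if t \<in> near l then a l t else 0)
      \<le> (if l \<in> Z then C * sqrt (Q / j) * kern Q (j * legendre (of_int l / j)) else 0)" if l: "l \<in> \<Lambda>" for l
  proof -
    define t0 where "t0 = \<tau> (of_int l / j)"
    have e: "integral {\<eta>..\<xi>} (\<lambda>t. if t \<in> near l then a l t else 0) = integral (near l \<inter> {\<eta>..\<xi>}) (a l)"
      by (rule Henstock_Kurzweil_Integration.integral_restrict_Int)
    show ?thesis
    proof (cases "l \<in> Z")
      case True
      have "integral (near l \<inter> {\<eta>..\<xi>}) (a l) \<le> integral (near l) (a l)"
        unfolding near_def Int_atLeastAtMost
        by (intro integral_subset_le integrable_continuous_interval ca) (auto simp: a0)
      also have "\<dots> \<le> C * sqrt (Q / j) * kern Q (j * f t0 - of_int l * t0)"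
        unfolding C_def near_def t0_def[symmetric] a_def D_def p_def \<theta>_def L_def
        using r by (intro stationary_integral[OF Qp jp _ r2 _ c3]) (use jp in \<open>auto simp: t0_def\<close>)
      also have "j * f t0 - of_int l * t0 = - (j * legendre (of_int l / j))"
        using jp by (simp add: legendre_def t0_def algebra_simps)
      also have "kern Q (- (j * legendre (of_int l / j))) = kern Q (j * legendre (of_int l / j))"
        unfolding kern_def dist_int_minus ..
      finally show ?thesis using True e by simp
    next
      case False
      have "near l \<inter> {\<eta>..\<xi>} = {}" using False r l by (auto simp: Z_def near_def)
      then show ?thesis using False e by simp
    qed
  qed
  have iq: "(\<lambda>t. if t \<in> near l then a l t else 0) integrable_on {\<eta>..\<xi>}" for l
    unfolding integrable_restrict_Int near_def Int_atLeastAtMost by (intro integrable_continuous_interval ca)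
  have cfar: "continuous_on {\<eta>..\<xi>} (\<lambda>t. j / ((p l t)\<^sup>2 + j))" for l
  proof -
    have "(p l t)\<^sup>2 + j \<noteq> 0" for t using jp by (smt (verit) zero_le_power2)
    then show ?thesis by (intro continuous_intros cp) auto
  qed
  have Sa: "(\<Sum>l\<in>\<Lambda>. integral {\<eta>..\<xi>} (a l)) \<le> C * sqrt (Q / j) * (\<Sum>l\<in>Z. kern Q (j * legendre (of_int l / j)))
        + (\<xi> - \<eta>) * (M * Q * (8 * sqrt j))"
  proof -
    have "(\<Sum>l\<in>\<Lambda>. integral {\<eta>..\<xi>} (a l))
        \<le> (\<Sum>l\<in>\<Lambda>. (if l \<in> Z then C * sqrt (Q / j) * kern Q (j * legendre (of_int l / j)) else 0)
           + integral {\<eta>..\<xi>} (\<lambda>t. M * Q * (j / ((p l t)\<^sup>2 + j))))"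
    proof (rule sum_mono)
      fix l assume l: "l \<in> \<Lambda>"
      have if': "(\<lambda>t. M * Q * (j / ((p l t)\<^sup>2 + j))) integrable_on {\<eta>..\<xi>}"
        by (intro integrable_continuous_interval continuous_on_mult continuous_on_const cfar)
      have "integral {\<eta>..\<xi>} (a l) \<le> integral {\<eta>..\<xi>} (\<lambda>t. (if t \<in> near l then a l t else 0) + M * Q * (j / ((p l t)\<^sup>2 + j)))"
        by (intro integral_le integrable_add iq if' far integrable_continuous_interval ca)
      also have "\<dots> = integral {\<eta>..\<xi>} (\<lambda>t. if t \<in> near l then a l t else 0) + integral {\<eta>..\<xi>} (\<lambda>t. M * Q * (j / ((p l t)\<^sup>2 + j)))"
        by (rule Henstock_Kurzweil_Integration.integral_add[OF iq if'])
      finally show "integral {\<eta>..\<xi>} (a l) \<le> (if l \<in> Z then C * sqrt (Q / j) * kern Q (j * legendre (of_int l / j)) else 0)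
           + integral {\<eta>..\<xi>} (\<lambda>t. M * Q * (j / ((p l t)\<^sup>2 + j)))" using nearint[OF l] by linarith
    qed
    also have "\<dots> = (\<Sum>l\<in>Z. C * sqrt (Q / j) * kern Q (j * legendre (of_int l / j)))
        + (\<Sum>l\<in>\<Lambda>. integral {\<eta>..\<xi>} (\<lambda>t. M * Q * (j / ((p l t)\<^sup>2 + j))))"
    proof -
      have "{l\<in>\<Lambda>. l \<in> Z} = Z" by (auto simp: Z_def)
      then show ?thesis using \<Lambda> by (simp add: sum.distrib sum.inter_filter[symmetric])
    qed
    also have "(\<Sum>l\<in>\<Lambda>. integral {\<eta>..\<xi>} (\<lambda>t. M * Q * (j / ((p l t)\<^sup>2 + j))))
        = integral {\<eta>..\<xi>} (\<lambda>t. \<Sum>l\<in>\<Lambda>. M * Q * (j / ((p l t)\<^sup>2 + j)))"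
      using \<Lambda> by (intro Henstock_Kurzweil_Integration.integral_sum[symmetric] integrable_continuous_interval continuous_on_mult continuous_on_const cfar)
    also have "\<dots> \<le> integral {\<eta>..\<xi>} (\<lambda>t. M * Q * (8 * sqrt j))"
    proof (rule integral_le)
      show "(\<lambda>t. \<Sum>l\<in>\<Lambda>. M * Q * (j / ((p l t)\<^sup>2 + j))) integrable_on {\<eta>..\<xi>}"
        by (intro integrable_continuous_interval continuous_on_sum continuous_on_mult continuous_on_const cfar)
      fix t assume "t \<in> {\<eta>..\<xi>}"
      have "(\<Sum>l\<in>\<Lambda>. 1 / ((j * f' t - of_int l)\<^sup>2 + (sqrt j)\<^sup>2)) \<le> 8 / sqrt j"
        using \<Lambda> j by (intro far_sum) auto
      then have "M * Q * (j * (\<Sum>l\<in>\<Lambda>. 1 / ((j * f' t - of_int l)\<^sup>2 + (sqrt j)\<^sup>2))) \<le> M * Q * (j * (8 / sqrt j))"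
        using M0 jp by (intro mult_left_mono) auto
      also have "j * (8 / sqrt j) = 8 * sqrt j"
      proof -
        have "x * x * (8 / x) = 8 * x" for x :: real by simp
        from this[of "sqrt j"] show ?thesis using jp by simp
      qed
      finally show "(\<Sum>l\<in>\<Lambda>. M * Q * (j / ((p l t)\<^sup>2 + j))) \<le> M * Q * (8 * sqrt j)"
        using jp by (simp add: p_def sum_distrib_left)
    qed auto
    also have "\<dots> = (\<xi> - \<eta>) * (M * Q * (8 * sqrt j))" using I by simp
    finally show ?thesis by (simp add: sum_distrib_left)
  qed
  define b where "b l t = \<bar>w' t\<bar> * (Q * (\<bar>p l t\<bar> / D l t))" for l t
  have cb: "continuous_on {\<eta>..\<xi>} (b l)" for l
    unfolding b_def using Dp by (intro continuous_intros w(2) cp cD) (auto, metis less_irrefl)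
  have Sb: "(\<Sum>l\<in>\<Lambda>. integral {\<eta>..\<xi>} (b l)) \<le> 2 * (Q * (sqrt (Q / j) + 2 * (1 + ln (real N))))"
  proof -
    define E where "E = Q * (sqrt (Q / j) + 2 * (1 + ln (real N)))"
    have E0: "E \<ge> 0" using N(1) jp by (simp add: E_def)
    have "(\<Sum>l\<in>\<Lambda>. integral {\<eta>..\<xi>} (b l)) = integral {\<eta>..\<xi>} (\<lambda>t. \<Sum>l\<in>\<Lambda>. b l t)"
      using \<Lambda> by (intro Henstock_Kurzweil_Integration.integral_sum[symmetric] integrable_continuous_interval cb)
    also have "\<dots> \<le> integral {\<eta>..\<xi>} (\<lambda>t. \<bar>w' t\<bar> * E)"
    proof (rule integral_le)
      show "(\<lambda>t. \<Sum>l\<in>\<Lambda>. b l t) integrable_on {\<eta>..\<xi>}" by (intro integrable_continuous_interval continuous_on_sum cb)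
      show "(\<lambda>t. \<bar>w' t\<bar> * E) integrable_on {\<eta>..\<xi>}" by (intro integrable_continuous_interval continuous_intros w(2))
      fix t assume t: "t \<in> {\<eta>..\<xi>}"
      have "(\<Sum>l\<in>\<Lambda>. \<bar>p l t\<bar> / D l t) \<le> 1 / sqrt L + 2 * (1 + ln (real N))"
        unfolding p_def D_def using N(2)[OF t] by (intro log_sum \<Lambda> Lp N(1)) auto
      also have "1 / sqrt L = sqrt (Q / j)" using jp Qp by (simp add: L_def real_sqrt_divide)
      finally have "\<bar>w' t\<bar> * (Q * (\<Sum>l\<in>\<Lambda>. \<bar>p l t\<bar> / D l t)) \<le> \<bar>w' t\<bar> * E"
        unfolding E_def by (intro mult_left_mono) auto
      then show "(\<Sum>l\<in>\<Lambda>. b l t) \<le> \<bar>w' t\<bar> * E" by (simp add: b_def sum_distrib_left)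
    qed
    also have "\<dots> = integral {\<eta>..\<xi>} (\<lambda>t. \<bar>w' t\<bar>) * E" by simp
    also have "\<dots> \<le> 2 * E" using w(6) E0 by (intro mult_right_mono)
    finally show ?thesis by (simp add: E_def)
  qed
  have "(\<Sum>l\<in>\<Lambda>. norm (integral {\<eta>..\<xi>} (\<lambda>t. of_real (w t) * esum1 Q (j * f t - of_int l * t))))
      \<le> (\<Sum>l\<in>\<Lambda>. (4 + c2) * integral {\<eta>..\<xi>} (a l) + integral {\<eta>..\<xi>} (b l))"
  proof (rule sum_mono)
    fix l assume "l \<in> \<Lambda>"
    have "norm (integral {\<eta>..\<xi>} (\<lambda>t. of_real (w t) * esum1 Q (j * f t - of_int l * t)))
      \<le> integral {\<eta>..\<xi>} (\<lambda>t. ((4 + c2) * j + \<bar>w' t\<bar> * \<bar>p l t\<bar>) / D l t * kern Q (\<theta> l t))"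
      unfolding p_def D_def L_def \<theta>_def by (rule weighted_integral_bound[OF I Q jp w(1-5)])
    also have "\<dots> \<le> integral {\<eta>..\<xi>} (\<lambda>t. (4 + c2) * a l t + b l t)"
    proof (rule integral_le)
      show "(\<lambda>t. ((4 + c2) * j + \<bar>w' t\<bar> * \<bar>p l t\<bar>) / D l t * kern Q (\<theta> l t)) integrable_on {\<eta>..\<xi>}"
        using Dp Q by (intro integrable_continuous_interval continuous_intros cp cD c\<theta> w(2)) (auto, metis less_irrefl)
      show "(\<lambda>t. (4 + c2) * a l t + b l t) integrable_on {\<eta>..\<xi>}"
        by (intro integrable_continuous_interval continuous_intros ca cb)
      fix t assume "t \<in> {\<eta>..\<xi>}"
      have "((4 + c2) * j + \<bar>w' t\<bar> * \<bar>p l t\<bar>) / D l t * kern Q (\<theta> l t)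
          = (4 + c2) * a l t + \<bar>w' t\<bar> * (\<bar>p l t\<bar> / D l t) * kern Q (\<theta> l t)"
        by (simp add: a_def add_divide_distrib distrib_right)
      also have "\<dots> \<le> (4 + c2) * a l t + \<bar>w' t\<bar> * (\<bar>p l t\<bar> / D l t) * Q"
        using Dp[of l t] kern_le[OF Qp] by (intro add_left_mono mult_left_mono) auto
      finally show "((4 + c2) * j + \<bar>w' t\<bar> * \<bar>p l t\<bar>) / D l t * kern Q (\<theta> l t) \<le> (4 + c2) * a l t + b l t"
        by (simp add: b_def mult_ac)
    qed
    also have "\<dots> = (4 + c2) * integral {\<eta>..\<xi>} (a l) + integral {\<eta>..\<xi>} (b l)"
      by (subst Henstock_Kurzweil_Integration.integral_add)
         (auto intro!: integrable_continuous_interval continuous_intros ca cb)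
    finally show "norm (integral {\<eta>..\<xi>} (\<lambda>t. of_real (w t) * esum1 Q (j * f t - of_int l * t)))
      \<le> (4 + c2) * integral {\<eta>..\<xi>} (a l) + integral {\<eta>..\<xi>} (b l)" .
  qed
  also have "\<dots> = (4 + c2) * (\<Sum>l\<in>\<Lambda>. integral {\<eta>..\<xi>} (a l)) + (\<Sum>l\<in>\<Lambda>. integral {\<eta>..\<xi>} (b l))"
    by (simp only: sum.distrib sum_distrib_left)
  also have "\<dots> \<le> (4 + c2) * (C * sqrt (Q / j) * (\<Sum>l\<in>Z. kern Q (j * legendre (of_int l / j)))
        + (\<xi> - \<eta>) * (M * Q * (8 * sqrt j))) + 2 * (Q * (sqrt (Q / j) + 2 * (1 + ln (real N))))"
    using c2_pos by (intro add_mono mult_left_mono Sa Sb) auto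
  finally show ?thesis unfolding C_def M_def Z_def .
qed

end

section \<open>The cutoff and the passage to oscillatory integrals\<close>

lemma lipschitz_zero_extension:
  fixes H :: "real \<Rightarrow> complex"
  assumes "\<eta> \<le> \<xi>" "0 \<le> L" "H \<eta> = 0" "H \<xi> = 0"
    and lip: "\<And>s t. s \<in> {\<eta>..\<xi>} \<Longrightarrow> t \<in> {\<eta>..\<xi>} \<Longrightarrow> norm (H s - H t) \<le> L * \<bar>s - t\<bar>"
  shows "norm ((if s \<in> {\<eta>..\<xi>} then H s else 0) - (if t \<in> {\<eta>..\<xi>} then H t else 0)) \<le> L * \<bar>s - t\<bar>"
proof -
  have one: "norm (H s) \<le> L * \<bar>s - t\<bar>" if "s \<in> {\<eta>..\<xi>}" "t \<notin> {\<eta>..\<xi>}" for s t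
  proof -
    have "t < \<eta> \<or> \<xi> < t" using that(2) by auto
    then consider "t < \<eta>" | "\<xi> < t" by blast
    then show ?thesis
    proof cases
      case 1
      have "norm (H s) \<le> L * \<bar>s - \<eta>\<bar>" using lip[of s \<eta>] that assms by simp
      also have "\<dots> \<le> L * \<bar>s - t\<bar>" using 1 that assms by (intro mult_left_mono) auto
      finally show ?thesis .
    next
      case 2
      have "norm (H s) \<le> L * \<bar>s - \<xi>\<bar>" using lip[of s \<xi>] that assms by simp
      also have "\<dots> \<le> L * \<bar>s - t\<bar>" using 2 that assms by (intro mult_left_mono) auto
      finally show ?thesis .
    qed
  qed
  show ?thesis
    using lip[of s t] one[of s t] one[of t s] assms(2) by (auto simp: abs_minus_commute)
qed

text \<open>It vanishes at both endpoints, rises to the midpoint and falls again, so its total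
  variation is at most 2 for every \<open>\<kappa>\<close>; this controls the terms with the
  derivative of the weight. A rational function keeps that derivative explicit and
  continuous.\<close>

definition cutoff :: "real \<Rightarrow> real \<Rightarrow> real \<Rightarrow> real \<Rightarrow> real" where
  "cutoff \<eta> \<xi> \<kappa> t = (t - \<eta>) * (\<xi> - t) / ((t - \<eta>) * (\<xi> - t) + \<kappa>)"

definition cutoff' :: "real \<Rightarrow> real \<Rightarrow> real \<Rightarrow> real \<Rightarrow> real" where
  "cutoff' \<eta> \<xi> \<kappa> t = \<kappa> * (\<eta> + \<xi> - 2 * t) / ((t - \<eta>) * (\<xi> - t) + \<kappa>)\<^sup>2"

lemma cutoff_props:
  assumes "\<eta> \<le> \<xi>" "0 < \<kappa>"
  shows "t \<in> {\<eta>..\<xi>} \<Longrightarrow> (cutoff \<eta> \<xi> \<kappa> has_real_derivative cutoff' \<eta> \<xi> \<kappa> t) (at t within S)"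
    and "continuous_on {\<eta>..\<xi>} (cutoff' \<eta> \<xi> \<kappa>)"
    and "cutoff \<eta> \<xi> \<kappa> \<eta> = 0" "cutoff \<eta> \<xi> \<kappa> \<xi> = 0"
    and "t \<in> {\<eta>..\<xi>} \<Longrightarrow> 0 \<le> cutoff \<eta> \<xi> \<kappa> t \<and> cutoff \<eta> \<xi> \<kappa> t \<le> 1"
    and "integral {\<eta>..\<xi>} (\<lambda>t. \<bar>cutoff' \<eta> \<xi> \<kappa> t\<bar>) \<le> 2"
    and "t \<in> {\<eta>..\<xi>} \<Longrightarrow> \<bar>cutoff' \<eta> \<xi> \<kappa> t\<bar> \<le> (\<xi> - \<eta>) / \<kappa>"
proof -
  have u: "0 \<le> (t - \<eta>) * (\<xi> - t)" if "t \<in> {\<eta>..\<xi>}" for t using that by auto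
  have pos: "0 < (t - \<eta>) * (\<xi> - t) + \<kappa>" if "t \<in> {\<eta>..\<xi>}" for t using u[OF that] assms by simp
  show der: "(cutoff \<eta> \<xi> \<kappa> has_real_derivative cutoff' \<eta> \<xi> \<kappa> t) (at t within S)" if t: "t \<in> {\<eta>..\<xi>}" for t S
  proof -
    have du: "((\<lambda>t. (t - \<eta>) * (\<xi> - t)) has_real_derivative (\<eta> + \<xi> - 2 * t)) (at t within S)"
      by (auto intro!: derivative_eq_intros simp: algebra_simps)
    have du': "((\<lambda>t. (t - \<eta>) * (\<xi> - t) + \<kappa>) has_real_derivative (\<eta> + \<xi> - 2 * t)) (at t within S)"
      using DERIV_add[OF du DERIV_const[of \<kappa>]] by simp
    have "((\<lambda>t. (t - \<eta>) * (\<xi> - t) / ((t - \<eta>) * (\<xi> - t) + \<kappa>)) has_real_derivative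
        ((\<eta> + \<xi> - 2 * t) * ((t - \<eta>) * (\<xi> - t) + \<kappa>) - (t - \<eta>) * (\<xi> - t) * (\<eta> + \<xi> - 2 * t))
          / (((t - \<eta>) * (\<xi> - t) + \<kappa>) * ((t - \<eta>) * (\<xi> - t) + \<kappa>))) (at t within S)"
      using pos[OF t] by (intro DERIV_divide du du') simp
    moreover have "(d * (x + \<kappa>) - x * d) / ((x + \<kappa>) * (x + \<kappa>)) = \<kappa> * d / (x + \<kappa>)\<^sup>2" for d x
      by (simp add: power2_eq_square algebra_simps)
    ultimately show ?thesis by (simp only: cutoff_def[abs_def] cutoff'_def)
  qed
  show c': "continuous_on {\<eta>..\<xi>} (cutoff' \<eta> \<xi> \<kappa>)"
    unfolding cutoff'_def[abs_def] using pos by (intro continuous_intros) (force dest: pos)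
  show ends: "cutoff \<eta> \<xi> \<kappa> \<eta> = 0" "cutoff \<eta> \<xi> \<kappa> \<xi> = 0" by (simp_all add: cutoff_def)
  show w01: "0 \<le> cutoff \<eta> \<xi> \<kappa> t \<and> cutoff \<eta> \<xi> \<kappa> t \<le> 1" if t: "t \<in> {\<eta>..\<xi>}" for t
    using u[OF t] pos[OF t] assms by (simp add: cutoff_def)
  \<comment> \<open>The derivative changes sign only at the midpoint, so its absolute value
    integrates to twice the value of the cutoff there.\<close>
  define c where "c = (\<eta> + \<xi>) / 2"
  have c: "\<eta> \<le> c" "c \<le> \<xi>" using assms by (auto simp: c_def)
  have ci: "(\<lambda>t. \<bar>cutoff' \<eta> \<xi> \<kappa> t\<bar>) integrable_on {\<eta>..\<xi>}"
    by (intro integrable_continuous_interval continuous_intros c')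
  have "integral {\<eta>..c} (\<lambda>t. \<bar>cutoff' \<eta> \<xi> \<kappa> t\<bar>) = cutoff \<eta> \<xi> \<kappa> c - cutoff \<eta> \<xi> \<kappa> \<eta>"
  proof (rule integral_unique)
    have "(cutoff' \<eta> \<xi> \<kappa> has_integral cutoff \<eta> \<xi> \<kappa> c - cutoff \<eta> \<xi> \<kappa> \<eta>) {\<eta>..c}"
      using c by (intro fundamental_theorem_of_calculus) (auto simp: has_real_derivative_iff_has_vector_derivative[symmetric] intro!: der)
    then show "((\<lambda>t. \<bar>cutoff' \<eta> \<xi> \<kappa> t\<bar>) has_integral cutoff \<eta> \<xi> \<kappa> c - cutoff \<eta> \<xi> \<kappa> \<eta>) {\<eta>..c}"
      by (rule has_integral_eq[rotated]) (use assms in \<open>auto simp: cutoff'_def c_def\<close>)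
  qed
  then have 1: "integral {\<eta>..c} (\<lambda>t. \<bar>cutoff' \<eta> \<xi> \<kappa> t\<bar>) \<le> 1" using w01[of c] c ends by simp
  have "integral {c..\<xi>} (\<lambda>t. \<bar>cutoff' \<eta> \<xi> \<kappa> t\<bar>) = - (cutoff \<eta> \<xi> \<kappa> \<xi> - cutoff \<eta> \<xi> \<kappa> c)"
  proof (rule integral_unique)
    have "(cutoff' \<eta> \<xi> \<kappa> has_integral cutoff \<eta> \<xi> \<kappa> \<xi> - cutoff \<eta> \<xi> \<kappa> c) {c..\<xi>}"
      using c by (intro fundamental_theorem_of_calculus) (auto simp: has_real_derivative_iff_has_vector_derivative[symmetric] intro!: der)
    from has_integral_neg[OF this]
    show "((\<lambda>t. \<bar>cutoff' \<eta> \<xi> \<kappa> t\<bar>) has_integral - (cutoff \<eta> \<xi> \<kappa> \<xi> - cutoff \<eta> \<xi> \<kappa> c)) {c..\<xi>}"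
    proof (rule has_integral_eq[rotated])
      fix t assume t: "t \<in> {c..\<xi>}"
      then have "\<eta> + \<xi> - 2 * t \<le> 0" by (auto simp: c_def)
      then have "cutoff' \<eta> \<xi> \<kappa> t \<le> 0" using assms unfolding cutoff'_def by (intro divide_nonpos_nonneg mult_nonneg_nonpos) auto
      then show "- cutoff' \<eta> \<xi> \<kappa> t = \<bar>cutoff' \<eta> \<xi> \<kappa> t\<bar>" by simp
    qed
  qed
  then have 2: "integral {c..\<xi>} (\<lambda>t. \<bar>cutoff' \<eta> \<xi> \<kappa> t\<bar>) \<le> 1" using w01[of c] c ends by simp
  show "integral {\<eta>..\<xi>} (\<lambda>t. \<bar>cutoff' \<eta> \<xi> \<kappa> t\<bar>) \<le> 2"
    using Henstock_Kurzweil_Integration.integral_combine[OF c ci] 1 2 by linarith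
  show "\<bar>cutoff' \<eta> \<xi> \<kappa> t\<bar> \<le> (\<xi> - \<eta>) / \<kappa>" if t: "t \<in> {\<eta>..\<xi>}" for t
  proof -
    have "\<bar>cutoff' \<eta> \<xi> \<kappa> t\<bar> = \<kappa> * \<bar>\<eta> + \<xi> - 2 * t\<bar> / ((t - \<eta>) * (\<xi> - t) + \<kappa>)\<^sup>2"
      using assms by (simp add: cutoff'_def abs_mult)
    also have "\<dots> \<le> \<kappa> * (\<xi> - \<eta>) / \<kappa>\<^sup>2"
      using t u[OF t] assms by (intro frac_le mult_left_mono power_mono) auto
    also have "\<dots> = (\<xi> - \<eta>) / \<kappa>" using assms by (simp add: power2_eq_square)
    finally show ?thesis .
  qed
qed

context convex_curve begin

text \<open>For fixed \<open>q\<close> the numerators are summed with the Fejer kernel. Expanding it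
  and substituting \<open>x = q * t\<close> gives integrals over one interval common to all
  \<open>q\<close>, so the sum over \<open>q\<close> can be moved inside, where it becomes
  \<open>esum1\<close>. A frequency arises from at most \<open>K\<close> pairs of the expansion,
  which cancels the factor \<open>1 / K\<close>.\<close>

lemma exponential_sum_stationary:
  fixes Q j :: nat
  assumes I: "\<eta> < \<xi>" and Q: "1 \<le> Q" and j: "1 \<le> j" and f'\<eta>: "0 \<le> f' \<eta>" "f' \<eta> \<le> 1"
    and w: "w = cutoff \<eta> \<xi> (1 / (real Q)\<^sup>2)"
    and \<Lambda>: "\<Lambda> = {- int (Q ^ 8)..int (Q ^ 8)}"
  shows "norm (\<Sum>q=1..Q. \<Sum>a\<in>{a::int. of_int a / real q \<in> {\<eta>..\<xi>}}. of_real (w (of_int a / real q)) * echar (real j * (real q * f (of_int a / real q))))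
    \<le> (\<Sum>l\<in>\<Lambda>. norm (integral {\<eta>..\<xi>} (\<lambda>t. of_real (w t) * esum1 Q (real j * f t - of_int l * t))))
      + real Q * ((2 * (\<bar>\<eta>\<bar> + \<bar>\<xi>\<bar>) + 5) * Q * (2 * ((\<xi> - \<eta>) * (real Q)\<^sup>2 + 2 * pi * real j * (1 + c2 * (\<xi> - \<eta>))) / real Q ^ 4))"
proof -
  define \<kappa> where "\<kappa> = 1 / (real Q)\<^sup>2"
  have Qp: "real Q \<ge> 1" using Q by simp
  have \<kappa>p: "\<kappa> > 0" using Qp by (simp add: \<kappa>_def)
  note wp = cutoff_props[OF less_imp_le[OF I] \<kappa>p, folded w[folded \<kappa>_def]]
  define B where "B = 1 + c2 * (\<xi> - \<eta>)"
  have B0: "B \<ge> 1" using I c2_pos by (simp add: B_def)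
  define Lp where "Lp = (\<xi> - \<eta>) * (real Q)\<^sup>2 + 2 * pi * real j * B"
  have Lp0: "Lp \<ge> 0" using I B0 pi_ge_zero by (simp add: Lp_def)
  have f'B: "\<bar>f' t\<bar> \<le> B" if t: "t \<in> {\<eta>..\<xi>}" for t
  proof -
    have "0 \<le> c1 * (t - \<eta>)" using t c1_pos by simp
    moreover have "c2 * (t - \<eta>) \<le> c2 * (\<xi> - \<eta>)" using t c2_pos by (intro mult_left_mono) auto
    ultimately show ?thesis using f'_bounds[of \<eta> t] t f'\<eta> by (simp add: B_def)
  qed
  have mvt: "\<bar>F s - F t\<bar> \<le> L * \<bar>s - t\<bar>"
    if st: "s \<in> {\<eta>..\<xi>}" "t \<in> {\<eta>..\<xi>}" and d: "\<And>x. x \<in> {\<eta>..\<xi>} \<Longrightarrow> (F has_real_derivative F' x) (at x within {\<eta>..\<xi>})"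
      "\<And>x. x \<in> {\<eta>..\<xi>} \<Longrightarrow> \<bar>F' x\<bar> \<le> L" for F F' :: "real \<Rightarrow> real" and s t L
    using field_differentiable_bound[of "{\<eta>..\<xi>}" F F' L s t] st d by (simp add: dist_real_def)
  \<comment> \<open>Extension by zero keeps the function Lipschitz on the whole line because the
    cutoff vanishes at both ends; this is the purpose of the smoothing.\<close>
  define h where "h q x = (if x / real q \<in> {\<eta>..\<xi>} then of_real (w (x / real q)) * echar (real j * (real q * f (x / real q))) else 0)" for q x
  have lip: "norm (h q x - h q y) \<le> Lp * \<bar>x - y\<bar>" if q: "q \<in> {1..Q}" for q x y
  proof -
    have qp: "real q \<ge> 1" using q by simp
    define H where "H t = of_real (w t) * echar (real j * (real q * f t))" for t
    define L where "L = (\<xi> - \<eta>) / \<kappa> + 2 * pi * (real j * real q * B)"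
    have "norm ((if x / real q \<in> {\<eta>..\<xi>} then H (x / real q) else 0) - (if y / real q \<in> {\<eta>..\<xi>} then H (y / real q) else 0)) \<le> L * \<bar>x / real q - y / real q\<bar>"
    proof (rule lipschitz_zero_extension)
      show "\<eta> \<le> \<xi>" using I by simp
      show "0 \<le> L" using I \<kappa>p B0 pi_ge_zero by (simp add: L_def)
      show "H \<eta> = 0" "H \<xi> = 0" using wp(3,4) by (simp_all add: H_def)
      fix s t assume st: "s \<in> {\<eta>..\<xi>}" "t \<in> {\<eta>..\<xi>}"
      have 1: "\<bar>w s - w t\<bar> \<le> (\<xi> - \<eta>) / \<kappa> * \<bar>s - t\<bar>" using mvt[OF st wp(1) wp(7)] .
      have 2: "\<bar>f s - f t\<bar> \<le> B * \<bar>s - t\<bar>"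
        using mvt[OF st has_field_derivative_at_within[OF deriv1] f'B] .
      have "H s - H t = of_real (w s - w t) * echar (real j * (real q * f s)) + of_real (w t) * (echar (real j * (real q * f s)) - echar (real j * (real q * f t)))"
        by (simp add: H_def algebra_simps)
      then have "norm (H s - H t) \<le> norm (of_real (w s - w t) * echar (real j * (real q * f s))) + norm (of_real (w t) * (echar (real j * (real q * f s)) - echar (real j * (real q * f t))))"
        using norm_triangle_ineq by simp
      also have "\<dots> = \<bar>w s - w t\<bar> + \<bar>w t\<bar> * norm (echar (real j * (real q * f s)) - echar (real j * (real q * f t)))"
        by (simp only: norm_mult norm_of_real norm_echar mult_1_right)
      also have "\<dots> \<le> (\<xi> - \<eta>) / \<kappa> * \<bar>s - t\<bar> + 1 * (2 * pi * (real j * real q * (B * \<bar>s - t\<bar>)))"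
      proof (intro add_mono mult_mono 1)
        show "\<bar>w t\<bar> \<le> 1" using wp(5)[OF st(2)] by simp
        have "norm (echar (real j * (real q * f s)) - echar (real j * (real q * f t))) \<le> 2 * pi * \<bar>real j * (real q * f s) - real j * (real q * f t)\<bar>"
          by (rule norm_echar_diff_le)
        also have "\<dots> = 2 * pi * (real j * real q * \<bar>f s - f t\<bar>)"
          by (simp add: right_diff_distrib[symmetric] abs_mult)
        also have "\<dots> \<le> 2 * pi * (real j * real q * (B * \<bar>s - t\<bar>))"
          using 2 pi_ge_zero by (intro mult_left_mono) auto
        finally show "norm (echar (real j * (real q * f s)) - echar (real j * (real q * f t))) \<le> 2 * pi * (real j * real q * (B * \<bar>s - t\<bar>))" .
      qed auto
      also have "\<dots> = L * \<bar>s - t\<bar>" by (simp add: L_def algebra_simps)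
      finally show "norm (H s - H t) \<le> L * \<bar>s - t\<bar>" .
    qed
    then have "norm (h q x - h q y) \<le> L * \<bar>x / real q - y / real q\<bar>" by (simp only: h_def H_def)
    also have "\<dots> = (L / real q) * \<bar>x - y\<bar>" using qp by (simp add: diff_divide_distrib[symmetric])
    also have "\<dots> \<le> Lp * \<bar>x - y\<bar>"
    proof (rule mult_right_mono)
      have "L / real q = (\<xi> - \<eta>) * (real Q)\<^sup>2 / real q + 2 * pi * real j * B"
        using qp by (simp add: L_def \<kappa>_def add_divide_distrib)
      also have "\<dots> \<le> (\<xi> - \<eta>) * (real Q)\<^sup>2 / 1 + 2 * pi * real j * B"
        using I qp by (intro add_right_mono divide_left_mono) auto
      also have "\<dots> = Lp" by (simp add: Lp_def)
      finally show "L / real q \<le> Lp" .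
    qed simp
    finally show ?thesis .
  qed
  have hcont: "continuous_on S (h q)" if "q \<in> {1..Q}" for S q
  proof -
    have "lipschitz_on Lp UNIV (h q)" using lip[OF that] Lp0 by (intro lipschitz_onI) (auto simp: dist_norm)
    then show ?thesis using lipschitz_on_continuous_on continuous_on_subset by blast
  qed
  \<comment> \<open>Every \<open>h q\<close> vanishes where \<open>x\<close> exceeds
    \<open>M - 1\<close> in absolute value, so the unit cells around the integers from
    \<open>- M\<close> to \<open>M\<close> contain the whole support.\<close>
  define M where "M = nat \<lceil>(\<bar>\<eta>\<bar> + \<bar>\<xi>\<bar>) * real Q\<rceil> + 1"
  have M: "(\<bar>\<eta>\<bar> + \<bar>\<xi>\<bar>) * real Q + 1 \<le> real M" "real M \<le> (\<bar>\<eta>\<bar> + \<bar>\<xi>\<bar>) * real Q + 2"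
  proof -
    have "0 \<le> (\<bar>\<eta>\<bar> + \<bar>\<xi>\<bar>) * real Q" by simp
    then show "(\<bar>\<eta>\<bar> + \<bar>\<xi>\<bar>) * real Q + 1 \<le> real M" "real M \<le> (\<bar>\<eta>\<bar> + \<bar>\<xi>\<bar>) * real Q + 2"
      unfolding M_def by linarith+
  qed
  have range: "\<bar>x\<bar> \<le> real M - 1" if "q \<in> {1..Q}" "x / real q \<in> {\<eta>..\<xi>}" for q x
  proof -
    have qp: "real q \<ge> 1" "real q \<le> real Q" using that by auto
    have "\<bar>x / real q\<bar> \<le> \<bar>\<eta>\<bar> + \<bar>\<xi>\<bar>" using that(2) by auto
    then have "\<bar>x\<bar> \<le> (\<bar>\<eta>\<bar> + \<bar>\<xi>\<bar>) * real q" using qp by (simp add: abs_divide divide_le_eq)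
    also have "\<dots> \<le> (\<bar>\<eta>\<bar> + \<bar>\<xi>\<bar>) * real Q" using qp by (intro mult_left_mono) auto
    finally show ?thesis using M by linarith
  qed
  have inner: "(\<Sum>a\<in>{a::int. of_int a / real q \<in> {\<eta>..\<xi>}}. of_real (w (of_int a / real q)) * echar (real j * (real q * f (of_int a / real q))))
      = (\<Sum>i<2 * M + 1. h q (of_int (- int M + int i)))" if q: "q \<in> {1..Q}" for q
  proof -
    have sub: "{a::int. of_int a / real q \<in> {\<eta>..\<xi>}} \<subseteq> {- int M..int M}"
    proof
      fix a :: int assume "a \<in> {a::int. of_int a / real q \<in> {\<eta>..\<xi>}}"
      then have "\<bar>real_of_int a\<bar> \<le> real M - 1" using range[OF q] by blast
      then show "a \<in> {- int M..int M}" by auto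
    qed
    have "(\<Sum>i<2 * M + 1. h q (of_int (- int M + int i))) = (\<Sum>a\<in>{- int M..int M}. h q (of_int a))"
      by (rule sum.reindex_bij_witness[of _ "\<lambda>a. nat (a + int M)" "\<lambda>i. - int M + int i"]) auto
    also have "\<dots> = (\<Sum>a\<in>{a::int. of_int a / real q \<in> {\<eta>..\<xi>}}. h q (of_int a))"
      by (rule sum.mono_neutral_right[OF _ sub]) (auto simp: h_def)
    also have "\<dots> = (\<Sum>a\<in>{a::int. of_int a / real q \<in> {\<eta>..\<xi>}}. of_real (w (of_int a / real q)) * echar (real j * (real q * f (of_int a / real q))))"
      by (intro sum.cong) (auto simp: h_def)
    finally show ?thesis by simp
  qed
  \<comment> \<open>With \<open>sqrt K = Q ^ 4\<close> the total error stays bounded when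
    \<open>j\<close> is at most a multiple of \<open>Q\<close>: there are O(Q^2) cells in all, and
    the Lipschitz constant is O(Q^2).\<close>
  define K where "K = Q ^ 8"
  have K: "K \<ge> 1" "sqrt (real K) = real Q ^ 4"
  proof -
    have "real K = (real Q ^ 4)\<^sup>2" unfolding K_def power_mult[symmetric] of_nat_power by simp
    then show "sqrt (real K) = real Q ^ 4" by (simp only: real_sqrt_abs) simp
  qed (use Q in \<open>simp add: K_def\<close>)
  define lo hi where "lo = of_int (- int M) - (1/2 :: real)" and "hi = lo + real (2 * M + 1)"
  have lohi: "lo = - real M - 1/2" "hi = real M + 1/2" by (auto simp: lo_def hi_def)
  define J where "J q = integral {lo..hi} (\<lambda>x. h q x * of_real (fejer K x))" for q
  have err: "norm ((\<Sum>i<2 * M + 1. h q (of_int (- int M + int i))) - J q) \<le> real (2 * M + 1) * (2 * Lp / real Q ^ 4)" if "q \<in> {1..Q}" for q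
    using fejer_summation[OF K(1) Lp0 lip[OF that], where m = "- int M" and n = "2 * M + 1"]
    unfolding J_def lo_def hi_def K(2) .
  define U where "U l = integral {\<eta>..\<xi>} (\<lambda>t. of_real (w t) * esum1 Q (real j * f t - of_int l * t))" for l :: int
  have cw: "continuous_on {\<eta>..\<xi>} w" using wp(1) by (intro DERIV_continuous_on)
  have stretch: "integral {lo..hi} (\<lambda>x. h q x * echar (of_int k * x))
      = of_nat q * integral {\<eta>..\<xi>} (\<lambda>t. of_real (w t) * echar (real q * (real j * f t + of_int k * t)))" if q: "q \<in> {1..Q}" for q k
  proof -
    have qp: "real q > 0" using q by simp
    define G where "G x = of_real (w (x / real q)) * echar (real j * (real q * f (x / real q))) * echar (of_int k * x)" for x
    have mem: "x / real q \<in> {\<eta>..\<xi>} \<longleftrightarrow> x \<in> {real q * \<eta>..real q * \<xi>}" for x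
      using qp by (auto simp: le_divide_eq divide_le_eq mult.commute)
    have "(\<lambda>x. h q x * echar (of_int k * x)) = (\<lambda>x. if x \<in> {real q * \<eta>..real q * \<xi>} then G x else 0)"
      by (simp only: fun_eq_iff h_def G_def mem) simp
    then have "integral {lo..hi} (\<lambda>x. h q x * echar (of_int k * x)) = integral ({real q * \<eta>..real q * \<xi>} \<inter> {lo..hi}) G"
      by (simp only: Henstock_Kurzweil_Integration.integral_restrict_Int)
    also have "{real q * \<eta>..real q * \<xi>} \<inter> {lo..hi} = {real q * \<eta>..real q * \<xi>}"
    proof -
      have "x \<in> {lo..hi}" if "x \<in> {real q * \<eta>..real q * \<xi>}" for x
      proof -
        have "\<bar>x\<bar> \<le> real M - 1" using range[OF q] that mem by blast
        then show ?thesis unfolding lohi by auto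
      qed
      then show ?thesis by blast
    qed
    also have "integral {real q * \<eta>..real q * \<xi>} G = of_nat q * integral {\<eta>..\<xi>} (\<lambda>t. G (real q * t))"
    proof -
      have cG: "continuous_on {real q * \<eta>..real q * \<xi>} G"
        unfolding G_def using qp mem
        by (intro continuous_intros continuous_on_compose2[OF cw] continuous_on_compose2[OF cont0[of UNIV]]) auto
      have iq: "inverse (real q) * (real q * c) = c" for c using qp by (simp add: field_simps)
      have "(G has_integral integral {real q * \<eta>..real q * \<xi>} G) (cbox (real q * \<eta>) (real q * \<xi>))"
        using integrable_integral[OF integrable_continuous_interval[OF cG]] by simp
      from has_integral_affinity'[OF this qp, of 0]
      have "((\<lambda>t. G (real q * t)) has_integral (integral {real q * \<eta>..real q * \<xi>} G /\<^sub>R real q)) {\<eta>..\<xi>}"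
        using qp by (simp add: iq)
      then have "integral {\<eta>..\<xi>} (\<lambda>t. G (real q * t)) = integral {real q * \<eta>..real q * \<xi>} G /\<^sub>R real q"
        by (rule integral_unique)
      then show ?thesis using qp by (simp add: scaleR_conv_of_real)
    qed
    also have "integral {\<eta>..\<xi>} (\<lambda>t. G (real q * t)) = integral {\<eta>..\<xi>} (\<lambda>t. of_real (w t) * echar (real q * (real j * f t + of_int k * t)))"
    proof (rule arg_cong[where f = "integral {\<eta>..\<xi>}"], rule ext)
      fix t
      have "echar (real q * (real j * f t + of_int k * t)) = echar (real j * (real q * f t)) * echar (of_int k * (real q * t))"
        unfolding echar_add[symmetric] by (simp add: algebra_simps)
      then show "G (real q * t) = of_real (w t) * echar (real q * (real j * f t + of_int k * t))"
        using qp by (simp add: G_def)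
    qed
    finally show ?thesis .
  qed
  have Usum: "(\<Sum>q=1..Q. integral {lo..hi} (\<lambda>x. h q x * echar (of_int k * x))) = U (- k)" for k
  proof -
    have "(\<Sum>q=1..Q. integral {lo..hi} (\<lambda>x. h q x * echar (of_int k * x)))
        = (\<Sum>q=1..Q. integral {\<eta>..\<xi>} (\<lambda>t. of_nat q * (of_real (w t) * echar (real q * (real j * f t + of_int k * t)))))"
      using stretch by (intro sum.cong refl) simp
    also have "\<dots> = integral {\<eta>..\<xi>} (\<lambda>t. \<Sum>q=1..Q. of_nat q * (of_real (w t) * echar (real q * (real j * f t + of_int k * t))))"
      by (intro Henstock_Kurzweil_Integration.integral_sum[symmetric] integrable_continuous_interval continuous_intros cw cont0) auto
    also have "\<dots> = U (- k)" unfolding U_def esum1_def by (simp add: sum_distrib_left mult_ac)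
    finally show ?thesis .
  qed
  have \<Lambda>K: "\<Lambda> = {- int K..int K}" by (simp add: \<Lambda> K_def)
  have "(\<Sum>q=1..Q. J q) = (\<Sum>q=1..Q. (\<Sum>p\<in>sq2 K. integral {lo..hi} (\<lambda>x. h q x * echar (of_int (diff2 p) * x))) / of_nat K)"
    unfolding J_def by (intro sum.cong refl fejer_integral_expansion hcont)
  also have "\<dots> = (\<Sum>p\<in>sq2 K. U (- diff2 p)) / of_nat K"
    unfolding sum_divide_distrib[symmetric] Usum[symmetric] by (subst sum.swap) simp
  finally have "norm (\<Sum>q=1..Q. J q) = norm (\<Sum>p\<in>sq2 K. U (- diff2 p)) / real K" by (simp add: norm_divide)
  also have "\<dots> \<le> (\<Sum>p\<in>sq2 K. norm (U (- diff2 p))) / real K" by (intro divide_right_mono norm_sum) auto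
  also have "(\<Sum>p\<in>sq2 K. norm (U (- diff2 p))) = (\<Sum>l\<in>\<Lambda>. \<Sum>p\<in>{p\<in>sq2 K. - diff2 p = l}. norm (U (- diff2 p)))"
    by (intro sum.group[symmetric]) (auto simp: \<Lambda>K sq2_def diff2_def)
  also have "\<dots> = (\<Sum>l\<in>\<Lambda>. real (card {p\<in>sq2 K. - diff2 p = l}) * norm (U l))"
    by (intro sum.cong refl) auto
  also have "\<dots> \<le> (\<Sum>l\<in>\<Lambda>. real K * norm (U l))"
  proof (intro sum_mono mult_right_mono)
    fix l
    have "{p\<in>sq2 K. - diff2 p = l} = {p\<in>sq2 K. diff2 p = - l}" by auto
    then show "real (card {p\<in>sq2 K. - diff2 p = l}) \<le> real K" using card_diff2_le[of K "- l"] by simp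
  qed simp
  also have "(\<Sum>l\<in>\<Lambda>. real K * norm (U l)) / real K = (\<Sum>l\<in>\<Lambda>. norm (U l))"
    using K(1) by (simp add: sum_distrib_left[symmetric])
  finally have main: "norm (\<Sum>q=1..Q. J q) \<le> (\<Sum>l\<in>\<Lambda>. norm (U l))" by (simp add: divide_right_mono)
  have "(\<Sum>q=1..Q. \<Sum>a\<in>{a::int. of_int a / real q \<in> {\<eta>..\<xi>}}. of_real (w (of_int a / real q)) * echar (real j * (real q * f (of_int a / real q))))
      = (\<Sum>q=1..Q. J q) + (\<Sum>q=1..Q. (\<Sum>i<2 * M + 1. h q (of_int (- int M + int i))) - J q)"
    unfolding sum.distrib[symmetric] using inner by (intro sum.cong refl) simp
  then have "norm (\<Sum>q=1..Q. \<Sum>a\<in>{a::int. of_int a / real q \<in> {\<eta>..\<xi>}}. of_real (w (of_int a / real q)) * echar (real j * (real q * f (of_int a / real q))))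
      \<le> norm (\<Sum>q=1..Q. J q) + norm (\<Sum>q=1..Q. (\<Sum>i<2 * M + 1. h q (of_int (- int M + int i))) - J q)"
    using norm_triangle_ineq by simp
  also have "norm (\<Sum>q=1..Q. (\<Sum>i<2 * M + 1. h q (of_int (- int M + int i))) - J q) \<le> (\<Sum>q=1..Q. real (2 * M + 1) * (2 * Lp / real Q ^ 4))"
    by (intro order_trans[OF norm_sum] sum_mono err)
  also have "\<dots> = real Q * (real (2 * M + 1) * (2 * Lp / real Q ^ 4))" by simp
  also have "\<dots> \<le> real Q * ((2 * (\<bar>\<eta>\<bar> + \<bar>\<xi>\<bar>) + 5) * Q * (2 * Lp / real Q ^ 4))"
  proof (intro mult_left_mono mult_right_mono)
    have "real (2 * M + 1) \<le> 2 * ((\<bar>\<eta>\<bar> + \<bar>\<xi>\<bar>) * real Q) + 5" using M(2) by simp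
    also have "\<dots> \<le> (2 * (\<bar>\<eta>\<bar> + \<bar>\<xi>\<bar>) + 5) * Q" using Qp by (simp add: algebra_simps)
    finally show "real (2 * M + 1) \<le> (2 * (\<bar>\<eta>\<bar> + \<bar>\<xi>\<bar>) + 5) * Q" .
  qed (use Lp0 in auto)
  finally show ?thesis using main by (simp add: U_def Lp_def B_def)
qed

end

section \<open>Exponential sums along a convex curve\<close>

definition weighted_sum :: "real \<Rightarrow> real \<Rightarrow> (real \<Rightarrow> real) \<Rightarrow> nat \<Rightarrow> nat \<Rightarrow> complex" where
  "weighted_sum \<eta> \<xi> f Q j = (\<Sum>q=1..Q. \<Sum>a\<in>{a::int. of_int a / real q \<in> {\<eta>..\<xi>}}.
     of_real (cutoff \<eta> \<xi> (1 / (real Q)\<^sup>2) (of_int a / real q)) * echar (real j * (real q * f (of_int a / real q))))"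

lemma finite_fractions: "0 < j \<Longrightarrow> finite {l::int. u \<le> of_int l / j \<and> of_int l / j \<le> (v::real)}"
proof -
  assume j: "0 < j"
  have "{l::int. u \<le> of_int l / j \<and> of_int l / j \<le> v} \<subseteq> {\<lceil>u * j\<rceil>..\<lfloor>v * j\<rfloor>}"
    using j by (auto simp: le_divide_eq divide_le_eq ceiling_le_iff le_floor_iff)
  then show ?thesis by (rule finite_subset) simp
qed

text \<open>In the range \<open>j \<le> 16 * x ^ 4\<close> the quantity \<open>s\<close> is at least
  \<open>x / 4\<close>, a positive power of \<open>Q\<close>. Constants and logarithms of
  \<open>Q\<close> can therefore be absorbed into \<open>s\<close>.\<close>

lemma scale_bounds:
  fixes x s :: real
  assumes x: "1 \<le> x" and Q: "real Q = x ^ 6" and j: "1 \<le> j" "j \<le> 16 * x ^ 4"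
    and s: "s = sqrt (real Q / j)"
  shows "x \<le> 4 * s" "1 \<le> 4 * s" "ln (real Q) \<le> 24 * s" "j \<le> 16 * real Q"
proof -
  have "x\<^sup>2 / 16 \<le> real Q / j"
  proof -
    have "x\<^sup>2 * j \<le> x\<^sup>2 * (16 * x ^ 4)" using j x by (intro mult_left_mono) auto
    also have "\<dots> = 16 * real Q" by (simp add: Q flip: power_add)
    finally show ?thesis using j by (simp add: field_simps)
  qed
  then have "sqrt (x\<^sup>2 / 16) \<le> s" unfolding s by simp
  moreover have "sqrt (x\<^sup>2 / 16) = x / 4" using x by (intro real_sqrt_unique) (auto simp: power_divide)
  ultimately show 1: "x \<le> 4 * s" by simp
  then show "1 \<le> 4 * s" using x by simp
  have "ln (real Q) = 6 * ln x" using x by (simp add: Q ln_realpow)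
  also have "\<dots> \<le> 6 * x" using x ln_le_minus_one[of x] by simp
  finally show "ln (real Q) \<le> 24 * s" using 1 by simp
  have "x ^ 4 \<le> x ^ 6" using x by (intro power_increasing) auto
  then show "j \<le> 16 * real Q" using j Q by simp
qed

text \<open>The constant is fixed before \<open>f\<close>, as the passage to the closure requires;
  the normalisation of \<open>f' \<eta>\<close> bounds \<open>f'\<close> on the interval and makes
  this possible. The window of slopes in the kernel sum depends on \<open>f\<close> only through its
  position, while its length is determined by \<open>c2\<close> and the interval.\<close>

lemma weighted_sum_bound:
  fixes \<eta> \<xi> c1 c2 :: real
  assumes I: "\<eta> < \<xi>" and c: "0 < c1" "c1 \<le> c2"
  shows "\<exists>C>0. \<forall>f f' f'' Q j x. convex_curve f f' f'' c1 c2 \<longrightarrow> 0 \<le> f' \<eta> \<longrightarrow> f' \<eta> \<le> 1 \<longrightarrow>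
    1 \<le> x \<longrightarrow> real Q = x ^ 6 \<longrightarrow> 1 \<le> j \<longrightarrow> real j \<le> 16 * x ^ 4 \<longrightarrow>
    norm (weighted_sum \<eta> \<xi> f Q j) \<le> C * (real Q * sqrt (real Q / real j) + real Q * sqrt (real j)
      + sqrt (real Q / real j) * (\<Sum>l\<in>{l. f' (\<eta> - 1) \<le> of_int l / real j \<and> of_int l / real j \<le> f' (\<eta> - 1) + c2 * (\<xi> - \<eta> + 2)}.
          kern Q (real j * convex_curve.legendre f f' (of_int l / real j))))"
proof -
  have c2p: "0 < c2" using c by simp
  define B where "B = 1 + c2 * (\<xi> - \<eta>)"
  have B: "B \<ge> 1" using I c2p by (simp add: B_def)
  define c3 c4 where "c3 = c1 * sqrt (2 / c2)" and "c4 = min 1 (1 / (2 * c2))"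
  define K1 where "K1 = (4 + c2) * (2 * (8 / c1 + 8 / c3 ^ 3))"
  define K2 where "K2 = (4 + c2) * ((\<xi> - \<eta>) * ((1 + 1 / (c1 * c4)\<^sup>2) * 8))"
  define E where "E = (2 * (\<bar>\<eta>\<bar> + \<bar>\<xi>\<bar>) + 5) * (2 * ((\<xi> - \<eta>) + 32 * pi * B))"
  define K3 where "K3 = 2 + 4 * (196 + 4 * ln (16 * B + 2)) + 4 * E"
  have c3p: "c3 > 0" using c c2p by (simp add: c3_def)
  have K1p: "K1 \<ge> 0" using c c2p c3p by (simp add: K1_def)
  have K2p: "K2 \<ge> 0" using I c2p by (simp add: K2_def)
  have Ep: "E \<ge> 0" using I B pi_ge_zero by (simp add: E_def)
  have lB: "ln (16 * B + 2) \<ge> 0" using B by (intro ln_ge_zero) auto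
  have K3p: "K3 \<ge> 2" using Ep lB by (simp add: K3_def)
  show ?thesis
  proof (intro exI[of _ "K1 + K2 + K3"] conjI allI impI)
    show "K1 + K2 + K3 > 0" using K1p K2p K3p by simp
    fix f f' f'' :: "real \<Rightarrow> real" and Q j :: nat and x :: real
    assume cc: "convex_curve f f' f'' c1 c2" and f': "0 \<le> f' \<eta>" "f' \<eta> \<le> 1" and x: "1 \<le> x"
      and Qx: "real Q = x ^ 6" and j: "1 \<le> j" "real j \<le> 16 * x ^ 4"
    interpret convex_curve f f' f'' c1 c2 by fact
    have Q1: "real Q \<ge> 1" using x Qx by simp
    then have Qn: "1 \<le> Q" by simp
    have jp: "real j \<ge> 1" using j by simp
    define s where "s = sqrt (real Q / real j)"
    note sb = scale_bounds[OF x Qx jp j(2) s_def]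
    define \<kappa> where "\<kappa> = 1 / (real Q)\<^sup>2"
    have \<kappa>p: "\<kappa> > 0" using Q1 by (simp add: \<kappa>_def)
    define w where "w = cutoff \<eta> \<xi> \<kappa>"
    note wp = cutoff_props[OF less_imp_le[OF I] \<kappa>p, folded w_def]
    define \<Lambda> where "\<Lambda> = {- int (Q ^ 8)..int (Q ^ 8)}"
    \<comment> \<open>Bounds \<open>j * f' t - l\<close> for all frequencies in
      \<open>\<Lambda>\<close>. It is polynomial in \<open>Q\<close>, so its logarithm costs only a
      constant times \<open>s\<close>.\<close>
    define N where "N = nat \<lceil>real j * B + real Q ^ 8\<rceil>"
    have Q8: "real Q ^ 8 \<ge> 1" "real Q \<le> real Q ^ 8"
      using Q1 power_increasing[of 1 8 "real Q"] by simp_all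
    have jB: "real j * B \<ge> 0" using B by simp
    have N: "real j * B + real Q ^ 8 \<le> real N" "real N \<le> real j * B + real Q ^ 8 + 1"
      using jB Q8 unfolding N_def by linarith+
    have N1: "N \<ge> 1" using N(1) jB Q8 by linarith
    have lnN: "1 + ln (real N) \<le> (196 + 4 * ln (16 * B + 2)) * s"
    proof -
      have "real j \<le> 16 * real Q ^ 8" using sb(4) Q8(2) by linarith
      then have "real j * B \<le> 16 * real Q ^ 8 * B" using B by (intro mult_right_mono) simp_all
      then have "real N \<le> (16 * B + 2) * real Q ^ 8" using N(2) Q8 by (simp add: algebra_simps)
      then have "ln (real N) \<le> ln ((16 * B + 2) * real Q ^ 8)" using N1 by (intro ln_mono) auto
      also have "\<dots> = ln (16 * B + 2) + 8 * ln (real Q)" using B Q1 by (simp add: ln_mult ln_realpow)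
      also have "\<dots> \<le> ln (16 * B + 2) * (4 * s) + 8 * (24 * s)"
        using mult_left_mono[OF sb(2) lB] sb(3) by simp
      finally show ?thesis using sb(2) by (simp add: algebra_simps)
    qed
    have Nh: "\<bar>real j * f' t - of_int l\<bar> \<le> real N" if t: "t \<in> {\<eta>..\<xi>}" and l: "l \<in> \<Lambda>" for t l
    proof -
      have "c1 * (t - \<eta>) \<ge> 0" "c2 * (t - \<eta>) \<le> c2 * (\<xi> - \<eta>)" using t c c2p by (auto intro!: mult_left_mono)
      then have "0 \<le> f' t" "f' t \<le> B" using f'_bounds[of \<eta> t] t f' by (auto simp: B_def)
      then have "0 \<le> real j * f' t" "real j * f' t \<le> real j * B" by (auto intro!: mult_left_mono)
      moreover have "real_of_int l \<le> real_of_int (int (Q ^ 8))" "real_of_int (- int (Q ^ 8)) \<le> real_of_int l"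
        using l unfolding \<Lambda>_def of_int_le_iff by auto
      then have "\<bar>real_of_int l\<bar> \<le> real Q ^ 8" by simp
      ultimately show ?thesis using N(1) by linarith
    qed
    define KS where "KS = (\<Sum>l\<in>{l. f' (\<eta> - 1) \<le> of_int l / real j \<and> of_int l / real j \<le> f' (\<eta> - 1) + c2 * (\<xi> - \<eta> + 2)}.
          kern Q (real j * legendre (of_int l / real j)))"
    have KS: "(\<Sum>l\<in>{l\<in>\<Lambda>. \<eta> - 1 \<le> \<tau> (of_int l / real j) \<and> \<tau> (of_int l / real j) \<le> \<xi> + 1}. kern Q (real j * legendre (of_int l / real j))) \<le> KS"
      unfolding KS_def
    proof (rule sum_mono2)
      show "finite {l. f' (\<eta> - 1) \<le> of_int l / real j \<and> of_int l / real j \<le> f' (\<eta> - 1) + c2 * (\<xi> - \<eta> + 2)}"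
        using jp by (intro finite_fractions) simp
      have "f' (\<eta> - 1) \<le> y \<and> y \<le> f' (\<eta> - 1) + c2 * (\<xi> - \<eta> + 2)" if "\<eta> - 1 \<le> \<tau> y" "\<tau> y \<le> \<xi> + 1" for y
      proof -
        have "c1 * (\<tau> y - (\<eta> - 1)) \<ge> 0" "c2 * (\<tau> y - (\<eta> - 1)) \<le> c2 * (\<xi> - \<eta> + 2)"
          using that c c2p by (auto intro!: mult_left_mono)
        then show ?thesis using f'_bounds[OF that(1)] by simp
      qed
      then show "{l\<in>\<Lambda>. \<eta> - 1 \<le> \<tau> (of_int l / real j) \<and> \<tau> (of_int l / real j) \<le> \<xi> + 1}
        \<subseteq> {l. f' (\<eta> - 1) \<le> of_int l / real j \<and> of_int l / real j \<le> f' (\<eta> - 1) + c2 * (\<xi> - \<eta> + 2)}" by blast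
      show "0 \<le> kern Q (real j * legendre (of_int l / real j))" for l
        using less_imp_le[OF kern_pos[of "real Q"]] Q1 by simp
    qed
    have Err: "real Q * ((2 * (\<bar>\<eta>\<bar> + \<bar>\<xi>\<bar>) + 5) * Q * (2 * ((\<xi> - \<eta>) * (real Q)\<^sup>2 + 2 * pi * real j * B) / real Q ^ 4)) \<le> E"
    proof -
      have "2 * pi * real j * B \<le> 2 * pi * (16 * (real Q)\<^sup>2) * B"
      proof -
        have "real Q * 1 \<le> real Q * real Q" using Q1 by (intro mult_left_mono) auto
        then have "real j \<le> 16 * (real Q)\<^sup>2" using sb(4) by (simp add: power2_eq_square)
        then show ?thesis using B pi_ge_zero by (intro mult_right_mono mult_left_mono) auto
      qed
      then have h: "(\<xi> - \<eta>) * (real Q)\<^sup>2 + 2 * pi * real j * B \<le> ((\<xi> - \<eta>) + 32 * pi * B) * (real Q)\<^sup>2" by (simp add: algebra_simps)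
      have "real Q * ((2 * (\<bar>\<eta>\<bar> + \<bar>\<xi>\<bar>) + 5) * Q * (2 * ((\<xi> - \<eta>) * (real Q)\<^sup>2 + 2 * pi * real j * B) / real Q ^ 4))
        \<le> real Q * ((2 * (\<bar>\<eta>\<bar> + \<bar>\<xi>\<bar>) + 5) * Q * (2 * (((\<xi> - \<eta>) + 32 * pi * B) * (real Q)\<^sup>2) / real Q ^ 4))"
        using h by (intro mult_left_mono divide_right_mono) auto
      also have "\<dots> = E" using Q1 by (simp add: E_def power2_eq_square power4_eq_xxxx)
      finally show ?thesis .
    qed
    have rearrange: "A * (G * s * K + d * (M * q * (8 * r))) + 2 * (q * (s + 2 * (h * s)))
        = A * G * (s * K) + A * (d * (M * 8)) * (q * r) + (2 + 4 * h) * (q * s)" for A G K d M q r h :: real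
      by (simp add: algebra_simps)
    have "norm (weighted_sum \<eta> \<xi> f Q j) \<le> (\<Sum>l\<in>\<Lambda>. norm (integral {\<eta>..\<xi>} (\<lambda>t. of_real (w t) * esum1 Q (real j * f t - of_int l * t)))) + E"
      using exponential_sum_stationary[OF I Qn j(1) f' w_def[unfolded \<kappa>_def] \<Lambda>_def] Err
      unfolding weighted_sum_def w_def \<kappa>_def B_def by linarith
    also have "(\<Sum>l\<in>\<Lambda>. norm (integral {\<eta>..\<xi>} (\<lambda>t. of_real (w t) * esum1 Q (real j * f t - of_int l * t))))
      \<le> (4 + c2) * (2 * (8 / c1 + 8 / c3 ^ 3) * sqrt (Q / real j)
          * (\<Sum>l\<in>{l\<in>\<Lambda>. \<eta> - 1 \<le> \<tau> (of_int l / real j) \<and> \<tau> (of_int l / real j) \<le> \<xi> + 1}. kern Q (real j * legendre (of_int l / real j)))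
        + (\<xi> - \<eta>) * ((1 + 1 / (c1 * c4)\<^sup>2) * Q * (8 * sqrt (real j))))
      + 2 * (Q * (sqrt (Q / real j) + 2 * (1 + ln (real N))))"
    proof (rule stationary_sum[where w' = "cutoff' \<eta> \<xi> \<kappa>"])
      show "\<eta> \<le> \<xi>" "0 < Q" "1 \<le> real j" "finite \<Lambda>" using I Qn jp by (auto simp: \<Lambda>_def)
    qed (use wp Nh N1 in \<open>auto simp: c3_def c4_def\<close>)
    also have "\<dots> \<le> (4 + c2) * (2 * (8 / c1 + 8 / c3 ^ 3) * s * KS
        + (\<xi> - \<eta>) * ((1 + 1 / (c1 * c4)\<^sup>2) * Q * (8 * sqrt (real j))))
      + 2 * (Q * (s + 2 * ((196 + 4 * ln (16 * B + 2)) * s)))"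
      unfolding s_def[symmetric] using c2p c c3p KS lnN sb(2)
      by (intro add_mono mult_left_mono order_refl) auto
    also have "\<dots> = K1 * (s * KS) + K2 * (Q * sqrt (real j)) + (2 + 4 * (196 + 4 * ln (16 * B + 2))) * (Q * s)"
      unfolding K1_def K2_def by (rule rearrange)
    finally have "norm (weighted_sum \<eta> \<xi> f Q j) \<le> K1 * (s * KS) + K2 * (Q * sqrt (real j)) + (2 + 4 * (196 + 4 * ln (16 * B + 2))) * (Q * s) + E"
      by simp
    also have "E \<le> 4 * E * (Q * s)"
    proof -
      have "1 * 1 \<le> real Q * (4 * s)" using Q1 sb(2) by (intro mult_mono) auto
      then have "E * 1 \<le> E * (real Q * (4 * s))" using Ep by (intro mult_left_mono) auto
      then show ?thesis by (simp add: mult_ac)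
    qed
    finally have main: "norm (weighted_sum \<eta> \<xi> f Q j) \<le> K1 * (s * KS) + K2 * (Q * sqrt (real j)) + K3 * (Q * s)"
      by (simp add: K3_def distrib_right)
    have KS0: "KS \<ge> 0" unfolding KS_def using kern_pos[of "real Q"] Q1 by (intro sum_nonneg less_imp_le) auto
    have gen: "A * X + B' * Y + D * Z \<le> (A + B' + D) * (Z + Y + X)"
      if "0 \<le> A" "0 \<le> B'" "0 \<le> D" "0 \<le> X" "0 \<le> Y" "0 \<le> Z" for A B' D X Y Z :: real
    proof -
      have "A * X \<le> (A + B' + D) * X" "B' * Y \<le> (A + B' + D) * Y" "D * Z \<le> (A + B' + D) * Z"
        using that by (auto intro!: mult_right_mono)
      then show ?thesis by (simp add: distrib_left)
    qed
    have "0 \<le> s * KS" "0 \<le> real Q * sqrt (real j)" "0 \<le> real Q * s" "0 \<le> K3" using K3p KS0 sb(2) by simp_all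
    then have "norm (weighted_sum \<eta> \<xi> f Q j) \<le> (K1 + K2 + K3) * (Q * s + Q * sqrt (real j) + s * KS)"
      by (intro order_trans[OF main] gen K1p K2p)
    then show "norm (weighted_sum \<eta> \<xi> f Q j) \<le> (K1 + K2 + K3) * (real Q * sqrt (real Q / real j) + real Q * sqrt (real j)
      + sqrt (real Q / real j) * (\<Sum>l\<in>{l. f' (\<eta> - 1) \<le> of_int l / real j \<and> of_int l / real j \<le> f' (\<eta> - 1) + c2 * (\<xi> - \<eta> + 2)}.
          kern Q (real j * legendre (of_int l / real j))))"
      by (simp only: s_def KS_def)
  qed
qed

text \<open>Summing over the block turns the kernel sums for single \<open>j\<close> into one sum
  over \<open>denominators\<close>, to which \<open>kern_sum_layers\<close> applies with the
  Legendre transform as the strongly convex function. The saving in the kernel sums comes from this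
  average over \<open>j\<close>.\<close>

lemma dyadic_block_bound:
  fixes \<eta> \<xi> c1 c2 :: real
  assumes I: "\<eta> < \<xi>" and c: "0 < c1" "c1 \<le> c2"
  shows "\<exists>C>0. \<forall>f f' f'' Q x J. convex_curve f f' f'' c1 c2 \<longrightarrow> 0 \<le> f' \<eta> \<longrightarrow> f' \<eta> \<le> 1 \<longrightarrow>
    1 \<le> x \<longrightarrow> real Q = x ^ 6 \<longrightarrow> 1 \<le> J \<longrightarrow> J \<le> 16 * x ^ 4 \<longrightarrow>
    (\<Sum>j\<in>{j. J / 2 < real j \<and> real j \<le> J}. norm (weighted_sum \<eta> \<xi> f Q j))
      \<le> C * (x ^ 9 * (sqrt J * (1 + ln J)) + x ^ 6 * (J * sqrt J))"
proof -
  obtain C0 where C0: "C0 > 0" and bd: "\<forall>f f' f'' Q j x. convex_curve f f' f'' c1 c2 \<longrightarrow> 0 \<le> f' \<eta> \<longrightarrow> f' \<eta> \<le> 1 \<longrightarrow>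
    1 \<le> x \<longrightarrow> real Q = x ^ 6 \<longrightarrow> 1 \<le> j \<longrightarrow> real j \<le> 16 * x ^ 4 \<longrightarrow>
    norm (weighted_sum \<eta> \<xi> f Q j) \<le> C0 * (real Q * sqrt (real Q / real j) + real Q * sqrt (real j)
      + sqrt (real Q / real j) * (\<Sum>l\<in>{l. f' (\<eta> - 1) \<le> of_int l / real j \<and> of_int l / real j \<le> f' (\<eta> - 1) + c2 * (\<xi> - \<eta> + 2)}.
          kern Q (real j * convex_curve.legendre f f' (of_int l / real j))))"
    using weighted_sum_bound[OF I c] by (elim exE conjE)
  have c2p: "0 < c2" using c by simp
  define a b where "a = c1 / (2 * c2\<^sup>2)" and "b = c2 / (2 * c1\<^sup>2)"
  define V where "V = c2 * (\<xi> - \<eta> + 2)"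
  define \<kappa> where "\<kappa> = min 1 (1 / (2 * b))"
  define c0 where "c0 = min (1/16) a"
  define P1 where "P1 = 2 * (2 * (V / \<kappa> + 1) + 16 * (V / \<kappa> + 1) / sqrt a + 8 * (3 + 3 * b * V) / sqrt a)"
  define P2 where "P2 = (V + 1 + (3 * b * V + 5) * (4 + 4 / a)) * (4 / c0 + 10 / c0)"
  have p: "a > 0" "b > 0" "V > 0" using c c2p I by (auto simp: a_def b_def V_def)
  have c0p: "c0 > 0" "\<kappa> > 0" using p by (auto simp: c0_def \<kappa>_def)
  have P1: "P1 \<ge> 0" and P2: "P2 \<ge> 0" using p c0p unfolding P1_def P2_def by simp_all
  show ?thesis
  proof (intro exI[of _ "C0 * (3 + 48 * P1 + 16 * P2)"] conjI allI impI)
    show "C0 * (3 + 48 * P1 + 16 * P2) > 0" using C0 P1 P2 by simp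
    fix f f' f'' :: "real \<Rightarrow> real" and Q :: nat and x J :: real
    assume cc: "convex_curve f f' f'' c1 c2" and f': "0 \<le> f' \<eta>" "f' \<eta> \<le> 1" and x: "1 \<le> x"
      and Qx: "real Q = x ^ 6" and J: "1 \<le> J" "J \<le> 16 * x ^ 4"
    interpret convex_curve f f' f'' c1 c2 by fact
    interpret L: strongly_convex legendre \<tau> a b unfolding a_def b_def by (rule legendre_strongly_convex)
    define u where "u = f' (\<eta> - 1)"
    define D where "D = {j::nat. J / 2 < real j \<and> real j \<le> J}"
    define F where "F j = {l::int. u \<le> of_int l / real j \<and> of_int l / real j \<le> u + V}" for j :: nat
    define KS where "KS j = (\<Sum>l\<in>F j. kern Q (real j * legendre (of_int l / real j)))" for j :: nat
    define y where "y = sqrt J"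
    have y: "y \<ge> 1" "J = y\<^sup>2" using J by (auto simp: y_def)
    \<comment> \<open>A common bound for \<open>sqrt (Q / j)\<close> on the block, from
      \<open>j \<ge> J / 4\<close>.\<close>
    define S where "S = 2 * x ^ 3 / y"
    have S0: "S \<ge> 0" using x y by (simp add: S_def)
    have Q1: "real Q \<ge> 1" using x Qx by simp
    have D1: "1 \<le> j" "real j \<le> J" "J / 4 \<le> real j" if "j \<in> D" for j
      using that J by (auto simp: D_def)
    have Dsub: "D \<subseteq> {1..nat \<lfloor>J\<rfloor>}" using D1 by (auto simp: le_nat_floor)
    then have finD: "finite D" by (rule finite_subset) simp
    have "card D \<le> nat \<lfloor>J\<rfloor>" using card_mono[OF _ Dsub] by simp
    then have "real (card D) \<le> real (nat \<lfloor>J\<rfloor>)" by simp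
    also have "\<dots> \<le> J" using J by simp
    finally have cardD: "real (card D) \<le> J" .
    have KS0: "KS j \<ge> 0" for j unfolding KS_def using less_imp_le[OF kern_pos[of "real Q"]] Q1 by (intro sum_nonneg) auto
    have each: "norm (weighted_sum \<eta> \<xi> f Q j) \<le> C0 * (real Q * S + real Q * y + S * KS j)" if j: "j \<in> D" for j
    proof -
      have jp: "real j \<ge> 1" using D1[OF j] by simp
      have sq: "sqrt (real Q / real j) \<le> S"
      proof (rule real_le_lsqrt)
        show "0 \<le> S" by (rule S0)
        have "real Q / real j \<le> real Q / (J / 4)" using D1(3)[OF j] J Q1 jp by (intro divide_left_mono) auto
        also have "\<dots> = S\<^sup>2" using y by (simp add: S_def Qx power_divide power_mult_distrib flip: power_mult)
        finally show "real Q / real j \<le> S\<^sup>2" .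
      qed
      have "sqrt (real j) \<le> y" using D1[OF j] by (simp add: y_def)
      moreover have "norm (weighted_sum \<eta> \<xi> f Q j) \<le> C0 * (real Q * sqrt (real Q / real j) + real Q * sqrt (real j) + sqrt (real Q / real j) * KS j)"
        using bd[rule_format, OF cc f' x Qx] D1[OF j] J unfolding KS_def F_def u_def V_def by simp
      ultimately show ?thesis using sq C0 KS0[of j] Q1
        by (elim order_trans) (intro add_mono mult_left_mono mult_right_mono, auto)
    qed
    have KSsum: "(\<Sum>j\<in>D. KS j) = (\<Sum>(l, j)\<in>L.denominators u (u + V) J. kern Q (of_int j * legendre (of_int l / of_int j)))"
    proof -
      have finF: "finite (F j)" if "j \<in> D" for j unfolding F_def using D1[OF that] by (intro finite_fractions) auto
      have "(\<Sum>j\<in>D. KS j) = (\<Sum>(j, l)\<in>Sigma D F. kern Q (real j * legendre (of_int l / real j)))"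
        unfolding KS_def using finD finF by (intro sum.Sigma) auto
      also have "\<dots> = (\<Sum>(l, j)\<in>L.denominators u (u + V) J. kern Q (of_int j * legendre (of_int l / of_int j)))"
        by (rule sum.reindex_bij_witness[of _ "\<lambda>(l, j). (nat j, l)" "\<lambda>(j, l). (l, int j)"])
          (use J in \<open>auto simp: D_def F_def L.denominators_def\<close>)
      finally show ?thesis .
    qed
    have "(\<Sum>j\<in>D. KS j) \<le> P1 * (8 * (real Q * (J * (1 + ln J))) + 16 * (J\<^sup>2 * sqrt (real Q))) + P2 * J powr (8/3)"
      unfolding KSsum P2_def using p J Q1
      by (intro L.kern_sum_layers[where \<kappa> = \<kappa>]) (auto simp: \<kappa>_def c0_def P1_def)
    also have "sqrt (real Q) = x ^ 3"
      using x by (intro real_sqrt_unique) (auto simp: Qx simp flip: power_mult)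
    \<comment> \<open>The cost of the large layers is folded into the term with
      \<open>J\<^sup>2 * sqrt Q\<close>: because \<open>J \<le> 16 * x ^ 4\<close>, the excess
      \<open>J powr (2/3)\<close> is at most \<open>8 * x ^ 3\<close>.\<close>
    also have "J powr (8/3) \<le> 8 * x ^ 3 * J\<^sup>2"
    proof -
      have "J powr (2/3) \<le> J powr (3/4)" using J by (intro powr_mono) auto
      also have "\<dots> \<le> (16 * x ^ 4) powr (3/4)" using J by (intro powr_mono2) auto
      also have "16 * x ^ 4 = (2 * x) powr 4" using x by (simp add: power_mult_distrib)
      also have "\<dots> powr (3/4) = (2 * x) powr 3" by (simp add: powr_powr)
      also have "\<dots> = 8 * x ^ 3" using x by (simp add: power_mult_distrib)
      finally have "J powr (2/3) * J powr 2 \<le> 8 * x ^ 3 * J powr 2" by (intro mult_right_mono) auto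
      moreover have "J powr (8/3) = J powr (2/3) * J powr 2" by (simp flip: powr_add)
      ultimately show ?thesis using J by simp
    qed
    finally have KSb: "(\<Sum>j\<in>D. KS j) \<le> P1 * (8 * (real Q * (J * (1 + ln J))) + 16 * (J\<^sup>2 * x ^ 3)) + P2 * (8 * x ^ 3 * J\<^sup>2)"
      using P2 by (simp add: mult_left_mono)
    have "(\<Sum>j\<in>D. norm (weighted_sum \<eta> \<xi> f Q j)) \<le> (\<Sum>j\<in>D. C0 * (real Q * S + real Q * y + S * KS j))"
      by (intro sum_mono each)
    also have "\<dots> = C0 * (real (card D) * (real Q * S + real Q * y) + S * (\<Sum>j\<in>D. KS j))"
      by (simp add: sum_distrib_left[symmetric] sum.distrib distrib_left)
    also have "\<dots> \<le> C0 * (J * (real Q * S + real Q * y)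
        + S * (P1 * (8 * (real Q * (J * (1 + ln J))) + 16 * (J\<^sup>2 * x ^ 3)) + P2 * (8 * x ^ 3 * J\<^sup>2)))"
      using C0 cardD KSb S0 y by (intro mult_left_mono add_mono mult_right_mono) auto
    also have "\<dots> = C0 * (2 * (x ^ 9 * (y * 1)) + x ^ 6 * (J * y) + P1 * (16 * (x ^ 9 * (y * (1 + ln J))) + 32 * (x ^ 6 * (J * y))) + 16 * P2 * (x ^ 6 * (J * y)))"
    proof -
      have Sy: "S * y = 2 * x ^ 3" using y(1) by (simp add: S_def)
      have x9: "x ^ 6 * x ^ 3 = x ^ 9" and x6: "x ^ 3 * x ^ 3 = x ^ 6" by (simp_all flip: power_add)
      have "J * (real Q * S) = real Q * (y * (S * y))" unfolding y(2) by (simp add: power2_eq_square)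
      also have "\<dots> = 2 * ((x ^ 6 * x ^ 3) * y)" unfolding Sy Qx by simp
      finally have 1: "J * (real Q * S) = 2 * (x ^ 9 * y)" unfolding x9 .
      have 2: "S * (real Q * (J * X)) = 2 * (x ^ 9 * (y * X))" for X
      proof -
        have "S * (real Q * (J * X)) = (J * (real Q * S)) * X" by simp
        then show ?thesis unfolding 1 by simp
      qed
      have "S * (J\<^sup>2 * x ^ 3) = (S * y) * (J * y * x ^ 3)" unfolding y(2) by (simp add: power2_eq_square)
      also have "\<dots> = 2 * ((x ^ 3 * x ^ 3) * (J * y))" unfolding Sy by simp
      finally have 3: "S * (J\<^sup>2 * x ^ 3) = 2 * (x ^ 6 * (J * y))" unfolding x6 .
      have gen: "C * (J * (q * S + q * y) + S * (p1 * (8 * (q * (J * L)) + 16 * (J2 * x3)) + p2 * (8 * x3 * J2)))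
        = C * (J * (q * S) + q * (J * y) + p1 * (8 * (S * (q * (J * L))) + 16 * (S * (J2 * x3))) + p2 * (8 * (S * (J2 * x3))))"
        for C J q S y p1 L J2 x3 p2 :: real by (simp add: algebra_simps)
      show ?thesis unfolding gen 1 2 3 by (simp add: Qx)
    qed
    also have "\<dots> \<le> C0 * ((3 + 48 * P1 + 16 * P2) * (x ^ 9 * (y * (1 + ln J)) + x ^ 6 * (J * y)))"
    proof (rule mult_left_mono)
      define A where "A = x ^ 9 * (y * (1 + ln J))"
      define B where "B = x ^ 6 * (J * y)"
      have lJ: "0 \<le> ln J" using J by simp
      have AB: "0 \<le> A" "0 \<le> B" using x y J lJ by (auto simp: A_def B_def)
      have A1: "x ^ 9 * (y * 1) \<le> A" unfolding A_def using x y lJ by (intro mult_left_mono) auto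
      have gen: "2 * A' + B + p1 * (16 * A + 32 * B) + 16 * p2 * B \<le> (3 + 48 * p1 + 16 * p2) * (A + B)"
        if "A' \<le> A" "0 \<le> p1" "0 \<le> p2" for A' p1 p2
      proof -
        have "0 \<le> p1 * A" "0 \<le> p1 * B" "0 \<le> p2 * A" "0 \<le> p2 * B" using that AB by auto
        then show ?thesis using that(1) AB by (simp add: algebra_simps)
      qed
      show "2 * (x ^ 9 * (y * 1)) + x ^ 6 * (J * y) + P1 * (16 * (x ^ 9 * (y * (1 + ln J))) + 32 * (x ^ 6 * (J * y))) + 16 * P2 * (x ^ 6 * (J * y))
        \<le> (3 + 48 * P1 + 16 * P2) * (x ^ 9 * (y * (1 + ln J)) + x ^ 6 * (J * y))"
        using gen[OF A1 P1 P2] by (simp only: A_def B_def)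
    qed (use C0 in simp)
    finally show "(\<Sum>j\<in>{j. J / 2 < real j \<and> real j \<le> J}. norm (weighted_sum \<eta> \<xi> f Q j))
      \<le> C0 * (3 + 48 * P1 + 16 * P2) * (x ^ 9 * (sqrt J * (1 + ln J)) + x ^ 6 * (J * sqrt J))"
      unfolding D_def y_def by (simp only: mult.assoc)
  qed
qed

section \<open>Summation over dyadic blocks\<close>

lemma sum_powers_sqrt2_le: "(\<Sum>i\<le>n. sqrt 2 ^ i) \<le> 4 * sqrt 2 ^ n"
proof (induction n)
  case (Suc n)
  have "4 / 3 \<le> sqrt 2" by (rule real_le_rsqrt) (simp add: power2_eq_square)
  then have "4 * sqrt 2 ^ n \<le> 3 * (sqrt 2 * sqrt 2 ^ n)"
    using mult_right_mono[of 4 "3 * sqrt 2" "sqrt 2 ^ n"] by simp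
  then show ?case using Suc unfolding sum.atMost_Suc power_Suc by linarith
qed simp

lemma sum_inverse_powers_sqrt2_le:
  "(\<Sum>i=n..<n + m. (1 / sqrt 2) ^ i * (1 + real i)) \<le> 4 * (1 / sqrt 2) ^ n * (4 + real n)"
proof -
  define z where "z = 1 / sqrt 2"
  have "1 / sqrt 2 \<le> 5 / 7"
  proof -
    have "7 / 5 \<le> sqrt 2" by (rule real_le_rsqrt) (simp add: power2_eq_square)
    then show ?thesis by (simp add: field_simps)
  qed
  then have z: "0 < z" "z \<le> 5 / 7" by (auto simp: z_def)
  \<comment> \<open>Telescoping: the consecutive differences of \<open>4 * z ^ k * (4 + k)\<close>
    dominate the summand, for which \<open>z \<le> 5 / 7\<close> is enough.\<close>
  have "(\<Sum>i=n..<n + m. z ^ i * (1 + real i)) \<le> 4 * z ^ n * (4 + real n) - 4 * z ^ (n + m) * (4 + real (n + m))"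
  proof (induction m)
    case (Suc m)
    define k where "k = n + m"
    have "1 + real k \<le> 4 * (4 + real k) - 4 * z * (5 + real k)"
      using mult_right_mono[OF z(2), of "5 + real k"] by simp
    then have "z ^ k * (1 + real k) \<le> z ^ k * (4 * (4 + real k) - 4 * z * (5 + real k))"
      using z by (intro mult_left_mono) auto
    also have "\<dots> = 4 * z ^ k * (4 + real k) - 4 * z ^ Suc k * (4 + real (Suc k))" by (simp add: algebra_simps)
    finally show ?case using Suc by (simp add: k_def)
  qed simp
  also have "\<dots> \<le> 4 * z ^ n * (4 + real n)" using z by simp
  finally show ?thesis by (simp add: z_def)
qed

text \<open>The cut is at \<open>p\<close>, where \<open>2 ^ i\<close> passes
  \<open>1 / \<delta>\<close>. Before it the sum is \<open>\<delta>\<close> times a growing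
  geometric progression, after it a decaying one, and both are governed by the terms at the cut, of
  size \<open>sqrt \<delta> * (1 + p)\<close>. Since \<open>\<delta> \<le> 1/2\<close>, additive
  constants are absorbed by \<open>ln (1 / \<delta>)\<close>.\<close>

lemma sum_min_dyadic_le:
  fixes \<delta> :: real
  assumes \<delta>: "0 < \<delta>" "\<delta> \<le> 1/2"
  shows "(\<Sum>i\<le>m. min \<delta> (1 / 2 ^ i) * (sqrt 2 ^ i * (1 + real i))) \<le> 64 * (sqrt \<delta> * ln (1 / \<delta>))"
proof -
  define y where "y = sqrt 2"
  have y: "y > 0" "y\<^sup>2 = 2" by (auto simp: y_def)
  have y2: "2 ^ i = y ^ i * y ^ i" for i by (simp add: y_def flip: power_mult_distrib)
  define p where "p = nat \<lfloor>log 2 (1 / \<delta>)\<rfloor>"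
  have \<delta>2: "2 \<le> 1 / \<delta>" using \<delta> by (simp add: field_simps)
  have "log 2 2 \<le> log 2 (1 / \<delta>)" using \<delta>2 by (intro log_mono) auto
  then have lg: "1 \<le> log 2 (1 / \<delta>)" by simp
  have p1: "1 \<le> p" "real p \<le> log 2 (1 / \<delta>)" "log 2 (1 / \<delta>) < real p + 1"
    using lg unfolding p_def by linarith+
  have pl: "2 ^ p \<le> 1 / \<delta>" using p1(2) \<delta> by (simp add: le_log_iff powr_realpow)
  have pu: "1 / \<delta> < 2 ^ Suc p"
  proof -
    have "1 / \<delta> = 2 powr log 2 (1 / \<delta>)" using \<delta> by simp
    also have "\<dots> < 2 powr real (Suc p)" using p1(3) by (intro powr_less_mono) auto
    also have "\<dots> = 2 ^ Suc p" by (rule powr_realpow) simp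
    finally show ?thesis .
  qed
  have yp: "y ^ p \<le> 1 / sqrt \<delta>"
  proof -
    have "sqrt (2 ^ p) \<le> sqrt (1 / \<delta>)" using pl by simp
    then show ?thesis by (simp add: y_def real_sqrt_power real_sqrt_divide)
  qed
  have zp: "(1 / y) ^ Suc p \<le> sqrt \<delta>"
  proof -
    have "sqrt (1 / \<delta>) \<le> sqrt (2 ^ Suc p)" using pu by (intro real_sqrt_le_mono) simp
    then have "1 / sqrt \<delta> \<le> y ^ Suc p" by (simp only: y_def real_sqrt_power real_sqrt_divide real_sqrt_one)
    then have "1 / y ^ Suc p \<le> sqrt \<delta>" using \<delta> y by (simp add: field_simps)
    then show ?thesis by (simp add: power_one_over)
  qed
  have nn: "0 \<le> min \<delta> (1 / 2 ^ i) * (y ^ i * (1 + real i))" for i using \<delta> y by simp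
  have "(\<Sum>i\<le>m. min \<delta> (1 / 2 ^ i) * (y ^ i * (1 + real i))) \<le> (\<Sum>i\<in>{..p} \<union> {Suc p..<Suc p + m}. min \<delta> (1 / 2 ^ i) * (y ^ i * (1 + real i)))"
    using nn by (intro sum_mono2) auto
  also have "\<dots> = (\<Sum>i\<le>p. min \<delta> (1 / 2 ^ i) * (y ^ i * (1 + real i))) + (\<Sum>i=Suc p..<Suc p + m. min \<delta> (1 / 2 ^ i) * (y ^ i * (1 + real i)))"
    by (intro sum.union_disjoint) auto
  also have "(\<Sum>i\<le>p. min \<delta> (1 / 2 ^ i) * (y ^ i * (1 + real i))) \<le> (\<Sum>i\<le>p. \<delta> * (1 + real p) * y ^ i)"
  proof (rule sum_mono)
    fix i assume "i \<in> {..p}"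
    then have "min \<delta> (1 / 2 ^ i) * (y ^ i * (1 + real i)) \<le> \<delta> * (y ^ i * (1 + real p))"
      using \<delta> y by (intro mult_mono) auto
    then show "min \<delta> (1 / 2 ^ i) * (y ^ i * (1 + real i)) \<le> \<delta> * (1 + real p) * y ^ i" by (simp add: mult_ac)
  qed
  also have "\<dots> = \<delta> * (1 + real p) * (\<Sum>i\<le>p. y ^ i)" by (simp add: sum_distrib_left)
  also have "\<dots> \<le> \<delta> * (1 + real p) * (4 * (1 / sqrt \<delta>))"
    using sum_powers_sqrt2_le[of p, folded y_def] yp \<delta> by (intro mult_left_mono) auto
  also have "\<dots> = 4 * sqrt \<delta> * (1 + real p)"
  proof -
    have "\<delta> / sqrt \<delta> = sqrt \<delta>" using \<delta> by (simp add: real_div_sqrt)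
    then show ?thesis by (metis (no_types, opaque_lifting) mult.assoc mult.commute times_divide_eq_right mult.right_neutral)
  qed
  also have "(\<Sum>i=Suc p..<Suc p + m. min \<delta> (1 / 2 ^ i) * (y ^ i * (1 + real i))) \<le> (\<Sum>i=Suc p..<Suc p + m. (1 / y) ^ i * (1 + real i))"
  proof (rule sum_mono)
    fix i
    have "min \<delta> (1 / 2 ^ i) * (y ^ i * (1 + real i)) \<le> (1 / 2 ^ i) * (y ^ i * (1 + real i))"
      using y by (intro mult_right_mono) auto
    also have "\<dots> = (1 / y) ^ i * (1 + real i)" unfolding y2 using y by (simp add: power_one_over)
    finally show "min \<delta> (1 / 2 ^ i) * (y ^ i * (1 + real i)) \<le> (1 / y) ^ i * (1 + real i)" .
  qed
  also have "\<dots> \<le> 4 * (1 / y) ^ Suc p * (4 + real (Suc p))" unfolding y_def by (rule sum_inverse_powers_sqrt2_le)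
  also have "\<dots> \<le> 4 * sqrt \<delta> * (4 + real (Suc p))" using zp by (intro mult_right_mono mult_left_mono) auto
  also have "4 * sqrt \<delta> * (1 + real p) + 4 * sqrt \<delta> * (4 + real (Suc p)) = 4 * sqrt \<delta> * (6 + 2 * real p)"
    by (simp add: algebra_simps)
  also have "\<dots> \<le> 4 * sqrt \<delta> * (8 * (2 * ln (1 / \<delta>)))"
  proof (rule mult_left_mono)
    have "ln (1 / \<delta>) = log 2 (1 / \<delta>) * ln 2" by (simp add: log_def)
    moreover have "real p * (1/2) \<le> log 2 (1 / \<delta>) * ln 2"
      using p1 lg ln2_ge_two_thirds by (intro mult_mono) auto
    ultimately show "6 + 2 * real p \<le> 8 * (2 * ln (1 / \<delta>))" using p1(1) by simp
  qed (use \<delta> in simp)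
  finally show ?thesis by (simp add: y_def)
qed

lemma sum_dyadic_blocks:
  fixes g :: "nat \<Rightarrow> real"
  shows "(\<Sum>k=1..2 ^ m. g k) = (\<Sum>i\<le>m. \<Sum>k\<in>{k. 2 ^ i / 2 < real k \<and> real k \<le> 2 ^ i}. g k)"
proof (induction m)
  case 0
  have "1 / 2 < real k \<and> real k \<le> 1 \<longleftrightarrow> k = 1" for k by auto
  then have "{k. 2 ^ 0 / 2 < real k \<and> real k \<le> 2 ^ 0} = {1::nat}" unfolding power_0 by blast
  then show ?case by simp
next
  case (Suc m)
  have "2 ^ Suc m / 2 < real k \<longleftrightarrow> 2 ^ m < k" "real k \<le> 2 ^ Suc m \<longleftrightarrow> k \<le> 2 ^ Suc m" for k
  proof -
    have "2 ^ Suc m / 2 = real (2 ^ m)" "2 ^ Suc m = real (2 ^ Suc m)" by simp_all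
    then show "2 ^ Suc m / 2 < real k \<longleftrightarrow> 2 ^ m < k" "real k \<le> 2 ^ Suc m \<longleftrightarrow> k \<le> 2 ^ Suc m"
      by (metis of_nat_less_iff) (metis of_nat_le_iff of_nat_numeral of_nat_power)
  qed
  then have D: "{k. 2 ^ Suc m / 2 < real k \<and> real k \<le> 2 ^ Suc m} = {2 ^ m<..2 ^ Suc m::nat}"
    by (simp only: set_eq_iff mem_Collect_eq greaterThanAtMost_iff simp_thms)
  have "{1..b} = {1..a} \<union> {a<..b}" if "1 \<le> a" "a \<le> b" for a b :: nat using that by auto
  then have U: "{1..2 ^ Suc m} = {1..2 ^ m} \<union> {2 ^ m<..2 ^ Suc m::nat}" by simp
  have "(\<Sum>k=1..2 ^ Suc m. g k) = (\<Sum>k=1..2 ^ m. g k) + (\<Sum>k\<in>{2 ^ m<..2 ^ Suc m}. g k)"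
    unfolding U by (intro sum.union_disjoint) auto
  then show ?case unfolding sum.atMost_Suc D Suc .
qed

text \<open>Against \<open>min \<delta> (1 / 2 ^ i)\<close> the first part of
  \<open>dyadic_block_bound\<close> is summed by \<open>sum_min_dyadic_le\<close>, and the second
  becomes a geometric sum dominated by its last term, of order \<open>x ^ 8\<close>. Against
  \<open>1 / H\<close> both parts are of that order at most, the factor \<open>1 + i\<close> in the
  first being paid for by one power of \<open>x\<close>.\<close>

lemma weighted_sums_total:
  fixes \<eta> \<xi> c1 c2 :: real
  assumes I: "\<eta> < \<xi>" and c: "0 < c1" "c1 \<le> c2"
  shows "\<exists>C>0. \<forall>f f' f'' Q x \<delta> H. convex_curve f f' f'' c1 c2 \<longrightarrow> 0 \<le> f' \<eta> \<longrightarrow> f' \<eta> \<le> 1 \<longrightarrow>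
    1 \<le> x \<longrightarrow> real Q = x ^ 6 \<longrightarrow> 0 < \<delta> \<longrightarrow> \<delta> \<le> 1/2 \<longrightarrow> x ^ 4 \<le> real H \<longrightarrow> real H \<le> 2 * x ^ 4 \<longrightarrow>
    (\<Sum>k=1..2*H. (min \<delta> (1 / real k) + 1 / real H) * norm (weighted_sum \<eta> \<xi> f Q k))
      \<le> C * (sqrt \<delta> * ln (1 / \<delta>) * x ^ 9 + x ^ 8)"
proof -
  obtain C0 where C0: "C0 > 0" and bd: "\<forall>f f' f'' Q x J. convex_curve f f' f'' c1 c2 \<longrightarrow> 0 \<le> f' \<eta> \<longrightarrow> f' \<eta> \<le> 1 \<longrightarrow>
    1 \<le> x \<longrightarrow> real Q = x ^ 6 \<longrightarrow> 1 \<le> J \<longrightarrow> J \<le> 16 * x ^ 4 \<longrightarrow>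
    (\<Sum>j\<in>{j. J / 2 < real j \<and> real j \<le> J}. norm (weighted_sum \<eta> \<xi> f Q j))
      \<le> C0 * (x ^ 9 * (sqrt J * (1 + ln J)) + x ^ 6 * (J * sqrt J))"
    using dyadic_block_bound[OF I c] by (elim exE conjE)
  show ?thesis
  proof (intro exI[of _ "C0 * 432"] conjI allI impI)
    show "C0 * 432 > 0" using C0 by simp
    fix f f' f'' :: "real \<Rightarrow> real" and Q H :: nat and x \<delta> :: real
    assume cc: "convex_curve f f' f'' c1 c2" and f': "0 \<le> f' \<eta>" "f' \<eta> \<le> 1" and x: "1 \<le> x"
      and Qx: "real Q = x ^ 6" and \<delta>: "0 < \<delta>" "\<delta> \<le> 1/2" and H: "x ^ 4 \<le> real H" "real H \<le> 2 * x ^ 4"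
    define T where "T k = norm (weighted_sum \<eta> \<xi> f Q k)" for k
    have T0: "T k \<ge> 0" for k by (simp add: T_def)
    define y where "y = sqrt 2"
    have y: "y > 0" by (simp add: y_def)
    have x4: "1 \<le> x ^ 4" using x by simp
    have Hp: "1 \<le> real H" using H x4 by linarith
    \<comment> \<open>Rounding \<open>2 * H\<close> up to a power of two gives at most
      \<open>4 * H\<close>, which is within the range \<open>16 * x ^ 4\<close> of
      \<open>dyadic_block_bound\<close>.\<close>
    define m where "m = (LEAST m. 2 * H \<le> 2 ^ m)"
    have "2 * H \<le> 2 ^ (2 * H)" by (rule less_imp_le) (rule less_exp)
    from LeastI[of "\<lambda>m. 2 * H \<le> 2 ^ m", OF this] have m: "2 * H \<le> 2 ^ m" unfolding m_def .
    have "m \<noteq> 0" using m Hp by (cases m) auto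
    then obtain m' where m': "m = Suc m'" by (cases m) auto
    have "\<not> 2 * H \<le> 2 ^ m'"
      using not_less_Least[of m' "\<lambda>m. 2 * H \<le> 2 ^ m"] m' unfolding m_def by simp
    then have "2 ^ m \<le> 4 * H" by (simp add: m')
    then have "real (2 ^ m) \<le> real (4 * H)" by (rule of_nat_mono)
    then have m2: "2 ^ m \<le> 16 * x ^ 4" using H x4 by simp
    have y2: "2 ^ i = y ^ i * y ^ i" for i by (simp add: y_def flip: power_mult_distrib)
    have ys: "sqrt (2 ^ i) = y ^ i" for i by (simp add: y_def real_sqrt_power)
    have ym: "y ^ m \<le> 4 * x\<^sup>2"
    proof -
      have "sqrt (2 ^ m) \<le> 4 * x\<^sup>2"
        using m2 by (intro real_le_lsqrt) (simp_all add: power_mult_distrib flip: power_mult)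
      then show ?thesis unfolding ys .
    qed
    have my: "1 + real m \<le> 9 * x"
    proof -
      have "real m * ln 2 = ln (2 ^ m)" by (simp add: ln_realpow)
      also have "\<dots> \<le> ln (16 * x ^ 4)" using m2 x by (intro ln_mono) auto
      also have "\<dots> = ln (2 ^ 4 * x ^ 4)" by simp
      also have "\<dots> = 4 * ln 2 + 4 * ln x" using x by (simp only: ln_mult ln_realpow) (simp add: ln_mult ln_realpow)
      also have "\<dots> \<le> 4 * ln 2 + 4 * (x - 1)" using x ln_le_minus_one[of x] by simp
      finally have "(real m - 4) * ln 2 \<le> 4 * (x - 1)" by (simp add: algebra_simps)
      moreover have "real m - 4 \<le> max 0 ((real m - 4) * ln 2 * 2)"
      proof (cases "4 \<le> real m")
        case True
        have "(real m - 4) * (1 / 2) \<le> (real m - 4) * ln 2" using True ln2_ge_two_thirds by (intro mult_left_mono) auto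
        then show ?thesis by simp
      qed simp
      moreover have "1 + M \<le> 9 * x" if "z \<le> 4 * (x - 1)" "M - 4 \<le> max 0 (z * 2)" for M z
        using that x by (auto simp: max_def split: if_splits)
      ultimately show ?thesis by blast
    qed
    have blk: "(\<Sum>k\<in>{k. 2 ^ i / 2 < real k \<and> real k \<le> 2 ^ i}. T k) \<le> C0 * (x ^ 9 * (y ^ i * (1 + real i)) + x ^ 6 * (2 ^ i * y ^ i))"
      if i: "i \<le> m" for i
    proof -
      have "(2::real) ^ i \<le> 2 ^ m" using i by (intro power_increasing) auto
      then have J: "1 \<le> (2::real) ^ i" "2 ^ i \<le> 16 * x ^ 4" using order_trans[OF _ m2] by auto
      have "(\<Sum>k\<in>{k. 2 ^ i / 2 < real k \<and> real k \<le> 2 ^ i}. T k) \<le> C0 * (x ^ 9 * (y ^ i * (1 + ln (2 ^ i))) + x ^ 6 * (2 ^ i * y ^ i))"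
        unfolding T_def ys[symmetric] by (rule bd[rule_format, OF cc f' x Qx J])
      also have "\<dots> \<le> C0 * (x ^ 9 * (y ^ i * (1 + real i)) + x ^ 6 * (2 ^ i * y ^ i))"
      proof -
        have "real i * ln 2 \<le> real i * 1" using ln2_le_25_over_36 by (intro mult_left_mono) auto
        then have "ln (2 ^ i) \<le> real i" by (simp add: ln_realpow)
        then show ?thesis using C0 x y by (intro mult_left_mono add_right_mono add_left_mono) auto
      qed
      finally show ?thesis .
    qed
    define W where "W i = 2 * min \<delta> (1 / 2 ^ i) + 1 / real H" for i :: nat
    have W0: "W i \<ge> 0" for i using \<delta> by (simp add: W_def)
    have "(\<Sum>k=1..2*H. (min \<delta> (1 / real k) + 1 / real H) * T k) \<le> (\<Sum>k=1..2^m. (min \<delta> (1 / real k) + 1 / real H) * T k)"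
      using m \<delta> T0 by (intro sum_mono2) auto
    also have "\<dots> = (\<Sum>i\<le>m. \<Sum>k\<in>{k. 2 ^ i / 2 < real k \<and> real k \<le> 2 ^ i}. (min \<delta> (1 / real k) + 1 / real H) * T k)"
      by (rule sum_dyadic_blocks)
    also have "\<dots> \<le> (\<Sum>i\<le>m. \<Sum>k\<in>{k. 2 ^ i / 2 < real k \<and> real k \<le> 2 ^ i}. W i * T k)"
    proof (intro sum_mono mult_right_mono T0)
      fix i k assume "k \<in> {k. 2 ^ i / 2 < real k \<and> real k \<le> 2 ^ i}"
      then have k: "2 ^ i / 2 < real k" by simp
      have "1 / real k \<le> 1 / (2 ^ i / 2)" using k by (intro divide_left_mono) (auto intro!: mult_pos_pos order.strict_trans[OF _ k])
      then have "1 / real k \<le> 2 * (1 / 2 ^ i)" by simp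
      then have "min \<delta> (1 / real k) \<le> 2 * min \<delta> (1 / 2 ^ i)" using \<delta> by (auto simp: min_def)
      then show "min \<delta> (1 / real k) + 1 / real H \<le> W i" by (simp add: W_def)
    qed
    also have "\<dots> = (\<Sum>i\<le>m. W i * (\<Sum>k\<in>{k. 2 ^ i / 2 < real k \<and> real k \<le> 2 ^ i}. T k))"
      by (simp add: sum_distrib_left)
    also have "\<dots> \<le> (\<Sum>i\<le>m. W i * (C0 * (x ^ 9 * (y ^ i * (1 + real i)) + x ^ 6 * (2 ^ i * y ^ i))))"
      using blk W0 by (intro sum_mono mult_left_mono) auto
    also have "\<dots> \<le> (\<Sum>i\<le>m. C0 * (2 * x ^ 9 * (min \<delta> (1 / 2 ^ i) * (y ^ i * (1 + real i)))
        + (2 * x ^ 6 + x ^ 9 * (9 * x) / x ^ 4 + x ^ 6 * (16 * x ^ 4) / x ^ 4) * y ^ i))"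
    proof (rule sum_mono)
      fix i assume "i \<in> {..m}"
      then have i: "i \<le> m" by simp
      define \<mu> where "\<mu> = min \<delta> (1 / 2 ^ i)"
      have \<mu>: "0 \<le> \<mu>" "\<mu> * 2 ^ i \<le> 1"
      proof -
        show "0 \<le> \<mu>" using \<delta> by (simp add: \<mu>_def)
        have "\<mu> * 2 ^ i \<le> (1 / 2 ^ i) * 2 ^ i" by (intro mult_right_mono) (auto simp: \<mu>_def)
        then show "\<mu> * 2 ^ i \<le> 1" by simp
      qed
      have "0 < real H * x ^ 4" using Hp x4 by (intro mult_pos_pos) linarith+
      then have h: "0 \<le> 1 / real H" "1 / real H \<le> 1 / x ^ 4" using H by (auto intro!: divide_left_mono)
      have i2: "(2::real) ^ i \<le> 16 * x ^ 4" by (rule order_trans[OF power_increasing[OF i] m2]) simp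
      have i1: "1 + real i \<le> 9 * x" using my i by simp
      have a: "\<mu> * (x ^ 6 * (2 ^ i * y ^ i)) \<le> x ^ 6 * y ^ i"
        using mult_right_mono[OF \<mu>(2), of "x ^ 6 * y ^ i"] x y by (simp add: mult_ac)
      have b: "(1 / real H) * (x ^ 9 * (y ^ i * (1 + real i))) \<le> (1 / x ^ 4) * (x ^ 9 * (y ^ i * (9 * x)))"
        using h i1 x y by (intro mult_mono) auto
      have d: "(1 / real H) * (x ^ 6 * (2 ^ i * y ^ i)) \<le> (1 / x ^ 4) * (x ^ 6 * ((16 * x ^ 4) * y ^ i))"
        using h i2 x y by (intro mult_mono) auto
      have "W i * (x ^ 9 * (y ^ i * (1 + real i)) + x ^ 6 * (2 ^ i * y ^ i))
        = 2 * x ^ 9 * (\<mu> * (y ^ i * (1 + real i))) + 2 * (\<mu> * (x ^ 6 * (2 ^ i * y ^ i)))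
          + (1 / real H) * (x ^ 9 * (y ^ i * (1 + real i))) + (1 / real H) * (x ^ 6 * (2 ^ i * y ^ i))"
      proof -
        have "(2 * \<mu> + h) * (A * B + D) = 2 * A * (\<mu> * B) + 2 * (\<mu> * D) + h * (A * B) + h * D" for h A B D :: real
          by (simp add: algebra_simps)
        then show ?thesis unfolding W_def \<mu>_def[symmetric] .
      qed
      also have "\<dots> \<le> 2 * x ^ 9 * (\<mu> * (y ^ i * (1 + real i))) + 2 * (x ^ 6 * y ^ i)
          + (1 / x ^ 4) * (x ^ 9 * (y ^ i * (9 * x))) + (1 / x ^ 4) * (x ^ 6 * ((16 * x ^ 4) * y ^ i))"
        using a b d by (intro add_mono order_refl) simp_all
      also have "\<dots> = 2 * x ^ 9 * (\<mu> * (y ^ i * (1 + real i))) + (2 * x ^ 6 + x ^ 9 * (9 * x) / x ^ 4 + x ^ 6 * (16 * x ^ 4) / x ^ 4) * y ^ i"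
      proof -
        have "Z + 2 * (A * Y) + (1 / r) * (B * (Y * D)) + (1 / r) * (A * (E * Y)) = Z + (2 * A + B * D / r + A * E / r) * Y" for Z A Y r B D E :: real
          by (cases "r = 0") (simp_all add: field_simps)
        then show ?thesis .
      qed
      finally have "C0 * (W i * (x ^ 9 * (y ^ i * (1 + real i)) + x ^ 6 * (2 ^ i * y ^ i)))
        \<le> C0 * (2 * x ^ 9 * (\<mu> * (y ^ i * (1 + real i))) + (2 * x ^ 6 + x ^ 9 * (9 * x) / x ^ 4 + x ^ 6 * (16 * x ^ 4) / x ^ 4) * y ^ i)"
        using C0 by (intro mult_left_mono) auto
      then show "W i * (C0 * (x ^ 9 * (y ^ i * (1 + real i)) + x ^ 6 * (2 ^ i * y ^ i))) \<le> C0 * (2 * x ^ 9 * (min \<delta> (1 / 2 ^ i) * (y ^ i * (1 + real i)))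
        + (2 * x ^ 6 + x ^ 9 * (9 * x) / x ^ 4 + x ^ 6 * (16 * x ^ 4) / x ^ 4) * y ^ i)"
        unfolding \<mu>_def mult.left_commute[of "W i" C0] .
    qed
    also have "2 * x ^ 6 + x ^ 9 * (9 * x) / x ^ 4 + x ^ 6 * (16 * x ^ 4) / x ^ 4 = 27 * x ^ 6"
      using x by (simp add: eval_nat_numeral)
    also have "(\<Sum>i\<le>m. C0 * (2 * x ^ 9 * (min \<delta> (1 / 2 ^ i) * (y ^ i * (1 + real i))) + 27 * x ^ 6 * y ^ i))
        = C0 * (2 * x ^ 9 * (\<Sum>i\<le>m. min \<delta> (1 / 2 ^ i) * (y ^ i * (1 + real i))) + 27 * x ^ 6 * (\<Sum>i\<le>m. y ^ i))"
      unfolding sum_distrib_left[symmetric] sum.distrib ..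
    also have "\<dots> \<le> C0 * (2 * x ^ 9 * (64 * (sqrt \<delta> * ln (1 / \<delta>))) + 27 * x ^ 6 * (4 * (4 * x\<^sup>2)))"
      using C0 x sum_min_dyadic_le[OF \<delta>, of m, folded y_def] sum_powers_sqrt2_le[of m, folded y_def] ym
      by (intro mult_left_mono add_mono) auto
    also have "\<dots> = C0 * (128 * (sqrt \<delta> * ln (1 / \<delta>) * x ^ 9) + 432 * x ^ 8)"
    proof -
      have "x ^ 6 * x\<^sup>2 = x ^ 8" by (simp flip: power_add)
      then have "27 * x ^ 6 * (4 * (4 * x\<^sup>2)) = 432 * x ^ 8" by simp
      then show ?thesis by simp
    qed
    also have "\<dots> \<le> C0 * (432 * (sqrt \<delta> * ln (1 / \<delta>) * x ^ 9) + 432 * x ^ 8)"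
    proof -
      have "0 \<le> ln (1 / \<delta>)" using \<delta> by (intro ln_ge_zero) (auto simp: field_simps)
      then have "0 \<le> sqrt \<delta> * ln (1 / \<delta>) * x ^ 9" using \<delta> x by (intro mult_nonneg_nonneg) auto
      then have "128 * (sqrt \<delta> * ln (1 / \<delta>) * x ^ 9) \<le> 432 * (sqrt \<delta> * ln (1 / \<delta>) * x ^ 9)" by (intro mult_right_mono) auto
      then show ?thesis using C0 by (intro mult_left_mono add_right_mono) auto
    qed
    finally show "(\<Sum>k=1..2*H. (min \<delta> (1 / real k) + 1 / real H) * norm (weighted_sum \<eta> \<xi> f Q k))
      \<le> C0 * 432 * (sqrt \<delta> * ln (1 / \<delta>) * x ^ 9 + x ^ 8)"
      unfolding T_def by (simp add: mult.assoc distrib_left)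
  qed
qed

section \<open>Counting rational points\<close>

lemma fractions_eq: "0 < q \<Longrightarrow> {a::int. of_int a / real q \<in> {\<eta>..\<xi>}} = {\<lceil>\<eta> * real q\<rceil>..\<lfloor>\<xi> * real q\<rfloor>}"
  by (auto simp: le_divide_eq divide_le_eq ceiling_le_iff le_floor_iff)

lemma card_fractions:
  assumes "0 < q" "\<eta> < \<xi>"
  shows "\<bar>real (card {a::int. of_int a / real q \<in> {\<eta>..\<xi>}}) - real q * (\<xi> - \<eta>)\<bar> \<le> 1"
proof -
  have "0 < real q * (\<xi> - \<eta>)" using assms by simp
  then have lt: "\<eta> * real q < \<xi> * real q" by (simp add: algebra_simps)
  have "real (card {\<lceil>\<eta> * real q\<rceil>..\<lfloor>\<xi> * real q\<rfloor>}) = real_of_int (\<lfloor>\<xi> * real q\<rfloor> - \<lceil>\<eta> * real q\<rceil> + 1)"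
  proof -
    have "0 \<le> \<lfloor>\<xi> * real q\<rfloor> - \<lceil>\<eta> * real q\<rceil> + 1" using lt by linarith
    then show ?thesis by simp
  qed
  moreover have "real q * (\<xi> - \<eta>) = \<xi> * real q - \<eta> * real q" by (simp add: algebra_simps)
  ultimately show ?thesis unfolding fractions_eq[OF assms(1)] using lt by linarith
qed

text \<open>For each \<open>q\<close> only the first and the last numerator can come arbitrarily
  close to an endpoint, and these are given up. At any other point \<open>t\<close> both distances
  are at least \<open>1 / q\<close>, so \<open>(t - \<eta>) * (\<xi> - t)\<close> is at least a
  constant times \<open>1 / q\<close>, which is large against the parameter
  \<open>1 / Q\<^sup>2\<close> of the cutoff.\<close>

lemma cutoff_defect:
  fixes a :: int
  assumes I: "\<eta> < \<xi>" and q: "0 < q" "q \<le> Q" and a: "of_int a / real q \<in> {\<eta>..\<xi>}"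
  shows "1 - cutoff \<eta> \<xi> (1 / (real Q)\<^sup>2) (of_int a / real q)
    \<le> (if a = \<lceil>\<eta> * real q\<rceil> then 1 else 0) + (if a = \<lfloor>\<xi> * real q\<rfloor> then 1 else 0) + 2 / ((\<xi> - \<eta>) * real Q)"
proof -
  define \<kappa> where "\<kappa> = 1 / (real Q)\<^sup>2"
  define t where "t = real_of_int a / real q"
  have Qp: "real Q > 0" "real q > 0" "real q \<le> real Q" using q by auto
  have \<kappa>: "0 < \<kappa>" using Qp by (simp add: \<kappa>_def)
  have pos: "0 \<le> 2 / ((\<xi> - \<eta>) * real Q)" using I Qp by simp
  have t: "t \<in> {\<eta>..\<xi>}" using a by (simp add: t_def)
  have w0: "0 \<le> cutoff \<eta> \<xi> \<kappa> t" using cutoff_props(5)[OF less_imp_le[OF I] \<kappa> t] by simp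
  show ?thesis
  proof (cases "a = \<lceil>\<eta> * real q\<rceil> \<or> a = \<lfloor>\<xi> * real q\<rfloor>")
    case True
    have "1 - v \<le> (if X then 1 else 0) + (if Y then 1 else 0) + p" if "X \<or> Y" "0 \<le> v" "0 \<le> p" for X Y and v p :: real
      using that by auto
    from this[OF True w0 pos] show ?thesis unfolding \<kappa>_def t_def .
  next
    case False
    have "a \<in> {\<lceil>\<eta> * real q\<rceil>..\<lfloor>\<xi> * real q\<rfloor>}" unfolding fractions_eq[OF q(1), symmetric] using a by (rule CollectI)
    then have "\<lceil>\<eta> * real q\<rceil> \<le> a" "a \<le> \<lfloor>\<xi> * real q\<rfloor>" by (simp_all only: atLeastAtMost_iff)
    then have "\<eta> * real q + 1 \<le> of_int a" "of_int a \<le> \<xi> * real q - 1" using False by linarith+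
    then have "1 / real q \<le> (of_int a - \<eta> * real q) / real q" "1 / real q \<le> (\<xi> * real q - of_int a) / real q"
      by (auto intro!: divide_right_mono)
    then have d: "1 / real q \<le> t - \<eta>" "1 / real q \<le> \<xi> - t"
      using Qp by (simp_all add: t_def diff_divide_distrib)
    define u where "u = (t - \<eta>) * (\<xi> - t)"
    have q0: "0 \<le> 1 / real q" by simp
    have t0: "0 \<le> t - \<eta>" "0 \<le> \<xi> - t" using order_trans[OF q0 d(1)] order_trans[OF q0 d(2)] by blast+
    have u: "(\<xi> - \<eta>) / (2 * real q) \<le> u"
    proof (cases "t - \<eta> \<le> \<xi> - t")
      case True
      have "(1 / real q) * ((\<xi> - \<eta>) / 2) \<le> (t - \<eta>) * (\<xi> - t)"
        using True I by (intro mult_mono d(1) t0 q0) simp_all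
      then show ?thesis by (simp add: u_def)
    next
      case False
      have "((\<xi> - \<eta>) / 2) * (1 / real q) \<le> (t - \<eta>) * (\<xi> - t)"
        using False I by (intro mult_mono d(2) t0 q0) simp_all
      then show ?thesis by (simp add: u_def)
    qed
    have up: "0 < (\<xi> - \<eta>) / (2 * real q)" using I Qp by simp
    have u0: "0 < u" using u up by linarith
    have "1 - cutoff \<eta> \<xi> \<kappa> t = \<kappa> / (u + \<kappa>)"
      unfolding cutoff_def u_def[symmetric] using u0 \<kappa> by (simp add: field_simps)
    also have "\<dots> \<le> \<kappa> / ((\<xi> - \<eta>) / (2 * real q))" 
    proof (intro divide_left_mono)
      show "0 < (u + \<kappa>) * ((\<xi> - \<eta>) / (2 * real q))" using u0 \<kappa> by (intro mult_pos_pos up) simp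
    qed (use u \<kappa> in linarith)+
    also have "\<dots> = 2 * real q / ((\<xi> - \<eta>) * (real Q)\<^sup>2)" by (simp add: \<kappa>_def)
    also have "\<dots> \<le> 2 * real Q / ((\<xi> - \<eta>) * (real Q)\<^sup>2)" using Qp I by (intro divide_right_mono) auto
    also have "\<dots> = 2 / ((\<xi> - \<eta>) * real Q)" using Qp by (simp add: power2_eq_square)
    finally show ?thesis using False by (simp add: \<kappa>_def t_def)
  qed
qed

lemma N_count_eq_sum:
  "real (N_count {\<eta>..\<xi>} f (real Q) \<delta>)
    = (\<Sum>(q, a)\<in>(SIGMA q:{1..Q}. {a::int. of_int a / real q \<in> {\<eta>..\<xi>}}). if dist_int (real q * f (of_int a / real q)) < \<delta> then 1 else 0)"
proof -
  define \<Omega> where "\<Omega> = (SIGMA q:{1..Q}. {a::int. of_int a / real q \<in> {\<eta>..\<xi>}})"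
  have fin: "finite \<Omega>" unfolding \<Omega>_def 
  proof (intro finite_SigmaI)
    show "finite {a::int. of_int a / real q \<in> {\<eta>..\<xi>}}" if "q \<in> {1..Q}" for q using that by (subst fractions_eq) auto
  qed simp
  define P where "P p = (dist_int (real (fst p) * f (of_int (snd p) / real (fst p))) < \<delta>)" for p :: "nat \<times> int"
  have "{(a :: int, q :: nat). 0 < q \<and> real q \<le> real Q \<and> of_int a / real q \<in> {\<eta>..\<xi>} \<and>
             dist_int (real q * f (of_int a / real q)) < \<delta>} = prod.swap ` {p\<in>\<Omega>. P p}"
    by (force simp: \<Omega>_def P_def image_iff)
  then have "N_count {\<eta>..\<xi>} f (real Q) \<delta> = card {p\<in>\<Omega>. P p}"
    unfolding N_count_def by (simp only: card_image[OF inj_swap])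
  also have "real \<dots> = (\<Sum>p\<in>\<Omega>. if P p then 1 else 0)"
    using fin by (simp add: sum.If_cases Int_def)
  finally show ?thesis by (simp add: \<Omega>_def P_def case_prod_beta)
qed

text \<open>Inserting the cutoff costs O(1) per denominator, hence O(Q) in all. The total weight is
  half of \<open>(\<xi> - \<eta>) * Q\<^sup>2\<close> up to O(Q), and the density
  \<open>2 * \<delta>\<close> turns it into the main term. Errors O(Q) disappear in
  \<open>x ^ 8\<close>.\<close>

lemma convex_curve_count:
  fixes \<eta> \<xi> c1 c2 :: real
  assumes I: "\<eta> < \<xi>" and c: "0 < c1" "c1 \<le> c2"
  shows "\<exists>C>0. \<forall>f f' f'' Q x \<delta>. convex_curve f f' f'' c1 c2 \<longrightarrow> 0 \<le> f' \<eta> \<longrightarrow> f' \<eta> \<le> 1 \<longrightarrow>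
    1 \<le> x \<longrightarrow> real Q = x ^ 6 \<longrightarrow> 0 < \<delta> \<longrightarrow> \<delta> \<le> 1/2 \<longrightarrow>
    \<bar>real (N_count {\<eta>..\<xi>} f (real Q) \<delta>) - (\<xi> - \<eta>) * \<delta> * (real Q)\<^sup>2\<bar>
      \<le> C * (sqrt \<delta> * ln (1 / \<delta>) * x ^ 9 + x ^ 8)"
proof -
  obtain C0 where C0: "C0 > 0" and bd: "\<forall>f f' f'' Q x \<delta> H. convex_curve f f' f'' c1 c2 \<longrightarrow> 0 \<le> f' \<eta> \<longrightarrow> f' \<eta> \<le> 1 \<longrightarrow>
    1 \<le> x \<longrightarrow> real Q = x ^ 6 \<longrightarrow> 0 < \<delta> \<longrightarrow> \<delta> \<le> 1/2 \<longrightarrow> x ^ 4 \<le> real H \<longrightarrow> real H \<le> 2 * x ^ 4 \<longrightarrow>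
    (\<Sum>k=1..2*H. (min \<delta> (1 / real k) + 1 / real H) * norm (weighted_sum \<eta> \<xi> f Q k))
      \<le> C0 * (sqrt \<delta> * ln (1 / \<delta>) * x ^ 9 + x ^ 8)"
    using weighted_sums_total[OF I c] by (elim exE conjE)
  define S where "S = \<xi> - \<eta>"
  have S: "S > 0" using I by (simp add: S_def)
  define C1 where "C1 = 2 + (2 / S) * (S + 1)"
  have C1: "C1 \<ge> 0" using S by (simp add: C1_def)
  define C2 where "C2 = C1 + 320 * (S + 1) + (S + 2 + 2 * C1)"
  have C2: "C2 \<ge> 0" using S C1 by (simp add: C2_def)
  show ?thesis
  proof (intro exI[of _ "320 * C0 + C2"] conjI allI impI)
    show "320 * C0 + C2 > 0" using C0 C2 by simp
    fix f f' f'' :: "real \<Rightarrow> real" and Q :: nat and x \<delta> :: real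
    assume cc: "convex_curve f f' f'' c1 c2" and f': "0 \<le> f' \<eta>" "f' \<eta> \<le> 1" and x: "1 \<le> x"
      and Qx: "real Q = x ^ 6" and \<delta>: "0 < \<delta>" "\<delta> \<le> 1/2"
    have Q1: "real Q \<ge> 1" using x Qx by simp
    \<comment> \<open>With \<open>H\<close> of order \<open>x ^ 4\<close> the term
      \<open>W / H\<close> of the Erdos-Turan inequality is O(x^8), because \<open>W\<close> is
      O(x^12).\<close>
    define H where "H = nat \<lceil>x ^ 4\<rceil>"
    have x4: "1 \<le> x ^ 4" using x by simp
    have H: "x ^ 4 \<le> real H" "real H \<le> 2 * x ^ 4" using x4 unfolding H_def by linarith+
    have H1: "1 \<le> H" using H x4 by linarith
    define A where "A q = {a::int. of_int a / real q \<in> {\<eta>..\<xi>}}" for q :: nat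
    define \<Omega> where "\<Omega> = Sigma {1..Q} A"
    define w where "w = cutoff \<eta> \<xi> (1 / (real Q)\<^sup>2)"
    define wt where "wt p = w (of_int (snd p) / real (fst p))" for p :: "nat \<times> int"
    define X where "X p = real (fst p) * f (of_int (snd p) / real (fst p))" for p :: "nat \<times> int"
    have finA: "finite (A q)" if "q \<in> {1..Q}" for q using that unfolding A_def by (subst fractions_eq) auto
    have fin: "finite \<Omega>" unfolding \<Omega>_def using finA by (intro finite_SigmaI) auto
    have \<kappa>: "0 < 1 / (real Q)\<^sup>2" using Q1 by simp
    have w01: "0 \<le> wt p \<and> wt p \<le> 1" if "p \<in> \<Omega>" for p
      using that cutoff_props(5)[OF less_imp_le[OF I] \<kappa>, folded w_def, of "of_int (snd p) / real (fst p)"]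
      by (auto simp: \<Omega>_def A_def wt_def)
    define W where "W = (\<Sum>p\<in>\<Omega>. wt p)"
    define G where "G p = (if dist_int (X p) < \<delta> then 1 else 0 :: real)" for p
    have G01: "0 \<le> G p \<and> G p \<le> 1" for p by (simp add: G_def)
    have cardA: "\<bar>real (card (A q)) - real q * S\<bar> \<le> 1" if "q \<in> {1..Q}" for q
      using card_fractions[OF _ I, of q] that by (simp add: A_def S_def)
    have N: "real (N_count {\<eta>..\<xi>} f (real Q) \<delta>) = (\<Sum>p\<in>\<Omega>. G p)"
      unfolding N_count_eq_sum \<Omega>_def A_def G_def X_def by (simp add: case_prod_beta)
    have defect: "(\<Sum>p\<in>\<Omega>. 1 - wt p) \<le> C1 * real Q"
    proof -
      have "(\<Sum>p\<in>\<Omega>. 1 - wt p) = (\<Sum>q\<in>{1..Q}. \<Sum>a\<in>A q. 1 - w (of_int a / real q))"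
        unfolding \<Omega>_def wt_def using finA by (subst sum.Sigma) (auto simp: case_prod_beta)
      also have "\<dots> \<le> (\<Sum>q\<in>{1..Q}. C1)"
      proof (rule sum_mono)
        fix q assume q: "q \<in> {1..Q}"
        then have q1: "0 < q" "q \<le> Q" by auto
        have "(\<Sum>a\<in>A q. 1 - w (of_int a / real q)) \<le> (\<Sum>a\<in>A q. (if a = \<lceil>\<eta> * real q\<rceil> then 1 else 0) + (if a = \<lfloor>\<xi> * real q\<rfloor> then 1 else 0) + 2 / (S * real Q))"
          unfolding w_def S_def using q1 by (intro sum_mono cutoff_defect[OF I]) (auto simp: A_def)
        also have "\<dots> = (\<Sum>a\<in>A q. if a = \<lceil>\<eta> * real q\<rceil> then 1 else 0) + (\<Sum>a\<in>A q. if a = \<lfloor>\<xi> * real q\<rfloor> then 1 else 0) + real (card (A q)) * (2 / (S * real Q))"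
          by (simp add: sum.distrib)
        also have "\<dots> \<le> 1 + 1 + (real Q * (S + 1)) * (2 / (S * real Q))"
        proof (intro add_mono mult_right_mono)
          show "(\<Sum>a\<in>A q. if a = \<lceil>\<eta> * real q\<rceil> then 1 else 0) \<le> (1::real)" "(\<Sum>a\<in>A q. if a = \<lfloor>\<xi> * real q\<rfloor> then 1 else 0) \<le> (1::real)"
            using finA[OF q] by (simp_all add: sum.delta)
          have "real (card (A q)) \<le> real q * S + 1" using cardA[OF q] by linarith
          also have "\<dots> \<le> real Q * S + real Q" using q1 Q1 S by (intro add_mono mult_right_mono) auto
          finally show "real (card (A q)) \<le> real Q * (S + 1)" by (simp add: distrib_left)
          show "0 \<le> 2 / (S * real Q)" using S Q1 by simp
        qed
        also have "\<dots> = C1" using Q1 S by (simp add: C1_def)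
        finally show "(\<Sum>a\<in>A q. 1 - w (of_int a / real q)) \<le> C1" .
      qed
      finally show ?thesis by (simp add: mult.commute)
    qed
    have tot: "real (card \<Omega>) = (\<Sum>q\<in>{1..Q}. real (card (A q)))"
      unfolding \<Omega>_def using finA by (simp add: card_SigmaI)
    have cO: "\<bar>real (card \<Omega>) - S * (real Q)\<^sup>2 / 2\<bar> \<le> (S / 2 + 1) * real Q"
    proof -
      have "(\<Sum>q\<in>{1..Q}. real q) = real Q * (real Q + 1) / 2" by (induction Q) (auto simp: field_simps)
      then have g: "(\<Sum>q\<in>{1..Q}. real q * S) = S * (real Q)\<^sup>2 / 2 + S / 2 * real Q"
        unfolding sum_distrib_right[symmetric] by (simp add: power2_eq_square field_simps)
      have "real (card \<Omega>) - (\<Sum>q\<in>{1..Q}. real q * S) = (\<Sum>q\<in>{1..Q}. real (card (A q)) - real q * S)"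
        by (simp add: tot sum_subtractf)
      also have "\<bar>\<dots>\<bar> \<le> (\<Sum>q\<in>{1..Q}. 1)" using cardA by (intro order_trans[OF sum_abs] sum_mono) auto
      finally have "\<bar>real (card \<Omega>) - (S * (real Q)\<^sup>2 / 2 + S / 2 * real Q)\<bar> \<le> real Q" unfolding g by simp
      moreover have "0 \<le> S / 2 * real Q" using S by simp
      moreover have "(S / 2 + 1) * real Q = S / 2 * real Q + real Q" by (simp add: distrib_right)
      ultimately show ?thesis by linarith
    qed
    have Wd: "(\<Sum>p\<in>\<Omega>. 1 - wt p) = real (card \<Omega>) - W" by (simp add: W_def sum_subtractf)
    have Wd0: "0 \<le> (\<Sum>p\<in>\<Omega>. 1 - wt p)" using w01 by (intro sum_nonneg) auto
    have W2: "\<bar>W - S * (real Q)\<^sup>2 / 2\<bar> \<le> (S / 2 + 1 + C1) * real Q"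
      using cO Wd Wd0 defect by (simp only: distrib_right abs_le_iff) linarith
    have Wle: "W / real H \<le> (S + 1) * x ^ 8"
    proof -
      have "real (card (A q)) \<le> real Q * (S + 1)" if q: "q \<in> {1..Q}" for q
      proof -
        have "real (card (A q)) \<le> real q * S + 1" using cardA[OF q] by linarith
        also have "\<dots> \<le> real Q * S + real Q" using q Q1 S by (intro add_mono mult_right_mono) auto
        finally show ?thesis by (simp add: distrib_left)
      qed
      then have "real (card \<Omega>) \<le> (\<Sum>q\<in>{1..Q}. real Q * (S + 1))" unfolding tot by (intro sum_mono)
      then have "W \<le> (S + 1) * (real Q)\<^sup>2" using Wd Wd0 by (simp add: power2_eq_square mult_ac)
      also have "\<dots> = (S + 1) * x ^ 8 * x ^ 4" by (simp add: Qx flip: power_mult power_add)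
      also have "\<dots> \<le> (S + 1) * x ^ 8 * real H" using H S x by (intro mult_left_mono) auto
      finally show ?thesis using H1 by (simp add: divide_le_eq)
    qed
    have ws: "(\<Sum>p\<in>\<Omega>. of_real (wt p) * echar (of_int (int k) * X p)) = weighted_sum \<eta> \<xi> f Q k" for k
      unfolding weighted_sum_def w_def[symmetric] A_def[symmetric] \<Omega>_def wt_def X_def using finA
      by (subst sum.Sigma) (auto simp: case_prod_beta)
    have ET: "\<bar>(\<Sum>p\<in>\<Omega>. wt p * G p) - 2 * \<delta> * W\<bar>
        \<le> 320 * ((\<Sum>k=1..2*H. (min \<delta> (1 / real k) + 1 / real H) * norm (weighted_sum \<eta> \<xi> f Q k)) + W / real H)"
      using erdos_turan[OF H1 \<delta> fin, of wt X] w01 unfolding ws W_def[symmetric] G_def by blast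
    define R where "R = sqrt \<delta> * ln (1 / \<delta>) * x ^ 9"
    have R0: "R \<ge> 0"
    proof -
      have "0 \<le> ln (1 / \<delta>)" using \<delta> by (intro ln_ge_zero) (auto simp: field_simps)
      then show ?thesis using \<delta> x unfolding R_def by (intro mult_nonneg_nonneg) auto
    qed
    have b1: "(\<Sum>k=1..2*H. (min \<delta> (1 / real k) + 1 / real H) * norm (weighted_sum \<eta> \<xi> f Q k)) \<le> C0 * (R + x ^ 8)"
      unfolding R_def by (rule bd[rule_format, OF cc f' x Qx \<delta> H])
    have NG: "\<bar>(\<Sum>p\<in>\<Omega>. G p) - (\<Sum>p\<in>\<Omega>. wt p * G p)\<bar> \<le> C1 * real Q"
    proof -
      have "(\<Sum>p\<in>\<Omega>. G p) - (\<Sum>p\<in>\<Omega>. wt p * G p) = (\<Sum>p\<in>\<Omega>. (1 - wt p) * G p)"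
        by (simp add: sum_subtractf left_diff_distrib)
      moreover have "0 \<le> (\<Sum>p\<in>\<Omega>. (1 - wt p) * G p)" using w01 G01 by (intro sum_nonneg) auto
      moreover have "(\<Sum>p\<in>\<Omega>. (1 - wt p) * G p) \<le> (\<Sum>p\<in>\<Omega>. (1 - wt p) * 1)"
        using w01 G01 by (intro sum_mono mult_left_mono) auto
      ultimately show ?thesis using defect by simp
    qed
    have dW: "\<bar>2 * \<delta> * W - S * \<delta> * (real Q)\<^sup>2\<bar> \<le> (S + 2 + 2 * C1) * real Q"
    proof -
      have "2 * \<delta> * W - S * \<delta> * (real Q)\<^sup>2 = 2 * \<delta> * (W - S * (real Q)\<^sup>2 / 2)" by (simp add: algebra_simps)
      then have "\<bar>2 * \<delta> * W - S * \<delta> * (real Q)\<^sup>2\<bar> = 2 * \<delta> * \<bar>W - S * (real Q)\<^sup>2 / 2\<bar>" using \<delta> by (simp add: abs_mult)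
      also have "\<dots> \<le> 2 * 1 * ((S / 2 + 1 + C1) * real Q)" using \<delta> W2 by (intro mult_mono) auto
      also have "\<dots> = (S + 2 + 2 * C1) * real Q" by (simp add: algebra_simps)
      finally show ?thesis .
    qed
    have "real Q \<le> x ^ 8" unfolding Qx using x by (intro power_increasing) auto
    then have q8: "C1 * real Q \<le> C1 * x ^ 8" "(S + 2 + 2 * C1) * real Q \<le> (S + 2 + 2 * C1) * x ^ 8"
      using C1 S by (auto intro!: mult_left_mono)
    have triangle: "\<bar>n - z\<bar> \<le> p' + 320 * (X' + Y') + r'"
      if "\<bar>n - a\<bar> \<le> p" "\<bar>a - b\<bar> \<le> 320 * (X + Y)" "\<bar>b - z\<bar> \<le> r" "X \<le> X'" "Y \<le> Y'" "p \<le> p'" "r \<le> r'"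
      for n a b z p r X Y X' Y' p' r' :: real
      using that by (smt (verit))
    have "\<bar>real (N_count {\<eta>..\<xi>} f (real Q) \<delta>) - S * \<delta> * (real Q)\<^sup>2\<bar>
      \<le> C1 * x ^ 8 + 320 * (C0 * (R + x ^ 8) + (S + 1) * x ^ 8) + (S + 2 + 2 * C1) * x ^ 8"
      unfolding N by (rule triangle[OF NG ET dW b1 Wle q8])
    also have "\<dots> = 320 * C0 * (R + x ^ 8) + C2 * x ^ 8" by (simp add: C2_def algebra_simps)
    also have "\<dots> \<le> 320 * C0 * (R + x ^ 8) + C2 * (R + x ^ 8)" using C2 R0 by (intro add_left_mono mult_left_mono) auto
    finally show "\<bar>real (N_count {\<eta>..\<xi>} f (real Q) \<delta>) - (\<xi> - \<eta>) * \<delta> * (real Q)\<^sup>2\<bar>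
      \<le> (320 * C0 + C2) * (sqrt \<delta> * ln (1 / \<delta>) * x ^ 9 + x ^ 8)"
      by (simp add: R_def S_def distrib_right)
  qed
qed

section \<open>Reduction of a general curve to a normalised convex one\<close>

lemma antiderivative_exists:
  fixes \<phi> :: "real \<Rightarrow> real"
  assumes "continuous_on UNIV \<phi>"
  shows "\<exists>\<Phi>. \<Phi> c = v \<and> (\<forall>x. (\<Phi> has_real_derivative \<phi> x) (at x))"
proof (intro exI[of _ "\<lambda>u::real. v + (LBINT y=c..u. \<phi> y)"] conjI allI)
  show "v + (LBINT y=c..c. \<phi> y) = v" by simp
  fix x
  define a b where "a = min c x - 1" and "b = max c x + 1"
  have "((\<lambda>u. LBINT y=c..u. \<phi> y) has_vector_derivative \<phi> x) (at x within {a..b})"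
    using continuous_on_subset[OF assms]
    by (intro interval_integral_FTC2) (auto simp: a_def b_def)
  moreover have "at x within {a..b} = at x"
    by (rule at_within_interior) (auto simp: a_def b_def)
  ultimately have "((\<lambda>u. LBINT y=c..u. \<phi> y) has_real_derivative \<phi> x) (at x)"
    by (simp add: has_real_derivative_iff_has_vector_derivative)
  then show "((\<lambda>u. v + (LBINT y=c..u. \<phi> y)) has_real_derivative \<phi> x) (at x)"
    by (auto intro!: derivative_eq_intros)
qed

lemma antiderivatives_agree:
  fixes F G \<phi> :: "real \<Rightarrow> real"
  assumes "\<And>x. x \<in> {\<eta>..\<xi>} \<Longrightarrow> (F has_real_derivative \<phi> x) (at x within {\<eta>..\<xi>})"
    and "\<And>x. x \<in> {\<eta>..\<xi>} \<Longrightarrow> (G has_real_derivative \<phi> x) (at x within {\<eta>..\<xi>})"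
    and "F \<eta> = G \<eta>" and x: "x \<in> {\<eta>..\<xi>}"
  shows "F x = G x"
proof -
  have "\<exists>c. \<forall>x\<in>{\<eta>..\<xi>}. F x - G x = c"
  proof (rule has_field_derivative_zero_constant)
    fix x assume "x \<in> {\<eta>..\<xi>}"
    then show "((\<lambda>x. F x - G x) has_real_derivative 0) (at x within {\<eta>..\<xi>})"
      using DERIV_diff[OF assms(1,2)] by simp
  qed simp
  then obtain d where d: "\<forall>x\<in>{\<eta>..\<xi>}. F x - G x = d" by blast
  moreover have "\<eta> \<in> {\<eta>..\<xi>}" using x by auto
  ultimately have "d = 0" using assms(3) by fastforce
  then show ?thesis using d x by fastforce
qed

lemma constant_sign:
  fixes g :: "real \<Rightarrow> real"
  assumes "continuous_on {\<eta>..\<xi>} g" "\<eta> < \<xi>" "0 < c1" "\<And>x. x \<in> {\<eta>..\<xi>} \<Longrightarrow> c1 \<le> \<bar>g x\<bar>"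
  obtains \<sigma> :: real where "\<sigma> = 1 \<or> \<sigma> = -1" "\<And>x. x \<in> {\<eta>..\<xi>} \<Longrightarrow> \<sigma> * g x = \<bar>g x\<bar>"
proof -
  have "(\<forall>x\<in>{\<eta>..\<xi>}. 0 \<le> g x) \<or> (\<forall>x\<in>{\<eta>..\<xi>}. g x \<le> 0)"
  proof (rule ccontr)
    assume "\<not> ?thesis"
    then obtain s t where st: "s \<in> {\<eta>..\<xi>}" "t \<in> {\<eta>..\<xi>}" "g s < 0" "0 < g t" by (auto simp: not_le)
    have "connected (g ` {\<eta>..\<xi>})" using assms(1) by (intro connected_continuous_image) auto
    then have "0 \<in> g ` {\<eta>..\<xi>}" using st connectedD_interval[of _ "g s" "g t" 0] by auto
    then obtain x where "x \<in> {\<eta>..\<xi>}" "g x = 0" by auto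
    then show False using assms(3) assms(4)[of x] by simp
  qed
  then show ?thesis
  proof
    assume "\<forall>x\<in>{\<eta>..\<xi>}. 0 \<le> g x"
    then show ?thesis using that[of 1] by simp
  next
    assume "\<forall>x\<in>{\<eta>..\<xi>}. g x \<le> 0"
    then show ?thesis using that[of "-1"] by simp
  qed
qed

text \<open>The count is insensitive to a change of sign of \<open>g\<close> and to adding
  \<open>n * x\<close> with an integer \<open>n\<close>, because \<open>q * n * (a / q)\<close> is
  an integer. The second derivative has constant sign by continuity, so \<open>g\<close> can be made
  convex; extending the second derivative by its endpoint values and integrating twice keeps its
  bounds on the whole line.\<close>

lemma C2_class_normalize:
  assumes g: "g \<in> C2_class {\<eta>..\<xi>} c1 c2" and I: "\<eta> < \<xi>" and c: "0 < c1"
  obtains F F' F'' where "convex_curve F F' F'' c1 c2" "0 \<le> F' \<eta>" "F' \<eta> \<le> 1"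
    "\<And>Q \<delta>. N_count {\<eta>..\<xi>} g Q \<delta> = N_count {\<eta>..\<xi>} F Q \<delta>"
proof -
  obtain g' g'' where d: "\<And>x. x \<in> {\<eta>..\<xi>} \<Longrightarrow> (g has_real_derivative g' x) (at x within {\<eta>..\<xi>})"
      "\<And>x. x \<in> {\<eta>..\<xi>} \<Longrightarrow> (g' has_real_derivative g'' x) (at x within {\<eta>..\<xi>})"
      "continuous_on {\<eta>..\<xi>} g''" "\<And>x. x \<in> {\<eta>..\<xi>} \<Longrightarrow> c1 \<le> \<bar>g'' x\<bar> \<and> \<bar>g'' x\<bar> \<le> c2"
    using g unfolding C2_class_def by blast
  obtain \<sigma> :: real where \<sigma>: "\<sigma> = 1 \<or> \<sigma> = -1" "\<And>x. x \<in> {\<eta>..\<xi>} \<Longrightarrow> \<sigma> * g'' x = \<bar>g'' x\<bar>"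
    using constant_sign[OF d(3) I c] d(4) by blast
  define cl where "cl t = max \<eta> (min \<xi> t)" for t :: real
  have cl: "cl t \<in> {\<eta>..\<xi>}" for t using I by (auto simp: cl_def)
  have cl_id: "cl t = t" if "t \<in> {\<eta>..\<xi>}" for t using that by (auto simp: cl_def)
  define F'' where "F'' t = \<sigma> * g'' (cl t)" for t
  have cF'': "continuous_on UNIV F''"
    unfolding F''_def
  proof (intro continuous_intros continuous_on_compose2[OF d(3)])
    show "continuous_on UNIV cl" unfolding cl_def by (intro continuous_intros)
  qed (use cl in auto)
  \<comment> \<open>Subtracting the integer part of the slope at \<open>\<eta>\<close> brings it
    into the unit interval, so that later constants do not depend on the size of the derivative of
    \<open>g\<close>.\<close>
  define n where "n = \<lfloor>\<sigma> * g' \<eta>\<rfloor>"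
  obtain F' where F': "F' \<eta> = \<sigma> * g' \<eta> - of_int n" "\<And>x. (F' has_real_derivative F'' x) (at x)"
    using antiderivative_exists[OF cF'', of \<eta> "\<sigma> * g' \<eta> - of_int n"] by blast
  have cF': "continuous_on UNIV F'" using F'(2) by (intro DERIV_continuous_on) (auto intro: has_field_derivative_at_within)
  obtain F where F: "F \<eta> = \<sigma> * g \<eta> - of_int n * \<eta>" "\<And>x. (F has_real_derivative F' x) (at x)"
    using antiderivative_exists[OF cF', of \<eta> "\<sigma> * g \<eta> - of_int n * \<eta>"] by blast
  have e1: "F' x = \<sigma> * g' x - of_int n" if x: "x \<in> {\<eta>..\<xi>}" for x
  proof (rule antiderivatives_agree[where F = F' and G = "\<lambda>x. \<sigma> * g' x - of_int n" and x = x and \<phi> = F'' and \<eta> = \<eta> and \<xi> = \<xi>])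
    fix t assume t: "t \<in> {\<eta>..\<xi>}"
    show "(F' has_real_derivative F'' t) (at t within {\<eta>..\<xi>})" by (rule has_field_derivative_at_within[OF F'(2)])
    show "((\<lambda>x. \<sigma> * g' x - of_int n) has_real_derivative F'' t) (at t within {\<eta>..\<xi>})"
      using d(2)[OF t] by (auto intro!: derivative_eq_intros simp: F''_def cl_id[OF t])
  qed (use F' x in auto)
  have e0: "F x = \<sigma> * g x - of_int n * x" if x: "x \<in> {\<eta>..\<xi>}" for x
  proof (rule antiderivatives_agree[where F = F and G = "\<lambda>x. \<sigma> * g x - of_int n * x" and x = x and \<phi> = F' and \<eta> = \<eta> and \<xi> = \<xi>])
    fix t assume t: "t \<in> {\<eta>..\<xi>}"
    show "(F has_real_derivative F' t) (at t within {\<eta>..\<xi>})" by (rule has_field_derivative_at_within[OF F(2)])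
    show "((\<lambda>x. \<sigma> * g x - of_int n * x) has_real_derivative F' t) (at t within {\<eta>..\<xi>})"
      using d(1)[OF t] by (auto intro!: derivative_eq_intros simp: e1[OF t])
  qed (use F x in auto)
  have "convex_curve F F' F'' c1 c2"
  proof
    show "c1 \<le> F'' x" "F'' x \<le> c2" for x using \<sigma>(2)[OF cl] d(4)[OF cl] by (simp_all add: F''_def)
  qed (use c F F' cF'' in auto)
  moreover have "0 \<le> F' \<eta>" "F' \<eta> \<le> 1" unfolding F'(1) n_def by linarith+
  moreover have "N_count {\<eta>..\<xi>} g Q \<delta> = N_count {\<eta>..\<xi>} F Q \<delta>" for Q \<delta>
  proof -
    have "dist_int (real q * g (of_int a / real q)) = dist_int (real q * F (of_int a / real q))"
      if q: "0 < q" "of_int a / real q \<in> {\<eta>..\<xi>}" for a :: int and q :: nat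
    proof -
      have "real q * F (of_int a / real q) = \<sigma> * (real q * g (of_int a / real q)) + of_int (- n * a)"
        using q(1) by (simp add: e0[OF q(2)] algebra_simps)
      then have "dist_int (real q * F (of_int a / real q)) = dist_int (\<sigma> * (real q * g (of_int a / real q)))"
        by (simp only: dist_int_add_int)
      also have "\<dots> = dist_int (real q * g (of_int a / real q))" using \<sigma>(1) by (auto simp: dist_int_minus)
      finally show ?thesis by simp
    qed
    then have "{(a :: int, q :: nat). 0 < q \<and> real q \<le> Q \<and> of_int a / real q \<in> {\<eta>..\<xi>} \<and> dist_int (real q * g (of_int a / real q)) < \<delta>}
      = {(a :: int, q :: nat). 0 < q \<and> real q \<le> Q \<and> of_int a / real q \<in> {\<eta>..\<xi>} \<and> dist_int (real q * F (of_int a / real q)) < \<delta>}"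
      by (auto simp del: atLeastAtMost_iff)
    then show ?thesis by (simp add: N_count_def)
  qed
  ultimately show ?thesis using that by blast
qed

lemma C2_class_count:
  fixes \<eta> \<xi> c1 c2 :: real
  assumes I: "\<eta> < \<xi>" and c: "0 < c1" "c1 \<le> c2"
  obtains C where "C > 0" "\<And>g Q \<delta>. g \<in> C2_class {\<eta>..\<xi>} c1 c2 \<Longrightarrow> 1 \<le> Q \<Longrightarrow> 0 < \<delta> \<Longrightarrow> \<delta> \<le> 1/2 \<Longrightarrow>
    \<bar>real (N_count {\<eta>..\<xi>} g (real Q) \<delta>) - (\<xi> - \<eta>) * \<delta> * (real Q)\<^sup>2\<bar>
      \<le> C * (\<delta> powr (1/2) * ln (1 / \<delta>) * real Q powr (3/2) + real Q powr (4/3))"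
proof -
  obtain C where C: "C > 0" and bd: "\<forall>f f' f'' Q x \<delta>. convex_curve f f' f'' c1 c2 \<longrightarrow> 0 \<le> f' \<eta> \<longrightarrow> f' \<eta> \<le> 1 \<longrightarrow>
    1 \<le> x \<longrightarrow> real Q = x ^ 6 \<longrightarrow> 0 < \<delta> \<longrightarrow> \<delta> \<le> 1/2 \<longrightarrow>
    \<bar>real (N_count {\<eta>..\<xi>} f (real Q) \<delta>) - (\<xi> - \<eta>) * \<delta> * (real Q)\<^sup>2\<bar>
      \<le> C * (sqrt \<delta> * ln (1 / \<delta>) * x ^ 9 + x ^ 8)"
    using convex_curve_count[OF I c] by (elim exE conjE)
  show ?thesis
  proof (rule that[OF C])
    fix g :: "real \<Rightarrow> real" and Q :: nat and \<delta> :: real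
    assume g: "g \<in> C2_class {\<eta>..\<xi>} c1 c2" and Q: "1 \<le> Q" and \<delta>: "0 < \<delta>" "\<delta> \<le> 1/2"
    define x where "x = real Q powr (1/6)"
    have Q1: "1 \<le> real Q" using Q by simp
    have x: "1 \<le> x" unfolding x_def using Q1 by (intro ge_one_powr_ge_zero) auto
    have pw: "x ^ k = real Q powr (real k / 6)" for k
      using x Q1 by (simp add: x_def powr_powr flip: powr_realpow)
    have Qx: "real Q = x ^ 6" unfolding pw using Q1 by simp
    obtain F F' F'' where F: "convex_curve F F' F'' c1 c2" "0 \<le> F' \<eta>" "F' \<eta> \<le> 1"
      "\<And>Q \<delta>. N_count {\<eta>..\<xi>} g Q \<delta> = N_count {\<eta>..\<xi>} F Q \<delta>"
      using C2_class_normalize[OF g I c(1)] by blast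
    have "\<bar>real (N_count {\<eta>..\<xi>} g (real Q) \<delta>) - (\<xi> - \<eta>) * \<delta> * (real Q)\<^sup>2\<bar> \<le> C * (sqrt \<delta> * ln (1 / \<delta>) * x ^ 9 + x ^ 8)"
      unfolding F(4) by (rule bd[rule_format, OF F(1-3) x Qx \<delta>])
    also have "sqrt \<delta> = \<delta> powr (1/2)" using \<delta> by (simp add: powr_half_sqrt)
    also have "x ^ 9 = real Q powr (3/2)" unfolding pw by simp
    also have "x ^ 8 = real Q powr (4/3)" unfolding pw by simp
    finally show "\<bar>real (N_count {\<eta>..\<xi>} g (real Q) \<delta>) - (\<xi> - \<eta>) * \<delta> * (real Q)\<^sup>2\<bar>
      \<le> C * (\<delta> powr (1/2) * ln (1 / \<delta>) * real Q powr (3/2) + real Q powr (4/3))" .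
  qed
qed

section \<open>Passage to the closure\<close>

lemma N_count_le:
  assumes "\<And>a q. 0 < q \<Longrightarrow> real q \<le> Q \<Longrightarrow> of_int a / real q \<in> {\<eta>..\<xi>} \<Longrightarrow>
    dist_int (real q * f (of_int a / real q)) < \<delta> \<Longrightarrow> dist_int (real q * g (of_int a / real q)) < \<delta>'"
  shows "N_count {\<eta>..\<xi>} f Q \<delta> \<le> N_count {\<eta>..\<xi>} g Q \<delta>'"
  unfolding N_count_def using assms by (intro card_mono finite_N_count) auto

lemma dist_int_mult_close:
  assumes "\<bar>u - v\<bar> \<le> \<epsilon>" "real q \<le> Q" "0 \<le> \<epsilon>"
  shows "dist_int (real q * v) \<le> dist_int (real q * u) + Q * \<epsilon>"
proof -
  have "\<bar>real q * v - real q * u\<bar> = real q * \<bar>u - v\<bar>" by (simp add: abs_mult abs_minus_commute flip: right_diff_distrib)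
  also have "\<dots> \<le> Q * \<epsilon>" using assms by (intro mult_mono) auto
  finally show ?thesis using dist_int_lipschitz[of "real q * v" "real q * u"] by linarith
qed

theorem theorem4:
  fixes \<eta> \<xi> c1 c2 :: real
  assumes "\<eta> < \<xi>" and "0 < c1" and "c1 \<le> c2"
  shows "\<exists>C. \<forall>f \<in> C2_class_closure {\<eta>..\<xi>} c1 c2. \<forall>\<delta> \<in> {0<..1/2}. \<forall>Q::nat. Q > 1 \<longrightarrow>
           \<bar>real (N_count {\<eta>..\<xi>} f (real Q) \<delta>) - (\<xi> - \<eta>) * \<delta> * (real Q)\<^sup>2\<bar>
             \<le> C * (\<delta> powr (1/2) * ln (1/\<delta>) * real Q powr (3/2) + real Q powr (4/3))"
proof -
  obtain C where C: "C > 0" and bd: "\<And>g Q \<delta>. g \<in> C2_class {\<eta>..\<xi>} c1 c2 \<Longrightarrow> 1 \<le> Q \<Longrightarrow> 0 < \<delta> \<Longrightarrow> \<delta> \<le> 1/2 \<Longrightarrow>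
    \<bar>real (N_count {\<eta>..\<xi>} g (real Q) \<delta>) - (\<xi> - \<eta>) * \<delta> * (real Q)\<^sup>2\<bar>
      \<le> C * (\<delta> powr (1/2) * ln (1 / \<delta>) * real Q powr (3/2) + real Q powr (4/3))"
    using C2_class_count[OF assms] by blast
  show ?thesis
  proof (intro exI[of _ "2 * C + 1"] ballI allI impI)
    fix f :: "real \<Rightarrow> real" and \<delta> :: real and Q :: nat
    assume f: "f \<in> C2_class_closure {\<eta>..\<xi>} c1 c2" and \<delta>': "\<delta> \<in> {0<..1/2}" and Q: "Q > 1"
    have \<delta>: "0 < \<delta>" "\<delta> \<le> 1/2" using \<delta>' by auto
    have Q1: "1 \<le> Q" "1 \<le> real Q" using Q by auto
    define S where "S = \<xi> - \<eta>"
    have S: "S > 0" using assms by (simp add: S_def)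
    define A where "A = \<delta> powr (1/2) * ln (1 / \<delta>) * real Q powr (3/2)"
    define B where "B = real Q powr (4/3)"
    have B1: "1 \<le> B" unfolding B_def using Q1 by (intro ge_one_powr_ge_zero) auto
    have l0: "0 \<le> ln (1 / \<delta>)" using \<delta> by (intro ln_ge_zero) (auto simp: field_simps)
    then have A0: "0 \<le> A" unfolding A_def by simp
    have close: "\<exists>g\<in>C2_class {\<eta>..\<xi>} c1 c2. \<forall>x\<in>{\<eta>..\<xi>}. \<bar>f x - g x\<bar> \<le> \<epsilon>" if "\<epsilon> > 0" for \<epsilon>
      using f that assms(1) by (subst (asm) C2_class_closure_iff) auto
    have upper: "real (N_count {\<eta>..\<xi>} f (real Q) \<delta>) \<le> S * \<delta> * (real Q)\<^sup>2 + C * (A + B)"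
    proof -
      define P where "P = {(a :: int, q :: nat). 0 < q \<and> real q \<le> real Q \<and> of_int a / real q \<in> {\<eta>..\<xi>} \<and> dist_int (real q * f (of_int a / real q)) < \<delta>}"
      have finP: "finite P" unfolding P_def by (rule finite_N_count) simp
      define v where "v p = dist_int (real (snd p) * f (of_int (fst p) / real (snd p)))" for p :: "int \<times> nat"
      \<comment> \<open>As the counting condition is strict, the finitely many counted points stay
        below \<open>\<delta>\<close> by a margin \<open>\<delta> - M\<close>. An approximation
        finer than this margin divided by \<open>Q\<close> counts all of them with the same
        \<open>\<delta>\<close>, so the upper bound needs no perturbation. The inserted 0 takes care
        of an empty set.\<close>
      define M where "M = Max (insert 0 (v ` P))"
      have M: "M < \<delta>" "\<And>p. p \<in> P \<Longrightarrow> v p \<le> M"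
        using finP \<delta> by (auto simp: M_def P_def v_def)
      define \<epsilon> where "\<epsilon> = (\<delta> - M) / (2 * real Q)"
      have \<epsilon>: "\<epsilon> > 0" "real Q * \<epsilon> < \<delta> - M" using M(1) Q1 by (auto simp: \<epsilon>_def)
      obtain g where g: "g \<in> C2_class {\<eta>..\<xi>} c1 c2" "\<And>x. x \<in> {\<eta>..\<xi>} \<Longrightarrow> \<bar>f x - g x\<bar> \<le> \<epsilon>" using close[OF \<epsilon>(1)] by blast
      have "N_count {\<eta>..\<xi>} f (real Q) \<delta> \<le> N_count {\<eta>..\<xi>} g (real Q) \<delta>"
      proof (rule N_count_le)
        fix a :: int and q :: nat
        assume h: "0 < q" "real q \<le> real Q" "of_int a / real q \<in> {\<eta>..\<xi>}" "dist_int (real q * f (of_int a / real q)) < \<delta>"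
        then have "(a, q) \<in> P" by (simp add: P_def)
        from M(2)[OF this] have "dist_int (real q * f (of_int a / real q)) \<le> M" by (simp add: v_def)
        then show "dist_int (real q * g (of_int a / real q)) < \<delta>"
          using dist_int_mult_close[OF g(2)[OF h(3)] h(2)] \<epsilon> by fastforce
      qed
      then have "real (N_count {\<eta>..\<xi>} f (real Q) \<delta>) \<le> real (N_count {\<eta>..\<xi>} g (real Q) \<delta>)" by simp
      then show ?thesis using bd[OF g(1) Q1(1) \<delta>] unfolding A_def B_def S_def by linarith
    qed
    have lower: "S * \<delta> * (real Q)\<^sup>2 - (2 * C + 1) * (A + B) \<le> real (N_count {\<eta>..\<xi>} f (real Q) \<delta>)"
    proof -
      \<comment> \<open>For the lower bound a margin has to be created. The second entry changes the
        main term by at most 1, which is absorbed since \<open>B \<ge> 1\<close>; the first keeps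
        \<open>\<delta>1\<close> at least \<open>\<delta> / 2\<close>, so that the logarithm stays
        comparable.\<close>
      define \<theta> where "\<theta> = min (\<delta> / 2) (1 / (S * (real Q)\<^sup>2))"
      have SQ: "0 < S * (real Q)\<^sup>2" using S Q1 by simp
      have \<theta>: "0 < \<theta>" "\<theta> \<le> \<delta> / 2" "\<theta> \<le> 1 / (S * (real Q)\<^sup>2)" using \<delta> SQ by (simp_all add: \<theta>_def)
      have "\<theta> * (S * (real Q)\<^sup>2) \<le> 1" using \<theta>(3) SQ by (simp only: pos_le_divide_eq)
      then have \<theta>1: "S * \<theta> * (real Q)\<^sup>2 \<le> 1" by (simp add: mult_ac)
      define \<delta>1 where "\<delta>1 = \<delta> - \<theta>"
      have \<delta>1: "0 < \<delta>1" "\<delta>1 \<le> 1/2" "\<delta> / 2 \<le> \<delta>1" "\<delta>1 \<le> \<delta>" using \<theta> \<delta> by (auto simp: \<delta>1_def)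
      define \<epsilon> where "\<epsilon> = \<theta> / (2 * real Q)"
      have \<epsilon>: "\<epsilon> > 0" "real Q * \<epsilon> < \<theta>" using \<theta> Q1 by (auto simp: \<epsilon>_def)
      obtain g where g: "g \<in> C2_class {\<eta>..\<xi>} c1 c2" "\<And>x. x \<in> {\<eta>..\<xi>} \<Longrightarrow> \<bar>f x - g x\<bar> \<le> \<epsilon>" using close[OF \<epsilon>(1)] by blast
      have "N_count {\<eta>..\<xi>} g (real Q) \<delta>1 \<le> N_count {\<eta>..\<xi>} f (real Q) \<delta>"
      proof (rule N_count_le)
        fix a :: int and q :: nat
        assume h: "0 < q" "real q \<le> real Q" "of_int a / real q \<in> {\<eta>..\<xi>}" "dist_int (real q * g (of_int a / real q)) < \<delta>1"
        have "\<bar>g (of_int a / real q) - f (of_int a / real q)\<bar> \<le> \<epsilon>" using g(2)[OF h(3)] by (simp add: abs_minus_commute)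
        from dist_int_mult_close[OF this h(2)] show "dist_int (real q * f (of_int a / real q)) < \<delta>"
          using h(4) \<epsilon> by (simp add: \<delta>1_def)
      qed
      then have N: "real (N_count {\<eta>..\<xi>} g (real Q) \<delta>1) \<le> real (N_count {\<eta>..\<xi>} f (real Q) \<delta>)" by simp
      have "\<delta>1 powr (1/2) * ln (1 / \<delta>1) \<le> \<delta> powr (1/2) * (2 * ln (1 / \<delta>))"
      proof (rule mult_mono)
        show "\<delta>1 powr (1/2) \<le> \<delta> powr (1/2)" using \<delta>1 by (intro powr_mono2) auto
        \<comment> \<open>Since \<open>\<delta> \<le> 1/2\<close>, halving \<open>\<delta>\<close>
          does not lead below \<open>\<delta>\<^sup>2\<close>, so the logarithm at most doubles.
          This is the factor 2 in \<open>2 * C + 1\<close>; the summand 1 pays for the change of the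
          main term.\<close>
        have "\<delta> * \<delta> \<le> \<delta> * (1 / 2)" using \<delta> by (intro mult_left_mono) auto
        then have "\<delta>\<^sup>2 \<le> \<delta>1" using \<delta>1(3) by (simp add: power2_eq_square)
        then have "ln (\<delta>\<^sup>2) \<le> ln \<delta>1" using \<delta> by (intro ln_mono) auto
        then show "ln (1 / \<delta>1) \<le> 2 * ln (1 / \<delta>)" using \<delta> \<delta>1(1) by (simp add: ln_div ln_realpow)
        show "0 \<le> ln (1 / \<delta>1)" using \<delta>1 by (intro ln_ge_zero) (auto simp: field_simps)
      qed simp
      then have "\<delta>1 powr (1/2) * ln (1 / \<delta>1) * real Q powr (3/2) \<le> \<delta> powr (1/2) * (2 * ln (1 / \<delta>)) * real Q powr (3/2)"
        by (rule mult_right_mono) simp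
      then have "\<delta>1 powr (1/2) * ln (1 / \<delta>1) * real Q powr (3/2) + B \<le> 2 * (A + B)" using B1 by (simp add: A_def)
      then have "C * (\<delta>1 powr (1/2) * ln (1 / \<delta>1) * real Q powr (3/2) + B) \<le> C * (2 * (A + B))" using C by (intro mult_left_mono) auto
      then have "S * \<delta>1 * (real Q)\<^sup>2 - C * (2 * (A + B)) \<le> real (N_count {\<eta>..\<xi>} g (real Q) \<delta>1)"
        using bd[OF g(1) Q1(1) \<delta>1(1,2)] unfolding B_def S_def by linarith
      moreover have "S * \<delta>1 * (real Q)\<^sup>2 = S * \<delta> * (real Q)\<^sup>2 - S * \<theta> * (real Q)\<^sup>2" by (simp add: \<delta>1_def algebra_simps)
      moreover have "(2 * C + 1) * (A + B) = C * (2 * (A + B)) + (A + B)" by (simp add: algebra_simps)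
      ultimately show ?thesis using N \<theta>1 A0 B1 by linarith
    qed
    have "C * (A + B) \<le> (2 * C + 1) * (A + B)" using C A0 B1 by (intro mult_right_mono) auto
    then have "\<bar>real (N_count {\<eta>..\<xi>} f (real Q) \<delta>) - S * \<delta> * (real Q)\<^sup>2\<bar> \<le> (2 * C + 1) * (A + B)"
      using upper lower by linarith
    then show "\<bar>real (N_count {\<eta>..\<xi>} f (real Q) \<delta>) - (\<xi> - \<eta>) * \<delta> * (real Q)\<^sup>2\<bar>
             \<le> (2 * C + 1) * (\<delta> powr (1/2) * ln (1/\<delta>) * real Q powr (3/2) + real Q powr (4/3))"
      by (simp only: A_def B_def S_def)
  qed
qed

end
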